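(* Let $d\ge 2$, $m\ge 1$, $G=\mathbb{Z}^m$, let $F$ be a Keane, infinitely complete IET of $d$ intervals on $[0,1)$ with continuous extension $T:K\to K$, and let $\phi=(\phi_1,\dots,\phi_d)\in G^d$ be such that $\phi_1,\dots,\phi_d$ generate $G$. Suppose that the skew-product $T_\phi:K\times G\to K\times G$ is of periodic type. Then the ergodic invariant Radon measures for $T_\phi$ are precisely the Maharam measures; that is: (I) For every homomorphism $\psi:G\to\mathbb{R}$ there exists a unique (up to scaling) nonzero finite Borel measure $\nu_\psi$ on $K$ which is quasi-invariant under $T$ with $\dfrac{d(\nu_\psi\circ T)}{d\nu_\psi}=e^{-\psi\circ\phi}$, and this measure is non-atomic. Given such $\nu_\psi$, define the Maharam measure $\mu_\psi$ on $K\times G$ by $d\mu_\psi(x,a)=d\nu_\psi(x)\,e^{\psi(a)}\,d\mu_G(a)$, where $\mu_G$ is the Haar (counting) measure on $G$. (II) Each Maharam measure $\mu_\psi$ is an ergodic invariant Radon measure for $T_\phi$. (III) Every ergodic invariant Radon measure for $T_\phi$ is, up to scale, a Maharam measure $\mu_\psi$ for some homomorphism $\psi:G\to\mathbb{R}$.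
   Context: **IETs.** Let $d\ge2$. An interval exchange transformation (IET) of $d$ intervals on $[a,b)$ is a bijection $F:[a,b)\to[a,b)$ together with marked points $a=x_0<x_1<\dots<x_{d-1}<x_d=b$ (part of the data; $F$ may be continuous at some $x_i$) such that $F$ is a translation on each $I_i=[x_{i-1},x_i)$. $F$ is Keane if $F^n(x_i)\notin\{x_1,\dots,x_{d-1}\}$ for all $0\le i\le d-1$, $n\ge1$. **Rauzy–Veech induction.** Let $F$ be a Keane IET on $[a,b)$ whose exchanged intervals $I_j$ are labelled by $\{1,\dots,d\}$. Let $I_\alpha$ be the rightmost interval and let $\beta$ be such that $F(I_\beta)$ is rightmost; then $|I_\alpha|\ne|I_\beta|$. If $|I_\alpha|>|I_\beta|$ put $I^{(1)}=[a,b)\setminus F(I_\beta)$, $I^{(1)}_\alpha=I_\alpha\setminus F(I_\beta)$ and $I^{(1)}_j=I_j$ for $j\ne\alpha$. If $|I_\alpha|<|I_\beta|$ put $I^{(1)}=[a,b)\setminus I_\alpha$, $I^{(1)}_\alpha=F^{-1}(I_\alpha)$, $I^{(1)}_\beta=I_\beta\setminus F^{-1}(I_\alpha)$ and $I^{(1)}_j=I_j$ otherwise. The first return map $F^{(1)}$ of $F$ to $I^{(1)}$ is again a Keane IET exchanging the $I^{(1)}_j$. Iterating gives nested intervals $I^{(0)}\supset I^{(1)}\supset\cdots$ with the same left endpoint, the first return maps $F^{(k)}$ on $I^{(k)}$, and the labelled intervals $I^{(k)}_j$ (for $F^{(0)}=F$, $I_j=[x_{j-1},x_j)$). Let $q^{(0,k)}_j$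 be the return time of $I^{(k)}_j$ to $I^{(k)}$ under $F$, and $A^{(0,k)}_{ij}=\#\{0\le l<q^{(0,k)}_j: F^l(I^{(k)}_j)\subset I_i\}$. $F$ is infinitely complete if $\lim_{n\to\infty}A^{(0,n)}_{ij}=\infty$ for all $i,j$. **Compactification.** For $F$ Keane on $[0,1)$ let $\{y_1,\dots,y_{d-1}\}=\{F(x_i):0\le i\le d-1\}\setminus\{0\}$ and, for $n\ge0$, $D_n^+=\{F^n(y_i)\}_i$, $D_n^-=\{F^{-n}(x_i):1\le i\le d-1\}$. Put $\rho=\sum_{n\ge0}\sum_{x\in D_n^+\sqcup D_n^-}2^{-n}\delta_x$, $l(x)=\rho([0,x))$ for $x\in[0,1]$, $r(x)=\rho([0,x])$ for $x\in[0,1)$, and $K=l((0,1])\cup r([0,1))\subset\mathbb{R}$, a Cantor set. The continuous extension $T:K\to K$ is the homeomorphism with $T\circ r=r\circ F$ on $[0,1)$ (so $T(l(x))=l(\lim_{y\to x^-}F(y))$). Put $K_i=l((x_{i-1},x_i])\cup r([x_{i-1},x_i))$, clopen sets partitioning $K$. **Skew-products.** For $\phi\in G^d$ define $\phi:K\to G$ by $\phi|_{K_i}=\phi_i$ (and similarly $\phi:[0,1)\to G$ by $\phi|_{I_i}=\phi_i$). Put $T_\phi(x,a)=(T(x),a+\phi(x))$ on $K\times G$ and $F_\phi(x,a)=(F(x),a+\phi(x))$ on $[0,1)\times G$. **Periodic type.** $\widetilde{\mathcal R}^N(F_\phi)$ denotes the first return map of $F_\phi$ to $I^{(N)}\times G$,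 rescaled in the first coordinate by $1/|I^{(N)}|$ to a map of $[0,1)\times G$. $F_\phi$ (with $F$ infinitely complete), and equally $T_\phi$, is of periodic type if $\widetilde{\mathcal R}^N(F_\phi)=F_\phi$ for some $N\ge1$ (equality including labelled exchanged intervals; thus the rescaled $F^{(N)}$ equals $F$ and $(A^{(0,N)})^T\phi=\phi$). **Measures.** A Radon measure is a Borel measure finite on compact sets; measures are taken to be nonzero. $(\nu\circ T)(B)=\nu(T(B))$; $\nu$ is quasi-invariant if $\nu\circ T$ is absolutely continuous with respect to $\nu$. *)

theory Defs
  imports "HOL-Analysis.Analysis" "HOL-Computational_Algebra.Group_Closure"
begin

section \<open>Interval exchange transformations\<close>

text \<open>The marked points are \<open>x 0 < \<dots> < x d\<close> and the exchanged intervals are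
  \<open>marked_interval x i\<close> for \<open>i \<in> {1..d}\<close>. Values of \<open>F\<close> outside \<open>[a,b)\<close> are never used.\<close>

definition marked_interval :: "(nat \<Rightarrow> real) \<Rightarrow> nat \<Rightarrow> real set" where
  "marked_interval x i = {x (i - 1)..<x i}"

definition iet :: "nat \<Rightarrow> real \<Rightarrow> real \<Rightarrow> (nat \<Rightarrow> real) \<Rightarrow> (real \<Rightarrow> real) \<Rightarrow> bool" where
  "iet d a b x F \<longleftrightarrow>
     2 \<le> d \<and> x 0 = a \<and> x d = b \<and> (\<forall>i<d. x i < x (Suc i)) \<and>
     bij_betw F {a..<b} {a..<b} \<and>
     (\<forall>i\<in>{1..d}. \<exists>c. \<forall>y\<in>marked_interval x i. F y = y + c)"

definition keane :: "nat \<Rightarrow> (nat \<Rightarrow> real) \<Rightarrow> (real \<Rightarrow> real) \<Rightarrow> bool" where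
  "keane d x F \<longleftrightarrow> (\<forall>i<d. \<forall>n\<ge>1. (F ^^ n) (x i) \<notin> x ` {1..d - 1})"

section \<open>First return maps and Rauzy--Veech induction\<close>

definition return_time :: "('a \<Rightarrow> 'a) \<Rightarrow> 'a set \<Rightarrow> 'a \<Rightarrow> nat" where
  "return_time f S p = (LEAST n. 1 \<le> n \<and> (f ^^ n) p \<in> S)"

definition first_return :: "('a \<Rightarrow> 'a) \<Rightarrow> 'a set \<Rightarrow> 'a \<Rightarrow> 'a" where
  "first_return f S p = (f ^^ return_time f S p) p"

text \<open>A triple of a map, the interval on which it acts, and the intervals it exchanges, labelled
  by \<open>{1..d}\<close>.\<close>

type_synonym labelled_iet = "(real \<Rightarrow> real) \<times> real set \<times> (nat \<Rightarrow> real set)"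

text \<open>For Keane maps the two lengths compared below are never equal. The intervals are half-open
  on the right, so that the rightmost ones are those with the largest supremum.\<close>

fun rauzy_veech :: "nat \<Rightarrow> labelled_iet \<Rightarrow> labelled_iet" where
  "rauzy_veech d (F, I, J) =
     (let \<alpha> = (THE j. j \<in> {1..d} \<and> Sup (J j) = Sup I);
          \<beta> = (THE j. j \<in> {1..d} \<and> Sup (F ` J j) = Sup I)
      in if measure lborel (J \<alpha>) > measure lborel (J \<beta>)
         then (let I' = I - F ` J \<beta>
               in (first_return F I', I', J(\<alpha> := J \<alpha> - F ` J \<beta>)))
         else (let I' = I - J \<alpha>; P = {y \<in> I. F y \<in> J \<alpha>}
               in (first_return F I', I', J(\<alpha> := P, \<beta> := J \<beta> - P))))"

definition rv_iterate :: "nat \<Rightarrow> (nat \<Rightarrow> real) \<Rightarrow> (real \<Rightarrow> real) \<Rightarrow> nat \<Rightarrow> labelled_iet" where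
  "rv_iterate d x F k = (rauzy_veech d ^^ k) (F, {x 0..<x d}, marked_interval x)"

definition rv_domain :: "nat \<Rightarrow> (nat \<Rightarrow> real) \<Rightarrow> (real \<Rightarrow> real) \<Rightarrow> nat \<Rightarrow> real set" where
  "rv_domain d x F k = fst (snd (rv_iterate d x F k))"

definition rv_interval :: "nat \<Rightarrow> (nat \<Rightarrow> real) \<Rightarrow> (real \<Rightarrow> real) \<Rightarrow> nat \<Rightarrow> nat \<Rightarrow> real set" where
  "rv_interval d x F k = snd (snd (rv_iterate d x F k))"

text \<open>The return time is constant on each labelled interval.\<close>

definition rv_time :: "nat \<Rightarrow> (nat \<Rightarrow> real) \<Rightarrow> (real \<Rightarrow> real) \<Rightarrow> nat \<Rightarrow> nat \<Rightarrow> nat" where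
  "rv_time d x F k j =
     (THE q. \<forall>y\<in>rv_interval d x F k j. return_time F (rv_domain d x F k) y = q)"

definition rv_matrix :: "nat \<Rightarrow> (nat \<Rightarrow> real) \<Rightarrow> (real \<Rightarrow> real) \<Rightarrow> nat \<Rightarrow> nat \<Rightarrow> nat \<Rightarrow> nat" where
  "rv_matrix d x F k i j =
     card {l. l < rv_time d x F k j \<and> (F ^^ l) ` rv_interval d x F k j \<subseteq> marked_interval x i}"

definition infinitely_complete :: "nat \<Rightarrow> (nat \<Rightarrow> real) \<Rightarrow> (real \<Rightarrow> real) \<Rightarrow> bool" where
  "infinitely_complete d x F \<longleftrightarrow>
     (\<forall>i\<in>{1..d}. \<forall>j\<in>{1..d}. filterlim (\<lambda>n. rv_matrix d x F n i j) at_top sequentially)"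

section \<open>Compactification of an exchange of \<open>[0,1)\<close>\<close>

definition D_plus :: "nat \<Rightarrow> (nat \<Rightarrow> real) \<Rightarrow> (real \<Rightarrow> real) \<Rightarrow> nat \<Rightarrow> real set" where
  "D_plus d x F n = (F ^^ n) ` (F ` x ` {0..d - 1} - {0})"

definition D_minus :: "nat \<Rightarrow> (nat \<Rightarrow> real) \<Rightarrow> (real \<Rightarrow> real) \<Rightarrow> nat \<Rightarrow> real set" where
  "D_minus d x F n = (inv_into {0..<1} F ^^ n) ` x ` {1..d - 1}"

text \<open>\<open>rho d x F S\<close> is the mass of \<open>S\<close> under the finite measure giving, for every \<open>n\<close>, a point mass
  \<open>2\<^sup>-\<^sup>n\<close> to every element of the disjoint union of \<open>D_plus d x F n\<close> and \<open>D_minus d x F n\<close>.\<close>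

definition rho :: "nat \<Rightarrow> (nat \<Rightarrow> real) \<Rightarrow> (real \<Rightarrow> real) \<Rightarrow> real set \<Rightarrow> real" where
  "rho d x F S =
     (\<Sum>n. (1 / 2) ^ n * ((\<Sum>y\<in>D_plus d x F n. indicator S y) + (\<Sum>y\<in>D_minus d x F n. indicator S y)))"

definition lmap :: "nat \<Rightarrow> (nat \<Rightarrow> real) \<Rightarrow> (real \<Rightarrow> real) \<Rightarrow> real \<Rightarrow> real" where
  "lmap d x F y = rho d x F {0..<y}"

definition rmap :: "nat \<Rightarrow> (nat \<Rightarrow> real) \<Rightarrow> (real \<Rightarrow> real) \<Rightarrow> real \<Rightarrow> real" where
  "rmap d x F y = rho d x F {0..y}"

definition compactification :: "nat \<Rightarrow> (nat \<Rightarrow> real) \<Rightarrow> (real \<Rightarrow> real) \<Rightarrow> real set" where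
  "compactification d x F = lmap d x F ` {0<..1} \<union> rmap d x F ` {0..<1}"

definition comp_piece :: "nat \<Rightarrow> (nat \<Rightarrow> real) \<Rightarrow> (real \<Rightarrow> real) \<Rightarrow> nat \<Rightarrow> real set" where
  "comp_piece d x F i = lmap d x F ` {x (i - 1)<..x i} \<union> rmap d x F ` {x (i - 1)..<x i}"

text \<open>As \<open>rmap d x F ` {0..<1}\<close> is dense in the compactification, this determines \<open>T\<close> there; the
  values of \<open>T\<close> elsewhere are irrelevant.\<close>

definition continuous_extension ::
    "nat \<Rightarrow> (nat \<Rightarrow> real) \<Rightarrow> (real \<Rightarrow> real) \<Rightarrow> (real \<Rightarrow> real) \<Rightarrow> bool" where
  "continuous_extension d x F T \<longleftrightarrow>
     (\<exists>T'. homeomorphism (compactification d x F) (compactification d x F) T T') \<and>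
     (\<forall>y\<in>{0..<1}. T (rmap d x F y) = rmap d x F (F y))"

section \<open>Skew products and periodic type\<close>

definition step_function :: "nat \<Rightarrow> (nat \<Rightarrow> 'a set) \<Rightarrow> (nat \<Rightarrow> 'g) \<Rightarrow> 'a \<Rightarrow> 'g" where
  "step_function d P \<phi> z = \<phi> (THE i. i \<in> {1..d} \<and> z \<in> P i)"

definition skew_product :: "('a \<Rightarrow> 'a) \<Rightarrow> ('a \<Rightarrow> 'g::plus) \<Rightarrow> 'a \<times> 'g \<Rightarrow> 'a \<times> 'g" where
  "skew_product f c = (\<lambda>(z, a). (f z, a + c z))"

definition iet_skew ::
    "nat \<Rightarrow> (nat \<Rightarrow> real) \<Rightarrow> (real \<Rightarrow> real) \<Rightarrow> (nat \<Rightarrow> 'g::plus) \<Rightarrow> real \<times> 'g \<Rightarrow> real \<times> 'g" where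
  "iet_skew d x F \<phi> = skew_product F (step_function d (marked_interval x) \<phi>)"

definition comp_skew ::
    "nat \<Rightarrow> (nat \<Rightarrow> real) \<Rightarrow> (real \<Rightarrow> real) \<Rightarrow> (real \<Rightarrow> real) \<Rightarrow> (nat \<Rightarrow> 'g::plus) \<Rightarrow>
      real \<times> 'g \<Rightarrow> real \<times> 'g" where
  "comp_skew d x F T \<phi> = skew_product T (step_function d (comp_piece d x F) \<phi>)"

text \<open>The first return map to \<open>rv_domain d x F N \<times> G\<close>, rescaled to \<open>[0,1) \<times> G\<close>. All the intervals
  \<open>rv_domain d x F N\<close> have left endpoint \<open>0\<close>.\<close>

definition renormalized_skew ::
    "nat \<Rightarrow> (nat \<Rightarrow> real) \<Rightarrow> (real \<Rightarrow> real) \<Rightarrow> (nat \<Rightarrow> 'g::plus) \<Rightarrow> nat \<Rightarrow> real \<times> 'g \<Rightarrow> real \<times> 'g" where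
  "renormalized_skew d x F \<phi> N = (\<lambda>(y, a).
     let L = measure lborel (rv_domain d x F N);
         (z, b) = first_return (iet_skew d x F \<phi>) (rv_domain d x F N \<times> UNIV) (L * y, a)
     in (z / L, b))"

definition periodic_type ::
    "nat \<Rightarrow> (nat \<Rightarrow> real) \<Rightarrow> (real \<Rightarrow> real) \<Rightarrow> (nat \<Rightarrow> 'g::plus) \<Rightarrow> bool" where
  "periodic_type d x F \<phi> \<longleftrightarrow> (\<exists>N\<ge>1.
     (\<forall>p\<in>{0..<1} \<times> UNIV. renormalized_skew d x F \<phi> N p = iet_skew d x F \<phi> p) \<and>
     (\<forall>j\<in>{1..d}. (\<lambda>y. y / measure lborel (rv_domain d x F N)) ` rv_interval d x F N j
        = marked_interval x j))"

section \<open>Measures\<close>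

definition borel_measure_on :: "'a::topological_space set \<Rightarrow> 'a measure \<Rightarrow> bool" where
  "borel_measure_on S \<mu> \<longleftrightarrow> sets \<mu> = sets (restrict_space borel S)"

definition radon_measure_on :: "'a::topological_space set \<Rightarrow> 'a measure \<Rightarrow> bool" where
  "radon_measure_on S \<mu> \<longleftrightarrow>
     borel_measure_on S \<mu> \<and> emeasure \<mu> S \<noteq> 0 \<and>
     (\<forall>C. compact C \<and> C \<subseteq> S \<longrightarrow> emeasure \<mu> C < \<infinity>)"

definition invariant_measure :: "('a \<Rightarrow> 'a) \<Rightarrow> 'a measure \<Rightarrow> bool" where
  "invariant_measure f \<mu> \<longleftrightarrow>
     f \<in> measurable \<mu> \<mu> \<and>
     (\<forall>B\<in>sets \<mu>. emeasure \<mu> (f -` B \<inter> space \<mu>) = emeasure \<mu> B)"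

definition ergodic_measure :: "('a \<Rightarrow> 'a) \<Rightarrow> 'a measure \<Rightarrow> bool" where
  "ergodic_measure f \<mu> \<longleftrightarrow>
     (\<forall>B\<in>sets \<mu>. f -` B \<inter> space \<mu> = B \<longrightarrow> emeasure \<mu> B = 0 \<or> emeasure \<mu> (space \<mu> - B) = 0)"

definition ergodic_invariant_radon :: "'a::topological_space set \<Rightarrow> ('a \<Rightarrow> 'a) \<Rightarrow> 'a measure \<Rightarrow> bool" where
  "ergodic_invariant_radon S f \<mu> \<longleftrightarrow>
     radon_measure_on S \<mu> \<and> invariant_measure f \<mu> \<and> ergodic_measure f \<mu>"

definition non_atomic :: "'a measure \<Rightarrow> bool" where
  "non_atomic \<nu> \<longleftrightarrow>
     (\<forall>A\<in>sets \<nu>. 0 < emeasure \<nu> A \<longrightarrow>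
        (\<exists>B\<in>sets \<nu>. B \<subseteq> A \<and> 0 < emeasure \<nu> B \<and> emeasure \<nu> B < emeasure \<nu> A))"

text \<open>The measure \<open>\<nu> \<circ> f\<close> giving mass \<open>\<nu> (f B)\<close> to \<open>B\<close>, for \<open>f\<close> a bimeasurable bijection of the
  underlying space.\<close>

definition measure_comp :: "'a measure \<Rightarrow> ('a \<Rightarrow> 'a) \<Rightarrow> 'a measure" where
  "measure_comp \<nu> f = measure_of (space \<nu>) (sets \<nu>) (\<lambda>B. emeasure \<nu> (f ` B))"

definition quasi_invariant :: "('a \<Rightarrow> 'a) \<Rightarrow> 'a measure \<Rightarrow> bool" where
  "quasi_invariant f \<nu> \<longleftrightarrow> absolutely_continuous \<nu> (measure_comp \<nu> f)"

definition conformal_measure ::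
    "nat \<Rightarrow> (nat \<Rightarrow> real) \<Rightarrow> (real \<Rightarrow> real) \<Rightarrow> (real \<Rightarrow> real) \<Rightarrow> (nat \<Rightarrow> 'g) \<Rightarrow> ('g \<Rightarrow> real) \<Rightarrow>
      real measure \<Rightarrow> bool" where
  "conformal_measure d x F T \<phi> \<psi> \<nu> \<longleftrightarrow>
     borel_measure_on (compactification d x F) \<nu> \<and> finite_measure \<nu> \<and>
     emeasure \<nu> (compactification d x F) \<noteq> 0 \<and> quasi_invariant T \<nu> \<and>
     (AE z in \<nu>. RN_deriv \<nu> (measure_comp \<nu> T) z
        = ennreal (exp (- \<psi> (step_function d (comp_piece d x F) \<phi> z))))"

definition maharam_measure :: "('g \<Rightarrow> real) \<Rightarrow> real measure \<Rightarrow> (real \<times> 'g) measure" where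
  "maharam_measure \<psi> \<nu> = density (\<nu> \<Otimes>\<^sub>M count_space UNIV) (\<lambda>(z, a). ennreal (exp (\<psi> a)))"

end

theory Submission
  imports Defs "HOL-Probability.Helly_Selection"
begin

text \<open>By periodicity the first return map of the skew product to a short interval \<open>[0,\<Lambda>)\<close> is the
  skew product itself, rescaled. Itineraries up to the return define a substitution on the letters
  which preserves the sums of \<open>\<phi>\<close> over words; infinite completeness makes its
  matrix positive after passing to a power. In \<open>K\<close> this gives nested Kakutani--Rokhlin partitions
  into clopen levels whose diameters tend to \<open>0\<close>, all of whose stages look alike. Since
  \<open>F\<close> is Keane, every marked point is interior to the image of an exchanged interval, and this,
  together with the generation of \<open>G\<close>, yields for each \<open>g\<close> a power of the substitution in
  whose words every letter occurs twice with prefix sums differing by \<open>g\<close>.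

  Ergodicity of Maharam measures: if an invariant set and the complement of its translate by \<open>g\<close>
  met in positive measure, both would almost fill one level; two occurrences of its letter with
  displacement \<open>g\<close> place a common piece, of mass bounded below, in both, a contradiction. Conversely
  an ergodic invariant Radon measure is proportional or singular to each of its translates, and
  the same two occurrences exclude singularity; the proportionality factors are \<open>e\<^sup>\<psi>\<close>. Conformal
  measures exist as weak limits of weighted orbit segments, and are unique because the sum of two
  of them yields an ergodic Maharam measure.\<close>

section \<open>Substitutions\<close>

text \<open>What links the scales is that the substitution preserves the \<open>\<phi>\<close>-sum
  of every letter: the shift in \<open>G\<close> between two visits to a base of stage
  \<open>k\<close> inside one tower of stage \<open>k + 1\<close> is a difference of prefix sums of
  one fixed finite word, independent of \<open>k\<close>. So an estimate with finitely many
  constants holds at all stages at once. One word realises only finitely many differences while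
  \<open>G\<close> is infinite; hence each \<open>g\<close> receives a substitution of its own, and
  the measure theory treats one \<open>g\<close> at a time. Levels of towers in \<open>[0,1)\<close>
  are half-open intervals and not clopen. Their endpoints, apart from \<open>0\<close> and
  \<open>1\<close>, belong to the orbits of the marked points, and \<open>K\<close> doubles those;
  this is why the endpoints of the induced intervals are tracked through the whole induction. The
  measures on \<open>K \<times> G\<close> are infinite but finite on each fibre
  \<open>K \<times> {a}\<close>, so they are decomposed fibre by fibre, and the pieces are then
  saturated to strictly invariant sets, the only ones to which ergodicity as defined
  applies.\<close>

primrec subst_pow :: "('a \<Rightarrow> 'a list) \<Rightarrow> nat \<Rightarrow> 'a \<Rightarrow> 'a list" where
  "subst_pow \<sigma> 0 j = [j]"
| "subst_pow \<sigma> (Suc k) j = concat (map (subst_pow \<sigma> k) (\<sigma> j))"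

lemma subst_pow_0: "subst_pow \<sigma> 0 = (\<lambda>j. [j])"
  by (rule ext) simp

text \<open>The recursion splits off the first application of \<open>\<sigma>\<close>, so that a
  word of order \<open>Suc k\<close> is a concatenation of words of order \<open>k\<close>, as a
  tower of stage \<open>Suc k\<close> is a stack of towers of stage \<open>k\<close>. Powers act as
  endomorphisms of the free monoid, which gives every other splitting.\<close>

lemma subst_pow_add:
  "subst_pow \<sigma> (m + n) j = concat (map (subst_pow \<sigma> m) (subst_pow \<sigma> n j))"
proof (induction n arbitrary: j)
  case (Suc n)
  have "map (subst_pow \<sigma> (m + n)) (\<sigma> j) = map (\<lambda>i. concat (map (subst_pow \<sigma> m) (subst_pow \<sigma> n i))) (\<sigma> j)"
    using Suc by simp
  moreover have "concat (map (\<lambda>i. concat (map (subst_pow \<sigma> m) (subst_pow \<sigma> n i))) l) =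
      concat (map (subst_pow \<sigma> m) (concat (map (subst_pow \<sigma> n) l)))" for l
    by (induction l) auto
  ultimately show ?case
    by (simp del: map_eq_conv)
qed simp

lemma sum_list_concat_map:
  fixes f :: "'a \<Rightarrow> 'b::comm_monoid_add"
  assumes "\<And>i. i \<in> set u \<Longrightarrow> sum_list (map f (w i)) = f i"
  shows "sum_list (map f (concat (map w u))) = sum_list (map f u)"
  using assms by (induction u) auto

text \<open>A position in a concatenation is a block \<open>l\<close> together with an offset
  \<open>r\<close>; \<open>concat_map_position\<close> is the converse. In terms of towers, a level
  of a high tower is level \<open>r\<close> of the \<open>l\<close>-th small tower crossed.\<close>

lemma concat_map_nth:
  assumes "m < length (concat (map v u))"
  shows "\<exists>l<length u. \<exists>r<length (v (u ! l)).
    m = length (concat (map v (take l u))) + r \<and> concat (map v u) ! m = v (u ! l) ! r"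
  using assms
proof (induction u arbitrary: m)
  case (Cons a u)
  show ?case
  proof (cases "m < length (v a)")
    case True
    then have "(0::nat) < length (a # u)" "m < length (v ((a # u) ! 0))"
      "m = length (concat (map v (take 0 (a # u)))) + m"
      "concat (map v (a # u)) ! m = v ((a # u) ! 0) ! m" by (auto simp: nth_append)
    then show ?thesis by blast
  next
    case False
    then have "m - length (v a) < length (concat (map v u))" using Cons.prems by auto
    from Cons.IH[OF this] obtain l r where lr: "l < length u" "r < length (v (u ! l))"
      "m - length (v a) = length (concat (map v (take l u))) + r"
      "concat (map v u) ! (m - length (v a)) = v (u ! l) ! r" by blast
    then have "Suc l < length (a # u)" "r < length (v ((a # u) ! Suc l))"
      "m = length (concat (map v (take (Suc l) (a # u)))) + r"
      "concat (map v (a # u)) ! m = v ((a # u) ! Suc l) ! r" using False by (auto simp: nth_append)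
    then show ?thesis by blast
  qed
qed simp

lemma concat_map_position:
  assumes "l < length u" "r < length (v (u ! l))"
  shows "length (concat (map v (take l u))) + r < length (concat (map v u))"
    and "concat (map v u) ! (length (concat (map v (take l u))) + r) = v (u ! l) ! r"
proof -
  have "map v u = map v (take l u) @ v (u ! l) # map v (drop (Suc l) u)"
    using id_take_nth_drop[OF assms(1)] by (metis list.simps(9) map_append)
  then have "concat (map v u) = concat (map v (take l u)) @ v (u ! l) @ concat (map v (drop (Suc l) u))"
    by simp
  then show "length (concat (map v (take l u))) + r < length (concat (map v u))"
    and "concat (map v u) ! (length (concat (map v (take l u))) + r) = v (u ! l) ! r"
    using assms by (auto simp: nth_append)
qed

text \<open>\<open>set_word\<close> says that the matrix of the substitution is positive already at
  the first power, and \<open>sum_word\<close> that its transpose fixes \<open>\<phi>\<close>, as in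
  the definition of periodic type.\<close>

locale primitive_substitution =
  fixes A :: "'a set" and \<sigma> :: "'a \<Rightarrow> 'a list" and \<phi> :: "'a \<Rightarrow> 'g::ab_group_add"
  assumes finite_letters: "finite A" and letters_nonempty: "A \<noteq> {}"
    and set_word: "j \<in> A \<Longrightarrow> set (\<sigma> j) = A"
    and sum_word: "j \<in> A \<Longrightarrow> sum_list (map \<phi> (\<sigma> j)) = \<phi> j"
begin

lemma set_pow_subset: "j \<in> A \<Longrightarrow> set (subst_pow \<sigma> n j) \<subseteq> A"
proof (induction n arbitrary: j)
  case (Suc n)
  then show ?case using set_word[of j] by fastforce
qed simp

lemma set_pow: "j \<in> A \<Longrightarrow> n \<ge> 1 \<Longrightarrow> set (subst_pow \<sigma> n j) = A"
proof (induction n arbitrary: j)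
  case (Suc n)
  show ?case
  proof (cases "n = 0")
    case False
    then show ?thesis using Suc set_word[of j] letters_nonempty by fastforce
  qed (use Suc set_word[of j] in auto)
qed simp

lemma sum_pow: "j \<in> A \<Longrightarrow> sum_list (map \<phi> (subst_pow \<sigma> n j)) = \<phi> j"
proof (induction n arbitrary: j)
  case (Suc n)
  have "sum_list (map \<phi> (concat (map (subst_pow \<sigma> n) (\<sigma> j)))) = sum_list (map \<phi> (\<sigma> j))"
    using Suc set_word[of j] by (intro sum_list_concat_map) auto
  then show ?case using sum_word Suc.prems by simp
qed simp

section \<open>Displacements between occurrences of letters in iterated words\<close>

definition occurs :: "nat \<Rightarrow> 'a \<Rightarrow> 'a \<Rightarrow> 'g \<Rightarrow> bool" where
  "occurs n i j s \<longleftrightarrow> (\<exists>u v. subst_pow \<sigma> n j = u @ i # v \<and> s = sum_list (map \<phi> u))"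

lemma occurs_exists: "i \<in> A \<Longrightarrow> j \<in> A \<Longrightarrow> n \<ge> 1 \<Longrightarrow> \<exists>s. occurs n i j s"
  using set_pow[of j n] unfolding occurs_def by (metis split_list)

text \<open>A letter is replaced by a word with the same \<open>\<phi>\<close>-sum, so the prefix in
  front of \<open>j'\<close> keeps its sum \<open>t\<close> after \<open>m\<close> further
  substitutions.\<close>

lemma occurs_add:
  assumes "occurs m i j' s" "occurs n j' j t" "j \<in> A"
  shows "occurs (m + n) i j (s + t)"
proof -
  obtain u v where u: "subst_pow \<sigma> m j' = u @ i # v" "s = sum_list (map \<phi> u)"
    using assms unfolding occurs_def by auto
  obtain u' v' where u': "subst_pow \<sigma> n j = u' @ j' # v'" "t = sum_list (map \<phi> u')"
    using assms unfolding occurs_def by auto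
  have "set u' \<subseteq> A" using set_pow_subset[OF \<open>j \<in> A\<close>, of n] u' by auto
  then have "sum_list (map \<phi> (concat (map (subst_pow \<sigma> m) u'))) = t"
    unfolding u' by (intro sum_list_concat_map sum_pow) auto
  moreover have "subst_pow \<sigma> (m + n) j =
      (concat (map (subst_pow \<sigma> m) u') @ u) @ i # (v @ concat (map (subst_pow \<sigma> m) v'))"
    unfolding subst_pow_add u' using u by simp
  ultimately show ?thesis
    unfolding occurs_def using u by (intro exI conjI) (assumption, simp add: add.commute)
qed

text \<open>The common word may be any iterate over any letter;
  \<open>displacement_eventually\<close> turns this into all high iterates over all letters.\<close>

definition displacement :: "'a \<Rightarrow> 'a \<Rightarrow> 'g \<Rightarrow> bool" where
  "displacement i i' g \<longleftrightarrow> (\<exists>n j s s'. j \<in> A \<and> occurs n i j s \<and> occurs n i' j s' \<and> s' - s = g)"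

lemma displacement_eventually:
  assumes "displacement i i' g"
  shows "\<forall>\<^sub>F n in sequentially. \<forall>j\<in>A. \<exists>s s'. occurs n i j s \<and> occurs n i' j s' \<and> s' - s = g"
proof -
  obtain n k s s' where n: "k \<in> A" "occurs n i k s" "occurs n i' k s'" "s' - s = g"
    using assms unfolding displacement_def by blast
  show ?thesis
    unfolding eventually_sequentially
  \<comment> \<open>The extra unit leaves at least one substitution for \<open>k\<close> to occur in
    the word of \<open>j\<close>.\<close>
  proof (intro exI[of _ "n + 1"] allI impI ballI)
    fix n' j assume n': "n + 1 \<le> n'" and j: "j \<in> A"
    then obtain t where t: "occurs (n' - n) k j t"
      using occurs_exists[OF n(1) j, of "n' - n"] by fastforce
    have "occurs n' i j (s + t)" "occurs n' i' j (s' + t)"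
      using occurs_add[OF n(2) t j] occurs_add[OF n(3) t j] n' by auto
    moreover have "(s' + t) - (s + t) = g" using n by simp
    ultimately show "\<exists>s s'. occurs n' i j s \<and> occurs n' i' j s' \<and> s' - s = g" by blast
  qed
qed

text \<open>The occurrences of \<open>j\<close> and \<open>j'\<close> are expanded, and one letter
  is picked inside each of the two copies.\<close>

lemma displacement_inner:
  assumes "displacement j j' h" "occurs n i j t" "occurs n i' j' t'"
  shows "displacement i i' (h + t' - t)"
proof -
  obtain m k s s' where m: "k \<in> A" "occurs m j k s" "occurs m j' k s'" "s' - s = h"
    using assms unfolding displacement_def by blast
  have "occurs (n + m) i k (t + s)" "occurs (n + m) i' k (t' + s')"
    using occurs_add[OF assms(2) m(2) m(1)] occurs_add[OF assms(3) m(3) m(1)] by auto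
  moreover have "(t' + s') - (t + s) = h + t' - t" using m by (auto simp: algebra_simps)
  ultimately show ?thesis unfolding displacement_def using m(1) by blast
qed

lemma displacement_minus: "displacement i i' g \<Longrightarrow> displacement i' i (- g)"
  unfolding displacement_def by (metis minus_diff_eq)

text \<open>Of two copies of the same letter \<open>j\<close> at distance \<open>y\<close>, the
  letter \<open>i\<close> is taken in the first and \<open>i'\<close> in the second.
  Self-displacements of any letter thus act on the displacements of any pair of letters.\<close>

lemma displacement_act:
  assumes "displacement j j y" "displacement i i' z" "j \<in> A"
  shows "displacement i i' (y + z)"
proof -
  obtain n s s' where n: "occurs n i j s" "occurs n i' j s'" "s' - s = z"
    using displacement_eventually[OF assms(2)] \<open>j \<in> A\<close> eventually_happens by fastforce
  show ?thesis using displacement_inner[OF assms(1) n(1,2)] n(3) by (simp add: algebra_simps)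
qed

lemma displacement_zero: "i \<in> A \<Longrightarrow> displacement i i 0"
  unfolding displacement_def using occurs_exists[of i _ 1] letters_nonempty
  by (metis cancel_comm_monoid_add_class.diff_cancel order_refl)

text \<open>The two displacements need not meet at the same occurrence of \<open>i'\<close>. In a
  common word the gap \<open>s' - u\<close> between its two occurrences is itself a
  self-displacement of \<open>i'\<close>, and acting with it on the pair of outer occurrences
  repairs the mismatch.\<close>

lemma displacement_trans:
  assumes "displacement i i' g" "displacement i' i'' g'" "i' \<in> A"
  shows "displacement i i'' (g + g')"
proof -
  obtain j where "j \<in> A" using letters_nonempty by auto
  have "\<forall>\<^sub>F n in sequentially. (\<exists>s s'. occurs n i j s \<and> occurs n i' j s' \<and> s' - s = g) \<and>
      (\<exists>s s'. occurs n i' j s \<and> occurs n i'' j s' \<and> s' - s = g')"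
    using displacement_eventually[OF assms(1)] displacement_eventually[OF assms(2)]
    by eventually_elim (use \<open>j \<in> A\<close> in blast)
  then obtain n s s' u u' where n: "occurs n i j s" "occurs n i' j s'" "s' - s = g"
      "occurs n i' j u" "occurs n i'' j u'" "u' - u = g'"
    using eventually_happens by fastforce
  have "displacement i' i' (s' - u)" "displacement i i'' (u' - s)"
    unfolding displacement_def using n \<open>j \<in> A\<close> by blast+
  then have "displacement i i'' (s' - u + (u' - s))"
    by (rule displacement_act) fact
  moreover have "s' - u + (u' - s) = g + g'" using n by (auto simp: algebra_simps)
  ultimately show ?thesis by simp
qed

end

text \<open>The displacements between occurrences of letters form cosets of one subgroup; if every two
  neighbouring letters can follow the same letter, all these cosets are equal, and the
  subgroup contains every \<open>\<phi> i\<close>.\<close>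

lemma (in primitive_substitution) displacements_everything:
  fixes d :: nat and e :: "nat \<Rightarrow> 'a"
  assumes A: "A = e ` {1..d}"
    and generates: "group_closure (\<phi> ` A) = UNIV"
    and follow: "\<And>i. i \<in> A \<Longrightarrow> \<exists>i'\<in>A. displacement i i' (\<phi> i)"
    and fork: "\<And>l. 1 \<le> l \<Longrightarrow> l < d \<Longrightarrow>
      \<exists>i\<in>A. displacement i (e l) (\<phi> i) \<and> displacement i (e (Suc l)) (\<phi> i)"
  shows "\<forall>\<^sub>F n in sequentially. \<forall>i\<in>A. \<forall>j\<in>A. \<exists>s s'. occurs n i j s \<and> occurs n i j s' \<and> s' - s = g"
proof -
  have eA: "e l \<in> A" if "1 \<le> l" "l \<le> d" for l using that A by auto
  have step: "displacement (e l) (e (Suc l)) 0" if l: "1 \<le> l" "l < d" for l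
  proof -
    obtain i where i: "i \<in> A" "displacement i (e l) (\<phi> i)" "displacement i (e (Suc l)) (\<phi> i)"
      using fork l by blast
    then show ?thesis using displacement_trans[OF displacement_minus[OF i(2)] i(3) i(1)] by simp
  qed
  have from1: "displacement (e 1) (e l) 0" if "1 \<le> l" "l \<le> d" for l
    using that
  proof (induction l rule: nat_induct_at_least)
    case base
    then show ?case using displacement_zero eA by auto
  next
    case (Suc l)
    then show ?case using displacement_trans[OF Suc.IH step[of l]] eA by auto
  qed
  have d1: "1 \<le> d" using letters_nonempty A by auto
  have any: "displacement i i' 0" if i: "i \<in> A" "i' \<in> A" for i i'
  proof -
    have "displacement (e 1) i 0" "displacement (e 1) i' 0" using from1 A i by auto
    then show ?thesis
      using displacement_trans[OF displacement_minus] eA[of 1] d1 by fastforce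
  qed
  have gen: "displacement i i (\<phi> i)" if i: "i \<in> A" for i
  proof -
    obtain i' where i': "i' \<in> A" "displacement i i' (\<phi> i)" using follow[OF i] by blast
    then show ?thesis using displacement_trans[OF i'(2) any[OF i'(1) i] i'(1)] by simp
  qed
  have all: "displacement i i g" if i: "i \<in> A" for i
  proof -
    have "g \<in> group_closure (\<phi> ` A)" using generates by simp
    then show ?thesis
    proof induction
      case (base s)
      \<comment> \<open>Self-displacements of \<open>j\<close> act on the trivial displacement of
        \<open>i\<close>, so every letter inherits those of all others.\<close>
      have "displacement i i (\<phi> j)" if "j \<in> A" for j
        using displacement_act[OF gen[OF that] displacement_zero[OF i] that] by simp
      then show ?case using base displacement_zero[OF i] by auto
    next
      case (diff s t)
      show ?case
        using displacement_trans[OF diff.IH(1) displacement_minus[OF diff.IH(2)] i] by simp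
    qed
  qed
  show ?thesis
    using displacement_eventually[OF all] finite_letters by (intro eventually_ball_finite) auto
qed

section \<open>Rauzy--Veech induction\<close>

text \<open>Makes the choices of the rightmost interval and of the interval with rightmost image
  well defined. A largest right endpoint below \<open>b\<close> would lie in an interval reaching
  further right; two half-open intervals ending at \<open>b\<close> both contain the larger of their
  left endpoints.\<close>

lemma halfopen_rightmost:
  fixes s t :: "'i \<Rightarrow> real"
  assumes A: "finite A" and st: "\<And>j. j \<in> A \<Longrightarrow> s j < t j"
    and U: "(\<Union>j\<in>A. {s j..<t j}) = {a..<b}" and ab: "a < b"
    and disj: "\<And>i j. i \<in> A \<Longrightarrow> j \<in> A \<Longrightarrow> i \<noteq> j \<Longrightarrow> {s i..<t i} \<inter> {s j..<t j} = {}"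
  shows "\<exists>!j. j \<in> A \<and> t j = b"
proof -
  have le: "a \<le> s j \<and> t j \<le> b" if j: "j \<in> A" for j
  proof
    have sub: "{s j..<t j} \<subseteq> {a..<b}" using U j by blast
    then show "a \<le> s j" using st[OF j] by auto
    show "t j \<le> b"
    proof (rule ccontr)
      assume "\<not> t j \<le> b"
      then have "max (s j) b \<in> {s j..<t j}" using st[OF j] by auto
      then have "max (s j) b < b" using sub by auto
      then show False by auto
    qed
  qed
  have ne: "A \<noteq> {}" using U ab by auto
  define m where "m = Max (t ` A)"
  have m_in: "m \<in> t ` A" unfolding m_def using A ne by (intro Max_in) auto
  then obtain k where k: "k \<in> A" "m = t k" by auto
  have "m = b"
  proof (rule ccontr)
    assume "m \<noteq> b"
    then have "m \<in> {a..<b}" using le[OF k(1)] st[OF k(1)] k by auto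
    then obtain j where j: "j \<in> A" "m \<in> {s j..<t j}" using U by blast
    have "t j \<le> m" unfolding m_def using A j by auto
    then show False using j by auto
  qed
  show ?thesis
  proof (rule ex1I[of _ k])
    show "k \<in> A \<and> t k = b" using k \<open>m = b\<close> by auto
    fix j assume j: "j \<in> A \<and> t j = b"
    show "j = k"
    proof (rule ccontr)
      assume "j \<noteq> k"
      then have "{s j..<t j} \<inter> {s k..<t k} = {}" using disj j k by auto
      moreover have "max (s j) (s k) \<in> {s j..<t j} \<inter> {s k..<t k}"
        using j k \<open>m = b\<close> st[of j] st[of k] by auto
      ultimately show False by auto
    qed
  qed
qed

lemma image_translation_halfopen:
  fixes f :: "real \<Rightarrow> real"
  assumes "\<And>y. y \<in> {s..<t} \<Longrightarrow> f y = y + c"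
  shows "f ` {s..<t} = {s + c..<t + c}"
proof -
  have "f ` {s..<t} = (\<lambda>y. y + c) ` {s..<t}" using assms by (intro image_cong) auto
  then show ?thesis by simp
qed

section \<open>Keane interval exchanges on [0,1), the orbits of their marked points and one step of
  induction\<close>

locale keane_iet =
  fixes d :: nat and x :: "nat \<Rightarrow> real" and F :: "real \<Rightarrow> real"
  assumes iet: "iet d 0 1 x F" and keane: "keane d x F"
begin

abbreviation letters :: "nat set" where "letters \<equiv> {1..d}"
abbreviation mark :: "nat \<Rightarrow> real set" where "mark \<equiv> marked_interval x"

lemma d2: "2 \<le> d" and x0: "x 0 = 0" and xd: "x d = 1" and x_Suc: "i < d \<Longrightarrow> x i < x (Suc i)"
  and F_bij: "bij_betw F {0..<1} {0..<1}"
  using iet unfolding iet_def by auto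

lemma F_translation: "i \<in> letters \<Longrightarrow> \<exists>c. \<forall>y\<in>mark i. F y = y + c"
  using iet unfolding iet_def by auto

lemma x_less: "i < j \<Longrightarrow> j \<le> d \<Longrightarrow> x i < x j"
proof (induction j)
  case (Suc j)
  then show ?case using x_Suc[of j] by (cases "i = j") auto
qed simp

lemma x_le: "i \<le> j \<Longrightarrow> j \<le> d \<Longrightarrow> x i \<le> x j"
  using x_less[of i j] by (cases "i = j") auto

lemma x_ge0: "i \<le> d \<Longrightarrow> 0 \<le> x i" using x_le[of 0 i] x0 by simp

lemma x_less_1: "i < d \<Longrightarrow> x i < 1" using x_less[of i d] xd by simp

lemma x_pos: "0 < i \<Longrightarrow> i \<le> d \<Longrightarrow> 0 < x i" using x_less[of 0 i] x0 by simp

lemma x_le_1: "i \<le> d \<Longrightarrow> x i \<le> 1" using x_le[of i d] xd by simp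

lemma mark_subset: "i \<in> letters \<Longrightarrow> mark i \<subseteq> {0..<1}"
  unfolding marked_interval_def using x_ge0[of "i - 1"] x_le_1[of i] by fastforce

lemma mark_endpoints: "i \<in> letters \<Longrightarrow> x (i - 1) < x i"
  using x_less[of "i - 1" i] by auto

lemma mark_disjoint: 
  assumes "i \<in> letters" "j \<in> letters" "i \<noteq> j"
  shows "mark i \<inter> mark j = {}"
proof -
  have "mark i \<inter> mark j = {}" if "i < j" "j \<in> letters" for i j
    unfolding marked_interval_def using x_le[of i "j - 1"] that by fastforce
  then show ?thesis using assms by (metis Int_commute linorder_neqE_nat)
qed

lemma mark_cover: "(\<Union>i\<in>letters. mark i) = {0..<1}"
proof
  show "(\<Union>i\<in>letters. mark i) \<subseteq> {0..<1}" using mark_subset by blast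
  have "\<exists>i\<in>{1..n}. z \<in> mark i" if "0 \<le> z" "z < x n" "n \<le> d" for z n
    using that
  proof (induction n)
    case (Suc n)
    show ?case
    proof (cases "z < x n")
      case True
      then obtain i where "i \<in> {1..n}" "z \<in> mark i" using Suc by auto
      then show ?thesis by (intro bexI[of _ i]) auto
    next
      case False
      then show ?thesis using Suc by (intro bexI[of _ "Suc n"]) (auto simp: marked_interval_def)
    qed
  qed (use x0 in auto)
  from this[of _ d] show "{0..<1} \<subseteq> (\<Union>i\<in>letters. mark i)" using xd by auto
qed

lemma letter_unique: "z \<in> mark i \<Longrightarrow> z \<in> mark j \<Longrightarrow> i \<in> letters \<Longrightarrow> j \<in> letters \<Longrightarrow> i = j"
  using mark_disjoint by blast

lemma F_in: "z \<in> {0..<1} \<Longrightarrow> F z \<in> {0..<1}"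
  using F_bij unfolding bij_betw_def by blast

lemma F_pow_in: "z \<in> {0..<1} \<Longrightarrow> (F ^^ n) z \<in> {0..<1}"
proof (induction n)
  case (Suc n)
  then show ?case using F_in[of "(F ^^ n) z"] by simp
qed simp

lemma F_inj: "inj_on F {0..<1}"
  using F_bij unfolding bij_betw_def by blast

lemma F_pow_inj:
  assumes "(F ^^ n) z = (F ^^ n) w" "z \<in> {0..<1}" "w \<in> {0..<1}"
  shows "z = w"
  using assms(1)
proof (induction n)
  case (Suc n)
  then show ?case using F_inj F_pow_in[OF assms(2)] F_pow_in[OF assms(3)]
    by (auto dest!: inj_onD)
qed simp

text \<open>Full orbits of the marked points \<open>x 0, ..., x (d - 1)\<close>, closed under
  \<open>F\<close> and its inverse. The left endpoints of all intervals produced by the induction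
  stay in this set, and apart from \<open>0\<close> its points are atoms of the measure that defines
  \<open>K\<close> (\<open>orbits_D\<close>).\<close>

inductive_set orbits :: "real set" where
  start: "i < d \<Longrightarrow> x i \<in> orbits"
| forward: "z \<in> orbits \<Longrightarrow> z \<in> {0..<1} \<Longrightarrow> F z \<in> orbits"
| backward: "F z \<in> orbits \<Longrightarrow> z \<in> {0..<1} \<Longrightarrow> z \<in> orbits"

lemma orbits_subset: "z \<in> orbits \<Longrightarrow> z \<in> {0..<1}"
proof (induction rule: orbits.induct)
  case (start i)
  then show ?case using x_ge0[of i] x_less_1[of i] by auto
qed (use F_in in auto)

lemma orbits_pow: "z \<in> orbits \<Longrightarrow> (F ^^ n) z \<in> orbits"
proof (induction n)
  case (Suc n)
  then show ?case using forward orbits_subset by simp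
qed simp

lemma orbits_pow_back: "(F ^^ n) z \<in> orbits \<Longrightarrow> z \<in> {0..<1} \<Longrightarrow> z \<in> orbits"
proof (induction n)
  case (Suc n)
  then show ?case using backward F_pow_in by simp
qed simp

text \<open>What survives every induction step. \<open>s\<close> and \<open>t\<close> are the
  endpoints of the labelled intervals, \<open>q\<close> their return times and \<open>b\<close> the
  length of the domain. The Keane clause concerns left endpoints and exempts \<open>0\<close> as a
  target, for \<open>0\<close> is always the image of some left endpoint. The last two clauses say
  that the orbit segments of length \<open>q j\<close> over \<open>J j\<close> are towers for
  \<open>F\<close>: each level lies in one marked interval, only the bottom meets \<open>I\<close>,
  and the levels cover \<open>[0,1)\<close>.\<close>

definition rv_inv ::
    "(real \<Rightarrow> real) \<Rightarrow> real set \<Rightarrow> (nat \<Rightarrow> real set) \<Rightarrow> (nat \<Rightarrow> real) \<Rightarrow> (nat \<Rightarrow> real) \<Rightarrow> (nat \<Rightarrow> nat) \<Rightarrow>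
      real \<Rightarrow> bool" where
  "rv_inv f I J s t q b \<longleftrightarrow>
     0 < b \<and> b \<le> 1 \<and> I = {0..<b} \<and> (b = 1 \<or> b \<in> orbits) \<and>
     (\<forall>j\<in>letters. J j = {s j..<t j} \<and> s j < t j \<and> s j \<in> orbits) \<and>
     (\<Union>j\<in>letters. J j) = I \<and> disjoint_family_on J letters \<and>
     (\<forall>j\<in>letters. \<exists>c. \<forall>y\<in>J j. f y = y + c) \<and> bij_betw f I I \<and>
     (\<forall>j\<in>letters. \<forall>i\<in>letters. \<forall>n\<ge>1. s i \<noteq> 0 \<longrightarrow> (f ^^ n) (s j) \<noteq> s i) \<and>
     (\<forall>j\<in>letters. 1 \<le> q j \<and>
        (\<forall>y\<in>J j. f y = (F ^^ q j) y \<and> (\<forall>l. 0 < l \<and> l < q j \<longrightarrow> (F ^^ l) y \<notin> I)) \<and>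
        (\<forall>l<q j. \<exists>i\<in>letters. (F ^^ l) ` J j \<subseteq> mark i)) \<and>
     (\<forall>z\<in>{0..<1}. \<exists>j\<in>letters. \<exists>y\<in>J j. \<exists>l<q j. z = (F ^^ l) y)"

lemma rv_invD:
  assumes "rv_inv f I J s t q b"
  shows "0 < b" "b \<le> 1" "I = {0..<b}" "b = 1 \<or> b \<in> orbits"
    "\<forall>j\<in>letters. J j = {s j..<t j} \<and> s j < t j \<and> s j \<in> orbits"
    "(\<Union>j\<in>letters. J j) = I" "disjoint_family_on J letters"
    "\<forall>j\<in>letters. \<exists>c. \<forall>y\<in>J j. f y = y + c" "bij_betw f I I"
    "\<forall>j\<in>letters. \<forall>i\<in>letters. \<forall>n\<ge>1. s i \<noteq> 0 \<longrightarrow> (f ^^ n) (s j) \<noteq> s i"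
    "\<forall>j\<in>letters. 1 \<le> q j \<and>
        (\<forall>y\<in>J j. f y = (F ^^ q j) y \<and> (\<forall>l. 0 < l \<and> l < q j \<longrightarrow> (F ^^ l) y \<notin> I)) \<and>
        (\<forall>l<q j. \<exists>i\<in>letters. (F ^^ l) ` J j \<subseteq> mark i)"
    "\<forall>z\<in>{0..<1}. \<exists>j\<in>letters. \<exists>y\<in>J j. \<exists>l<q j. z = (F ^^ l) y"
  using assms unfolding rv_inv_def by - (elim conjE, assumption)+

lemma rv_inv_start: "rv_inv F {x 0..<x d} mark (\<lambda>j. x (j - 1)) x (\<lambda>j. 1) 1"
proof -
  have o: "x (j - 1) \<in> orbits" if "j \<in> letters" for j
    using that by (intro orbits.start) auto
  have k: "(F ^^ n) (x (j - 1)) \<noteq> x (i - 1)"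
    if "j \<in> letters" "i \<in> letters" "n \<ge> 1" "x (i - 1) \<noteq> 0" for i j n
  proof -
    have "i - 1 \<noteq> 0" using that x0 by metis
    then have "x (i - 1) \<in> x ` {1..d - 1}" using that by (intro imageI) auto
    moreover have "j - 1 < d" using that by auto
    then have "(F ^^ n) (x (j - 1)) \<notin> x ` {1..d - 1}"
      using keane that unfolding keane_def by blast
    ultimately show ?thesis by metis
  qed
  have cov: "\<exists>j\<in>letters. \<exists>y\<in>mark j. \<exists>l<1::nat. z = (F ^^ l) y" if z: "z \<in> {0..<1}" for z
  proof -
    obtain i where "i \<in> letters" "z \<in> mark i" using mark_cover z by blast
    then show ?thesis by (intro bexI[of _ i] bexI[of _ z] exI[of _ 0]) auto
  qed
  show ?thesis
    unfolding rv_inv_def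
  proof (intro conjI)
    show "\<forall>j\<in>letters. mark j = {x (j - 1)..<x j} \<and> x (j - 1) < x j \<and> x (j - 1) \<in> orbits"
      using o mark_endpoints by (simp add: marked_interval_def)
    show "disjoint_family_on mark letters"
      unfolding disjoint_family_on_def using mark_disjoint by blast
    show "\<forall>j\<in>letters. \<forall>i\<in>letters. \<forall>n\<ge>1. x (i - 1) \<noteq> 0 \<longrightarrow> (F ^^ n) (x (j - 1)) \<noteq> x (i - 1)"
      using k by blast
    show "\<forall>j\<in>letters. 1 \<le> (1::nat) \<and>
        (\<forall>y\<in>mark j. F y = (F ^^ 1) y \<and> (\<forall>l. 0 < l \<and> l < 1 \<longrightarrow> (F ^^ l) y \<notin> {x 0..<x d})) \<and>
        (\<forall>l<1. \<exists>i\<in>letters. (F ^^ l) ` mark j \<subseteq> mark i)"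
      by auto
  qed (use mark_cover F_translation F_bij cov x0 xd in auto)
qed

text \<open>Both kinds of induction step have one shape. Each new interval \<open>J' j\<close> lies
  in an old interval \<open>J (p j)\<close>; all of them return to \<open>I'\<close> after one
  application of \<open>f\<close>, except \<open>J' \<gamma>\<close>, which passes once through
  \<open>J \<alpha>\<close> outside \<open>I'\<close> and returns after two. Hence its tower is the
  tower of \<open>p \<gamma>\<close> with that of \<open>\<alpha>\<close> stacked on top.\<close>

lemma rv_inv_induce:
  assumes inv: "rv_inv f I J s t q b"
    and I': "I' = {0..<e}" "0 < e" "e < b" "e \<in> orbits"
    and \<gamma>: "\<gamma> \<in> letters" and \<alpha>: "\<alpha> \<in> letters" and p: "\<And>j. j \<in> letters \<Longrightarrow> p j \<in> letters"
    and J': "\<And>j. j \<in> letters \<Longrightarrow> J' j = {s' j..<t' j} \<and> s' j < t' j \<and> s' j \<in> orbits"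
    and U: "(\<Union>j\<in>letters. J' j) = I'" and disj: "disjoint_family_on J' letters"
    and sub: "\<And>j. j \<in> letters \<Longrightarrow> J' j \<subseteq> J (p j)"
    and stay: "\<And>j y. j \<in> letters \<Longrightarrow> j \<noteq> \<gamma> \<Longrightarrow> y \<in> J' j \<Longrightarrow> f y \<in> I'"
    and leave: "\<And>y. y \<in> J' \<gamma> \<Longrightarrow> f y \<in> J \<alpha> \<and> f y \<notin> I' \<and> f (f y) \<in> I'"
    and onto: "I - I' \<subseteq> f ` J' \<gamma>"
    and kn: "\<And>i j n. j \<in> letters \<Longrightarrow> i \<in> letters \<Longrightarrow> n \<ge> 1 \<Longrightarrow> s' i \<noteq> 0 \<Longrightarrow> (f ^^ n) (s' j) \<noteq> s' i"
    and q': "q' = (\<lambda>j. if j = \<gamma> then q (p \<gamma>) + q \<alpha> else q (p j))"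
    and cover: "\<And>j y. j \<in> letters \<Longrightarrow> y \<in> J j \<Longrightarrow>
      \<exists>j'\<in>letters. \<exists>y'\<in>J' j'. \<exists>m. y = (F ^^ m) y' \<and> m + q j \<le> q' j'"
  shows "rv_inv (first_return f I') I' J' s' t' q' e"
proof -
  let ?g = "first_return f I'"
  note inv' = rv_invD[OF inv]
  note I = inv'(3) and UJ = inv'(6) and fb = inv'(9) and b1 = inv'(2)
  have tr: "\<exists>c. \<forall>y\<in>J j. f y = y + c" if "j \<in> letters" for j
    using inv'(8) that by blast
  have dyn: "1 \<le> q j \<and>
        (\<forall>y\<in>J j. f y = (F ^^ q j) y \<and> (\<forall>l. 0 < l \<and> l < q j \<longrightarrow> (F ^^ l) y \<notin> I)) \<and>
        (\<forall>l<q j. \<exists>i\<in>letters. (F ^^ l) ` J j \<subseteq> mark i)" if "j \<in> letters" for j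
    using inv'(11) that by (rule bspec)
  have cov: "\<exists>j\<in>letters. \<exists>y\<in>J j. \<exists>l<q j. z = (F ^^ l) y" if "z \<in> {0..<1}" for z
    using inv'(12) that by (rule bspec)
  have I'I: "I' \<subseteq> I" using I' I by auto
  have J'I': "J' j \<subseteq> I'" if "j \<in> letters" for j using U that by auto
  have g1: "?g y = f y" if "j \<in> letters" "j \<noteq> \<gamma>" "y \<in> J' j" for j y
  proof -
    have "return_time f I' y = 1"
      unfolding return_time_def using stay[OF that] by (intro Least_equality) auto
    then show ?thesis by (simp add: first_return_def)
  qed
  have g2: "?g y = f (f y)" if "y \<in> J' \<gamma>" for y
  proof -
    have "return_time f I' y = 2"
      unfolding return_time_def
    proof (rule Least_equality)
      show "1 \<le> (2::nat) \<and> (f ^^ 2) y \<in> I'" using leave[OF that] by (simp add: numeral_2_eq_2)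
      fix n assume n: "1 \<le> n \<and> (f ^^ n) y \<in> I'"
      then have "n \<noteq> 1" using leave[OF that] by auto
      then show "2 \<le> n" using n by auto
    qed
    then show ?thesis by (simp add: first_return_def numeral_2_eq_2)
  qed
  have which: "\<exists>j\<in>letters. y \<in> J' j" if "y \<in> I'" for y using U that by blast
  have g_in: "?g y \<in> I'" if y: "y \<in> I'" for y
  proof -
    obtain j where j: "j \<in> letters" "y \<in> J' j" using which[OF y] by auto
    then show ?thesis using g1[of j y] g2[of y] stay[of j y] leave[of y] by (cases "j = \<gamma>") auto
  qed
  have f_inj: "inj_on f I" and f_im: "f ` I = I" using fb by (auto simp: bij_betw_def)
  have g_cases: "?g y = f y \<and> f y \<in> I' \<or> ?g y = f (f y) \<and> f y \<in> I - I'" if y: "y \<in> I'" for y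
  proof -
    obtain j where j: "j \<in> letters" "y \<in> J' j" using which[OF y] by auto
    have "f y \<in> I" using f_im I'I y by auto
    then show ?thesis using j g1[of j y] g2[of y] stay[of j y] leave[of y] by (cases "j = \<gamma>") auto
  qed
  have bij: "bij_betw ?g I' I'"
    unfolding bij_betw_def
  proof
    show "inj_on ?g I'"
    proof (rule inj_onI)
      fix y z assume yz: "y \<in> I'" "z \<in> I'" "?g y = ?g z"
      have in_I: "y \<in> I" "z \<in> I" "f y \<in> I" "f z \<in> I" using yz I'I f_im by auto
      have "f y = f z"
        using g_cases[OF yz(1)] g_cases[OF yz(2)] yz(3)
      proof (elim disjE conjE)
        assume "?g y = f y" "?g z = f (f z)" "f y \<in> I'" "f z \<in> I - I'"
        then have "y = f z" using yz in_I f_inj by (auto dest: inj_onD)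
        then show ?thesis using \<open>f z \<in> I - I'\<close> yz by auto
      next
        assume "?g y = f (f y)" "?g z = f z" "f z \<in> I'" "f y \<in> I - I'"
        then have "z = f y" using yz in_I f_inj by (auto dest: inj_onD)
        then show ?thesis using \<open>f y \<in> I - I'\<close> yz by auto
      next
        assume "?g y = f (f y)" "?g z = f (f z)"
        then show ?thesis using yz in_I f_inj by (auto dest: inj_onD)
      qed auto
      then show "y = z" using in_I f_inj by (auto dest: inj_onD)
    qed
    show "?g ` I' = I'"
    proof
      show "?g ` I' \<subseteq> I'" using g_in by auto
      show "I' \<subseteq> ?g ` I'"
      proof
        fix z assume z: "z \<in> I'"
        then obtain y where y: "y \<in> I" "z = f y" using f_im I'I by (metis imageE subsetD)
        show "z \<in> ?g ` I'"
        proof (cases "y \<in> I'")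
          case True
          then have "?g y = z" using g_cases[OF True] y z by auto
          then show ?thesis using True by auto
        next
          case False
          then obtain u where u: "u \<in> J' \<gamma>" "y = f u" using onto y by auto
          then have "?g u = z" using g2 y by auto
          then show ?thesis using u J'I'[OF \<gamma>] by auto
        qed
      qed
    qed
  qed
  \<comment> \<open>Iterates of the induced map are iterates of \<open>f\<close> with at least as
    many steps, so the Keane property of \<open>f\<close> at the new left endpoints carries
    over.\<close>
  have g_pow: "\<exists>m\<ge>n. (?g ^^ n) y = (f ^^ m) y \<and> (?g ^^ n) y \<in> I'" if "y \<in> I'" for n y
  proof (induction n)
    case (Suc n)
    then obtain m where m: "m \<ge> n" "(?g ^^ n) y = (f ^^ m) y" "(?g ^^ n) y \<in> I'" by auto
    then have "(?g ^^ Suc n) y = (f ^^ Suc m) y \<or> (?g ^^ Suc n) y = (f ^^ Suc (Suc m)) y"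
      using g_cases[OF m(3)] by auto
    moreover have "(?g ^^ Suc n) y \<in> I'" using g_in[OF m(3)] by simp
    ultimately show ?case using m(1) by (metis Suc_le_mono le_SucI)
  qed (use that in \<open>auto intro: exI[of _ 0]\<close>)
  have kn': "(?g ^^ n) (s' j) \<noteq> s' i"
    if "j \<in> letters" "i \<in> letters" "n \<ge> 1" "s' i \<noteq> 0" for i j n
  proof -
    have "s' j \<in> I'" using J'[OF that(1)] J'I'[OF that(1)] by auto
    then obtain m where "m \<ge> n" "(?g ^^ n) (s' j) = (f ^^ m) (s' j)" using g_pow by blast
    then show ?thesis using kn[OF that(1,2) _ that(4), of m] that by auto
  qed
  have tr': "\<exists>c. \<forall>y\<in>J' j. ?g y = y + c" if j: "j \<in> letters" for j
  proof -
    obtain c where c: "\<forall>y\<in>J (p j). f y = y + c" using tr[OF p[OF j]] by auto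
    show ?thesis
    proof (cases "j = \<gamma>")
      case True
      obtain c' where c': "\<forall>y\<in>J \<alpha>. f y = y + c'" using tr[OF \<alpha>] by auto
      have "?g y = y + (c + c')" if "y \<in> J' j" for y
        using g2[of y] that True leave[of y] c c' sub[OF j] by auto
      then show ?thesis by blast
    next
      case False
      have "?g y = y + c" if "y \<in> J' j" for y
        using g1[OF j False that] that c sub[OF j] by auto
      then show ?thesis by blast
    qed
  qed
  have dyn': "1 \<le> q' j \<and>
        (\<forall>y\<in>J' j. ?g y = (F ^^ q' j) y \<and> (\<forall>l. 0 < l \<and> l < q' j \<longrightarrow> (F ^^ l) y \<notin> I')) \<and>
        (\<forall>l<q' j. \<exists>i\<in>letters. (F ^^ l) ` J' j \<subseteq> mark i)" if j: "j \<in> letters" for j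
  proof (cases "j = \<gamma>")
    case False
    then have qj: "q' j = q (p j)" using q' by simp
    show ?thesis
      unfolding qj
    proof (intro conjI ballI allI impI)
      show "1 \<le> q (p j)" using dyn[OF p[OF j]] by auto
      fix y assume y: "y \<in> J' j"
      then show "?g y = (F ^^ q (p j)) y" using g1[OF j False y] dyn[OF p[OF j]] sub[OF j] by auto
      fix l assume "0 < l \<and> l < q (p j)"
      then show "(F ^^ l) y \<notin> I'" using dyn[OF p[OF j]] sub[OF j] y I'I by blast
    next
      fix l assume "l < q (p j)"
      then obtain i where "i \<in> letters" "(F ^^ l) ` J (p j) \<subseteq> mark i" using dyn[OF p[OF j]] by auto
      then show "\<exists>i\<in>letters. (F ^^ l) ` J' j \<subseteq> mark i" using sub[OF j] by (meson image_mono order_trans)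
    qed
  next
    case True
    then have qj: "q' j = q \<alpha> + q (p j)" using q' by simp
    have fy: "f y = (F ^^ q (p j)) y" if "y \<in> J' j" for y using that dyn[OF p[OF j]] sub[OF j] by auto
    have late: "(F ^^ (l + q (p j))) y = (F ^^ l) (f y)" if "y \<in> J' j" for y l
      using fy[OF that] by (simp add: funpow_add)
    show ?thesis
    proof (intro conjI ballI allI impI)
      show "1 \<le> q' j" using dyn[OF p[OF j]] qj by auto
      fix y assume y: "y \<in> J' j"
      have fJ: "f y \<in> J \<alpha>" using leave y True by auto
      then show "?g y = (F ^^ q' j) y" using g2 y True dyn[OF \<alpha>] qj late[OF y] by auto
      fix l assume l: "0 < l \<and> l < q' j"
      show "(F ^^ l) y \<notin> I'"
      proof (cases "l < q (p j)")
        case True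
        then show ?thesis using dyn[OF p[OF j]] sub[OF j] y I'I l by blast
      next
        case False
        then obtain l' where l': "l = l' + q (p j)" by (metis add.commute le_add_diff_inverse not_less)
        then have *: "(F ^^ l) y = (F ^^ l') (f y)" using late y by auto
        show ?thesis
        proof (cases "l' = 0")
          case True
          then show ?thesis using * leave y \<open>j = \<gamma>\<close> by auto
        next
          case False
          then have "(F ^^ l') (f y) \<notin> I" using dyn[OF \<alpha>] fJ l l' qj by auto
          then show ?thesis using * I'I by auto
        qed
      qed
    next
      fix l assume l: "l < q' j"
      show "\<exists>i\<in>letters. (F ^^ l) ` J' j \<subseteq> mark i"
      proof (cases "l < q (p j)")
        case True
        then obtain i where "i \<in> letters" "(F ^^ l) ` J (p j) \<subseteq> mark i" using dyn[OF p[OF j]] by auto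
        then show ?thesis using sub[OF j] by (meson image_mono order_trans)
      next
        case False
        then obtain l' where l': "l = l' + q (p j)" by (metis add.commute le_add_diff_inverse not_less)
        then obtain i where i: "i \<in> letters" "(F ^^ l') ` J \<alpha> \<subseteq> mark i" using dyn[OF \<alpha>] l qj by auto
        have "(F ^^ l) y \<in> mark i" if "y \<in> J' j" for y
          using late[OF that, of l'] l' i leave[of y] that True by auto
        then show ?thesis using i by blast
      qed
    qed
  qed
  have cov': "\<exists>j\<in>letters. \<exists>y\<in>J' j. \<exists>l<q' j. z = (F ^^ l) y" if z: "z \<in> {0..<1}" for z
  proof -
    obtain j y l where j: "j \<in> letters" "y \<in> J j" "l < q j" "z = (F ^^ l) y" using cov[OF z] by auto
    obtain j' y' m where j': "j' \<in> letters" "y' \<in> J' j'" "y = (F ^^ m) y'" "m + q j \<le> q' j'"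
      using cover[OF j(1,2)] by auto
    have "z = (F ^^ (l + m)) y'" using j j' by (simp add: funpow_add)
    moreover have "l + m < q' j'" using j j' by auto
    ultimately show ?thesis using j' by blast
  qed
  show ?thesis
    unfolding rv_inv_def using I' b1 J' U disj tr' bij kn' dyn' cov' by (intro conjI) auto
qed

text \<open>The Keane clause with one iterate excludes \<open>f (s \<beta>) = s \<alpha>\<close>,
  that is, equal lengths. The remaining cases are the two kinds of step, with
  \<open>\<gamma> = \<beta>\<close> when the interval of \<open>\<alpha>\<close> is longer and
  \<open>\<gamma> = \<alpha>\<close> when that of \<open>\<beta>\<close> is.\<close>

lemma rv_inv_step:
  assumes inv: "rv_inv f I J s t q b"
  shows "\<exists>f' I' J' s' t' q' e. rauzy_veech d (f, I, J) = (f', I', J') \<and>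
    rv_inv f' I' J' s' t' q' e \<and> e < b"
proof -
  note inv' = rv_invD[OF inv]
  have b: "0 < b" "b \<le> 1" and I: "I = {0..<b}" and UJ: "(\<Union>j\<in>letters. J j) = I"
    and disjf: "disjoint_family_on J letters"
    and tr: "\<forall>j\<in>letters. \<exists>c. \<forall>y\<in>J j. f y = y + c" and fb: "bij_betw f I I"
    using inv'(1-9) by (simp_all only:)
  have J: "J j = {s j..<t j}" and st: "s j < t j" and orb: "s j \<in> orbits" if "j \<in> letters" for j
    using inv'(5) that by auto
  have kn: "(f ^^ n) (s j) \<noteq> s i" if "j \<in> letters" "i \<in> letters" "n \<ge> 1" "s i \<noteq> 0" for i j n
    using inv'(10) that by blast
  have fF: "f y = (F ^^ q j) y" if "j \<in> letters" "y \<in> J j" for j y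
    using inv'(11) that by blast
  have disj: "J i \<inter> J j = {}" if "i \<in> letters" "j \<in> letters" "i \<noteq> j" for i j
    using disjf that unfolding disjoint_family_on_def by blast
  obtain c where c: "\<And>j y. j \<in> letters \<Longrightarrow> y \<in> J j \<Longrightarrow> f y = y + c j"
    using bchoice[OF tr] by blast
  have f_inj: "inj_on f I" and f_im: "f ` I = I" using fb by (auto simp: bij_betw_def)
  have JI: "J j \<subseteq> I" if "j \<in> letters" for j using UJ that by blast
  have which: "\<exists>j\<in>letters. y \<in> J j" if "y \<in> I" for y using UJ that by blast
  have same: "i = j" if "y \<in> J i" "y \<in> J j" "i \<in> letters" "j \<in> letters" for i j y
    using disj that by blast
  have fJ: "f ` J j = {s j + c j..<t j + c j}" if j: "j \<in> letters" for j
    using c[OF j] unfolding J[OF j] by (rule image_translation_halfopen)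
  have f_back: "y \<in> J j" if "f y \<in> f ` J j" "y \<in> I" "j \<in> letters" for y j
    using that f_inj JI[of j] by (meson inj_on_image_mem_iff)
  have Ub: "(\<Union>j\<in>letters. {s j..<t j}) = {0..<b}" using UJ J I by auto
  have ex_\<alpha>: "\<exists>!j. j \<in> letters \<and> t j = b"
  proof (rule halfopen_rightmost[OF finite_atLeastAtMost st Ub b(1)])
    show "{s i..<t i} \<inter> {s j..<t j} = {}" if "i \<in> letters" "j \<in> letters" "i \<noteq> j" for i j
      using disj[OF that] J that by simp
  qed
  then obtain \<alpha> where \<alpha>: "\<alpha> \<in> letters" "t \<alpha> = b" by blast
  have "(\<Union>j\<in>letters. f ` J j) = f ` I" using UJ by blast
  then have Ub': "(\<Union>j\<in>letters. {s j + c j..<t j + c j}) = {0..<b}" using f_im fJ I by auto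
  have disj': "{s i + c i..<t i + c i} \<inter> {s j + c j..<t j + c j} = {}"
    if "i \<in> letters" "j \<in> letters" "i \<noteq> j" for i j
  proof -
    have "f ` J i \<inter> f ` J j = f ` (J i \<inter> J j)"
      using f_inj JI that by (metis inj_on_image_Int)
    then show ?thesis using disj[OF that] fJ that by auto
  qed
  have ex_\<beta>: "\<exists>!j. j \<in> letters \<and> t j + c j = b"
    using st by (intro halfopen_rightmost[OF finite_atLeastAtMost _ Ub' b(1) disj']) auto
  then obtain \<beta> where \<beta>: "\<beta> \<in> letters" "t \<beta> + c \<beta> = b" by blast
  have the_\<alpha>: "(THE j. j \<in> letters \<and> Sup (J j) = Sup I) = \<alpha>"
  proof (rule the_equality)
    show "\<alpha> \<in> letters \<and> Sup (J \<alpha>) = Sup I" using \<alpha> J st[of \<alpha>] b I by simp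
    fix j assume j: "j \<in> letters \<and> Sup (J j) = Sup I"
    then have "Sup {s j..<t j} = Sup {0..<b}" using J[of j] I by metis
    then have "t j = b" using j st[of j] b by simp
    then show "j = \<alpha>" using ex_\<alpha> j \<alpha> by blast
  qed
  have the_\<beta>: "(THE j. j \<in> letters \<and> Sup (f ` J j) = Sup I) = \<beta>"
  proof (rule the_equality)
    show "\<beta> \<in> letters \<and> Sup (f ` J \<beta>) = Sup I" using \<beta> fJ[of \<beta>] st[of \<beta>] b I by simp
    fix j assume j: "j \<in> letters \<and> Sup (f ` J j) = Sup I"
    then have "Sup {s j + c j..<t j + c j} = Sup {0..<b}" using fJ[of j] I by metis
    then have "t j + c j = b" using j st[of j] b by simp
    then show "j = \<beta>" using ex_\<beta> j \<beta> by blast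
  qed
  have len: "measure lborel (J j) = t j - s j" if "j \<in> letters" for j
    using J[OF that] st[OF that] by simp
  have s_ge0: "0 \<le> s j" if "j \<in> letters" for j using JI[OF that] J[OF that] st[OF that] I by auto
  have s\<alpha>: "s \<alpha> \<noteq> 0"
  proof
    assume "s \<alpha> = 0"
    then have *: "J \<alpha> = I" using J \<alpha> I by auto
    define k where "k = (if \<alpha> = 1 then 2 else 1::nat)"
    have k: "k \<in> letters" "k \<noteq> \<alpha>" using d2 by (auto simp: k_def)
    have "s k \<in> J k" using J[OF k(1)] st[OF k(1)] by auto
    then show False using disj[OF k(1) \<alpha>(1) k(2)] * JI[OF k(1)] by auto
  qed
  have s_in: "s j \<in> J j" if "j \<in> letters" for j using J[OF that] st[OF that] by auto
  have f_s\<beta>: "f (s \<beta>) \<noteq> s \<alpha>" using kn[OF \<beta>(1) \<alpha>(1), of 1] s\<alpha> by simp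
  \<comment> \<open>If the labels agreed, \<open>f\<close> would be the identity on the last
    interval and fix its left endpoint, against the Keane clause.\<close>
  have "\<alpha> \<noteq> \<beta>"
  proof
    assume "\<alpha> = \<beta>"
    then have "c \<beta> = 0" using \<alpha> \<beta> by auto
    then show False using f_s\<beta> c[OF \<beta>(1) s_in[OF \<beta>(1)]] \<open>\<alpha> = \<beta>\<close> by auto
  qed
  have ne_len: "s \<beta> + c \<beta> \<noteq> s \<alpha>" using f_s\<beta> c[OF \<beta>(1) s_in[OF \<beta>(1)]] by auto
  have J\<alpha>: "J \<alpha> = {s \<alpha>..<b}" and fJ\<beta>: "f ` J \<beta> = {s \<beta> + c \<beta>..<b}"
    using J[OF \<alpha>(1)] \<alpha> fJ[OF \<beta>(1)] \<beta> by auto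
  show ?thesis
  proof (cases "s \<alpha> < s \<beta> + c \<beta>")
    case True
    define e where "e = s \<beta> + c \<beta>"
    define I' where "I' = I - f ` J \<beta>"
    define J' where "J' = J(\<alpha> := J \<alpha> - f ` J \<beta>)"
    have e: "s \<alpha> < e" "e < b" unfolding e_def using True st[OF \<beta>(1)] \<beta> by auto
    have fJ\<beta>': "f ` J \<beta> = {e..<b}" using fJ\<beta> e_def by simp
    have sub: "f ` J \<beta> \<subseteq> J \<alpha>" unfolding fJ\<beta>' J\<alpha> using e by auto
    have I'eq: "I' = {0..<e}" unfolding I'_def fJ\<beta>' I using e s_ge0[OF \<alpha>(1)] by auto
    have J'_alt: "J' j = J j - f ` J \<beta>" if "j \<in> letters" for j
      unfolding J'_def using sub disj[OF that \<alpha>(1)] by auto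
    have rv: "rauzy_veech d (f, I, J) = (first_return f I', I', J')"
      unfolding rauzy_veech.simps the_\<alpha> the_\<beta> Let_def len[OF \<alpha>(1)] len[OF \<beta>(1)]
      using \<alpha> \<beta> True by (simp add: I'_def J'_def)
    have "rv_inv (first_return f I') I' J' s (t(\<alpha> := e)) (\<lambda>j. if j = \<beta> then q (id \<beta>) + q \<alpha> else q (id j)) e"
    proof (rule rv_inv_induce[OF inv I'eq, where \<gamma>=\<beta> and p=id and \<alpha>=\<alpha>])
      show "0 < e" using e s_ge0[OF \<alpha>(1)] by auto
      have "e = (F ^^ q \<beta>) (s \<beta>)"
        using fF[OF \<beta>(1) s_in[OF \<beta>(1)]] c[OF \<beta>(1) s_in[OF \<beta>(1)]] e_def by auto
      then show "e \<in> orbits" using orbits_pow orb \<beta> by auto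
      show "J' j = {s j..<(t(\<alpha> := e)) j} \<and> s j < (t(\<alpha> := e)) j \<and> s j \<in> orbits" if "j \<in> letters" for j
        unfolding J'_def using J[OF that] st[OF that] orb[OF that] J\<alpha> fJ\<beta>' e \<alpha> by auto
      show "(\<Union>j\<in>letters. J' j) = I'" using J'_alt UJ I'_def by auto
      show "disjoint_family_on J' letters"
        unfolding disjoint_family_on_def using J'_alt disj by blast
      show "J' j \<subseteq> J (id j)" if "j \<in> letters" for j using J'_alt[OF that] by auto
      show "f y \<in> I'" if "j \<in> letters" "j \<noteq> \<beta>" "y \<in> J' j" for j y
      proof -
        have y: "y \<in> J j" "y \<in> I" using J'_alt[OF that(1)] that JI by auto
        then have "f y \<notin> f ` J \<beta>" using f_back[of y \<beta>] \<beta> same that by blast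
        then show ?thesis using y f_im I'_def by auto
      qed
      show "f y \<in> J \<alpha> \<and> f y \<notin> I' \<and> f (f y) \<in> I'" if "y \<in> J' \<beta>" for y
      proof -
        have y: "y \<in> J \<beta>" using J'_alt[OF \<beta>(1)] that by auto
        then have fy: "f y \<in> J \<alpha>" "f y \<notin> I'" using sub I'_def by auto
        then have "f y \<in> I" using JI \<alpha> by auto
        moreover have "f (f y) \<notin> f ` J \<beta>"
          using f_back[OF _ \<open>f y \<in> I\<close> \<beta>(1)] same fy \<alpha> \<beta> \<open>\<alpha> \<noteq> \<beta>\<close> by blast
        ultimately show ?thesis using fy f_im I'_def by auto
      qed
      show "I - I' \<subseteq> f ` J' \<beta>" unfolding I'_def J'_def using \<open>\<alpha> \<noteq> \<beta>\<close> by auto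
      fix j y assume jy: "j \<in> letters" "y \<in> J j"
      show "\<exists>j'\<in>letters. \<exists>y'\<in>J' j'. \<exists>m. y = (F ^^ m) y' \<and>
          m + q j \<le> (if j' = \<beta> then q (id \<beta>) + q \<alpha> else q (id j'))"
      proof (cases "y \<in> f ` J \<beta>")
        case True
        then obtain u where u: "u \<in> J \<beta>" "y = f u" by auto
        have "j = \<alpha>" using True sub jy same \<alpha> by blast
        moreover have "u \<in> J' \<beta>" using u J'_def \<open>\<alpha> \<noteq> \<beta>\<close> by auto
        ultimately show ?thesis using u fF[OF \<beta>(1) u(1)] \<beta>(1)
          by (intro bexI[of _ \<beta>] bexI[of _ u] exI[of _ "q \<beta>"]) auto
      next
        case False
        then show ?thesis using jy J'_alt
          by (intro bexI[of _ j] bexI[of _ y] exI[of _ 0]) auto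
      qed
    qed (use e \<alpha> \<beta> kn in auto)
    then show ?thesis using rv e by blast
  next
    case False
    then have lt: "s \<beta> + c \<beta> < s \<alpha>" using ne_len by auto
    define e where "e = s \<alpha>"
    define I' where "I' = I - J \<alpha>"
    define P where "P = {y \<in> I. f y \<in> J \<alpha>}"
    define J' where "J' = J(\<alpha> := P, \<beta> := J \<beta> - P)"
    \<comment> \<open>\<open>z\<close> is the preimage of \<open>s \<alpha>\<close> in
      \<open>J \<beta>\<close>. It cuts \<open>J \<beta>\<close> into the new interval of
      \<open>\<beta>\<close> on its left and that of \<open>\<alpha>\<close> on its right; so
      \<open>z\<close> becomes the left endpoint labelled \<open>\<alpha>\<close>, and
      \<open>p\<close> sends \<open>\<alpha>\<close> to \<open>\<beta>\<close>.\<close>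
    define z where "z = s \<alpha> - c \<beta>"
    define s' where "s' = s(\<alpha> := z)"
    define t' where "t' = t(\<alpha> := t \<beta>, \<beta> := z)"
    define p where "p = id(\<alpha> := \<beta>)"
    define q' where "q' = (\<lambda>j. if j = \<alpha> then q (p \<alpha>) + q \<alpha> else q (p j))"
    have e: "0 < e" "e < b" unfolding e_def using s\<alpha> s_ge0[OF \<alpha>(1)] st[OF \<alpha>(1)] \<alpha> by auto
    have sub: "J \<alpha> \<subseteq> f ` J \<beta>" unfolding fJ\<beta> J\<alpha> using lt by auto
    have I'eq: "I' = {0..<e}" unfolding I'_def J\<alpha> I e_def[symmetric] using e by auto
    have P\<beta>: "P \<subseteq> J \<beta>"
    proof
      fix y assume "y \<in> P"
      then have "f y \<in> f ` J \<beta>" "y \<in> I" using sub unfolding P_def by auto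
      then show "y \<in> J \<beta>" by (rule f_back) (rule \<beta>(1))
    qed
    have z: "s \<beta> < z" "z < t \<beta>" unfolding z_def using lt \<beta>(2) e(2) e_def by linarith+
    have J\<beta>: "J \<beta> = {s \<beta>..<t \<beta>}" using J \<beta> by auto
    have P: "P = {z..<t \<beta>}"
    proof
      show "P \<subseteq> {z..<t \<beta>}"
      proof
        fix y assume y: "y \<in> P"
        then have "y \<in> J \<beta>" using P\<beta> by auto
        moreover from this have "f y = y + c \<beta>" using c \<beta> by auto
        ultimately show "y \<in> {z..<t \<beta>}" using y J\<alpha> J\<beta> unfolding P_def z_def by auto
      qed
      show "{z..<t \<beta>} \<subseteq> P"
      proof
        fix y assume y: "y \<in> {z..<t \<beta>}"
        then have "y \<in> J \<beta>" using J\<beta> z by auto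
        moreover from this have "f y = y + c \<beta>" using c \<beta> by auto
        ultimately show "y \<in> P" using y J\<alpha> JI[OF \<beta>(1)] \<beta> unfolding P_def z_def by auto
      qed
    qed
    have rv: "rauzy_veech d (f, I, J) = (first_return f I', I', J')"
      unfolding rauzy_veech.simps the_\<alpha> the_\<beta> Let_def len[OF \<alpha>(1)] len[OF \<beta>(1)]
      using \<alpha> \<beta> lt by (simp add: I'_def J'_def P_def)
    have J'_simps: "J' \<alpha> = P" "J' \<beta> = J \<beta> - P" "\<And>j. j \<noteq> \<alpha> \<Longrightarrow> j \<noteq> \<beta> \<Longrightarrow> J' j = J j"
      unfolding J'_def using \<open>\<alpha> \<noteq> \<beta>\<close> by auto
    have J'_alt: "J' j = J j - P" if "j \<in> letters" "j \<noteq> \<alpha>" for j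
      using J'_simps that P\<beta> disj[OF that(1) \<beta>(1)] by (cases "j = \<beta>") auto
    have zP: "z \<in> P" using P z by auto
    have zJ: "z \<in> J \<beta>" using zP P\<beta> by auto
    have fz: "f z = s \<alpha>" using c[OF \<beta>(1) zJ] z_def by auto
    have "rv_inv (first_return f I') I' J' s' t' q' e"
    proof (rule rv_inv_induce[OF inv I'eq, where \<gamma>=\<alpha> and p=p and \<alpha>=\<alpha>])
      show "e \<in> orbits" using orb \<alpha> e_def by auto
      show "p j \<in> letters" if "j \<in> letters" for j using that \<beta> p_def by auto
      have "(F ^^ q \<beta>) z = s \<alpha>" using fF[OF \<beta>(1) zJ] fz by simp
      then have "(F ^^ q \<beta>) z \<in> orbits" using orb[OF \<alpha>(1)] by simp
      moreover have "z \<in> {0..<1}" using zJ JI[OF \<beta>(1)] I b by auto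
      ultimately have zo: "z \<in> orbits" by (rule orbits_pow_back)
      show "J' j = {s' j..<t' j} \<and> s' j < t' j \<and> s' j \<in> orbits" if j: "j \<in> letters" for j
      proof (cases "j = \<alpha>")
        case True
        then show ?thesis using J'_simps P z zo \<open>\<alpha> \<noteq> \<beta>\<close> by (auto simp: s'_def t'_def)
      next
        case False
        then show ?thesis
        proof (cases "j = \<beta>")
          case True
          have "J \<beta> - P = {s \<beta>..<z}" unfolding J\<beta> P using z by auto
          then show ?thesis using True J'_simps z orb \<beta> False by (auto simp: s'_def t'_def)
        qed (use J'_simps J st orb j in \<open>auto simp: s'_def t'_def\<close>)
      qed
      have "(\<Union>j\<in>letters. J' j) = (\<Union>j\<in>letters - {\<alpha>}. J j)"
      proof
        show "(\<Union>j\<in>letters. J' j) \<subseteq> (\<Union>j\<in>letters - {\<alpha>}. J j)"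
        proof
          fix y assume "y \<in> (\<Union>j\<in>letters. J' j)"
          then obtain j where j: "j \<in> letters" "y \<in> J' j" by auto
          then show "y \<in> (\<Union>j\<in>letters - {\<alpha>}. J j)"
            using J'_simps(1) J'_alt[of j] P\<beta> \<beta>(1) \<open>\<alpha> \<noteq> \<beta>\<close> by (cases "j = \<alpha>") auto
        qed
        show "(\<Union>j\<in>letters - {\<alpha>}. J j) \<subseteq> (\<Union>j\<in>letters. J' j)"
        proof
          fix y assume "y \<in> (\<Union>j\<in>letters - {\<alpha>}. J j)"
          then obtain j where j: "j \<in> letters" "j \<noteq> \<alpha>" "y \<in> J j" by blast
          then show "y \<in> (\<Union>j\<in>letters. J' j)"
            using J'_simps(1) J'_alt[of j] \<alpha>(1) by (cases "y \<in> P") blast+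
        qed
      qed
      also have "\<dots> = I'"
        unfolding I'_def using UJ disj \<alpha>(1) by blast
      finally show "(\<Union>j\<in>letters. J' j) = I'" .
      have "J' i \<inter> J' j = {}" if "i \<in> letters" "j \<in> letters" "i \<noteq> j" for i j
        using that J'_simps(1) J'_alt disj[OF that] by (cases "i = \<alpha>"; cases "j = \<alpha>") auto
      then show "disjoint_family_on J' letters" unfolding disjoint_family_on_def by blast
      show "J' j \<subseteq> J (p j)" if "j \<in> letters" for j
        using J'_simps(1) J'_alt[OF that] P\<beta> by (auto simp: p_def)
      show "f y \<in> I'" if "j \<in> letters" "j \<noteq> \<alpha>" "y \<in> J' j" for j y
      proof -
        have y: "y \<in> I" "y \<notin> P" using J'_alt[OF that(1,2)] that JI[of j] by auto
        then show ?thesis using f_im P_def I'_def by auto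
      qed
      show "f y \<in> J \<alpha> \<and> f y \<notin> I' \<and> f (f y) \<in> I'" if "y \<in> J' \<alpha>" for y
      proof -
        have fy: "f y \<in> J \<alpha>" "f y \<in> I" "f y \<notin> I'"
          using that J'_simps(1) P_def I'_def JI[OF \<alpha>(1)] by auto
        have "f (f y) \<notin> J \<alpha>"
          using f_back[OF _ fy(2) \<beta>(1)] sub same fy(1) \<alpha>(1) \<beta>(1) \<open>\<alpha> \<noteq> \<beta>\<close> by blast
        then show ?thesis using fy f_im I'_def by auto
      qed
      show "I - I' \<subseteq> f ` J' \<alpha>"
      proof
        fix y assume "y \<in> I - I'"
        then have y: "y \<in> J \<alpha>" using I'_def by auto
        then obtain u where "u \<in> J \<beta>" "y = f u" using sub by auto
        then show "y \<in> f ` J' \<alpha>" using J'_simps(1) P_def y JI[OF \<beta>(1)] by auto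
      qed
      show "(f ^^ n) (s' j) \<noteq> s' i" if ij: "j \<in> letters" "i \<in> letters" "n \<ge> 1" "s' i \<noteq> 0" for i j n
      proof
        assume eq: "(f ^^ n) (s' j) = s' i"
        \<comment> \<open>An orbit meeting \<open>z\<close> meets \<open>s \<alpha>\<close> one step
          later, and the orbit starting at \<open>z\<close> is that of \<open>s \<alpha>\<close>
          delayed by one; this reduces the new Keane clause to the old one.\<close>
        have fn: "(f ^^ Suc m) z = (f ^^ m) (s \<alpha>)" for m using fz by (simp add: funpow_swap1)
        show False
        proof (cases "i = \<alpha>")
          case True
          then have hit: "(f ^^ Suc n) (s' j) = s \<alpha>" using eq fz s'_def by simp
          show False
          proof (cases "j = \<alpha>")
            case True
            then show False using hit fn[of n] kn[OF \<alpha>(1) \<alpha>(1) ij(3) s\<alpha>] s'_def by simp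
          next
            case False
            then show False using hit kn[OF ij(1) \<alpha>(1), of "Suc n"] s\<alpha> s'_def by simp
          qed
        next
          case False
          then have si: "s' i = s i" using s'_def by simp
          show False
          proof (cases "j = \<alpha>")
            case True
            obtain m where m: "n = Suc m" using ij(3) by (cases n) auto
            have hit: "(f ^^ m) (s \<alpha>) = s i" using eq si fn[of m] m True s'_def by simp
            show False
            proof (cases "m = 0")
              case True
              then have "s \<alpha> = s i" using hit by simp
              then show False using same[of "s i" \<alpha> i] s_in \<alpha>(1) ij(2) False by metis
            next
              case False
              then show False using hit kn[OF \<alpha>(1) ij(2), of m] si ij(4) by simp
            qed
          next
            case False
            then show False using eq si kn[OF ij(1-3)] ij(4) s'_def by simp
          qed
        qed
      qed
      fix j y assume jy: "j \<in> letters" "y \<in> J j"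
      show "\<exists>j'\<in>letters. \<exists>y'\<in>J' j'. \<exists>m. y = (F ^^ m) y' \<and> m + q j \<le> q' j'"
      proof (cases "j = \<alpha>")
        case True
        then obtain u where u: "u \<in> J \<beta>" "y = f u" using sub jy by auto
        have "u \<in> J' \<alpha>" using u J'_simps(1) P_def jy True JI[OF \<beta>(1)] by auto
        then show ?thesis using u fF[OF \<beta>(1) u(1)] \<alpha>(1) True
          by (intro bexI[of _ \<alpha>] bexI[of _ u] exI[of _ "q \<beta>"]) (auto simp: q'_def p_def)
      next
        case False
        show ?thesis
        proof (cases "y \<in> P")
          case True
          then have "j = \<beta>" using P\<beta> same jy \<beta>(1) by blast
          then show ?thesis using True J'_simps(1) \<alpha>(1)
            by (intro bexI[of _ \<alpha>] bexI[of _ y] exI[of _ 0]) (auto simp: q'_def p_def)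
        next
          case F': False
          then show ?thesis using jy False J'_alt[OF jy(1) False]
            by (intro bexI[of _ j] bexI[of _ y] exI[of _ 0]) (auto simp: q'_def p_def)
        qed
      qed
    qed (use e \<alpha> in \<open>auto simp: q'_def\<close>)
    then show ?thesis using rv e by blast
  qed
qed

lemma rv_inv_iterate:
  "\<exists>f I J s t q b. rv_iterate d x F k = (f, I, J) \<and> rv_inv f I J s t q b \<and> (k \<ge> 1 \<longrightarrow> b < 1)"
proof (induction k)
  case 0
  then show ?case using rv_inv_start by (auto simp: rv_iterate_def)
next
  case (Suc k)
  then obtain f I J s t q b where k: "rv_iterate d x F k = (f, I, J)" "rv_inv f I J s t q b" by blast
  obtain f' I' J' s' t' q' e where step: "rauzy_veech d (f, I, J) = (f', I', J')"
      "rv_inv f' I' J' s' t' q' e" "e < b"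
    using rv_inv_step[OF k(2)] by blast
  have "b \<le> 1" using k(2) by (simp add: rv_inv_def)
  moreover have "rv_iterate d x F (Suc k) = (f', I', J')" using k(1) step(1) by (simp add: rv_iterate_def)
  ultimately show ?case using step by (metis less_le_trans)
qed

end

section \<open>Self-similarity\<close>

context keane_iet
begin

text \<open>\<open>w j\<close> is the itinerary of \<open>\<Lambda> I\<^sub>j\<close> up to its return to \<open>[0,\<Lambda>)\<close>, where the
  first return map is the rescaled \<open>F\<close> and the induced cocycle is again \<open>\<phi>\<close>.\<close>

definition renormalizable :: "(nat \<Rightarrow> 'g::comm_monoid_add) \<Rightarrow> real \<Rightarrow> (nat \<Rightarrow> nat list) \<Rightarrow> bool" where
  "renormalizable \<phi> \<Lambda> w \<longleftrightarrow> 0 < \<Lambda> \<and> \<Lambda> \<le> 1 \<and>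
     (\<forall>j\<in>letters. w j \<noteq> [] \<and> set (w j) \<subseteq> letters \<and> sum_list (map \<phi> (w j)) = \<phi> j \<and>
        (\<forall>y\<in>mark j. (\<forall>l<length (w j). (F ^^ l) (\<Lambda> * y) \<in> mark (w j ! l)) \<and>
           (\<forall>l. 0 < l \<and> l < length (w j) \<longrightarrow> (F ^^ l) (\<Lambda> * y) \<notin> {0..<\<Lambda>}) \<and>
           (F ^^ length (w j)) (\<Lambda> * y) = \<Lambda> * F y)) \<and>
     (\<forall>z\<in>{0..<1}. \<exists>j\<in>letters. \<exists>y\<in>mark j. \<exists>l<length (w j). z = (F ^^ l) (\<Lambda> * y))"

lemma renormalizableD:
  assumes "renormalizable \<phi> \<Lambda> w"
  shows "0 < \<Lambda>" "\<Lambda> \<le> 1"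
    and "j \<in> letters \<Longrightarrow> w j \<noteq> []" "j \<in> letters \<Longrightarrow> set (w j) \<subseteq> letters"
    and "j \<in> letters \<Longrightarrow> sum_list (map \<phi> (w j)) = \<phi> j"
    and "j \<in> letters \<Longrightarrow> y \<in> mark j \<Longrightarrow> l < length (w j) \<Longrightarrow> (F ^^ l) (\<Lambda> * y) \<in> mark (w j ! l)"
    and "j \<in> letters \<Longrightarrow> y \<in> mark j \<Longrightarrow> 0 < l \<Longrightarrow> l < length (w j) \<Longrightarrow> (F ^^ l) (\<Lambda> * y) \<notin> {0..<\<Lambda>}"
    and "j \<in> letters \<Longrightarrow> y \<in> mark j \<Longrightarrow> (F ^^ length (w j)) (\<Lambda> * y) = \<Lambda> * F y"
    and "z \<in> {0..<1} \<Longrightarrow> \<exists>j\<in>letters. \<exists>y\<in>mark j. \<exists>l<length (w j). z = (F ^^ l) (\<Lambda> * y)"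
    and "j \<in> letters \<Longrightarrow> l < length (w j) \<Longrightarrow> w j ! l \<in> letters"
  using assms nth_mem[of l "w j"] unfolding renormalizable_def by blast+

lemma renormalizable_1: "renormalizable \<phi> 1 (\<lambda>j. [j])"
proof -
  have "\<exists>j\<in>letters. \<exists>y\<in>mark j. \<exists>l<length [j]. z = (F ^^ l) (1 * y)" if z: "z \<in> {0..<1}" for z
  proof -
    obtain i where "i \<in> letters" "z \<in> mark i" using mark_cover z by blast
    then show ?thesis by (intro bexI[of _ i] bexI[of _ z] exI[of _ 0]) auto
  qed
  then show ?thesis unfolding renormalizable_def by auto
qed

lemma letter_in: "z \<in> {0..<1} \<Longrightarrow> \<exists>i\<in>letters. z \<in> mark i"
  using mark_cover by blast

lemma scale_in: "0 < \<Lambda> \<Longrightarrow> \<Lambda> \<le> 1 \<Longrightarrow> z \<in> {0..<1} \<Longrightarrow> \<Lambda> * z \<in> {0..<1::real}"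
  by (auto intro: mult_le_one simp: mult_le_one le_less_trans[OF mult_left_le_one_le])

text \<open>One step of \<open>F\<close> at \<open>z\<close> corresponds to crossing a whole tower
  over \<open>\<Lambda> * z\<close>, namely the one named by the current letter of the
  itinerary.\<close>

lemma renormalizable_passage:
  assumes r: "renormalizable \<phi> \<Lambda> v" and it: "\<And>l. l < length u \<Longrightarrow> (F ^^ l) z \<in> mark (u ! l)"
    and u: "set u \<subseteq> letters" and l: "l \<le> length u"
  shows "(F ^^ length (concat (map v (take l u)))) (\<Lambda> * z) = \<Lambda> * (F ^^ l) z"
  using l
proof (induction l)
  case (Suc l)
  then have l: "l < length u" "u ! l \<in> letters" using u by (simp, meson Suc_le_lessD nth_mem subsetD)
  have "length (concat (map v (take (Suc l) u))) = length (v (u ! l)) + length (concat (map v (take l u)))"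
    using l by (simp add: take_Suc_conv_app_nth)
  then have "(F ^^ length (concat (map v (take (Suc l) u)))) (\<Lambda> * z) =
      (F ^^ length (v (u ! l))) (\<Lambda> * (F ^^ l) z)"
    using Suc by (simp add: funpow_add)
  then show ?case using renormalizableD(8)[OF r l(2) it[OF l(1)]] by simp
qed simp

text \<open>The point \<open>\<Lambda> * \<Lambda>' * y\<close> follows at scale
  \<open>\<Lambda>\<close> the itinerary of \<open>\<Lambda>' * y\<close>, crossing one
  \<open>v\<close>-tower per letter of \<open>w j\<close>; so powers of one renormalization are
  governed by powers of the substitution.\<close>

lemma renormalizable_mult:
  assumes v: "renormalizable \<phi> \<Lambda> v" and w: "renormalizable \<phi> \<Lambda>' w"
  shows "renormalizable \<phi> (\<Lambda> * \<Lambda>') (\<lambda>j. concat (map v (w j)))"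
proof -
  note V = renormalizableD[OF v] and W = renormalizableD[OF w]
  have j_part: "concat (map v (w j)) \<noteq> [] \<and> set (concat (map v (w j))) \<subseteq> letters \<and>
      sum_list (map \<phi> (concat (map v (w j)))) = \<phi> j" if j: "j \<in> letters" for j
  proof (intro conjI)
    show "concat (map v (w j)) \<noteq> []"
      using V(3) W(3,4)[OF j] by (cases "w j") auto
    show "set (concat (map v (w j))) \<subseteq> letters" using V(4) W(4)[OF j] by fastforce
    have "sum_list (map \<phi> (concat (map v (w j)))) = sum_list (map \<phi> (w j))"
      using V(5) W(4)[OF j] by (intro sum_list_concat_map) auto
    then show "sum_list (map \<phi> (concat (map v (w j)))) = \<phi> j" using W(5)[OF j] by simp
  qed
  have pass: "(F ^^ length (concat (map v (take l (w j))))) (\<Lambda> * \<Lambda>' * y) = \<Lambda> * (F ^^ l) (\<Lambda>' * y)"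
    if "j \<in> letters" "y \<in> mark j" "l \<le> length (w j)" for j y l
    using renormalizable_passage[OF v _ W(4)[OF that(1)] that(3), of "\<Lambda>' * y"] W(6)[OF that(1,2)]
    by (simp add: mult.assoc)
  have y_part: "(\<forall>l<length (concat (map v (w j))). (F ^^ l) (\<Lambda> * \<Lambda>' * y) \<in> mark (concat (map v (w j)) ! l)) \<and>
      (\<forall>l. 0 < l \<and> l < length (concat (map v (w j))) \<longrightarrow> (F ^^ l) (\<Lambda> * \<Lambda>' * y) \<notin> {0..<\<Lambda> * \<Lambda>'}) \<and>
      (F ^^ length (concat (map v (w j)))) (\<Lambda> * \<Lambda>' * y) = \<Lambda> * \<Lambda>' * F y"
    if j: "j \<in> letters" and y: "y \<in> mark j" for j y
  proof (intro conjI allI impI)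
    have *: "\<exists>l<length (w j). \<exists>r<length (v (w j ! l)). 
        concat (map v (w j)) ! m = v (w j ! l) ! r \<and>
        (F ^^ m) (\<Lambda> * \<Lambda>' * y) = (F ^^ r) (\<Lambda> * (F ^^ l) (\<Lambda>' * y))"
      if m: "m < length (concat (map v (w j)))" for m
    proof -
      obtain l r where lr: "l < length (w j)" "r < length (v (w j ! l))"
          "m = length (concat (map v (take l (w j)))) + r" "concat (map v (w j)) ! m = v (w j ! l) ! r"
        using concat_map_nth[OF m] by blast
      have "(F ^^ m) (\<Lambda> * \<Lambda>' * y) = (F ^^ r) ((F ^^ length (concat (map v (take l (w j))))) (\<Lambda> * \<Lambda>' * y))"
        unfolding lr(3) by (simp add: funpow_add add.commute)
      then show ?thesis
        using pass[OF j y, of l] lr(1,2,4) by auto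
    qed
    fix m assume "m < length (concat (map v (w j)))"
    then obtain l r where lr: "l < length (w j)" "r < length (v (w j ! l))"
        "concat (map v (w j)) ! m = v (w j ! l) ! r"
        "(F ^^ m) (\<Lambda> * \<Lambda>' * y) = (F ^^ r) (\<Lambda> * (F ^^ l) (\<Lambda>' * y))"
      using * by blast
    have "w j ! l \<in> letters" using W(10)[OF j] lr by blast
    then show "(F ^^ m) (\<Lambda> * \<Lambda>' * y) \<in> mark (concat (map v (w j)) ! m)"
      using V(6) W(6)[OF j y lr(1)] lr by simp
  next
    fix m assume m: "0 < m \<and> m < length (concat (map v (w j)))"
    then obtain l r where lr: "l < length (w j)" "r < length (v (w j ! l))"
        "m = length (concat (map v (take l (w j)))) + r"
      using concat_map_nth by blast
    have eq: "(F ^^ m) (\<Lambda> * \<Lambda>' * y) = (F ^^ r) (\<Lambda> * (F ^^ l) (\<Lambda>' * y))"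
      unfolding lr(3) using pass[OF j y, of l] lr(1) by (simp add: funpow_add add.commute)
    have L: "w j ! l \<in> letters" using W(10)[OF j] lr by blast
    show "(F ^^ m) (\<Lambda> * \<Lambda>' * y) \<notin> {0..<\<Lambda> * \<Lambda>'}"
    \<comment> \<open>At the bottom of a \<open>v\<close>-tower the point is
      \<open>\<Lambda>\<close> times a point outside \<open>[0,\<Lambda>')\<close>; on the other
      levels it is outside \<open>[0,\<Lambda>)\<close>, which contains
      \<open>[0,\<Lambda> * \<Lambda>')\<close>.\<close>
    proof (cases "r = 0")
      case True
      then have "l > 0" using m lr(3) by (cases l) auto
      then have "(F ^^ l) (\<Lambda>' * y) \<notin> {0..<\<Lambda>'}" using W(7)[OF j y _ lr(1)] by auto
      then show ?thesis using eq True V(1) by (auto simp: zero_le_mult_iff)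
    next
      case False
      have "(F ^^ r) (\<Lambda> * (F ^^ l) (\<Lambda>' * y)) \<notin> {0..<\<Lambda>}"
        using V(7)[OF L W(6)[OF j y lr(1)] _ lr(2)] False by auto
      moreover have "\<Lambda> * \<Lambda>' \<le> \<Lambda>" using V(1) W(1,2) by (simp add: mult_le_cancel_left1)
      ultimately show ?thesis using eq by auto
    qed
  next
    show "(F ^^ length (concat (map v (w j)))) (\<Lambda> * \<Lambda>' * y) = \<Lambda> * \<Lambda>' * F y"
      using pass[OF j y, of "length (w j)"] W(8)[OF j y] by simp
  qed
  have cover: "\<exists>j\<in>letters. \<exists>y\<in>mark j. \<exists>l<length (concat (map v (w j))). z = (F ^^ l) (\<Lambda> * \<Lambda>' * y)"
    if z: "z \<in> {0..<1}" for z
  proof -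
    obtain i u r where i: "i \<in> letters" "u \<in> mark i" "r < length (v i)" "z = (F ^^ r) (\<Lambda> * u)"
      using V(9)[OF z] by blast
    then have "u \<in> {0..<1}" using mark_subset by blast
    then obtain j y l where j: "j \<in> letters" "y \<in> mark j" "l < length (w j)" "u = (F ^^ l) (\<Lambda>' * y)"
      using W(9) by blast
    have "w j ! l \<in> letters" using W(10) j by blast
    then have il: "i = w j ! l" using letter_unique[OF i(2)] W(6)[OF j(1-3)] i(1) j(4) by auto
    have "z = (F ^^ (length (concat (map v (take l (w j)))) + r)) (\<Lambda> * \<Lambda>' * y)"
      using pass[OF j(1,2), of l] i(4) j(3,4) by (simp add: funpow_add add.commute)
    moreover have "length (concat (map v (take l (w j)))) + r < length (concat (map v (w j)))"
      using concat_map_position(1)[OF j(3)] i(3) il by blast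
    ultimately show ?thesis using j by blast
  qed
  have "0 < \<Lambda> * \<Lambda>'" "\<Lambda> * \<Lambda>' \<le> 1" using V(1,2) W(1,2) by (auto intro: mult_le_one)
  then show ?thesis
    unfolding renormalizable_def using j_part y_part cover by blast
qed

lemma renormalizable_pow:
  assumes "renormalizable \<phi> \<Lambda> w"
  shows "renormalizable \<phi> (\<Lambda> ^ k) (subst_pow w k)"
proof (induction k)
  case 0
  then show ?case using renormalizable_1 by (simp add: subst_pow_0)
next
  case (Suc k)
  have "subst_pow w (Suc k) = (\<lambda>j. concat (map (subst_pow w k) (w j)))" by (rule ext) simp
  then show ?case using renormalizable_mult[OF Suc assms] by (simp add: mult.commute)
qed

text \<open>Scaling by \<open>\<Lambda>\<close> turns a step of \<open>F\<close> into a power of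
  \<open>F\<close>, so it carries orbits into orbits once the marked points are carried there. This
  supplies doubled endpoints at all scales \<open>\<Lambda> ^ k\<close>.\<close>

lemma orbits_scale:
  assumes r: "renormalizable \<phi> \<Lambda> w" and x: "\<And>i. i < d \<Longrightarrow> \<Lambda> * x i \<in> orbits"
    and z: "z \<in> orbits"
  shows "\<Lambda> * z \<in> orbits"
  using z
proof (induction rule: orbits.induct)
  case (forward z)
  then obtain j where j: "j \<in> letters" "z \<in> mark j" using letter_in by blast
  show ?case using renormalizableD(8)[OF r j] orbits_pow[OF forward.IH, of "length (w j)"] by simp
next
  case (backward z)
  then obtain j where j: "j \<in> letters" "z \<in> mark j" using letter_in by blast
  have "(F ^^ length (w j)) (\<Lambda> * z) \<in> orbits" using renormalizableD(8)[OF r j] backward by simp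
  then show ?case
    by (rule orbits_pow_back) (rule scale_in[OF renormalizableD(1,2)[OF r] backward(2)])
qed (use x in auto)

lemma step_function_mark:
  assumes "i \<in> letters" "z \<in> mark i"
  shows "step_function d mark \<phi> z = \<phi> i"
proof -
  have "(THE i. i \<in> letters \<and> z \<in> mark i) = i"
    using assms letter_unique by (intro the_equality) blast+
  then show ?thesis by (simp add: step_function_def)
qed

lemma iet_skew_pow:
  fixes \<phi> :: "nat \<Rightarrow> 'g::comm_monoid_add"
  shows "(iet_skew d x F \<phi> ^^ n) (z, a) =
    ((F ^^ n) z, a + (\<Sum>l<n. step_function d mark \<phi> ((F ^^ l) z)))"
  by (induction n) (auto simp: iet_skew_def skew_product_def add.assoc)

text \<open>The two coordinates of the return map give two conclusions: the first, that points
  return by the rescaled \<open>F\<close>; the second, that the word read until the return has sum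
  \<open>\<phi> j\<close>. Agreement of the labelled intervals identifies
  \<open>\<Lambda> * x i\<close> with a left endpoint of the induction, which \<open>rv_inv\<close>
  keeps inside \<open>orbits\<close>.\<close>

lemma periodic_type_renormalizable:
  fixes \<phi> :: "nat \<Rightarrow> 'g::comm_monoid_add"
  assumes "periodic_type d x F \<phi>"
  shows "\<exists>\<Lambda> w. renormalizable \<phi> \<Lambda> w \<and> \<Lambda> < 1 \<and> \<Lambda> \<in> orbits \<and> (\<forall>i<d. \<Lambda> * x i \<in> orbits)"
proof -
  obtain N where N: "N \<ge> 1"
    "\<And>p. p \<in> {0..<1} \<times> UNIV \<Longrightarrow> renormalized_skew d x F \<phi> N p = iet_skew d x F \<phi> p"
    "\<And>j. j \<in> letters \<Longrightarrow> (\<lambda>y. y / measure lborel (rv_domain d x F N)) ` rv_interval d x F N j = mark j"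
    using assms unfolding periodic_type_def by auto
  obtain f I J s t q b where rv: "rv_iterate d x F N = (f, I, J)" and inv: "rv_inv f I J s t q b"
    and b1: "b < 1" using rv_inv_iterate[of N] N(1) by blast
  note inv' = rv_invD[OF inv]
  have dom: "rv_domain d x F N = I" "rv_interval d x F N = J"
    using rv by (auto simp: rv_domain_def rv_interval_def)
  have L: "measure lborel I = b" using inv'(1,3) by simp
  have Jmark: "(\<lambda>y. y / b) ` J j = mark j" if "j \<in> letters" for j using N(3)[OF that] dom L by simp
  have in_J: "b * y \<in> J j" if y: "j \<in> letters" "y \<in> mark j" for j y
  proof -
    obtain z where "z \<in> J j" "y = z / b" using Jmark[OF y(1)] y(2) by blast
    then show ?thesis using inv'(1) by simp
  qed
  have left: "s j = b * x (j - 1)" if j: "j \<in> letters" for j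
  proof -
    have J: "J j = {s j..<t j}" "s j < t j" using inv'(5) j by blast+
    have "b * x (j - 1) \<in> J j" using in_J[OF j] mark_endpoints[OF j] by (auto simp: marked_interval_def)
    moreover have "s j \<in> J j" using J by auto
    then have "s j / b \<in> mark j" using Jmark[OF j] by blast
    then have "x (j - 1) \<le> s j / b" by (simp add: marked_interval_def)
    ultimately show ?thesis using J inv'(1) by (auto simp: marked_interval_def field_simps)
  qed
  have "b \<in> orbits" using inv'(4) b1 by auto
  moreover have "b * x i \<in> orbits" if "i < d" for i
  proof -
    have "Suc i \<in> letters" using that by auto
    then show ?thesis using left[of "Suc i"] inv'(5) by fastforce
  qed
  moreover have dyn: "1 \<le> q j" "y \<in> J j \<Longrightarrow> f y = (F ^^ q j) y"
      "y \<in> J j \<Longrightarrow> 0 < l \<Longrightarrow> l < q j \<Longrightarrow> (F ^^ l) y \<notin> I"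
      "l < q j \<Longrightarrow> \<exists>i. i \<in> letters \<and> (F ^^ l) ` J j \<subseteq> mark i" if "j \<in> letters" for j l y
    using inv'(11) that by blast+
  define letter where "letter j l = (SOME i. i \<in> letters \<and> (F ^^ l) ` J j \<subseteq> mark i)" for j l
  have letter: "letter j l \<in> letters" "(F ^^ l) ` J j \<subseteq> mark (letter j l)"
    if "j \<in> letters" "l < q j" for j l
    using someI_ex[OF dyn(4)[OF that]] unfolding letter_def by blast+
  define w where "w j = map (letter j) [0..<q j]" for j
  have ret: "(F ^^ q j) (b * y) = b * F y \<and> (\<Sum>l<q j. \<phi> (letter j l)) = \<phi> j"
    if j: "j \<in> letters" and y: "y \<in> mark j" for j y
  proof -
    have bJ: "b * y \<in> J j" using in_J[OF j y] .
    have "b * y \<in> I" using inv'(6) j bJ by blast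
    then have "f (b * y) \<in> I" using inv'(9) unfolding bij_betw_def by blast
    then have "(F ^^ q j) (b * y) \<in> I" using dyn(2)[OF j bJ] by simp
    then have "return_time (iet_skew d x F \<phi>) (I \<times> UNIV) (b * y, 0) = q j"
      unfolding return_time_def iet_skew_pow using dyn(1)[OF j] dyn(3)[OF j bJ]
      by (intro Least_equality) (auto simp: not_less[symmetric])
    then have fr: "first_return (iet_skew d x F \<phi>) (I \<times> UNIV) (b * y, 0) =
        ((F ^^ q j) (b * y), 0 + (\<Sum>l<q j. step_function d mark \<phi> ((F ^^ l) (b * y))))"
      unfolding first_return_def by (simp only: iet_skew_pow)
    have sum: "(\<Sum>l<q j. step_function d mark \<phi> ((F ^^ l) (b * y))) = (\<Sum>l<q j. \<phi> (letter j l))"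
      using letter[OF j] bJ by (intro sum.cong refl step_function_mark) auto
    have "y \<in> {0..<1}" using y j mark_subset by blast
    then have "renormalized_skew d x F \<phi> N (y, 0) = iet_skew d x F \<phi> (y, 0)"
      using N(2)[of "(y, 0)"] by simp
    moreover have "renormalized_skew d x F \<phi> N (y, 0) =
        ((F ^^ q j) (b * y) / b, \<Sum>l<q j. \<phi> (letter j l))"
      unfolding renormalized_skew_def by (simp add: dom L fr sum)
    moreover have "iet_skew d x F \<phi> (y, 0) = (F y, \<phi> j)"
      by (simp add: iet_skew_def skew_product_def step_function_mark[OF j y])
    ultimately have "(F ^^ q j) (b * y) / b = F y" "(\<Sum>l<q j. \<phi> (letter j l)) = \<phi> j"
      by auto
    then show ?thesis using inv'(1) by (auto simp: field_simps)
  qed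
  have "renormalizable \<phi> b w"
    unfolding renormalizable_def
  proof (intro conjI ballI allI impI)
    show "0 < b" "b \<le> 1" using inv'(1,2) by auto
    fix j assume j: "j \<in> letters"
    show "w j \<noteq> []" using dyn(1)[OF j] by (simp add: w_def)
    show "set (w j) \<subseteq> letters" using letter(1)[OF j] by (auto simp: w_def)
    have "x (j - 1) \<in> mark j" using mark_endpoints[OF j] by (auto simp: marked_interval_def)
    then show "sum_list (map \<phi> (w j)) = \<phi> j"
      using ret[OF j] by (simp add: w_def interv_sum_list_conv_sum_set_nat atLeast0LessThan)
    fix y assume y: "y \<in> mark j"
    show "(F ^^ l) (b * y) \<in> mark (w j ! l)" if "l < length (w j)" for l
      using letter(2)[OF j, of l] that in_J[OF j y] by (auto simp: w_def)
    show "(F ^^ l) (b * y) \<notin> {0..<b}" if "0 < l \<and> l < length (w j)" for l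
      using dyn(3)[OF j in_J[OF j y], of l] that inv'(3) by (auto simp: w_def)
    show "(F ^^ length (w j)) (b * y) = b * F y" using ret[OF j y] by (simp add: w_def)
  next
    fix z assume z: "z \<in> {0..<1::real}"
    then obtain j y l where j: "j \<in> letters" "y \<in> J j" "l < q j" "z = (F ^^ l) y" using inv'(12) by blast
    have "y / b \<in> mark j" using Jmark[OF j(1)] j(2) by blast
    then show "\<exists>j\<in>letters. \<exists>y\<in>mark j. \<exists>l<length (w j). z = (F ^^ l) (b * y)"
      using j inv'(1) by (intro bexI[of _ j] bexI[of _ "y / b"] exI[of _ l]) (auto simp: w_def)
  qed
  ultimately show ?thesis using b1 by blast
qed

text \<open>Some stage \<open>n\<close> of the induction has a matrix with positive entries, so each
  of its towers visits every marked interval. Once \<open>\<Lambda> ^ k\<close> is below the length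
  of its domain, every orbit leaving \<open>[0,\<Lambda> ^ k)\<close> starts at the bottom of such a
  tower and must climb all of it before it can return.\<close>

lemma renormalizable_positive:
  assumes r: "renormalizable \<phi> \<Lambda> w" and \<Lambda>: "\<Lambda> < 1" and ic: "infinitely_complete d x F"
  shows "\<exists>k\<ge>1. \<forall>j\<in>letters. set (subst_pow w k j) = letters"
proof -
  have "\<forall>\<^sub>F n in sequentially. \<forall>i\<in>letters. \<forall>j\<in>letters. rv_matrix d x F n i j \<ge> 1"
    using ic unfolding infinitely_complete_def filterlim_at_top
    by (intro eventually_ball_finite ballI finite_atLeastAtMost) blast
  from eventually_happens'[OF sequentially_bot this]
  obtain n where n: "\<And>i j. i \<in> letters \<Longrightarrow> j \<in> letters \<Longrightarrow> rv_matrix d x F n i j \<ge> 1"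
    by blast
  obtain f I J s t q b where rv: "rv_iterate d x F n = (f, I, J)" and inv: "rv_inv f I J s t q b"
    using rv_inv_iterate[of n] by blast
  note inv' = rv_invD[OF inv]
  have dom: "rv_domain d x F n = I" "rv_interval d x F n = J"
    using rv by (auto simp: rv_domain_def rv_interval_def)
  have dyn: "1 \<le> q j" "y \<in> J j \<Longrightarrow> f y = (F ^^ q j) y"
      "y \<in> J j \<Longrightarrow> 0 < l \<Longrightarrow> l < q j \<Longrightarrow> (F ^^ l) y \<notin> I" if "j \<in> letters" for j l y
    using inv'(11) that by blast+
  have ret: "return_time F I y = q j" if j: "j \<in> letters" "y \<in> J j" for j y
  proof -
    have "y \<in> I" using inv'(6) j by blast
    then have "f y \<in> I" using inv'(9) unfolding bij_betw_def by blast
    then have "(F ^^ q j) y \<in> I" using dyn(2)[OF j] by simp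
    then show ?thesis
      unfolding return_time_def using dyn(1)[OF j(1)] dyn(3)[OF j]
      by (intro Least_equality) (auto simp: not_less[symmetric])
  qed
  have time: "rv_time d x F n j = q j" if j: "j \<in> letters" for j
  proof -
    have "s j \<in> J j" using inv'(5) j by fastforce
    then show ?thesis
      unfolding rv_time_def dom using ret[OF j] by (intro the_equality) auto
  qed
  have visit: "\<exists>l<q j. (F ^^ l) ` J j \<subseteq> mark i" if "i \<in> letters" "j \<in> letters" for i j
  proof -
    have "{l. l < q j \<and> (F ^^ l) ` J j \<subseteq> mark i} \<noteq> {}"
      using n[OF that] unfolding rv_matrix_def dom time[OF that(2)] by (metis card.empty not_one_le_zero)
    then show ?thesis by blast
  qed
  obtain k0 where k0: "\<Lambda> ^ k0 < b" using real_arch_pow_inv[OF inv'(1) \<Lambda>] by blast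
  define k where "k = Suc k0"
  have \<Lambda>k: "\<Lambda> ^ k < b"
    using k0 renormalizableD(1)[OF r] \<Lambda> unfolding k_def
    by (simp add: le_less_trans[OF mult_left_le_one_le])
  note R = renormalizableD[OF renormalizable_pow[OF r, of k]]
  have "set (subst_pow w k j) = letters" if j: "j \<in> letters" for j
  proof
    show "set (subst_pow w k j) \<subseteq> letters" using R(4)[OF j] .
    show "letters \<subseteq> set (subst_pow w k j)"
    proof
      fix i assume i: "i \<in> letters"
      have y: "x (j - 1) \<in> mark j" using mark_endpoints[OF j] by (auto simp: marked_interval_def)
      have small: "\<Lambda> ^ k * z \<in> I" if "z \<in> {0..<1}" for z
      proof -
        have "\<Lambda> ^ k * z \<le> \<Lambda> ^ k * 1" using that R(1) by (intro mult_left_mono) auto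
        then have "\<Lambda> ^ k * z < b" using \<Lambda>k by linarith
        then show ?thesis using that R(1) inv'(3) by auto
      qed
      have y01: "x (j - 1) \<in> {0..<1}" using mark_subset[OF j] y by blast
      then have "\<Lambda> ^ k * x (j - 1) \<in> I" by (rule small)
      then obtain j' where j': "j' \<in> letters" "\<Lambda> ^ k * x (j - 1) \<in> J j'" using inv'(6) by blast
      have "(F ^^ length (subst_pow w k j)) (\<Lambda> ^ k * x (j - 1)) \<in> I"
        using R(8)[OF j y] small[OF F_in[OF y01]] by simp
      moreover have "0 < length (subst_pow w k j)" using R(3)[OF j] by simp
      ultimately have le: "q j' \<le> length (subst_pow w k j)" using dyn(3)[OF j'] by (meson not_le)
      obtain l where l: "l < q j'" "(F ^^ l) ` J j' \<subseteq> mark i" using visit[OF i j'(1)] by blast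
      then have "(F ^^ l) (\<Lambda> ^ k * x (j - 1)) \<in> mark i" using j' by blast
      moreover have "(F ^^ l) (\<Lambda> ^ k * x (j - 1)) \<in> mark (subst_pow w k j ! l)"
        using R(6)[OF j y] l le by simp
      moreover have "subst_pow w k j ! l \<in> letters" using R(10)[OF j] l(1) le by simp
      ultimately have "i = subst_pow w k j ! l" using letter_unique i by blast
      then show "i \<in> set (subst_pow w k j)" using l le by auto
    qed
  qed
  then show ?thesis by (intro exI[of _ k]) (auto simp: k_def)
qed

text \<open>By the Keane property the preimage \<open>u\<close> of \<open>x l\<close> is no left
  endpoint, so the exchanged interval around \<open>u\<close> extends to both sides of
  \<open>u\<close>, and its image meets both neighbours of \<open>x l\<close>. The images are kept
  positive for the sake of \<open>displacement_neighbours\<close>.\<close>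

lemma fork:
  assumes l: "1 \<le> l" "l < d"
  shows "\<exists>i\<in>letters. \<exists>y\<in>mark i. \<exists>y'\<in>mark i. F y \<in> mark l \<and> 0 < F y \<and> F y' \<in> mark (Suc l) \<and> 0 < F y'"
proof -
  have xl: "x l \<in> {0..<1}" "0 < x l" using x_ge0[of l] x_less_1[of l] x_pos[of l] l by auto
  then obtain u where u: "u \<in> {0..<1}" "x l = F u" using F_bij unfolding bij_betw_def by blast
  obtain i where i: "i \<in> letters" "u \<in> mark i" using letter_in[OF u(1)] by blast
  have "u \<noteq> x (i - 1)"
  proof
    assume "u = x (i - 1)"
    then have "(F ^^ 1) (x (i - 1)) \<in> x ` {1..d - 1}" using u(2)[symmetric] l by auto
    moreover have "i - 1 < d" using i by auto
    ultimately show False using keane unfolding keane_def by blast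
  qed
  then have ui: "x (i - 1) < u" "u < x i" using i by (auto simp: marked_interval_def)
  obtain c where c: "\<forall>y\<in>mark i. F y = y + c" using F_translation[OF i(1)] by blast
  have xl1: "x (l - 1) < x l" "x l < x (Suc l)" "0 \<le> x (l - 1)"
    using x_less[of "l - 1" l] x_Suc[of l] x_ge0[of "l - 1"] l by auto
  \<comment> \<open>Half the smaller of the room left of \<open>u\<close> in its interval and the
    room left of \<open>x l\<close> in \<open>mark l\<close>.\<close>
  define e where "e = min (u - x (i - 1)) (x l - x (l - 1)) / 2"
  have e: "0 < e" "e < u - x (i - 1)" "e < x l - x (l - 1)" unfolding e_def using ui xl1 by auto
  have y: "u - e \<in> mark i" using e ui by (auto simp: marked_interval_def)
  then have "F (u - e) = x l - e" using c i u by auto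
  then have "F (u - e) \<in> mark l" "0 < F (u - e)" using e xl1 by (auto simp: marked_interval_def)
  moreover have "F u \<in> mark (Suc l)" "0 < F u" using u xl xl1 by (auto simp: marked_interval_def)
  ultimately show ?thesis using i y by blast
qed

text \<open>\<open>F\<close> is injective, so of two points in \<open>mark i\<close> at most one is
  mapped to \<open>0\<close>.\<close>

lemma follow:
  assumes i: "i \<in> letters"
  shows "\<exists>i'\<in>letters. \<exists>y\<in>mark i. F y \<in> mark i' \<and> 0 < F y"
proof -
  define u where "u = (x (i - 1) + x i) / 2"
  have y: "x (i - 1) \<in> mark i" "u \<in> mark i" "x (i - 1) \<noteq> u"
    using mark_endpoints[OF i] by (auto simp: marked_interval_def u_def)
  then have y01: "x (i - 1) \<in> {0..<1}" "u \<in> {0..<1}" using mark_subset[OF i] by blast+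
  then have "F (x (i - 1)) \<noteq> F u" using y F_inj by (meson inj_onD)
  then obtain z where z: "z \<in> mark i" "F z \<noteq> 0" using y by metis
  then have "F z \<in> {0..<1}" using mark_subset[OF i] F_in by blast
  moreover from this obtain i' where "i' \<in> letters" "F z \<in> mark i'" using letter_in by blast
  ultimately show ?thesis using z by (intro bexI[of _ i'] bexI[of _ z]) auto
qed

text \<open>A point whose image is bounded away from \<open>0\<close> is not on the top level of any sufficiently
  high tower, so that its letter and the next one are neighbours in an iterated word.\<close>

lemma displacement_neighbours:
  assumes r: "renormalizable \<phi> \<Lambda> w" and \<Lambda>: "\<Lambda> < 1" and S: "primitive_substitution letters w \<phi>"
    and i: "i \<in> letters" "i' \<in> letters" and y: "y \<in> mark i" "F y \<in> mark i'" "0 < F y"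
  shows "primitive_substitution.displacement letters w \<phi> i i' (\<phi> i)"
proof -
  interpret S: primitive_substitution letters w \<phi> by fact
  obtain k where k: "\<Lambda> ^ k < F y" using real_arch_pow_inv[OF y(3) \<Lambda>] by blast
  note R = renormalizableD[OF renormalizable_pow[OF r, of k]]
  have "y \<in> {0..<1}" using y(1) i(1) mark_subset by blast
  then obtain j u l where j: "j \<in> letters" "u \<in> mark j" "l < length (subst_pow w k j)"
    "y = (F ^^ l) (\<Lambda> ^ k * u)" using R(9) by blast
  let ?W = "subst_pow w k j"
  have top: "Suc l < length ?W"
  proof (rule ccontr)
    assume "\<not> Suc l < length ?W"
    then have "length ?W = Suc l" using j by simp
    then have "F y = \<Lambda> ^ k * F u" using R(8)[OF j(1,2)] j(4) by simp
    moreover have "F u < 1" using j(1,2) mark_subset F_in by fastforce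
    ultimately have "F y < \<Lambda> ^ k * 1" using R(1) by (metis mult_strict_left_mono)
    then show False using k by simp
  qed
  have W: "?W ! l \<in> letters" "?W ! Suc l \<in> letters" using R(10)[OF j(1)] top by (meson Suc_lessD)+
  have "i = ?W ! l" using letter_unique[OF y(1)] R(6)[OF j(1-3)] W(1) i j(4) by auto
  moreover have "i' = ?W ! Suc l"
    using letter_unique[OF y(2)] R(6)[OF j(1,2) top] W(2) i j(4) by auto
  ultimately have "S.occurs k i j (sum_list (map \<phi> (take l ?W)))"
    "S.occurs k i' j (sum_list (map \<phi> (take (Suc l) ?W)))"
    unfolding S.occurs_def using id_take_nth_drop[of l ?W] id_take_nth_drop[of "Suc l" ?W] top by auto
  moreover have "sum_list (map \<phi> (take (Suc l) ?W)) - sum_list (map \<phi> (take l ?W)) = \<phi> i"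
    using top \<open>i = ?W ! l\<close> by (simp add: take_Suc_conv_app_nth)
  ultimately show ?thesis unfolding S.displacement_def using j(1) by blast
qed

text \<open>The displacement \<open>g\<close> is a parameter, because a finite word has only
  finitely many differences of prefix sums; different \<open>g\<close> may thus need different
  \<open>\<Lambda>\<close> and \<open>w\<close>.\<close>

definition good_renorm :: "(nat \<Rightarrow> 'g::ab_group_add) \<Rightarrow> 'g \<Rightarrow> real \<Rightarrow> (nat \<Rightarrow> nat list) \<Rightarrow> bool" where
  "good_renorm \<phi> g \<Lambda> w \<longleftrightarrow> renormalizable \<phi> \<Lambda> w \<and> \<Lambda> < 1 \<and> \<Lambda> \<in> orbits \<and> (\<forall>i<d. \<Lambda> * x i \<in> orbits) \<and>
     (\<forall>j\<in>letters. set (w j) = letters) \<and>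
     (\<forall>i\<in>letters. \<forall>j\<in>letters. \<exists>l l'. l < length (w j) \<and> l' < length (w j) \<and> w j ! l = i \<and> w j ! l' = i \<and>
        sum_list (map \<phi> (take l' (w j))) - sum_list (map \<phi> (take l (w j))) = g)"

lemma renormalizable_pow_orbits:
  assumes r: "renormalizable \<phi> \<Lambda> w" and o: "\<Lambda> \<in> orbits" "\<And>i. i < d \<Longrightarrow> \<Lambda> * x i \<in> orbits"
  shows "k \<ge> 1 \<Longrightarrow> \<Lambda> ^ k \<in> orbits" and "i < d \<Longrightarrow> \<Lambda> ^ k * x i \<in> orbits"
proof -
  show "\<Lambda> ^ k * x i \<in> orbits" if i: "i < d" for i k
  proof (induction k)
    case 0
    then show ?case using orbits.start i by simp
  next
    case (Suc k)
    then show ?case using orbits_scale[OF r o(2) Suc] by (simp add: mult.assoc)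
  qed
  show "k \<ge> 1 \<Longrightarrow> \<Lambda> ^ k \<in> orbits"
  proof (induction k rule: nat_induct_at_least)
    case base
    then show ?case using o(1) by simp
  next
    case (Suc k)
    then show ?case using orbits_scale[OF r o(2) Suc.IH] by simp
  qed
qed

text \<open>Two powers are taken: the first makes the matrix positive, as
  \<open>primitive_substitution\<close> requires, and the second is high enough for the displacement
  \<open>g\<close> to occur in all words.\<close>

lemma good_renorm_exists:
  fixes \<phi> :: "nat \<Rightarrow> 'g::ab_group_add"
  assumes p: "periodic_type d x F \<phi>" and ic: "infinitely_complete d x F"
    and gen: "group_closure (\<phi> ` {1..d}) = UNIV"
  shows "\<exists>\<Lambda> w. good_renorm \<phi> g \<Lambda> w"
proof -
  obtain \<Lambda> w where r: "renormalizable \<phi> \<Lambda> w" and \<Lambda>: "\<Lambda> < 1"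
    and o: "\<Lambda> \<in> orbits" "\<And>i. i < d \<Longrightarrow> \<Lambda> * x i \<in> orbits"
    using periodic_type_renormalizable[OF p] by blast
  obtain k where k: "k \<ge> 1" "\<And>j. j \<in> letters \<Longrightarrow> set (subst_pow w k j) = letters"
    using renormalizable_positive[OF r \<Lambda> ic] by blast
  define \<Lambda>' where "\<Lambda>' = \<Lambda> ^ k"
  define v where "v = subst_pow w k"
  have r': "renormalizable \<phi> \<Lambda>' v" unfolding \<Lambda>'_def v_def by (rule renormalizable_pow[OF r])
  have o': "\<Lambda>' \<in> orbits" "\<And>i. i < d \<Longrightarrow> \<Lambda>' * x i \<in> orbits"
    unfolding \<Lambda>'_def using renormalizable_pow_orbits[OF r o] k by blast+
  have \<Lambda>': "\<Lambda>' < 1"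
    unfolding \<Lambda>'_def using \<Lambda> k(1) renormalizableD(1)[OF r] by (simp add: power_less_one_iff)
  interpret S: primitive_substitution letters v \<phi>
    using k renormalizableD(5)[OF r'] d2 by unfold_locales (auto simp: v_def)
  have disp: "S.displacement i i' (\<phi> i)" if "i \<in> letters" "i' \<in> letters" "y \<in> mark i" "F y \<in> mark i'" "0 < F y"
    for i i' y by (rule displacement_neighbours[OF r' \<Lambda>' S.primitive_substitution_axioms that])
  have "\<forall>\<^sub>F n in sequentially. \<forall>i\<in>letters. \<forall>j\<in>letters. \<exists>s s'. S.occurs n i j s \<and> S.occurs n i j s' \<and> s' - s = g"
  proof (rule S.displacements_everything[where e="\<lambda>i. i" and d=d])
    show "letters = (\<lambda>i. i) ` {1..d}" by simp
    show "group_closure (\<phi> ` letters) = UNIV" using gen .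
    show "\<exists>i'\<in>letters. S.displacement i i' (\<phi> i)" if i: "i \<in> letters" for i
      using follow[OF i] disp[OF i] by blast
    show "\<exists>i\<in>letters. S.displacement i l (\<phi> i) \<and> S.displacement i (Suc l) (\<phi> i)"
      if l: "1 \<le> l" "l < d" for l
    proof -
      have "l \<in> letters" "Suc l \<in> letters" using l by auto
      then show ?thesis using fork[OF l] disp by meson
    qed
  qed
  moreover have "\<forall>\<^sub>F n in sequentially. n \<ge> (1::nat)" by (rule eventually_ge_at_top)
  ultimately have "\<forall>\<^sub>F n in sequentially. n \<ge> 1 \<and>
      (\<forall>i\<in>letters. \<forall>j\<in>letters. \<exists>s s'. S.occurs n i j s \<and> S.occurs n i j s' \<and> s' - s = g)"
    by eventually_elim auto
  from eventually_happens'[OF sequentially_bot this] obtain n where n: "n \<ge> 1" and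
      occ: "\<And>i j. i \<in> letters \<Longrightarrow> j \<in> letters \<Longrightarrow> \<exists>s s'. S.occurs n i j s \<and> S.occurs n i j s' \<and> s' - s = g"
    by blast
  let ?W = "subst_pow v n"
  have pos: "\<exists>l<length (?W j). ?W j ! l = i \<and> s = sum_list (map \<phi> (take l (?W j)))"
    if o: "S.occurs n i j s" for i j s
  proof -
    obtain u v' where "?W j = u @ i # v'" "s = sum_list (map \<phi> u)" using o unfolding S.occurs_def by blast
    then show ?thesis by (intro exI[of _ "length u"]) auto
  qed
  have "good_renorm \<phi> g (\<Lambda>' ^ n) ?W"
    unfolding good_renorm_def
  proof (intro conjI ballI allI impI)
    show "renormalizable \<phi> (\<Lambda>' ^ n) ?W" by (rule renormalizable_pow[OF r'])
    show "\<Lambda>' ^ n < 1" using \<Lambda>' n renormalizableD(1)[OF r'] by (simp add: power_less_one_iff)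
    show "\<Lambda>' ^ n \<in> orbits" "i < d \<Longrightarrow> \<Lambda>' ^ n * x i \<in> orbits" for i
      using renormalizable_pow_orbits[OF r' o'] n by blast+
    show "set (?W j) = letters" if "j \<in> letters" for j using S.set_pow[OF that n] .
    fix i j assume "i \<in> letters" "j \<in> letters"
    then obtain s s' where "S.occurs n i j s" "S.occurs n i j s'" "s' - s = g" using occ by blast
    then show "\<exists>l l'. l < length (?W j) \<and> l' < length (?W j) \<and> ?W j ! l = i \<and> ?W j ! l' = i \<and>
        sum_list (map \<phi> (take l' (?W j))) - sum_list (map \<phi> (take l (?W j))) = g"
      using pos[of i j s] pos[of i j s'] by blast
  qed
  then show ?thesis by blast
qed

end

section \<open>The compactification\<close>

lemma finite_avoid_sides:
  fixes z :: real
  assumes "finite E"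
  shows "\<exists>\<delta>>0. {z - \<delta><..<z} \<inter> E = {} \<and> {z<..<z + \<delta>} \<inter> E = {}"
proof -
  obtain \<delta> where \<delta>: "\<delta> > 0" "\<And>y. y \<in> E \<Longrightarrow> y \<noteq> z \<Longrightarrow> \<delta> \<le> dist z y"
    using finite_set_avoid[OF assms, of z] by auto
  then show ?thesis by (intro exI[of _ \<delta>]) (fastforce simp: dist_real_def)
qed

context keane_iet
begin

section \<open>The atomic measure rho and the one-sided maps l and r\<close>

abbreviation K where "K \<equiv> compactification d x F"
abbreviation l where "l \<equiv> lmap d x F"
abbreviation r where "r \<equiv> rmap d x F"

definition D :: "nat \<Rightarrow> real set" where "D n = D_plus d x F n \<union> D_minus d x F n"

definition weight :: "nat \<Rightarrow> real set \<Rightarrow> real" where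
  "weight n S = (\<Sum>y\<in>D_plus d x F n. indicator S y) + (\<Sum>y\<in>D_minus d x F n. indicator S y)"

lemma finite_D_parts: "finite (D_plus d x F n)" "finite (D_minus d x F n)"
  by (auto simp: D_plus_def D_minus_def)

lemma finite_D: "finite (D n)"
  by (simp add: D_def finite_D_parts)

lemma card_D_plus: "card (D_plus d x F n) \<le> d"
proof -
  have "card (D_plus d x F n) \<le> card (F ` x ` {0..d - 1} - {0})"
    unfolding D_plus_def by (rule card_image_le) auto
  also have "\<dots> \<le> card (F ` x ` {0..d - 1})" by (intro card_mono) auto
  also have "\<dots> \<le> card {0..d - 1}" by (meson card_image_le finite_atLeastAtMost finite_imageI order_trans)
  also have "\<dots> \<le> d" using d2 by simp
  finally show ?thesis .
qed

lemma card_D_minus: "card (D_minus d x F n) \<le> d"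
proof -
  have "card (D_minus d x F n) \<le> card {1..d - 1}"
    unfolding D_minus_def by (meson card_image_le finite_atLeastAtMost finite_imageI order_trans)
  then show ?thesis using d2 by simp
qed

lemma weight_nonneg: "0 \<le> weight n S"
  unfolding weight_def by (intro add_nonneg_nonneg sum_nonneg) auto

lemma weight_le: "weight n S \<le> 2 * d"
proof -
  have "(\<Sum>y\<in>D_plus d x F n. indicator S y :: real) \<le> (\<Sum>y\<in>D_plus d x F n. 1)"
    "(\<Sum>y\<in>D_minus d x F n. indicator S y :: real) \<le> (\<Sum>y\<in>D_minus d x F n. 1)"
    by (intro sum_mono; simp add: indicator_def)+
  then show ?thesis unfolding weight_def using card_D_plus[of n] card_D_minus[of n] by simp
qed

lemma weight_mono: "S \<subseteq> S' \<Longrightarrow> weight n S \<le> weight n S'"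
  unfolding weight_def by (intro add_mono sum_mono) (auto simp: indicator_def)

lemma weight_Un: "S \<inter> S' = {} \<Longrightarrow> weight n (S \<union> S') = weight n S + weight n S'"
  unfolding weight_def by (simp add: indicator_disj_union sum.distrib)

lemma weight_disjoint: "S \<inter> D n = {} \<Longrightarrow> weight n S = 0"
proof -
  assume S: "S \<inter> D n = {}"
  have "(\<Sum>y\<in>E. indicator S y :: real) = 0" if "E \<subseteq> D n" for E
    using that S by (intro sum.neutral) (auto simp: indicator_def)
  then show ?thesis unfolding weight_def D_def by simp
qed

lemma weight_mem: "z \<in> S \<Longrightarrow> z \<in> D n \<Longrightarrow> 1 \<le> weight n S"
proof -
  assume z: "z \<in> S" "z \<in> D n"
  have *: "1 \<le> (\<Sum>y\<in>E. indicator S y :: real)" if "z \<in> E" "finite E" for E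
    using member_le_sum[of z E "indicator S :: real \<Rightarrow> real"] that z by simp
  have "0 \<le> (\<Sum>y\<in>D_plus d x F n. indicator S y :: real)" "0 \<le> (\<Sum>y\<in>D_minus d x F n. indicator S y :: real)"
    by (intro sum_nonneg; simp)+
  then show ?thesis
    using z(2) *[OF _ finite_D_parts(1)[of n]] *[OF _ finite_D_parts(2)[of n]]
    unfolding weight_def D_def by auto
qed

lemma rho_weight: "rho d x F S = (\<Sum>n. (1 / 2) ^ n * weight n S)"
  unfolding rho_def weight_def ..

lemma summable_weight: "summable (\<lambda>n. (1 / 2) ^ n * weight n S)"
proof (rule summable_comparison_test')
  show "summable (\<lambda>n. (1 / 2) ^ n * (2 * real d))" by (intro summable_mult2 summable_geometric) simp
  show "norm ((1 / 2) ^ n * weight n S) \<le> (1 / 2) ^ n * (2 * real d)" for n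
    using weight_le[of n S] weight_nonneg[of n S] by simp
qed

lemma rho_mono: "S \<subseteq> S' \<Longrightarrow> rho d x F S \<le> rho d x F S'"
  unfolding rho_weight by (intro suminf_le summable_weight mult_left_mono weight_mono) auto

lemma rho_Un: "S \<inter> S' = {} \<Longrightarrow> rho d x F (S \<union> S') = rho d x F S + rho d x F S'"
  unfolding rho_weight by (simp add: weight_Un distrib_left suminf_add summable_weight)

lemma rho_nonneg: "0 \<le> rho d x F S"
  unfolding rho_weight by (intro suminf_nonneg summable_weight) (simp add: weight_nonneg)

text \<open>The point masses of index \<open>n\<close> have total weight at most
  \<open>2 * d * (1 / 2) ^ n\<close>; summing from \<open>n0\<close> on gives the constant.\<close>

lemma rho_tail:
  assumes "\<And>n. n < n0 \<Longrightarrow> S \<inter> D n = {}"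
  shows "rho d x F S \<le> 4 * real d * (1 / 2) ^ n0"
proof -
  have "rho d x F S = (\<Sum>n. (1 / 2) ^ (n + n0) * weight (n + n0) S)"
    unfolding rho_weight using suminf_split_initial_segment[OF summable_weight[of S], of n0] assms
    by (simp add: weight_disjoint)
  also have "\<dots> \<le> (\<Sum>n. (1 / 2) ^ n * ((1 / 2) ^ n0 * (2 * real d)))"
  proof (rule suminf_le)
    show "summable (\<lambda>n. (1 / 2) ^ (n + n0) * weight (n + n0) S)"
      using summable_ignore_initial_segment[OF summable_weight[of S]] .
    show "summable (\<lambda>n. (1 / 2) ^ n * ((1 / 2) ^ n0 * (2 * real d)))"
      by (intro summable_mult2 summable_geometric) simp
    show "(1 / 2) ^ (n + n0) * weight (n + n0) S \<le> (1 / 2) ^ n * ((1 / 2) ^ n0 * (2 * real d))" for n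
      using weight_le[of "n + n0" S] by (simp add: power_add)
  qed
  also have "\<dots> = (\<Sum>n. (1 / 2 :: real) ^ n) * ((1 / 2) ^ n0 * (2 * real d))"
    by (intro suminf_mult2[symmetric] summable_geometric) simp
  also have "\<dots> = 4 * real d * (1 / 2) ^ n0" by (subst suminf_geometric) simp_all
  finally show ?thesis .
qed

lemma rho_pos: "z \<in> S \<Longrightarrow> z \<in> D n \<Longrightarrow> 0 < rho d x F S"
  unfolding rho_weight
proof (rule suminf_pos2[OF summable_weight])
  assume "z \<in> S" "z \<in> D n"
  then show "0 < (1 / 2) ^ n * weight n S" using weight_mem[of z S n] by simp
qed (simp add: weight_nonneg)

lemma tail_small: "e > 0 \<Longrightarrow> \<exists>n0. 4 * real d * (1 / 2) ^ n0 < e"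
proof -
  assume e: "e > 0"
  have pos: "0 < 4 * real d" using d2 by simp
  obtain n0 where "(1 / 2 :: real) ^ n0 < e / (4 * real d)"
    using real_arch_pow_inv[of "e / (4 * real d)" "1 / 2"] e pos by auto
  then show ?thesis using pos by (intro exI[of _ n0]) (simp add: field_simps)
qed

lemma lmap_minus_rmap:
  assumes "0 \<le> y" "y < z"
  shows "l z = r y + rho d x F {y<..<z}"
proof -
  have "{0..<z} = {0..y} \<union> {y<..<z}" using assms by auto
  then show ?thesis unfolding lmap_def rmap_def by (simp add: rho_Un[symmetric] disjoint_iff)
qed

lemma rmap_minus_rmap:
  assumes "0 \<le> y" "y \<le> z"
  shows "r z = r y + rho d x F {y<..z}"
proof -
  have "{0..z} = {0..y} \<union> {y<..z}" using assms by auto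
  then show ?thesis unfolding rmap_def by (simp add: rho_Un[symmetric] disjoint_iff)
qed

lemma rmap_le_lmap: "0 \<le> y \<Longrightarrow> y < z \<Longrightarrow> r y \<le> l z"
  using lmap_minus_rmap[of y z] rho_nonneg[of "{y<..<z}"] by linarith

lemma rmap_mono: "0 \<le> y \<Longrightarrow> y \<le> z \<Longrightarrow> r y \<le> r z"
  using rmap_minus_rmap[of y z] rho_nonneg[of "{y<..z}"] by linarith

lemma lmap_mono: "y \<le> z \<Longrightarrow> l y \<le> l z"
  unfolding lmap_def by (rule rho_mono) auto

text \<open>Only finitely many points carry the large masses; a one-sided neighbourhood of
  \<open>z\<close> avoids them, and \<open>rho_tail\<close> bounds the rest. So \<open>l\<close> is
  the left limit of \<open>r\<close>; likewise \<open>rmap_right_approach\<close> is right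
  continuity of \<open>r\<close>.\<close>

lemma rmap_left_approach:
  assumes "e > 0"
  shows "\<exists>\<delta>>0. \<forall>y. 0 \<le> y \<and> z - \<delta> < y \<and> y < z \<longrightarrow> l z - r y < e"
proof -
  obtain n0 where n0: "4 * real d * (1 / 2) ^ n0 < e" using tail_small[OF assms] by blast
  obtain \<delta> where \<delta>: "\<delta> > 0" "{z - \<delta><..<z} \<inter> (\<Union>n<n0. D n) = {}"
    using finite_avoid_sides[of "\<Union>n<n0. D n" z] finite_D by auto
  have "l z - r y < e" if y: "0 \<le> y" "z - \<delta> < y" "y < z" for y
  proof -
    have "{y<..<z} \<subseteq> {z - \<delta><..<z}" using y by auto
    then have "rho d x F {y<..<z} \<le> 4 * real d * (1 / 2) ^ n0"
      using \<delta>(2) by (intro rho_tail) blast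
    then show ?thesis using lmap_minus_rmap[of y z] y n0 by linarith
  qed
  then show ?thesis using \<delta> by blast
qed

lemma rmap_right_approach:
  assumes "e > 0"
  shows "\<exists>\<delta>>0. \<forall>y. 0 \<le> z \<and> z \<le> y \<and> y < z + \<delta> \<longrightarrow> r y - r z < e"
proof -
  obtain n0 where n0: "4 * real d * (1 / 2) ^ n0 < e" using tail_small[OF assms] by blast
  obtain \<delta> where \<delta>: "\<delta> > 0" "{z<..<z + \<delta>} \<inter> (\<Union>n<n0. D n) = {}"
    using finite_avoid_sides[of "\<Union>n<n0. D n" z] finite_D by auto
  have "r y - r z < e" if y: "0 \<le> z" "z \<le> y" "y < z + \<delta>" for y
  proof -
    have "{z<..y} \<subseteq> {z<..<z + \<delta>}" using y by auto
    then have "rho d x F {z<..y} \<le> 4 * real d * (1 / 2) ^ n0"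
      using \<delta>(2) by (intro rho_tail) blast
    then show ?thesis using rmap_minus_rmap[of z y] y n0 by linarith
  qed
  then show ?thesis using \<delta> by blast
qed

text \<open>Closures of images under \<open>r\<close> replace the sets of left and right limits in
  the definitions of \<open>K\<close> and \<open>comp_piece\<close>. This form commutes with finite
  unions and, by \<open>T_hat\<close>, with the dynamics, so that computations in \<open>K\<close>
  reduce to intervals and \<open>F\<close>.\<close>

definition hat :: "real set \<Rightarrow> real set" where "hat S = closure (r ` S)"

lemma hat_halfopen:
  assumes ab: "0 \<le> a" "a < b"
  shows "hat {a..<b} = l ` {a<..b} \<union> r ` {a..<b}"
proof
  show "l ` {a<..b} \<union> r ` {a..<b} \<subseteq> hat {a..<b}"
  proof -
    have "l z \<in> closure (r ` {a..<b})" if z: "z \<in> {a<..b}" for z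
      unfolding closure_approachable
    proof (intro allI impI)
      fix e :: real assume "e > 0"
      then obtain \<delta> where \<delta>: "\<delta> > 0" "\<And>y. 0 \<le> y \<Longrightarrow> z - \<delta> < y \<Longrightarrow> y < z \<Longrightarrow> l z - r y < e"
        using rmap_left_approach[OF \<open>e > 0\<close>, of z] by blast
      define y where "y = max a (z - \<delta> / 2)"
      have y: "0 \<le> y" "z - \<delta> < y" "y < z" "y \<in> {a..<b}" using z ab \<delta>(1) by (auto simp: y_def)
      then have "dist (r y) (l z) < e" using \<delta>(2)[OF y(1-3)] rmap_le_lmap[OF y(1,3)] by (simp add: dist_real_def)
      then show "\<exists>p\<in>r ` {a..<b}. dist p (l z) < e" using y by blast
    qed
    then show ?thesis unfolding hat_def using closure_subset by blast
  qed
  show "hat {a..<b} \<subseteq> l ` {a<..b} \<union> r ` {a..<b}"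
  proof
    fix p assume "p \<in> hat {a..<b}"
    then obtain P where P: "\<And>n. P n \<in> r ` {a..<b}" "P \<longlonglongrightarrow> p"
      unfolding hat_def closure_sequential by blast
    then have "\<exists>z. \<forall>n. z n \<in> {a..<b} \<and> P n = r (z n)" by (intro choice) blast
    then obtain z where z: "\<And>n. z n \<in> {a..<b}" "\<And>n. P n = r (z n)" by blast
    have "\<forall>n. z n \<in> {a..b}" using z(1) by (meson atLeastAtMost_iff atLeastLessThan_iff less_imp_le)
    then obtain L f where f: "L \<in> {a..b}" "strict_mono f" "(z \<circ> f) \<longlonglongrightarrow> L"
      using compact_Icc[of a b] unfolding compact_def by metis
    have lim: "(\<lambda>n. r (z (f n))) \<longlonglongrightarrow> p"
      using LIMSEQ_subseq_LIMSEQ[OF P(2) f(2)] z(2) by (simp add: o_def)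
    have zf: "(\<lambda>n. z (f n)) \<longlonglongrightarrow> L" using f(3) by (simp add: o_def)
    show "p \<in> l ` {a<..b} \<union> r ` {a..<b}"
    \<comment> \<open>If the points eventually stay at or above their limit \<open>L\<close>, the
      values tend to \<open>r L\<close>; otherwise infinitely many of them lie below
      \<open>L\<close>, and the limit is \<open>l L\<close>.\<close>
    proof (cases "\<forall>\<^sub>F n in sequentially. z (f n) \<ge> L")
      case True
      have "(\<lambda>n. r (z (f n))) \<longlonglongrightarrow> r L"
        unfolding tendsto_iff
      proof (intro allI impI)
        fix e :: real assume "e > 0"
        then obtain \<delta> where \<delta>: "\<delta> > 0" "\<And>y. 0 \<le> L \<Longrightarrow> L \<le> y \<Longrightarrow> y < L + \<delta> \<Longrightarrow> r y - r L < e"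
          using rmap_right_approach[OF \<open>e > 0\<close>, of L] by blast
        have "\<forall>\<^sub>F n in sequentially. dist (z (f n)) L < \<delta>" using zf \<delta>(1) by (simp add: tendsto_iff)
        with True show "\<forall>\<^sub>F n in sequentially. dist (r (z (f n))) (r L) < e"
        proof eventually_elim
          case (elim n)
          then have "r (z (f n)) - r L < e" using \<delta>(2) f(1) ab by (auto simp: dist_real_def)
          moreover have "r L \<le> r (z (f n))" using elim f(1) ab by (intro rmap_mono) auto
          ultimately show ?case by (simp add: dist_real_def)
        qed
      qed
      then have "p = r L" using lim LIMSEQ_unique by blast
      moreover have "L < b"
      proof -
        obtain n where "z (f n) \<ge> L" using True eventually_happens'[OF sequentially_bot] by blast
        then show ?thesis using z(1)[of "f n"] by auto
      qed
      ultimately show ?thesis using f(1) by auto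
    next
      case False
      then have fr: "\<exists>\<^sub>F n in sequentially. z (f n) < L" by (simp add: frequently_def not_less)
      have aL: "a < L"
      proof -
        obtain n where "z (f n) < L" using fr frequently_ex by blast
        then show ?thesis using z(1)[of "f n"] by auto
      qed
      have "\<bar>p - l L\<bar> < e" if "e > 0" for e
      proof -
        obtain \<delta> where \<delta>: "\<delta> > 0" "\<And>y. 0 \<le> y \<Longrightarrow> L - \<delta> < y \<Longrightarrow> y < L \<Longrightarrow> l L - r y < e / 2"
          using rmap_left_approach[of "e / 2" L] \<open>e > 0\<close> by auto
        have "\<forall>\<^sub>F n in sequentially. dist (z (f n)) L < \<delta>" using zf \<delta>(1) by (simp add: tendsto_iff)
        moreover have "\<forall>\<^sub>F n in sequentially. dist (r (z (f n))) p < e / 2"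
          using tendstoD[OF lim, of "e / 2"] \<open>e > 0\<close> by simp
        ultimately have ev: "\<forall>\<^sub>F n in sequentially. dist (z (f n)) L < \<delta> \<and> dist (r (z (f n))) p < e / 2"
          by eventually_elim auto
        have "\<exists>n. z (f n) < L \<and> dist (z (f n)) L < \<delta> \<and> dist (r (z (f n))) p < e / 2"
        proof (rule ccontr)
          assume "\<not> ?thesis"
          then have "\<forall>\<^sub>F n in sequentially. \<not> z (f n) < L" by (intro eventually_mono[OF ev]) blast
          then show False using fr by (simp add: frequently_def)
        qed
        then obtain n where n: "z (f n) < L" "dist (z (f n)) L < \<delta>" "dist (r (z (f n))) p < e / 2"
          by blast
        have "0 \<le> z (f n)" using z(1)[of "f n"] ab by auto
        then have "l L - r (z (f n)) < e / 2" "r (z (f n)) \<le> l L"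
          using \<delta>(2)[of "z (f n)"] n rmap_le_lmap by (auto simp: dist_real_def)
        then show ?thesis using n(3) by (auto simp: dist_real_def abs_if split: if_splits)
      qed
      then have "\<bar>p - l L\<bar> \<le> 0" by (meson field_le_epsilon less_imp_le add_0 dense_ge)
      then have "p = l L" by simp
      then show ?thesis using f(1) aL by auto
    qed
  qed
qed

lemma hat_mono: "S \<subseteq> S' \<Longrightarrow> hat S \<subseteq> hat S'"
  unfolding hat_def by (intro closure_mono image_mono)

lemma K_hat: "K = hat {0..<1}"
  unfolding compactification_def by (subst hat_halfopen) auto

lemma comp_piece_hat: "i \<in> letters \<Longrightarrow> comp_piece d x F i = hat (mark i)"
  unfolding comp_piece_def marked_interval_def
  using mark_endpoints[of i] x_ge0[of "i - 1"] by (subst hat_halfopen) auto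

lemma hat_bounds:
  assumes "0 \<le> a" "a < b" "p \<in> hat {a..<b}"
  shows "r a \<le> p" "p \<le> l b"
proof -
  have "(\<exists>z. a < z \<and> z \<le> b \<and> p = l z) \<or> (\<exists>z. a \<le> z \<and> z < b \<and> p = r z)"
    using assms hat_halfopen[OF assms(1,2)] by auto
  then show "r a \<le> p" "p \<le> l b"
    using assms rmap_le_lmap rmap_mono lmap_mono by (auto; meson order_trans less_imp_le)+
qed

lemma hat_subset_K: "S \<subseteq> {0..<1} \<Longrightarrow> hat S \<subseteq> K"
  unfolding K_hat by (rule hat_mono)

lemma compact_K: "compact K"
proof -
  have "K \<subseteq> {r 0..l 1}" unfolding K_hat using hat_bounds[of 0 1] by auto
  then have "bounded K" using bounded_closed_interval bounded_subset by blast
  moreover have "closed K" unfolding K_hat hat_def by simp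
  ultimately show ?thesis by (simp add: compact_eq_bounded_closed)
qed

lemma compact_hat: "S \<subseteq> {0..<1} \<Longrightarrow> compact (hat S)"
  using compact_Int_closed[OF compact_K, of "hat S"] hat_subset_K[of S]
  by (simp add: hat_def Int_absorb1)

lemma hat_UN: "finite I \<Longrightarrow> hat (\<Union>i\<in>I. S i) = (\<Union>i\<in>I. hat (S i))"
proof (induction I rule: finite_induct)
  case (insert i I)
  then show ?case by (simp add: hat_def image_Un closure_Un)
qed (simp add: hat_def)

section \<open>Atoms of rho and orbits of the marked points\<close>

lemma inv_F_pow: "z \<in> {0..<1} \<Longrightarrow> (inv_into {0..<1} F ^^ n) ((F ^^ n) z) = z"
proof (induction n)
  case (Suc n)
  have "inv_into {0..<1} F ((F ^^ Suc n) z) = (F ^^ n) z"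
    using inv_into_f_f[OF F_inj F_pow_in[OF Suc.prems, of n]] by simp
  then show ?case using Suc by (simp add: funpow_swap1)
qed simp

lemma inv_F_in: "z \<in> {0..<1} \<Longrightarrow> inv_into {0..<1} F z \<in> {0..<1} \<and> F (inv_into {0..<1} F z) = z"
  using F_bij inv_into_into[of z F "{0..<1}"] f_inv_into_f[of z F "{0..<1}"] unfolding bij_betw_def by auto

lemma inv_F_pow_in: "z \<in> {0..<1} \<Longrightarrow> (inv_into {0..<1} F ^^ n) z \<in> {0..<1}"
proof (induction n)
  case (Suc n)
  then show ?case using inv_F_in[of "(inv_into {0..<1} F ^^ n) z"] by simp
qed simp

lemma F_pow_inv: "z \<in> {0..<1} \<Longrightarrow> (F ^^ n) ((inv_into {0..<1} F ^^ n) z) = z"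
proof (induction n)
  case (Suc n)
  have "(F ^^ Suc n) ((inv_into {0..<1} F ^^ Suc n) z) =
      (F ^^ n) (F (inv_into {0..<1} F ((inv_into {0..<1} F ^^ n) z)))"
    by (simp add: funpow_swap1)
  then show ?case using inv_F_in[OF inv_F_pow_in[OF Suc.prems, of n]] Suc by simp
qed simp

lemma x_in: "i < d \<Longrightarrow> x i \<in> {0..<1}" using x_ge0[of i] x_less_1[of i] by auto

lemma D_plus_iff: "z \<in> D_plus d x F n \<longleftrightarrow> (\<exists>i<d. F (x i) \<noteq> 0 \<and> z = (F ^^ n) (F (x i)))"
proof -
  have "{0..d - 1} = {..<d}" using d2 by auto
  then show ?thesis unfolding D_plus_def by blast
qed

text \<open>Points of \<open>D_minus\<close> are recognised by their forward orbit, which keeps the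
  inverse of \<open>F\<close> out of the later arguments.\<close>

lemma D_minus_iff:
  assumes "z \<in> {0..<1}"
  shows "z \<in> D_minus d x F n \<longleftrightarrow> (\<exists>i\<in>{1..d - 1}. (F ^^ n) z = x i)"
proof
  assume "z \<in> D_minus d x F n"
  then obtain i where i: "i \<in> {1..d - 1}" "z = (inv_into {0..<1} F ^^ n) (x i)" by (auto simp: D_minus_def)
  then have "i < d" by auto
  then show "\<exists>i\<in>{1..d - 1}. (F ^^ n) z = x i" using F_pow_inv[OF x_in] i by blast
next
  assume "\<exists>i\<in>{1..d - 1}. (F ^^ n) z = x i"
  then obtain i where i: "i \<in> {1..d - 1}" "(F ^^ n) z = x i" by blast
  then have "z = (inv_into {0..<1} F ^^ n) (x i)" using inv_F_pow[OF assms, of n] by simp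
  then show "z \<in> D_minus d x F n" using i by (auto simp: D_minus_def)
qed

lemma marked_or_zero: "i < d \<Longrightarrow> x i = 0 \<or> x i \<in> D 0"
  using x0 by (cases "i = 0") (auto simp: D_def D_minus_def)

lemma image_marked_or_zero: "i < d \<Longrightarrow> F (x i) = 0 \<or> F (x i) \<in> D 0"
  by (auto simp: D_def D_plus_def)

text \<open>The point \<open>0\<close> may fail to be an atom: \<open>D_plus\<close> omits it at the
  start and \<open>D_minus\<close> starts from \<open>x 1\<close>. An orbit passing through
  \<open>0\<close> loses nothing by this, for the image of \<open>0\<close> is
  \<open>F (x 0)\<close>, which is in \<open>D_plus\<close> unless it is \<open>0\<close> again, and
  the preimage of \<open>0\<close> is a left endpoint.\<close>

lemma orbits_D: "z \<in> orbits \<Longrightarrow> z = 0 \<or> (\<exists>n. z \<in> D n)"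
proof (induction rule: orbits.induct)
  case (start i)
  then show ?case using marked_or_zero by blast
next
  case (forward z)
  have marked: "F z = 0 \<or> (\<exists>n. F z \<in> D n)" if "i < d" "z = x i" for i
    using image_marked_or_zero that by blast
  from forward.IH show ?case
  proof (elim disjE exE)
    assume "z = 0"
    then show ?thesis using marked[of 0] x0 d2 by simp
  next
    fix n assume "z \<in> D n"
    then consider "z \<in> D_plus d x F n" | "z \<in> D_minus d x F n" by (auto simp: D_def)
    then show ?thesis
    proof cases
      case 1
      then have "F z \<in> D_plus d x F (Suc n)" by (auto simp: D_plus_def)
      then show ?thesis by (auto simp: D_def)
    next
      case 2
      then obtain i where i: "i \<in> {1..d - 1}" "(F ^^ n) z = x i" using D_minus_iff forward by blast
      show ?thesis
      proof (cases n)
        case 0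
        then show ?thesis using marked[of i] i by auto
      next
        case (Suc m)
        then have "(F ^^ m) (F z) = x i" using i by (simp add: funpow_swap1)
        then have "F z \<in> D_minus d x F m" using D_minus_iff[OF F_in[OF forward(2)]] i by blast
        then show ?thesis by (auto simp: D_def)
      qed
    qed
  qed
next
  case (backward z)
  have inj: "z = y" if "F z = F y" "y \<in> {0..<1}" for y
    using that F_inj backward(2) by (meson inj_onD)
  from backward.IH show ?case
  proof (elim disjE exE)
    \<comment> \<open>On its exchanged interval \<open>F\<close> is a translation with values at
      least \<open>0\<close>, so the value \<open>0\<close> is taken at the left end.\<close>
    assume F0: "F z = 0"
    obtain i where i: "i \<in> letters" "z \<in> mark i" using letter_in backward by blast
    obtain c where c: "\<forall>y\<in>mark i. F y = y + c" using F_translation[OF i(1)] by blast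
    have left: "x (i - 1) \<in> mark i" using mark_endpoints[OF i(1)] by (auto simp: marked_interval_def)
    then have "0 \<le> F (x (i - 1))" using mark_subset[OF i(1)] F_in by fastforce
    then have "z \<le> x (i - 1)" using c left i F0 by fastforce
    then have "z = x (i - 1)" using i by (auto simp: marked_interval_def)
    moreover have "i - 1 < d" using i by auto
    ultimately show ?thesis using marked_or_zero by blast
  next
    fix n assume "F z \<in> D n"
    then consider "F z \<in> D_plus d x F n" | "F z \<in> D_minus d x F n" by (auto simp: D_def)
    then show ?thesis
    proof cases
      case 1
      then obtain i where id: "i < d" and i: "F (x i) \<noteq> 0" "F z = (F ^^ n) (F (x i))"
        unfolding D_plus_iff by blast
      show ?thesis
      proof (cases n)
        case 0
        then have "z = x i" using inj[of "x i"] i x_in[OF id] by simp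
        then show ?thesis using marked_or_zero[OF id] by blast
      next
        case (Suc m)
        then have "z = (F ^^ m) (F (x i))" using inj F_pow_in[OF F_in[OF x_in[OF id]]] i by simp
        then have "z \<in> D_plus d x F m" using i id D_plus_iff by blast
        then show ?thesis by (auto simp: D_def)
      qed
    next
      case 2
      then obtain i where i: "i \<in> {1..d - 1}" "(F ^^ n) (F z) = x i"
        using D_minus_iff[OF F_in[OF backward(2)]] by blast
      then have "(F ^^ Suc n) z = x i" by (simp add: funpow_swap1)
      then have "z \<in> D_minus d x F (Suc n)" using D_minus_iff[OF backward(2)] i by blast
      then show ?thesis by (auto simp: D_def)
    qed
  qed
qed

text \<open>Orbit points carry mass and hence split into two points of \<open>K\<close>. The
  separations between bases and levels below all come from such a gap.\<close>

lemma gap: "z \<in> orbits \<Longrightarrow> 0 < z \<Longrightarrow> l z < r z"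
proof -
  assume z: "z \<in> orbits" "0 < z"
  then obtain n where "z \<in> D n" using orbits_D by fastforce
  then have "0 < rho d x F {z}" by (rule rho_pos[rotated]) simp
  moreover have "{0..z} = {0..<z} \<union> {z}" using z by auto
  then have "r z = l z + rho d x F {z}"
    unfolding lmap_def rmap_def by (simp add: rho_Un[symmetric])
  ultimately show ?thesis by simp
qed

section \<open>Towers in the compactification\<close>

definition base :: "real \<Rightarrow> nat \<Rightarrow> real set" where "base \<Lambda> j = (\<lambda>y. \<Lambda> * y) ` mark j"

lemma base_eq:
  assumes "0 < \<Lambda>"
  shows "base \<Lambda> j = {\<Lambda> * x (j - 1)..<\<Lambda> * x j}"
proof
  show "base \<Lambda> j \<subseteq> {\<Lambda> * x (j - 1)..<\<Lambda> * x j}"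
    unfolding base_def marked_interval_def using assms by auto
  show "{\<Lambda> * x (j - 1)..<\<Lambda> * x j} \<subseteq> base \<Lambda> j"
  proof
    fix z assume "z \<in> {\<Lambda> * x (j - 1)..<\<Lambda> * x j}"
    then have "z / \<Lambda> \<in> mark j" "z = \<Lambda> * (z / \<Lambda>)"
      using assms by (auto simp: marked_interval_def field_simps)
    then show "z \<in> base \<Lambda> j" unfolding base_def by blast
  qed
qed

lemma base_subset: "0 < \<Lambda> \<Longrightarrow> \<Lambda> \<le> 1 \<Longrightarrow> j \<in> letters \<Longrightarrow> base \<Lambda> j \<subseteq> {0..<1}"
  unfolding base_def using mark_subset scale_in by blast

lemma F_pow_subset: "S \<subseteq> {0..<1} \<Longrightarrow> (F ^^ m) ` S \<subseteq> {0..<1}"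
  using F_pow_in by blast

lemma level_translation:
  assumes rn: "renormalizable \<phi> \<Lambda> w" and j: "j \<in> letters" and m: "m \<le> length (w j)"
  shows "\<exists>c. \<forall>y\<in>mark j. (F ^^ m) (\<Lambda> * y) = \<Lambda> * y + c"
  using m
proof (induction m)
  case (Suc m)
  then obtain c where c: "\<forall>y\<in>mark j. (F ^^ m) (\<Lambda> * y) = \<Lambda> * y + c" by auto
  have L: "w j ! m \<in> letters" using renormalizableD(10)[OF rn j] Suc.prems by simp
  obtain c' where c': "\<forall>y\<in>mark (w j ! m). F y = y + c'" using F_translation[OF L] by blast
  have "(F ^^ Suc m) (\<Lambda> * y) = \<Lambda> * y + (c + c')" if "y \<in> mark j" for y
    using renormalizableD(6)[OF rn j that, of m] c c' that Suc.prems by simp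
  then show ?case by blast
qed auto

text \<open>The level sits inside one marked interval, and its left end is already at or to the
  right of the left end of that interval; so no marked point is left for its interior.\<close>

lemma level_interior:
  assumes rn: "renormalizable \<phi> \<Lambda> w" and j: "j \<in> letters" and y: "x (j - 1) < y" "y < x j"
    and m: "m < length (w j)" and i: "i < d"
  shows "(F ^^ m) (\<Lambda> * y) \<noteq> x i"
proof -
  obtain c where c: "\<forall>y\<in>mark j. (F ^^ m) (\<Lambda> * y) = \<Lambda> * y + c"
    using level_translation[OF rn j] m by fastforce
  have in_mark: "y \<in> mark j" "x (j - 1) \<in> mark j" using y by (auto simp: marked_interval_def)
  define i' where "i' = w j ! m"
  have i': "i' \<in> letters" unfolding i'_def using renormalizableD(10)[OF rn j m] .
  have "(F ^^ m) (\<Lambda> * y) \<in> mark i'" "(F ^^ m) (\<Lambda> * x (j - 1)) \<in> mark i'"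
    unfolding i'_def using renormalizableD(6)[OF rn j _ m] in_mark by blast+
  moreover have "\<Lambda> * x (j - 1) < \<Lambda> * y" using y renormalizableD(1)[OF rn] by simp
  ultimately have inside: "x (i' - 1) < (F ^^ m) (\<Lambda> * y)" "(F ^^ m) (\<Lambda> * y) < x i'"
    using c in_mark by (auto simp: marked_interval_def)
  show ?thesis
  proof
    assume eq: "(F ^^ m) (\<Lambda> * y) = x i"
    show False
    proof (cases "i \<le> i' - 1")
      case True
      moreover have "i' - 1 \<le> d" using i' by auto
      ultimately show False using x_le[OF True] eq inside by linarith
    next
      case False
      then have "i' \<le> i" by auto
      then show False using x_le[of i' i] i eq inside by auto
    qed
  qed
qed

text \<open>A point of \<open>D_plus\<close> inside a level is followed backwards, a point of
  \<open>D_minus\<close> forwards. Either the marked point behind it is met inside the tower,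
  against \<open>level_interior\<close>, or the orbit first reaches the bottom of a tower, at a
  point of \<open>(0,\<Lambda>)\<close> lying in some \<open>D n'\<close> with
  \<open>n' \<le> n\<close>.\<close>

lemma level_avoids:
  assumes rn: "renormalizable \<phi> \<Lambda> w" and j: "j \<in> letters" and y: "x (j - 1) < y" "y < x j"
    and m: "m < length (w j)" and avoid: "\<And>n. n < n0 \<Longrightarrow> {0<..<\<Lambda>} \<inter> D n = {}" and n: "n < n0"
  shows "(F ^^ m) (\<Lambda> * y) \<notin> D n"
proof
  assume D: "(F ^^ m) (\<Lambda> * y) \<in> D n"
  note R = renormalizableD[OF rn]
  have ym: "y \<in> mark j" using y by (auto simp: marked_interval_def)
  have y01: "y \<in> {0..<1}" using mark_subset[OF j] ym by blast
  have \<Lambda>y01: "\<Lambda> * y \<in> {0..<1}" using scale_in[OF R(1,2) y01] .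
  have "j - 1 \<le> d" using j by auto
  then have y_pos: "0 < y" using y x_ge0[of "j - 1"] by linarith
  from D consider "(F ^^ m) (\<Lambda> * y) \<in> D_plus d x F n" | "(F ^^ m) (\<Lambda> * y) \<in> D_minus d x F n"
    by (auto simp: D_def)
  then show False
  proof cases
    case 1
    then obtain i where id: "i < d" and i: "F (x i) \<noteq> 0" "(F ^^ m) (\<Lambda> * y) = (F ^^ n) (F (x i))"
      unfolding D_plus_iff by blast
    show False
    proof (cases "Suc n \<le> m")
      case True
      then obtain m' where m': "m = Suc n + m'" using le_Suc_ex by blast
      have "(F ^^ Suc n) ((F ^^ m') (\<Lambda> * y)) = (F ^^ Suc n) (x i)"
        using i(2) unfolding m' by (simp add: funpow_add funpow_swap1)
      then have "(F ^^ m') (\<Lambda> * y) = x i"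
        by (rule F_pow_inj) (use F_pow_in[OF \<Lambda>y01] x_in[OF id] in auto)
      then show False using level_interior[OF rn j y _ id, of m'] m m' by simp
    next
      case False
      then obtain n' where n': "n = m + n'" using le_Suc_ex[of m n] by auto
      have "(F ^^ m) ((F ^^ n') (F (x i))) = (F ^^ m) (\<Lambda> * y)"
        using i(2) unfolding n' by (simp add: funpow_add)
      then have "(F ^^ n') (F (x i)) = \<Lambda> * y"
        by (rule F_pow_inj) (use F_pow_in[OF F_in[OF x_in[OF id]]] \<Lambda>y01 in auto)
      then have "\<Lambda> * y \<in> D n'" using i(1) id D_plus_iff[of "\<Lambda> * y" n'] unfolding D_def by auto
      moreover have "\<Lambda> * y \<in> {0<..<\<Lambda>}" using y_pos y01 R(1) by auto
      ultimately show False using avoid[of n'] n n' by auto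
    qed
  next
    case 2
    then obtain i where i: "i \<in> {1..d - 1}" "(F ^^ n) ((F ^^ m) (\<Lambda> * y)) = x i"
      using D_minus_iff[OF F_pow_in[OF \<Lambda>y01]] by blast
    then have id: "i < d" by auto
    have eq: "(F ^^ (n + m)) (\<Lambda> * y) = x i" using i by (simp add: funpow_add)
    have "\<not> n + m < length (w j)"
    proof
      assume "n + m < length (w j)"
      then show False using level_interior[OF rn j y _ id, of "n + m"] eq by simp
    qed
    then obtain n' where n': "n + m = n' + length (w j)" using le_Suc_ex[of "length (w j)" "n + m"] by (auto simp: add.commute)
    define u where "u = \<Lambda> * F y"
    have "u = (F ^^ length (w j)) (\<Lambda> * y)" unfolding u_def using R(8)[OF j ym] by simp
    then have u: "(F ^^ n') u = x i" using eq n' by (simp add: funpow_add)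
    have Fy: "F y \<in> {0..<1}" using F_in[OF y01] .
    have u01: "u \<in> {0..<1}" unfolding u_def using scale_in[OF R(1,2) Fy] .
    \<comment> \<open>The return point is positive because, by the Keane property,
      \<open>0 = x 0\<close> never reaches another marked point.\<close>
    have "u \<noteq> 0"
    proof
      assume "u = 0"
      then have *: "(F ^^ n') (x 0) = x i" using u x0 by simp
      show False
      proof (cases "n' = 0")
        case True
        then show False using * x_pos[of i] i id x0 by auto
      next
        case False
        then have "(F ^^ n') (x 0) \<notin> x ` {1..d - 1}"
          using keane d2 unfolding keane_def by auto
        then show False using * i by auto
      qed
    qed
    then have "u \<in> {0<..<\<Lambda>}" using u01 Fy R(1) by (auto simp: u_def)
    moreover have "u \<in> D n'" using D_minus_iff[OF u01] u i by (auto simp: D_def)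
    ultimately show False using avoid[of n'] n n' m by auto
  qed
qed

text \<open>The diameter in \<open>K\<close> is bounded by the mass of the open interval alone: the
  endpoints are split, and their own masses lie outside the level.\<close>

lemma level_small:
  assumes rn: "renormalizable \<phi> \<Lambda> w" and j: "j \<in> letters"
    and m: "m < length (w j)" and avoid: "\<And>n. n < n0 \<Longrightarrow> {0<..<\<Lambda>} \<inter> D n = {}"
    and pq: "p \<in> hat ((F ^^ m) ` base \<Lambda> j)" "q \<in> hat ((F ^^ m) ` base \<Lambda> j)"
  shows "dist p q \<le> 4 * real d * (1 / 2) ^ n0"
proof -
  obtain c where c: "\<forall>y\<in>mark j. (F ^^ m) (\<Lambda> * y) = \<Lambda> * y + c"
    using level_translation[OF rn j] m by fastforce
  note R = renormalizableD[OF rn]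
  define a b where "a = \<Lambda> * x (j - 1) + c" and "b = \<Lambda> * x j + c"
  have "(F ^^ m) ` base \<Lambda> j = (\<lambda>y. y + c) ` base \<Lambda> j"
    using c unfolding base_def image_image by (intro image_cong) auto
  then have ab: "(F ^^ m) ` base \<Lambda> j = {a..<b}" unfolding base_eq[OF R(1)] a_def b_def by simp
  have lt: "a < b" unfolding a_def b_def using mark_endpoints[OF j] R(1) by simp
  have "a \<in> (F ^^ m) ` base \<Lambda> j" using ab lt by simp
  then have a0: "0 \<le> a" using F_pow_subset[OF base_subset[OF R(1,2) j], of m] by fastforce
  have "{a<..<b} \<inter> D n = {}" if n: "n < n0" for n
  proof -
    have "z \<notin> D n" if z: "a < z" "z < b" for z
    proof -
      define y where "y = (z - c) / \<Lambda>"
      have zy: "z = \<Lambda> * y + c" using R(1) by (simp add: y_def)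
      have y: "x (j - 1) < y" "y < x j" using z R(1) unfolding zy a_def b_def by simp_all
      then have "z = (F ^^ m) (\<Lambda> * y)" using c zy by (auto simp: marked_interval_def)
      then show ?thesis using level_avoids[OF rn j y m avoid n] by simp
    qed
    then show ?thesis by auto
  qed
  then have "rho d x F {a<..<b} \<le> 4 * real d * (1 / 2) ^ n0" by (rule rho_tail)
  moreover have "r a \<le> p" "p \<le> l b" "r a \<le> q" "q \<le> l b"
    using hat_bounds[OF a0 lt] pq ab by auto
  ultimately show ?thesis using lmap_minus_rmap[OF a0 lt] by (auto simp: dist_real_def)
qed

end

section \<open>Nested towers for the homeomorphism T\<close>

locale keane_iet_extension = keane_iet +
  fixes T :: "real \<Rightarrow> real"
  assumes ext: "continuous_extension d x F T"
begin

lemma T_cont: "continuous_on K T" and T_image: "T ` K = K" and T_inj: "inj_on T K"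
  and T_inv_cont: "continuous_on K (inv_into K T)"
proof -
  obtain T' where h: "homeomorphism K K T T'" using ext unfolding continuous_extension_def by blast
  then show 1: "continuous_on K T" "T ` K = K" "inj_on T K"
    unfolding homeomorphism_def by (auto intro: inj_on_inverseI)
  have "inv_into K T y = T' y" if "y \<in> K" for y
    using h that 1 unfolding homeomorphism_def by (metis imageI inv_into_f_f)
  then show "continuous_on K (inv_into K T)"
    using h unfolding homeomorphism_def by (metis continuous_on_cong)
qed

lemma T_rmap: "y \<in> {0..<1} \<Longrightarrow> T (r y) = r (F y)"
  using ext unfolding continuous_extension_def by blast

text \<open>\<open>T\<close> is continuous and \<open>hat S\<close> compact, so images commute with
  closures; on the image of \<open>r\<close>, which is dense, \<open>T\<close> acts as
  \<open>F\<close>.\<close>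

lemma T_hat:
  assumes S: "S \<subseteq> {0..<1}"
  shows "T ` hat S = hat (F ` S)"
proof
  have "T (r y) = r (F y)" if "y \<in> S" for y using T_rmap S that by blast
  then have im: "T ` r ` S = r ` F ` S" by (simp add: image_image cong: image_cong)
  have cont: "continuous_on (hat S) T" using continuous_on_subset[OF T_cont hat_subset_K[OF S]] .
  show "T ` hat S \<subseteq> hat (F ` S)"
    unfolding hat_def
  proof (rule image_closure_subset)
    show "continuous_on (closure (r ` S)) T" using cont by (simp add: hat_def)
    show "T ` r ` S \<subseteq> closure (r ` F ` S)" unfolding im by (rule closure_subset)
  qed simp
  have "closed (T ` hat S)" using compact_continuous_image[OF cont compact_hat[OF S]] by (rule compact_imp_closed)
  moreover have "r ` F ` S \<subseteq> T ` hat S" unfolding im[symmetric] hat_def by (intro image_mono closure_subset)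
  ultimately show "hat (F ` S) \<subseteq> T ` hat S" unfolding hat_def[of "F ` S"] by (rule closure_minimal[rotated])
qed

lemma T_pow_hat: "S \<subseteq> {0..<1} \<Longrightarrow> (T ^^ m) ` hat S = hat ((F ^^ m) ` S)"
proof (induction m)
  case (Suc m)
  have "(T ^^ Suc m) ` hat S = T ` (T ^^ m) ` hat S" by (simp add: image_comp o_def)
  also have "\<dots> = hat (F ` (F ^^ m) ` S)" using Suc T_hat[OF F_pow_subset[OF Suc.prems]] by simp
  finally show ?case by (simp add: image_comp o_def)
qed simp

lemma T_pow_in: "p \<in> K \<Longrightarrow> (T ^^ m) p \<in> K"
proof (induction m)
  case (Suc m)
  then show ?case using T_image by auto
qed simp

lemma T_pow_inj:
  assumes "(T ^^ m) p = (T ^^ m) q" "p \<in> K" "q \<in> K"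
  shows "p = q"
  using assms(1)
proof (induction m)
  case (Suc m)
  then show ?case using T_inj T_pow_in[OF assms(2)] T_pow_in[OF assms(3)] by (auto dest: inj_onD)
qed simp

context
  fixes \<phi> :: "nat \<Rightarrow> 'g::comm_monoid_add" and \<Lambda> w
  assumes rn: "renormalizable \<phi> \<Lambda> w" and \<Lambda>o: "\<Lambda> = 1 \<or> \<Lambda> \<in> orbits"
    and xo: "\<And>i. i < d \<Longrightarrow> \<Lambda> * x i \<in> orbits"
begin

lemma base_bound: "j \<in> letters \<Longrightarrow> p \<in> hat (base \<Lambda> j) \<Longrightarrow> r (\<Lambda> * x (j - 1)) \<le> p \<and> p \<le> l (\<Lambda> * x j)"
  unfolding base_eq[OF renormalizableD(1)[OF rn]]
  using hat_bounds[of "\<Lambda> * x (j - 1)" "\<Lambda> * x j" p] mark_endpoints[of j] x_ge0[of "j - 1"] renormalizableD(1)[OF rn]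
  by auto

text \<open>Of two bases the left one lies below, and the right one above, the gap at the right
  endpoint \<open>\<Lambda> * x i\<close> of the left one.\<close>

lemma base_disjoint:
  assumes "i \<in> letters" "j \<in> letters" "i \<noteq> j"
  shows "hat (base \<Lambda> i) \<inter> hat (base \<Lambda> j) = {}"
proof -
  have *: "hat (base \<Lambda> i) \<inter> hat (base \<Lambda> j) = {}" if ij: "i \<in> letters" "j \<in> letters" "i < j" for i j
  proof -
    have "x i \<le> x (j - 1)" using ij by (intro x_le) auto
    then have "r (\<Lambda> * x i) \<le> r (\<Lambda> * x (j - 1))"
      using x_ge0[of i] ij renormalizableD(1)[OF rn] by (intro rmap_mono) auto
    moreover have "l (\<Lambda> * x i) < r (\<Lambda> * x i)"
      using ij x_pos[of i] renormalizableD(1)[OF rn] by (intro gap xo) auto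
    ultimately show ?thesis using base_bound[OF ij(1)] base_bound[OF ij(2)] by fastforce
  qed
  show ?thesis using *[of i j] *[of j i] assms by (cases "i < j") auto
qed

text \<open>Cancelling the smaller power by injectivity leaves a base point equal to
  \<open>(T ^^ n) p'\<close> with \<open>p'\<close> in a base and \<open>n\<close> below the height.
  For \<open>n = 0\<close> the bases are distinct; for \<open>n > 0\<close> the level lies over
  \<open>[\<Lambda>,1)\<close>, beyond the gap at \<open>\<Lambda>\<close>, while the bases stay
  below it.\<close>

lemma level_disjoint:
  assumes j: "j \<in> letters" "m < length (w j)" and j': "j' \<in> letters" "m' < length (w j')"
    and ne: "(j, m) \<noteq> (j', m')"
  shows "(T ^^ m) ` hat (base \<Lambda> j) \<inter> (T ^^ m') ` hat (base \<Lambda> j') = {}"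
proof -
  note R = renormalizableD[OF rn]
  have sub: "hat (base \<Lambda> j) \<subseteq> K" if "j \<in> letters" for j
    using hat_subset_K[OF base_subset[OF R(1,2) that]] .
  have *: "(T ^^ m) ` hat (base \<Lambda> j) \<inter> (T ^^ m') ` hat (base \<Lambda> j') = {}"
    if j: "j \<in> letters" "m < length (w j)" and j': "j' \<in> letters" "m' < length (w j')"
    and ne: "(j, m) \<noteq> (j', m')" and le: "m \<le> m'" for j m j' m'
  proof (rule ccontr)
    assume "\<not> ?thesis"
    then obtain p p' where p: "p \<in> hat (base \<Lambda> j)" "p' \<in> hat (base \<Lambda> j')" "(T ^^ m) p = (T ^^ m') p'"
      by blast
    obtain n where n: "m' = m + n" using le le_Suc_ex by blast
    have eq_m: "(T ^^ m) p = (T ^^ m) ((T ^^ n) p')" using p(3) n by (simp add: funpow_add)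
    have pK: "p \<in> K" using p(1) sub[OF j(1)] by blast
    have "(T ^^ n) p' \<in> K" using p(2) sub[OF j'(1)] T_pow_in by blast
    then have eq: "p = (T ^^ n) p'" by (rule T_pow_inj[OF eq_m pK])
    show False
    proof (cases "n = 0")
      case True
      then have "j \<noteq> j'" using ne n by auto
      then show False using base_disjoint[OF j(1) j'(1)] p eq True by auto
    next
      case False
      have "(F ^^ n) ` base \<Lambda> j' \<subseteq> {\<Lambda>..<1}"
      proof
        fix z assume "z \<in> (F ^^ n) ` base \<Lambda> j'"
        then obtain y where y: "y \<in> mark j'" "z = (F ^^ n) (\<Lambda> * y)" unfolding base_def by blast
        have "z \<notin> {0..<\<Lambda>}" using R(7)[OF j'(1) y(1), of n] False j'(2) n y(2) by auto
        moreover have "z \<in> {0..<1}"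
          using y(2) F_pow_in scale_in[OF R(1,2)] mark_subset[OF j'(1)] y(1) by blast
        ultimately show "z \<in> {\<Lambda>..<1}" by auto
      qed
      moreover have "p \<in> hat ((F ^^ n) ` base \<Lambda> j')"
        using eq p(2) T_pow_hat[OF base_subset[OF R(1,2) j'(1)], of n] by blast
      ultimately have pin: "p \<in> hat {\<Lambda>..<1}" using hat_mono by blast
      then have "\<Lambda> < 1" by (cases "\<Lambda> < 1") (auto simp: hat_def)
      then have "r \<Lambda> \<le> p" "l \<Lambda> < r \<Lambda>" using hat_bounds(1)[OF _ _ pin] gap \<Lambda>o R(1) by auto
      moreover have "p \<le> l (\<Lambda> * x j)" using base_bound[OF j(1) p(1)] by simp
      moreover have "l (\<Lambda> * x j) \<le> l \<Lambda>"
        using x_le_1[of j] j(1) R(1) by (intro lmap_mono) (simp add: mult_le_cancel_left2)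
      ultimately show False by simp
    qed
  qed
  show ?thesis
    using *[OF j j' ne] *[OF j' j] ne by (cases "m \<le> m'") auto
qed

lemma level_cover: "K = (\<Union>j\<in>letters. \<Union>m<length (w j). (T ^^ m) ` hat (base \<Lambda> j))"
proof -
  note R = renormalizableD[OF rn]
  have "{0..<1} = (\<Union>j\<in>letters. \<Union>m<length (w j). (F ^^ m) ` base \<Lambda> j)"
  proof
    show "{0..<1} \<subseteq> (\<Union>j\<in>letters. \<Union>m<length (w j). (F ^^ m) ` base \<Lambda> j)"
    proof
      fix z :: real assume "z \<in> {0..<1}"
      then obtain j y m where "j \<in> letters" "y \<in> mark j" "m < length (w j)" "z = (F ^^ m) (\<Lambda> * y)"
        using R(9) by blast
      then show "z \<in> (\<Union>j\<in>letters. \<Union>m<length (w j). (F ^^ m) ` base \<Lambda> j)"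
        unfolding base_def by blast
    qed
    show "(\<Union>j\<in>letters. \<Union>m<length (w j). (F ^^ m) ` base \<Lambda> j) \<subseteq> {0..<1}"
      using F_pow_subset[OF base_subset[OF R(1,2)]] by blast
  qed
  then have "K = hat (\<Union>j\<in>letters. \<Union>m<length (w j). (F ^^ m) ` base \<Lambda> j)" using K_hat by simp
  also have "\<dots> = (\<Union>j\<in>letters. \<Union>m<length (w j). (T ^^ m) ` hat (base \<Lambda> j))"
    using T_pow_hat[OF base_subset[OF R(1,2)]] by (simp add: hat_UN)
  finally show ?thesis .
qed

lemma level_letter:
  assumes j: "j \<in> letters" and m: "m < length (w j)"
  shows "(T ^^ m) ` hat (base \<Lambda> j) \<subseteq> hat (mark (w j ! m))"
proof -
  note R = renormalizableD[OF rn]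
  have "(F ^^ m) ` base \<Lambda> j \<subseteq> mark (w j ! m)" using R(6)[OF j _ m] unfolding base_def by blast
  then show ?thesis using T_pow_hat[OF base_subset[OF R(1,2) j]] hat_mono by simp
qed

end

text \<open>A point \<open>\<Lambda>' * u\<close> lies in the old base exactly when the climb
  through the \<open>\<Lambda>\<close>-towers reads the letter \<open>i\<close> at \<open>u\<close>;
  after rescaling by \<open>\<Lambda>'\<close> each earlier letter costs a whole
  \<open>v\<close>-tower, hence the exponent.\<close>

lemma base_refine:
  fixes \<phi> :: "nat \<Rightarrow> 'g::comm_monoid_add"
  assumes v: "renormalizable \<phi> \<Lambda>' v" and w: "renormalizable \<phi> \<Lambda> w" and i: "i \<in> letters"
  shows "hat (base \<Lambda>' i) = (\<Union>j\<in>letters. \<Union>m\<in>{m. m < length (w j) \<and> w j ! m = i}.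
    (T ^^ length (concat (map v (take m (w j))))) ` hat (base (\<Lambda>' * \<Lambda>) j))"
proof -
  note V = renormalizableD[OF v] and W = renormalizableD[OF w]
  let ?\<tau> = "\<lambda>j m. length (concat (map v (take m (w j))))"
  have pass: "(F ^^ ?\<tau> j m) (\<Lambda>' * \<Lambda> * y) = \<Lambda>' * (F ^^ m) (\<Lambda> * y)"
    if "j \<in> letters" "y \<in> mark j" "m < length (w j)" for j y m
    using renormalizable_passage[OF v _ W(4)[OF that(1)], of "\<Lambda> * y" m] W(6)[OF that(1,2)] that(3)
    by (simp add: mult.assoc)
  have "base \<Lambda>' i = (\<Union>j\<in>letters. \<Union>m\<in>{m. m < length (w j) \<and> w j ! m = i}. (F ^^ ?\<tau> j m) ` base (\<Lambda>' * \<Lambda>) j)"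
  proof
    show "base \<Lambda>' i \<subseteq> (\<Union>j\<in>letters. \<Union>m\<in>{m. m < length (w j) \<and> w j ! m = i}. (F ^^ ?\<tau> j m) ` base (\<Lambda>' * \<Lambda>) j)"
    proof
      fix z assume "z \<in> base \<Lambda>' i"
      then obtain u where u: "u \<in> mark i" "z = \<Lambda>' * u" unfolding base_def by blast
      then have "u \<in> {0..<1}" using mark_subset[OF i] by blast
      then obtain j y m where j: "j \<in> letters" "y \<in> mark j" "m < length (w j)" "u = (F ^^ m) (\<Lambda> * y)"
        using W(9) by blast
      have "w j ! m = i" using letter_unique W(6)[OF j(1-3)] W(10)[OF j(1,3)] u(1) i j(4) by blast
      moreover have "z = (F ^^ ?\<tau> j m) (\<Lambda>' * \<Lambda> * y)" using pass[OF j(1-3)] u(2) j(4) by simp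
      ultimately show "z \<in> (\<Union>j\<in>letters. \<Union>m\<in>{m. m < length (w j) \<and> w j ! m = i}. (F ^^ ?\<tau> j m) ` base (\<Lambda>' * \<Lambda>) j)"
        using j unfolding base_def by blast
    qed
    show "(\<Union>j\<in>letters. \<Union>m\<in>{m. m < length (w j) \<and> w j ! m = i}. (F ^^ ?\<tau> j m) ` base (\<Lambda>' * \<Lambda>) j) \<subseteq> base \<Lambda>' i"
    proof
      fix z assume "z \<in> (\<Union>j\<in>letters. \<Union>m\<in>{m. m < length (w j) \<and> w j ! m = i}. (F ^^ ?\<tau> j m) ` base (\<Lambda>' * \<Lambda>) j)"
      then obtain j m y where j: "j \<in> letters" "m < length (w j)" "w j ! m = i" "y \<in> mark j"
        "z = (F ^^ ?\<tau> j m) (\<Lambda>' * \<Lambda> * y)" unfolding base_def by blast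
      then show "z \<in> base \<Lambda>' i" using pass[of j y m] W(6)[of j y m] unfolding base_def by auto
    qed
  qed
  moreover have "(T ^^ n) ` hat (base (\<Lambda>' * \<Lambda>) j) = hat ((F ^^ n) ` base (\<Lambda>' * \<Lambda>) j)" if "j \<in> letters" for j n
    using V(1,2) W(1,2) that by (intro T_pow_hat base_subset) (auto intro: mult_le_one)
  ultimately show ?thesis by (simp add: hat_UN)
qed

text \<open>Finitely many points carry the large masses. They avoid \<open>(0,\<Lambda> ^ k)\<close>
  for large \<open>k\<close>, and then also the interiors of all levels.\<close>

lemma mesh:
  fixes \<phi> :: "nat \<Rightarrow> 'g::comm_monoid_add"
  assumes rn: "renormalizable \<phi> \<Lambda> w" and \<Lambda>: "\<Lambda> < 1" and e: "e > 0"
  shows "\<exists>k0. \<forall>k\<ge>k0. \<forall>j\<in>letters. \<forall>m<length (subst_pow w k j).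
    \<forall>p\<in>(T ^^ m) ` hat (base (\<Lambda> ^ k) j). \<forall>q\<in>(T ^^ m) ` hat (base (\<Lambda> ^ k) j). dist p q < e"
proof -
  obtain n0 where n0: "4 * real d * (1 / 2) ^ n0 < e" using tail_small[OF e] by blast
  obtain \<delta> where \<delta>: "\<delta> > 0" "{0<..<0 + \<delta>} \<inter> (\<Union>n<n0. D n) = {}"
    using finite_avoid_sides[of "\<Union>n<n0. D n" 0] finite_D by auto
  obtain k0 where k0: "\<Lambda> ^ k0 < \<delta>" using real_arch_pow_inv[OF \<delta>(1) \<Lambda>] by blast
  have "dist p q < e" if k: "k \<ge> k0" and j: "j \<in> letters" and m: "m < length (subst_pow w k j)"
    and pq: "p \<in> (T ^^ m) ` hat (base (\<Lambda> ^ k) j)" "q \<in> (T ^^ m) ` hat (base (\<Lambda> ^ k) j)" for k j m p q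
  proof -
    note rk = renormalizable_pow[OF rn, of k]
    have "\<Lambda> ^ k \<le> \<Lambda> ^ k0" using k \<Lambda> renormalizableD(1)[OF rn] by (intro power_decreasing) auto
    then have "{0<..<\<Lambda> ^ k} \<inter> D n = {}" if "n < n0" for n
      using \<delta>(2) k0 that by fastforce
    then have "dist p q \<le> 4 * real d * (1 / 2) ^ n0"
      using pq T_pow_hat[OF base_subset[OF renormalizableD(1,2)[OF rk] j], of m]
      by (intro level_small[OF rk j m]) auto
    then show ?thesis using n0 by simp
  qed
  then show ?thesis by blast
qed

end

section \<open>Invariant measures of skew products over clopen partitions\<close>

text \<open>The measure theory sees only a homeomorphism of a compact set, a finite partition into
  compact pieces and a cocycle that is constant on each piece. The group is countable, so measures
  on the product are determined by their fibres.\<close>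

locale piece_system =
  fixes K :: "real set" and T :: "real \<Rightarrow> real" and A :: "nat set" and P :: "nat \<Rightarrow> real set"
    and \<phi> :: "nat \<Rightarrow> 'g::{ab_group_add, countable}"
  assumes finite_A: "finite A" and compact_K: "compact K" and K_ne: "K \<noteq> {}"
    and T_bij: "bij_betw T K K" and T_cont: "continuous_on K T" and T_inv_cont: "continuous_on K (inv_into K T)"
    and P_compact: "i \<in> A \<Longrightarrow> compact (P i)" and P_cover: "(\<Union>i\<in>A. P i) = K"
    and P_disj: "i \<in> A \<Longrightarrow> j \<in> A \<Longrightarrow> i \<noteq> j \<Longrightarrow> P i \<inter> P j = {}"
begin

abbreviation BK :: "real measure" where "BK \<equiv> restrict_space borel K"
abbreviation Ti where "Ti \<equiv> inv_into K T"

definition cocycle :: "real \<Rightarrow> 'g" where "cocycle p = \<phi> (THE i. i \<in> A \<and> p \<in> P i)"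
definition PM :: "(real \<times> 'g) measure" where "PM = BK \<Otimes>\<^sub>M count_space UNIV"
abbreviation skew :: "real \<times> 'g \<Rightarrow> real \<times> 'g" where "skew \<equiv> skew_product T cocycle"
abbreviation \<Omega> :: "(real \<times> 'g) set" where "\<Omega> \<equiv> K \<times> UNIV"
definition sec :: "(real \<times> 'g) set \<Rightarrow> 'g \<Rightarrow> real set" where "sec X a = {p. (p, a) \<in> X}"

lemma cocycle_eq: "i \<in> A \<Longrightarrow> p \<in> P i \<Longrightarrow> cocycle p = \<phi> i"
proof -
  assume i: "i \<in> A" "p \<in> P i"
  then have "(THE i. i \<in> A \<and> p \<in> P i) = i" using P_disj by (intro the_equality) blast+
  then show ?thesis by (simp add: cocycle_def)
qed

lemma skew_apply: "skew (p, a) = (T p, a + cocycle p)"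
  by (simp add: skew_product_def)

lemma P_sub: "i \<in> A \<Longrightarrow> P i \<subseteq> K" using P_cover by blast

lemma piece: "p \<in> K \<Longrightarrow> \<exists>i\<in>A. p \<in> P i" using P_cover by blast

lemma T_in: "p \<in> K \<Longrightarrow> T p \<in> K" and T_inj: "inj_on T K" and T_surj: "T ` K = K"
  using T_bij by (auto simp: bij_betw_def)

lemma Ti_in: "p \<in> K \<Longrightarrow> Ti p \<in> K" and T_Ti: "p \<in> K \<Longrightarrow> T (Ti p) = p" and Ti_T: "p \<in> K \<Longrightarrow> Ti (T p) = p"
  using T_surj T_inj by (auto simp: inv_into_into f_inv_into_f)

lemma closed_K: "closed K" using compact_K by (rule compact_imp_closed)

lemma sets_BK: "B \<in> sets BK \<longleftrightarrow> B \<subseteq> K \<and> B \<in> sets borel"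
  using closed_K by (subst sets_restrict_space_iff) auto

lemma K_sets: "K \<in> sets BK" using closed_K sets_BK by auto

lemma P_sets: "i \<in> A \<Longrightarrow> P i \<in> sets BK"
  using P_compact P_sub sets_BK compact_imp_closed by fastforce

lemma T_meas: "T \<in> measurable BK BK"
  using borel_measurable_continuous_on_restrict[OF T_cont] T_in
  by (intro measurable_restrict_space2) (auto simp: space_restrict_space)

lemma Ti_meas: "Ti \<in> measurable BK BK"
  using borel_measurable_continuous_on_restrict[OF T_inv_cont] Ti_in
  by (intro measurable_restrict_space2) (auto simp: space_restrict_space)

lemma T_image_sets:
  assumes "B \<in> sets BK"
  shows "T ` B \<in> sets BK"
proof -
  have B: "B \<subseteq> K" using assms sets_BK by blast
  have "T ` B = Ti -` B \<inter> K"
  proof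
    show "T ` B \<subseteq> Ti -` B \<inter> K" using B Ti_T T_in by auto
    show "Ti -` B \<inter> K \<subseteq> T ` B" using T_Ti by (metis IntD1 IntD2 image_eqI subsetI vimageE)
  qed
  then show ?thesis using measurable_sets[OF Ti_meas assms] by (simp add: space_restrict_space)
qed

lemma T_vimage_sets: "B \<in> sets BK \<Longrightarrow> T -` B \<inter> K \<in> sets BK"
  using measurable_sets[OF T_meas] by (simp add: space_restrict_space)

lemma space_PM: "space PM = \<Omega>"
  by (simp add: PM_def space_pair_measure space_restrict_space)

lemma Times_PM: "B \<in> sets BK \<Longrightarrow> B \<times> {a} \<in> sets PM"
  unfolding PM_def by (intro pair_measureI) auto

lemma PM_iff: "X \<in> sets PM \<longleftrightarrow> X \<subseteq> \<Omega> \<and> (\<forall>a. sec X a \<in> sets BK)"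
proof
  assume X: "X \<in> sets PM"
  have "sec X a = (\<lambda>p. (p, a)) -` X" for a by (auto simp: sec_def)
  then show "X \<subseteq> \<Omega> \<and> (\<forall>a. sec X a \<in> sets BK)"
    using sets_Pair2[OF X[unfolded PM_def]] sets.sets_into_space[OF X] by (auto simp: space_PM)
next
  assume X: "X \<subseteq> \<Omega> \<and> (\<forall>a. sec X a \<in> sets BK)"
  have "X = (\<Union>a. sec X a \<times> {a})" by (auto simp: sec_def)
  moreover have "(\<Union>a. sec X a \<times> {a}) \<in> sets PM"
    using X Times_PM by (intro sets.countable_UN') auto
  ultimately show "X \<in> sets PM" by simp
qed

lemma PM_sub: "X \<in> sets PM \<Longrightarrow> X \<subseteq> \<Omega>" and sec_sets: "X \<in> sets PM \<Longrightarrow> sec X a \<in> sets BK"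
  using PM_iff by auto

lemma Omega_sets: "\<Omega> \<in> sets PM" using sets.top[of PM] by (simp add: space_PM)

lemma skew_in: "z \<in> \<Omega> \<Longrightarrow> skew z \<in> \<Omega>"
  using T_in by (cases z) (auto simp: skew_apply)

lemma skew_inj: "inj_on skew \<Omega>"
proof (rule inj_onI)
  fix z z' assume *: "z \<in> \<Omega>" "z' \<in> \<Omega>" "skew z = skew z'"
  obtain p a p' a' where z: "z = (p, a)" "z' = (p', a')" by (cases z, cases z') auto
  then have "p = p'" using * T_inj by (auto simp: skew_apply dest: inj_onD)
  then show "z = z'" using * z by (simp add: skew_apply)
qed

lemma skew_surj:
  assumes "z \<in> \<Omega>"
  shows "\<exists>y\<in>\<Omega>. skew y = z"
proof -
  obtain p a where z: "z = (p, a)" by (cases z)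
  have "skew (Ti p, a - cocycle (Ti p)) = z" using z assms T_Ti by (auto simp: skew_apply)
  then show ?thesis using z assms Ti_in by (intro bexI[of _ "(Ti p, a - cocycle (Ti p))"]) auto
qed

definition pre :: "(real \<times> 'g) set \<Rightarrow> (real \<times> 'g) set" where "pre X = skew -` X \<inter> \<Omega>"

lemma pre_image:
  assumes "X \<subseteq> \<Omega>"
  shows "pre (skew ` X) = X"
proof
  show "pre (skew ` X) \<subseteq> X"
  proof
    fix z assume "z \<in> pre (skew ` X)"
    then obtain y where y: "y \<in> X" "skew z = skew y" "z \<in> \<Omega>" unfolding pre_def by blast
    then have "z = y" using inj_onD[OF skew_inj y(2,3)] assms by blast
    then show "z \<in> X" using y by simp
  qed
  show "X \<subseteq> pre (skew ` X)" unfolding pre_def using assms by blast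
qed

lemma image_pre:
  assumes "X \<subseteq> \<Omega>"
  shows "skew ` pre X = X"
proof
  show "skew ` pre X \<subseteq> X" unfolding pre_def by blast
  show "X \<subseteq> skew ` pre X"
  proof
    fix z assume z: "z \<in> X"
    then obtain y where "y \<in> \<Omega>" "skew y = z" using skew_surj assms by blast
    then show "z \<in> skew ` pre X" unfolding pre_def using z by blast
  qed
qed

lemma sec_pre: "sec (pre X) a = (\<Union>i\<in>A. P i \<inter> (T -` sec X (a + \<phi> i) \<inter> K))"
proof
  show "sec (pre X) a \<subseteq> (\<Union>i\<in>A. P i \<inter> (T -` sec X (a + \<phi> i) \<inter> K))"
  proof
    fix p assume p: "p \<in> sec (pre X) a"
    then have "p \<in> K" by (auto simp: sec_def pre_def)
    then obtain i where "i \<in> A" "p \<in> P i" using piece by blast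
    then show "p \<in> (\<Union>i\<in>A. P i \<inter> (T -` sec X (a + \<phi> i) \<inter> K))"
      using p cocycle_eq by (auto simp: sec_def pre_def skew_apply)
  qed
  show "(\<Union>i\<in>A. P i \<inter> (T -` sec X (a + \<phi> i) \<inter> K)) \<subseteq> sec (pre X) a"
    using cocycle_eq by (auto simp: sec_def pre_def skew_apply)
qed

lemma pre_sets: "X \<in> sets PM \<Longrightarrow> pre X \<in> sets PM"
  unfolding PM_iff[of "pre X"] sec_pre
  using P_sets sec_sets T_vimage_sets finite_A
  by (auto simp: pre_def intro!: sets.finite_UN sets.Int)

lemma skew_image_sets:
  assumes X: "X \<in> sets PM"
  shows "skew ` X \<in> sets PM"
proof -
  have "sec (skew ` X) a = (\<Union>i\<in>A. T ` (P i \<inter> sec X (a - \<phi> i)))" for a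
  proof
    show "sec (skew ` X) a \<subseteq> (\<Union>i\<in>A. T ` (P i \<inter> sec X (a - \<phi> i)))"
    proof
      fix q assume "q \<in> sec (skew ` X) a"
      then obtain p b where p: "(p, b) \<in> X" "q = T p" "a = b + cocycle p"
        by (auto simp: sec_def skew_product_def)
      then have "p \<in> K" using PM_sub[OF X] by auto
      then obtain i where i: "i \<in> A" "p \<in> P i" using piece by blast
      then have "b = a - \<phi> i" using p cocycle_eq by simp
      then have "p \<in> P i \<inter> sec X (a - \<phi> i)" using i p by (simp add: sec_def)
      then show "q \<in> (\<Union>i\<in>A. T ` (P i \<inter> sec X (a - \<phi> i)))" using i(1) p(2) by blast
    qed
    show "(\<Union>i\<in>A. T ` (P i \<inter> sec X (a - \<phi> i))) \<subseteq> sec (skew ` X) a"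
    proof
      fix q assume "q \<in> (\<Union>i\<in>A. T ` (P i \<inter> sec X (a - \<phi> i)))"
      then obtain i p where i: "i \<in> A" "p \<in> P i" "(p, a - \<phi> i) \<in> X" "q = T p" by (auto simp: sec_def)
      then have "skew (p, a - \<phi> i) = (q, a)" using cocycle_eq by (simp add: skew_apply)
      then show "q \<in> sec (skew ` X) a" unfolding sec_def using i by (metis image_eqI mem_Collect_eq)
    qed
  qed
  moreover have "(\<Union>i\<in>A. T ` (P i \<inter> sec X (a - \<phi> i))) \<in> sets BK" for a
    using finite_A P_sets sec_sets[OF X] T_image_sets by (intro sets.finite_UN) (auto intro: sets.Int)
  moreover have "skew ` X \<subseteq> \<Omega>" using skew_in PM_sub[OF X] by blast
  ultimately show ?thesis using PM_iff by auto
qed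

lemma skew_measurable: "skew \<in> measurable PM PM"
  using pre_sets skew_in by (intro measurableI) (auto simp: space_PM pre_def)

lemma emeasure_slices:
  assumes "sets \<mu> = sets PM" "X \<in> sets PM"
  shows "emeasure \<mu> X = (\<integral>\<^sup>+a. emeasure \<mu> (sec X a \<times> {a}) \<partial>count_space UNIV)"
proof -
  have "X = (\<Union>a. sec X a \<times> {a})" by (auto simp: sec_def)
  then have "emeasure \<mu> X = emeasure \<mu> (\<Union>a. sec X a \<times> {a})" by simp
  also have "\<dots> = (\<integral>\<^sup>+a. emeasure \<mu> (sec X a \<times> {a}) \<partial>count_space UNIV)"
    using assms Times_PM sec_sets
    by (intro emeasure_UN_countable) (auto simp: disjoint_family_on_def)
  finally show ?thesis .
qed

lemma measure_eq_slices:
  assumes "sets \<mu> = sets PM" "sets \<mu>' = sets PM"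
    and "\<And>B a. B \<in> sets BK \<Longrightarrow> emeasure \<mu> (B \<times> {a}) = emeasure \<mu>' (B \<times> {a})"
  shows "\<mu> = \<mu>'"
proof (rule measure_eqI)
  fix X assume "X \<in> sets \<mu>"
  then have X: "X \<in> sets PM" using assms by simp
  show "emeasure \<mu> X = emeasure \<mu>' X"
    using emeasure_slices[OF assms(1) X] emeasure_slices[OF assms(2) X] assms(3) sec_sets[OF X] by simp
qed (use assms in simp)

definition radon_inv :: "(real \<times> 'g) measure \<Rightarrow> bool" where
  "radon_inv \<mu> \<longleftrightarrow> sets \<mu> = sets PM \<and> (\<forall>a. emeasure \<mu> (K \<times> {a}) < \<infinity>) \<and> emeasure \<mu> \<Omega> \<noteq> 0 \<and>
     (\<forall>X\<in>sets PM. emeasure \<mu> (pre X) = emeasure \<mu> X)"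

definition inv_set :: "(real \<times> 'g) set \<Rightarrow> bool" where
  "inv_set E \<longleftrightarrow> E \<in> sets PM \<and> pre E = E"

definition ergodic :: "(real \<times> 'g) measure \<Rightarrow> bool" where
  "ergodic \<mu> \<longleftrightarrow> (\<forall>E. inv_set E \<longrightarrow> emeasure \<mu> E = 0 \<or> emeasure \<mu> (\<Omega> - E) = 0)"

lemma inv_set_iff:
  assumes "inv_set E" "p \<in> K"
  shows "(T p, a + cocycle p) \<in> E \<longleftrightarrow> (p, a) \<in> E"
proof -
  have "(p, a) \<in> pre E \<longleftrightarrow> skew (p, a) \<in> E" using assms(2) by (simp add: pre_def del: skew_apply)
  then show ?thesis using assms(1) by (simp add: inv_set_def skew_apply)
qed

lemma radon_invD:
  assumes "radon_inv \<mu>"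
  shows "sets \<mu> = sets PM" "emeasure \<mu> (K \<times> {a}) < \<infinity>" "emeasure \<mu> \<Omega> \<noteq> 0"
    "X \<in> sets PM \<Longrightarrow> emeasure \<mu> (pre X) = emeasure \<mu> X"
  using assms by (auto simp: radon_inv_def)

lemma slice_finite:
  assumes "radon_inv \<mu>" "B \<subseteq> K"
  shows "emeasure \<mu> (B \<times> {a}) < \<infinity>"
proof -
  have "emeasure \<mu> (B \<times> {a}) \<le> emeasure \<mu> (K \<times> {a})"
    using assms radon_invD(1)[OF assms(1)] Times_PM[OF K_sets] by (intro emeasure_mono) auto
  then show ?thesis using radon_invD(2)[OF assms(1), of a] by (simp add: le_less_trans)
qed

lemma pre_Times:
  assumes i: "i \<in> A" and B: "B \<subseteq> P i"
  shows "pre (T ` B \<times> {a + \<phi> i}) = B \<times> {a}"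
proof -
  have "skew ` (B \<times> {a}) = T ` B \<times> {a + \<phi> i}"
  proof
    show "skew ` (B \<times> {a}) \<subseteq> T ` B \<times> {a + \<phi> i}" using cocycle_eq[OF i] B by (auto simp: skew_product_def)
    show "T ` B \<times> {a + \<phi> i} \<subseteq> skew ` (B \<times> {a})"
    proof
      fix z assume "z \<in> T ` B \<times> {a + \<phi> i}"
      then obtain p where p: "p \<in> B" "z = (T p, a + \<phi> i)" by auto
      then have "z = skew (p, a)" using cocycle_eq[OF i] B by (auto simp: skew_apply)
      then show "z \<in> skew ` (B \<times> {a})" using p by auto
    qed
  qed
  moreover have "B \<times> {a} \<subseteq> \<Omega>" using B P_sub[OF i] by auto
  ultimately show ?thesis using pre_image by metis
qed

lemma radon_inv_slice:
  assumes "radon_inv \<mu>" "i \<in> A" "B \<in> sets BK" "B \<subseteq> P i"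
  shows "emeasure \<mu> (T ` B \<times> {a + \<phi> i}) = emeasure \<mu> (B \<times> {a})"
  using radon_invD(4)[OF assms(1) Times_PM[OF T_image_sets[OF assms(3)]], of "a + \<phi> i"]
    pre_Times[OF assms(2,4)] by simp

text \<open>On \<open>P i \<times> {a}\<close> the skew product is \<open>T\<close> together with a
  shift of the fibre by \<open>\<phi> i\<close>. A general set is cut into such pieces, and the
  shift is absorbed by reindexing the sum over the fibres.\<close>

lemma invariant_from_slices:
  assumes S: "sets \<mu> = sets PM"
    and inv: "\<And>i B a. i \<in> A \<Longrightarrow> B \<in> sets BK \<Longrightarrow> B \<subseteq> P i \<Longrightarrow>
      emeasure \<mu> (T ` B \<times> {a + \<phi> i}) = emeasure \<mu> (B \<times> {a})"
    and X: "X \<in> sets PM"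
  shows "emeasure \<mu> (pre X) = emeasure \<mu> X"
proof -
  have TP: "T ` P i \<in> sets BK" if "i \<in> A" for i using T_image_sets P_sets that by blast
  have B: "P i \<inter> (T -` sec X b \<inter> K) \<in> sets BK" if "i \<in> A" for i b
    using P_sets[OF that] T_vimage_sets[OF sec_sets[OF X]] by (rule sets.Int)
  have imB: "T ` (P i \<inter> (T -` sec X b \<inter> K)) = T ` P i \<inter> sec X b" if "i \<in> A" for i b
    using P_sub[OF that] by auto
  have "emeasure \<mu> (pre X) = (\<integral>\<^sup>+a. emeasure \<mu> (sec (pre X) a \<times> {a}) \<partial>count_space UNIV)"
    by (rule emeasure_slices[OF S pre_sets[OF X]])
  also have "\<dots> = (\<integral>\<^sup>+a. (\<Sum>i\<in>A. emeasure \<mu> ((T ` P i \<inter> sec X (a + \<phi> i)) \<times> {a + \<phi> i})) \<partial>count_space UNIV)"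
  proof (rule nn_integral_cong)
    fix a
    have "sec (pre X) a \<times> {a} = (\<Union>i\<in>A. (P i \<inter> (T -` sec X (a + \<phi> i) \<inter> K)) \<times> {a})"
      unfolding sec_pre by auto
    then have "emeasure \<mu> (sec (pre X) a \<times> {a}) =
        (\<Sum>i\<in>A. emeasure \<mu> ((P i \<inter> (T -` sec X (a + \<phi> i) \<inter> K)) \<times> {a}))"
    proof (subst sum_emeasure)
      show "disjoint_family_on (\<lambda>i. (P i \<inter> (T -` sec X (a + \<phi> i) \<inter> K)) \<times> {a}) A"
        unfolding disjoint_family_on_def using P_disj by blast
    qed (use B Times_PM S finite_A in auto)
    also have "\<dots> = (\<Sum>i\<in>A. emeasure \<mu> ((T ` P i \<inter> sec X (a + \<phi> i)) \<times> {a + \<phi> i}))"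
      using inv[OF _ B] imB by (intro sum.cong refl) (metis inf_le1)
    finally show "emeasure \<mu> (sec (pre X) a \<times> {a}) =
        (\<Sum>i\<in>A. emeasure \<mu> ((T ` P i \<inter> sec X (a + \<phi> i)) \<times> {a + \<phi> i}))" .
  qed
  also have "\<dots> = (\<Sum>i\<in>A. \<integral>\<^sup>+a. emeasure \<mu> ((T ` P i \<inter> sec X (a + \<phi> i)) \<times> {a + \<phi> i}) \<partial>count_space UNIV)"
    by (intro nn_integral_sum) auto
  also have "\<dots> = (\<Sum>i\<in>A. \<integral>\<^sup>+a. emeasure \<mu> ((T ` P i \<inter> sec X a) \<times> {a}) \<partial>count_space UNIV)"
  proof (rule sum.cong[OF refl])
    fix i
    have "bij (\<lambda>a. a + \<phi> i)" by (rule bij_betwI[of _ _ _ "\<lambda>a. a - \<phi> i"]) auto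
    then show "(\<integral>\<^sup>+a. emeasure \<mu> ((T ` P i \<inter> sec X (a + \<phi> i)) \<times> {a + \<phi> i}) \<partial>count_space UNIV) =
        (\<integral>\<^sup>+a. emeasure \<mu> ((T ` P i \<inter> sec X a) \<times> {a}) \<partial>count_space UNIV)"
      using nn_integral_bij_count_space[of "\<lambda>a. a + \<phi> i" UNIV UNIV "\<lambda>a. emeasure \<mu> ((T ` P i \<inter> sec X a) \<times> {a})"]
      by simp
  qed
  also have "\<dots> = (\<integral>\<^sup>+a. (\<Sum>i\<in>A. emeasure \<mu> ((T ` P i \<inter> sec X a) \<times> {a})) \<partial>count_space UNIV)"
    by (intro nn_integral_sum[symmetric]) auto
  also have "\<dots> = (\<integral>\<^sup>+a. emeasure \<mu> (sec X a \<times> {a}) \<partial>count_space UNIV)"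
  proof (rule nn_integral_cong)
    fix a
    have "sec X a \<subseteq> K" using sec_sets[OF X] sets_BK by blast
    moreover have "K = (\<Union>i\<in>A. T ` P i)" using P_cover T_surj by blast
    ultimately have eq: "sec X a \<times> {a} = (\<Union>i\<in>A. (T ` P i \<inter> sec X a) \<times> {a})" by blast
    have disj: "T ` P i \<inter> T ` P j = {}" if "i \<in> A" "j \<in> A" "i \<noteq> j" for i j
      using inj_on_image_Int[OF T_inj P_sub P_sub, of i j] P_disj[of i j] that by simp
    have "T ` P i \<inter> sec X a \<in> sets BK" if "i \<in> A" for i
      using TP[OF that] sec_sets[OF X] by (rule sets.Int)
    then show "(\<Sum>i\<in>A. emeasure \<mu> ((T ` P i \<inter> sec X a) \<times> {a})) = emeasure \<mu> (sec X a \<times> {a})"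
      unfolding eq
    proof (intro sum_emeasure)
      show "disjoint_family_on (\<lambda>i. (T ` P i \<inter> sec X a) \<times> {a}) A"
        unfolding disjoint_family_on_def using disj by blast
    qed (use Times_PM S finite_A in auto)
  qed
  also have "\<dots> = emeasure \<mu> X" by (rule emeasure_slices[OF S X, symmetric])
  finally show ?thesis .
qed

subsection \<open>Ergodic measures are proportional or mutually singular\<close>

text \<open>The difference of two infinite measures makes no sense globally. Each fibre is finite
  for both, so the decomposition is taken there and the positive parts are united.\<close>

lemma hahn_scaled:
  assumes \<mu>: "radon_inv \<mu>" and \<mu>': "radon_inv \<mu>'"
  shows "\<exists>Y\<in>sets PM. (\<forall>X\<in>sets PM. X \<subseteq> Y \<longrightarrow> ennreal c * emeasure \<mu> X \<le> emeasure \<mu>' X) \<and>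
    (\<forall>X\<in>sets PM. X \<inter> Y = {} \<longrightarrow> emeasure \<mu>' X \<le> ennreal c * emeasure \<mu> X)"
proof -
  note S = radon_invD(1)[OF \<mu>] radon_invD(1)[OF \<mu>']
  have "\<exists>Y\<in>sets \<mu>'. Y \<subseteq> K \<times> {a} \<and>
      (\<forall>X\<in>sets \<mu>'. X \<subseteq> Y \<longrightarrow> scale_measure (ennreal c) \<mu> X \<le> \<mu>' X) \<and>
      (\<forall>X\<in>sets \<mu>'. X \<subseteq> K \<times> {a} \<longrightarrow> X \<inter> Y = {} \<longrightarrow> \<mu>' X \<le> scale_measure (ennreal c) \<mu> X)" for a
    using S Times_PM[OF K_sets, of a] radon_invD(2)[OF \<mu>, of a] radon_invD(2)[OF \<mu>', of a]
    by (intro unsigned_Hahn_decomposition) (auto simp: ennreal_mult_eq_top_iff)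
  then obtain y where y: "\<And>a. y a \<in> sets PM" "\<And>a. y a \<subseteq> K \<times> {a}"
    "\<And>a X. X \<in> sets PM \<Longrightarrow> X \<subseteq> y a \<Longrightarrow> ennreal c * emeasure \<mu> X \<le> emeasure \<mu>' X"
    "\<And>a X. X \<in> sets PM \<Longrightarrow> X \<subseteq> K \<times> {a} \<Longrightarrow> X \<inter> y a = {} \<Longrightarrow> emeasure \<mu>' X \<le> ennreal c * emeasure \<mu> X"
    unfolding S emeasure_scale_measure by metis
  define Y where "Y = (\<Union>a. y a)"
  have Y: "Y \<in> sets PM" unfolding Y_def using y(1) by (intro sets.countable_UN') auto
  have slices: "ennreal c * emeasure \<mu> X = (\<integral>\<^sup>+a. ennreal c * emeasure \<mu> (sec X a \<times> {a}) \<partial>count_space UNIV)"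
    if "X \<in> sets PM" for X
    using emeasure_slices[OF S(1) that] by (simp add: nn_integral_cmult)
  show ?thesis
  proof (intro bexI[OF _ Y] conjI ballI impI)
    fix X assume X: "X \<in> sets PM" "X \<subseteq> Y"
    have sub: "sec X a \<times> {a} \<subseteq> y a" for a
    proof
      fix z assume z: "z \<in> sec X a \<times> {a}"
      then have "z \<in> Y" using X(2) by (auto simp: sec_def)
      then obtain b where b: "z \<in> y b" unfolding Y_def by blast
      then have "b = a" using z y(2)[of b] by auto
      then show "z \<in> y a" using b by simp
    qed
    show "ennreal c * emeasure \<mu> X \<le> emeasure \<mu>' X"
      unfolding slices[OF X(1)] emeasure_slices[OF S(2) X(1)]
      by (intro nn_integral_mono y(3)[OF Times_PM[OF sec_sets[OF X(1)]] sub])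
  next
    fix X assume X: "X \<in> sets PM" "X \<inter> Y = {}"
    have "sec X a \<times> {a} \<subseteq> X" for a by (auto simp: sec_def)
    then have dis: "sec X a \<times> {a} \<inter> y a = {}" for a using X(2) unfolding Y_def by blast
    have sub: "sec X a \<times> {a} \<subseteq> K \<times> {a}" for a using PM_sub[OF X(1)] by (auto simp: sec_def)
    show "emeasure \<mu>' X \<le> ennreal c * emeasure \<mu> X"
      unfolding slices[OF X(1)] emeasure_slices[OF S(2) X(1)]
      by (intro nn_integral_mono y(4)[OF Times_PM[OF sec_sets[OF X(1)]] sub dis])
  qed
qed

text \<open>Being a positive set is stable under countable unions and, both measures being
  invariant, under images and preimages of the skew product. The union of all iterated images and
  preimages of \<open>Y\<close> is therefore positive and strictly invariant, and its complement
  avoids \<open>Y\<close>.\<close>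

lemma hahn_invariant:
  assumes \<mu>: "radon_inv \<mu>" and \<mu>': "radon_inv \<mu>'"
  shows "\<exists>E. inv_set E \<and> (\<forall>X\<in>sets PM. X \<subseteq> E \<longrightarrow> ennreal c * emeasure \<mu> X \<le> emeasure \<mu>' X) \<and>
    (\<forall>X\<in>sets PM. X \<inter> E = {} \<longrightarrow> emeasure \<mu>' X \<le> ennreal c * emeasure \<mu> X)"
proof -
  note S = radon_invD(1)[OF \<mu>] radon_invD(1)[OF \<mu>']
  define pos where "pos Y \<longleftrightarrow> Y \<in> sets PM \<and>
    (\<forall>X\<in>sets PM. X \<subseteq> Y \<longrightarrow> ennreal c * emeasure \<mu> X \<le> emeasure \<mu>' X)" for Y
  obtain Y where Y: "pos Y" "\<forall>X\<in>sets PM. X \<inter> Y = {} \<longrightarrow> emeasure \<mu>' X \<le> ennreal c * emeasure \<mu> X"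
    using hahn_scaled[OF \<mu> \<mu>', of c] unfolding pos_def by (elim bexE conjE) simp
  have pos_UN: "pos (\<Union>n. Z n)" if Z: "\<And>n::nat. pos (Z n)" for Z
    unfolding pos_def
  proof (intro conjI ballI impI)
    have Zs: "Z n \<in> sets PM" for n using Z pos_def by auto
    then show "(\<Union>n. Z n) \<in> sets PM" by auto
    fix X assume X: "X \<in> sets PM" "X \<subseteq> (\<Union>n. Z n)"
    define D where "D n = X \<inter> disjointed Z n" for n
    have "range (disjointed Z) \<subseteq> sets PM" using Zs by (intro sets.range_disjointed_sets) auto
    then have D: "D n \<in> sets PM" for n unfolding D_def using X(1) by (intro sets.Int) auto
    have disj: "disjoint_family D"
      unfolding D_def using disjoint_family_disjointed[of Z] by (auto simp: disjoint_family_on_def)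
    have XD: "X = (\<Union>n. D n)" unfolding D_def using X(2) UN_disjointed_eq[of Z] by auto
    have le: "ennreal c * emeasure \<mu> (D n) \<le> emeasure \<mu>' (D n)" for n
      using Z[of n] D[of n] disjointed_subset[of Z n] unfolding pos_def D_def by (meson inf.coboundedI2)
    have "ennreal c * emeasure \<mu> X = (\<Sum>n. ennreal c * emeasure \<mu> (D n))"
      unfolding XD using suminf_emeasure[of D \<mu>] D disj S by (simp add: image_subset_iff)
    also have "\<dots> \<le> (\<Sum>n. emeasure \<mu>' (D n))" by (intro suminf_le le) auto
    also have "\<dots> = emeasure \<mu>' X"
      unfolding XD using suminf_emeasure[of D \<mu>'] D disj S by (simp add: image_subset_iff)
    finally show "ennreal c * emeasure \<mu> X \<le> emeasure \<mu>' X" .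
  qed
  have pos_image: "pos (skew ` Z)" if Z: "pos Z" for Z
    unfolding pos_def
  proof (intro conjI ballI impI)
    have Zs: "Z \<in> sets PM" using Z pos_def by auto
    show "skew ` Z \<in> sets PM" using skew_image_sets[OF Zs] .
    fix X assume X: "X \<in> sets PM" "X \<subseteq> skew ` Z"
    have "pre X \<subseteq> pre (skew ` Z)" using X(2) unfolding pre_def by blast
    then have "pre X \<subseteq> Z" using pre_image[OF PM_sub[OF Zs]] by simp
    then have "ennreal c * emeasure \<mu> (pre X) \<le> emeasure \<mu>' (pre X)"
      using Z pre_sets[OF X(1)] unfolding pos_def by blast
    then show "ennreal c * emeasure \<mu> X \<le> emeasure \<mu>' X"
      using radon_invD(4)[OF \<mu> X(1)] radon_invD(4)[OF \<mu>' X(1)] by simp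
  qed
  have pos_pre: "pos (pre Z)" if Z: "pos Z" for Z
    unfolding pos_def
  proof (intro conjI ballI impI)
    have Zs: "Z \<in> sets PM" using Z pos_def by auto
    show "pre Z \<in> sets PM" using pre_sets[OF Zs] .
    fix X assume X: "X \<in> sets PM" "X \<subseteq> pre Z"
    have "skew ` X \<subseteq> Z" using X(2) image_pre[OF PM_sub[OF Zs]] by blast
    then have "ennreal c * emeasure \<mu> (skew ` X) \<le> emeasure \<mu>' (skew ` X)"
      using Z skew_image_sets[OF X(1)] unfolding pos_def by blast
    then show "ennreal c * emeasure \<mu> X \<le> emeasure \<mu>' X"
      using radon_invD(4)[OF \<mu> skew_image_sets[OF X(1)]] radon_invD(4)[OF \<mu>' skew_image_sets[OF X(1)]]
        pre_image[OF PM_sub[OF X(1)]] by simp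
  qed
  define U where "U n = ((`) skew ^^ n) Y" for n
  define V where "V n = (pre ^^ n) Y" for n
  have U: "pos (U n)" for n unfolding U_def by (induction n) (use Y(1) pos_image in auto)
  have V: "pos (V n)" for n unfolding V_def by (induction n) (use Y(1) pos_pre in auto)
  define E where "E = (\<Union>n. if even n then U (n div 2) else V (n div 2))"
  have E: "pos E" unfolding E_def by (intro pos_UN) (use U V in auto)
  have E_iff: "z \<in> E \<longleftrightarrow> (\<exists>n. z \<in> U n) \<or> (\<exists>n. z \<in> V n)" for z
  proof
    assume "z \<in> E"
    then show "(\<exists>n. z \<in> U n) \<or> (\<exists>n. z \<in> V n)" unfolding E_def by (auto split: if_splits)
  next
    assume "(\<exists>n. z \<in> U n) \<or> (\<exists>n. z \<in> V n)"
    then consider n where "z \<in> U n" | n where "z \<in> V n" by blast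
    then show "z \<in> E"
    proof cases
      case 1
      then show ?thesis unfolding E_def by (intro UN_I[of "2 * n"]) auto
    next
      case 2
      then show ?thesis unfolding E_def by (intro UN_I[of "2 * n + 1"]) auto
    qed
  qed
  have sub: "U n \<subseteq> \<Omega>" "V n \<subseteq> \<Omega>" for n using U V PM_sub unfolding pos_def by blast+
  have step: "skew z \<in> E \<longleftrightarrow> z \<in> E" if z: "z \<in> \<Omega>" for z
  proof
    assume "skew z \<in> E"
    then consider "skew z \<in> U 0" | n where "skew z \<in> U (Suc n)" | n where "skew z \<in> V n"
      unfolding E_iff by (metis not0_implies_Suc)
    then show "z \<in> E"
    proof cases
      case 1
      then have "z \<in> V (Suc 0)" using z by (simp add: U_def V_def pre_def)
      then show ?thesis using E_iff by blast
    next
      case (2 n)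
      then obtain y where "y \<in> U n" "skew z = skew y" by (auto simp: U_def)
      then have "z \<in> U n" using z sub skew_inj by (metis inj_onD subsetD)
      then show ?thesis using E_iff by blast
    next
      case (3 n)
      then have "z \<in> V (Suc n)" using z by (simp add: V_def pre_def)
      then show ?thesis using E_iff by blast
    qed
  next
    assume "z \<in> E"
    then consider n where "z \<in> U n" | "z \<in> V 0" | n where "z \<in> V (Suc n)"
      unfolding E_iff by (metis not0_implies_Suc)
    then show "skew z \<in> E"
    proof cases
      case (1 n)
      then have "skew z \<in> U (Suc n)" by (simp add: U_def)
      then show ?thesis using E_iff by blast
    next
      case 2
      then have "skew z \<in> U (Suc 0)" by (simp add: U_def V_def)
      then show ?thesis using E_iff by blast
    next
      case (3 n)
      then have "skew z \<in> V n" by (simp add: V_def pre_def)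
      then show ?thesis using E_iff by blast
    qed
  qed
  have "E \<subseteq> \<Omega>" using E PM_sub unfolding pos_def by blast
  then have "pre E = E" unfolding pre_def using step by blast
  then have "inv_set E" using E unfolding inv_set_def pos_def by simp
  moreover have "Y \<subseteq> E" using E_iff U_def by (metis funpow_0 subsetI)
  moreover have "\<forall>X\<in>sets PM. X \<inter> E = {} \<longrightarrow> emeasure \<mu>' X \<le> ennreal c * emeasure \<mu> X"
    using Y(2) \<open>Y \<subseteq> E\<close> by (meson disjoint_iff subsetD)
  ultimately show ?thesis using E unfolding pos_def by (intro exI[of _ E] conjI) auto
qed

lemma inv_set_compl: "inv_set E \<Longrightarrow> inv_set (\<Omega> - E)"
  unfolding inv_set_def
proof
  assume E: "E \<in> sets PM \<and> pre E = E"
  then show "\<Omega> - E \<in> sets PM" using Omega_sets by auto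
  have "skew z \<in> E \<longleftrightarrow> z \<in> E" if "z \<in> \<Omega>" for z using E that unfolding pre_def by blast
  then show "pre (\<Omega> - E) = \<Omega> - E" using skew_in unfolding pre_def by blast
qed

lemma positive_slice:
  assumes "radon_inv \<mu>"
  shows "\<exists>a. emeasure \<mu> (K \<times> {a}) \<noteq> 0"
proof (rule ccontr)
  assume "\<not> ?thesis"
  then have "\<And>a. emeasure \<mu> (K \<times> {a}) = 0" by simp
  moreover have "sec \<Omega> a = K" for a by (auto simp: sec_def)
  ultimately have "emeasure \<mu> \<Omega> = 0"
    using emeasure_slices[OF radon_invD(1)[OF assms] Omega_sets] by simp
  then show False using radon_invD(3)[OF assms] by simp
qed

lemma le_all_less:
  fixes c m y :: real
  assumes "\<And>t. c < t \<Longrightarrow> y \<le> t * m" "0 \<le> m"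
  shows "y \<le> c * m"
proof (rule field_le_epsilon)
  fix e :: real assume e: "e > 0"
  \<comment> \<open>Dividing by \<open>m + 1\<close> instead of \<open>m\<close> keeps the error
    below \<open>e\<close> and covers \<open>m = 0\<close>.\<close>
  have "y \<le> (c + e / (m + 1)) * m" using assms e by (intro assms(1)) simp
  also have "\<dots> = c * m + e * (m / (m + 1))" by (simp add: distrib_right)
  also have "\<dots> \<le> c * m + e * 1" using e assms(2) by (intro add_left_mono mult_left_mono) auto
  finally show "y \<le> c * m + e" by simp
qed

lemma le_all_greater:
  fixes c m y :: real
  assumes "\<And>t. 0 < t \<Longrightarrow> t < c \<Longrightarrow> t * m \<le> y" "0 \<le> m" "0 < c"
  shows "c * m \<le> y"
proof (rule field_le_epsilon)
  fix e :: real assume e: "e > 0"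
  define t where "t = max (c / 2) (c - e / (m + 1))"
  have t: "0 < t" "t < c" using assms e by (auto simp: t_def)
  have "c - t \<le> e / (m + 1)" by (auto simp: t_def)
  then have "(c - t) * m \<le> e / (m + 1) * m" using assms(2) by (rule mult_right_mono)
  also have "\<dots> = e * (m / (m + 1))" by simp
  also have "\<dots> \<le> e * 1" using e assms(2) by (intro mult_left_mono) auto
  finally show "c * m \<le> y + e" using assms(1)[OF t] by (simp add: algebra_simps)
qed

text \<open>For each \<open>c\<close>, ergodicity makes the invariant Hahn set of
  \<open>\<mu>' - c * \<mu>\<close> trivial for both measures. If they are not mutually singular, it
  is trivial in the same way for both, so \<open>\<mu>' \<le> c * \<mu>\<close> or
  \<open>c * \<mu> \<le> \<mu>'\<close> on all sets. The value of \<open>c\<close> at which the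
  alternatives switch is the factor of proportionality.\<close>

lemma ergodic_dichotomy:
  assumes \<mu>: "radon_inv \<mu>" "ergodic \<mu>" and \<mu>': "radon_inv \<mu>'" "ergodic \<mu>'"
  shows "(\<exists>c>0. \<forall>a. \<forall>B\<in>sets BK. emeasure \<mu>' (B \<times> {a}) = ennreal c * emeasure \<mu> (B \<times> {a})) \<or>
    (\<exists>E. inv_set E \<and> emeasure \<mu> (\<Omega> - E) = 0 \<and> emeasure \<mu>' E = 0)"
proof (rule disjCI)
  assume ns: "\<not> (\<exists>E. inv_set E \<and> emeasure \<mu> (\<Omega> - E) = 0 \<and> emeasure \<mu>' E = 0)"
  note S = radon_invD(1)[OF \<mu>(1)] radon_invD(1)[OF \<mu>'(1)]
  have comp: "(\<forall>X\<in>sets PM. emeasure \<mu>' X \<le> ennreal c * emeasure \<mu> X) \<or>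
      (\<forall>X\<in>sets PM. ennreal c * emeasure \<mu> X \<le> emeasure \<mu>' X)" for c
  proof -
    obtain E where E: "inv_set E" "\<forall>X\<in>sets PM. X \<subseteq> E \<longrightarrow> ennreal c * emeasure \<mu> X \<le> emeasure \<mu>' X"
      "\<forall>X\<in>sets PM. X \<inter> E = {} \<longrightarrow> emeasure \<mu>' X \<le> ennreal c * emeasure \<mu> X"
      using hahn_invariant[OF \<mu>(1) \<mu>'(1), of c] by (elim exE conjE)
    have Es: "E \<in> sets PM" using E(1) inv_set_def by blast
    have E2: "\<Omega> - (\<Omega> - E) = E" using PM_sub[OF Es] by blast
    have split: "emeasure N X = emeasure N (X \<inter> E) + emeasure N (X - E)"
      if "sets N = sets PM" "X \<in> sets PM" for N X
      using that Es plus_emeasure[of "X \<inter> E" N "X - E"] by (auto simp: Int_Diff_Un Int_Diff_disjoint)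
    have null: "emeasure N (X \<inter> Y) = 0" if "sets N = sets PM" "Y \<in> sets PM" "emeasure N Y = 0" for N X Y
      using that emeasure_mono[of "X \<inter> Y" Y N] by auto
    have "emeasure \<mu> E = 0 \<or> emeasure \<mu> (\<Omega> - E) = 0" using \<mu>(2) E(1) ergodic_def by blast
    then show ?thesis
    proof
      assume 0: "emeasure \<mu> E = 0"
      then have "emeasure \<mu>' (\<Omega> - E) \<noteq> 0" using ns inv_set_compl[OF E(1)] E2 by auto
      then have 1: "emeasure \<mu>' E = 0" using \<mu>'(2) E(1) ergodic_def by blast
      have "emeasure \<mu>' X \<le> ennreal c * emeasure \<mu> X" if X: "X \<in> sets PM" for X
      proof -
        have "emeasure \<mu>' X = emeasure \<mu>' (X - E)" using split[OF S(2) X] null[OF S(2) Es 1] by simp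
        also have "\<dots> \<le> ennreal c * emeasure \<mu> (X - E)" using E(3) X Es by auto
        also have "\<dots> \<le> ennreal c * emeasure \<mu> X" using X S by (intro mult_left_mono emeasure_mono) auto
        finally show ?thesis .
      qed
      then show ?thesis by blast
    next
      assume 0: "emeasure \<mu> (\<Omega> - E) = 0"
      have "ennreal c * emeasure \<mu> X \<le> emeasure \<mu>' X" if X: "X \<in> sets PM" for X
      proof -
        have "X - E = X \<inter> (\<Omega> - E)" using PM_sub[OF X] by blast
        then have "emeasure \<mu> (X - E) = 0" using null[OF S(1) _ 0, of X] Es Omega_sets by auto
        then have "ennreal c * emeasure \<mu> X = ennreal c * emeasure \<mu> (X \<inter> E)" using split[OF S(1) X] by simp
        also have "\<dots> \<le> emeasure \<mu>' (X \<inter> E)" using E(2) X Es by auto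
        also have "\<dots> \<le> emeasure \<mu>' X" using X S by (intro emeasure_mono) auto
        finally show ?thesis .
      qed
      then show ?thesis by blast
    qed
  qed
  define m where "m X = measure \<mu> X" for X
  define m' where "m' X = measure \<mu>' X" for X
  have fin: "emeasure \<mu> (B \<times> {a}) = ennreal (m (B \<times> {a}))" "emeasure \<mu>' (B \<times> {a}) = ennreal (m' (B \<times> {a}))"
    if "B \<subseteq> K" for B a
    unfolding m_def m'_def using slice_finite[OF \<mu>(1) that, of a] slice_finite[OF \<mu>'(1) that, of a]
    by (auto intro!: emeasure_eq_ennreal_measure)
  have comp': "(\<forall>B\<in>sets BK. \<forall>a. m' (B \<times> {a}) \<le> c * m (B \<times> {a})) \<or>
      (\<forall>B\<in>sets BK. \<forall>a. c * m (B \<times> {a}) \<le> m' (B \<times> {a}))" if c: "c > 0" for c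
  proof -
    have e: "ennreal c * emeasure \<mu> (B \<times> {a}) = ennreal (c * m (B \<times> {a}))" if "B \<in> sets BK" for B a
      using fin[of B a] that sets_BK c by (simp add: ennreal_mult m_def)
    have n: "0 \<le> m X" "0 \<le> m' X" "0 \<le> c * m X" for X using c by (auto simp: m_def m'_def)
    show ?thesis
      using comp[of c]
    proof
      assume h: "\<forall>X\<in>sets PM. emeasure \<mu>' X \<le> ennreal c * emeasure \<mu> X"
      have "m' (B \<times> {a}) \<le> c * m (B \<times> {a})" if "B \<in> sets BK" for B a
        using h[rule_format, OF Times_PM[OF that, of a]] e[OF that, of a] fin(2)[of B a] that sets_BK n
        by (simp add: ennreal_le_iff)
      then show ?thesis by blast
    next
      assume h: "\<forall>X\<in>sets PM. ennreal c * emeasure \<mu> X \<le> emeasure \<mu>' X"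
      have "c * m (B \<times> {a}) \<le> m' (B \<times> {a})" if "B \<in> sets BK" for B a
        using h[rule_format, OF Times_PM[OF that, of a]] e[OF that, of a] fin(2)[of B a] that sets_BK n
        by (simp add: ennreal_le_iff)
      then show ?thesis by blast
    qed
  qed
  obtain a0 where "emeasure \<mu> (K \<times> {a0}) \<noteq> 0" using positive_slice[OF \<mu>(1)] by blast
  then have m0: "m (K \<times> {a0}) > 0" using fin(1)[of K a0] by (simp add: m_def zero_less_measure_iff)
  \<comment> \<open>On the fibre of \<open>a0\<close> the lower bound \<open>t * m \<le> m'\<close>
    fails for \<open>t > c\<close> and the upper bound \<open>m' \<le> t * m\<close> fails for
    \<open>t < c\<close>; so the other bound holds everywhere.\<close>
  define c where "c = m' (K \<times> {a0}) / m (K \<times> {a0})"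
  have upper: "m' (B \<times> {a}) \<le> t * m (B \<times> {a})" if t: "c < t" and B: "B \<in> sets BK" for t B a
  proof -
    have "0 \<le> c" using m0 by (simp add: c_def m'_def)
    then have "0 < t" using t by simp
    moreover have "\<not> t * m (K \<times> {a0}) \<le> m' (K \<times> {a0})" using t m0 by (simp add: c_def field_simps)
    ultimately show ?thesis using comp'[of t] K_sets B by blast
  qed
  have le: "m' (B \<times> {a}) \<le> c * m (B \<times> {a})" if B: "B \<in> sets BK" for B a
  proof (rule le_all_less)
    show "m' (B \<times> {a}) \<le> t * m (B \<times> {a})" if "c < t" for t using upper[OF that B] .
  qed (simp add: m_def)
  have "c > 0"
  proof (rule ccontr)
    assume "\<not> c > 0"
    moreover have "0 \<le> c" using m0 by (simp add: c_def m'_def)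
    ultimately have "c = 0" by simp
    then have "m' (K \<times> {a}) = 0" for a using le[OF K_sets, of a] by (simp add: m'_def measure_le_0_iff)
    then have "emeasure \<mu>' (K \<times> {a}) = 0" for a using fin(2)[of K a] by simp
    then show False using positive_slice[OF \<mu>'(1)] by simp
  qed
  have lower: "t * m (B \<times> {a}) \<le> m' (B \<times> {a})" if t: "0 < t" "t < c" and B: "B \<in> sets BK" for t B a
  proof -
    have "\<not> m' (K \<times> {a0}) \<le> t * m (K \<times> {a0})" using t m0 by (simp add: c_def field_simps)
    then show ?thesis using comp'[OF t(1)] K_sets B by blast
  qed
  have ge: "c * m (B \<times> {a}) \<le> m' (B \<times> {a})" if B: "B \<in> sets BK" for B a
  proof (rule le_all_greater)
    show "t * m (B \<times> {a}) \<le> m' (B \<times> {a})" if "0 < t" "t < c" for t using lower[OF that B] .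
  qed (use \<open>c > 0\<close> in \<open>simp_all add: m_def\<close>)
  have "emeasure \<mu>' (B \<times> {a}) = ennreal c * emeasure \<mu> (B \<times> {a})" if B: "B \<in> sets BK" for B a
  proof -
    have "m' (B \<times> {a}) = c * m (B \<times> {a})" using le[OF B] ge[OF B] by (rule antisym)
    then show ?thesis using fin[of B a] B sets_BK \<open>c > 0\<close> by (simp add: ennreal_mult m_def)
  qed
  then show "\<exists>c>0. \<forall>a. \<forall>B\<in>sets BK. emeasure \<mu>' (B \<times> {a}) = ennreal c * emeasure \<mu> (B \<times> {a})"
    using \<open>c > 0\<close> by blast
qed

subsection \<open>Maharam measures\<close>

text \<open>The prescribed density of \<open>\<nu> \<circ> T\<close> tested on sets inside one
  piece, where it is constant; \<open>conformal_iff_RN_deriv\<close> shows the agreement with the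
  version through \<open>RN_deriv\<close>.\<close>

definition conformal :: "('g \<Rightarrow> real) \<Rightarrow> real measure \<Rightarrow> bool" where
  "conformal \<psi> \<nu> \<longleftrightarrow> sets \<nu> = sets BK \<and> finite_measure \<nu> \<and> emeasure \<nu> K \<noteq> 0 \<and>
     (\<forall>i\<in>A. \<forall>B\<in>sets BK. B \<subseteq> P i \<longrightarrow> emeasure \<nu> (T ` B) = ennreal (exp (- \<psi> (\<phi> i))) * emeasure \<nu> B)"

lemma conformalD:
  assumes "conformal \<psi> \<nu>"
  shows "sets \<nu> = sets BK" "finite_measure \<nu>" "emeasure \<nu> K \<noteq> 0" "space \<nu> = K"
    "i \<in> A \<Longrightarrow> B \<in> sets BK \<Longrightarrow> B \<subseteq> P i \<Longrightarrow> emeasure \<nu> (T ` B) = ennreal (exp (- \<psi> (\<phi> i))) * emeasure \<nu> B"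
  using assms sets_eq_imp_space_eq[of \<nu> BK] unfolding conformal_def by (auto simp: space_restrict_space)

lemma sets_maharam:
  assumes "sets \<nu> = sets BK"
  shows "sets (maharam_measure \<psi> \<nu>) = sets PM"
  unfolding maharam_measure_def PM_def using sets_pair_measure_cong[OF assms refl] by simp

lemma emeasure_maharam:
  fixes \<psi> :: "'g \<Rightarrow> real"
  assumes \<nu>: "sets \<nu> = sets BK" and B: "B \<in> sets BK"
  shows "emeasure (maharam_measure \<psi> \<nu>) (B \<times> {a}) = emeasure \<nu> B * ennreal (exp (\<psi> a))"
proof -
  interpret c: sigma_finite_measure "count_space (UNIV :: 'g set)"
    by (rule sigma_finite_measure_count_space_countable) simp
  have set: "B \<times> {a} \<in> sets (\<nu> \<Otimes>\<^sub>M count_space UNIV)" using B \<nu> by (intro pair_measureI) auto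
  have meas: "(\<lambda>(z :: real, a :: 'g). ennreal (exp (\<psi> a))) \<in> borel_measurable (\<nu> \<Otimes>\<^sub>M count_space UNIV)"
    by (simp add: case_prod_beta)
  have "emeasure (maharam_measure \<psi> \<nu>) (B \<times> {a}) =
      (\<integral>\<^sup>+z. (case z of (z, a) \<Rightarrow> ennreal (exp (\<psi> a))) * indicator (B \<times> {a}) z \<partial>(\<nu> \<Otimes>\<^sub>M count_space UNIV))"
    unfolding maharam_measure_def by (rule emeasure_density[OF meas set])
  also have "\<dots> = (\<integral>\<^sup>+z. ennreal (exp (\<psi> a)) * indicator (B \<times> {a}) z \<partial>(\<nu> \<Otimes>\<^sub>M count_space UNIV))"
    by (intro nn_integral_cong) (auto simp: indicator_def)
  also have "\<dots> = ennreal (exp (\<psi> a)) * emeasure (\<nu> \<Otimes>\<^sub>M count_space UNIV) (B \<times> {a})"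
    by (rule nn_integral_cmult_indicator[OF set])
  also have "emeasure (\<nu> \<Otimes>\<^sub>M count_space UNIV) (B \<times> {a}) = emeasure \<nu> B"
    using B \<nu> by (subst c.emeasure_pair_measure_Times) auto
  finally show ?thesis by (simp add: mult.commute)
qed

text \<open>The factor \<open>exp (- \<psi> (\<phi> i))\<close> that \<open>\<nu>\<close> gains
  under \<open>T\<close> is cancelled by the ratio of the weights of the fibres
  \<open>a + \<phi> i\<close> and \<open>a\<close>.\<close>

lemma maharam_radon_inv:
  assumes \<psi>: "Modules.additive \<psi>" and \<nu>: "conformal \<psi> \<nu>"
  shows "radon_inv (maharam_measure \<psi> \<nu>)"
proof -
  note C = conformalD[OF \<nu>]
  interpret finite_measure \<nu> using C(2) .
  let ?\<mu> = "maharam_measure \<psi> \<nu>"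
  have S: "sets ?\<mu> = sets PM" using sets_maharam[OF C(1)] .
  have e: "emeasure ?\<mu> (B \<times> {a}) = emeasure \<nu> B * ennreal (exp (\<psi> a))" if "B \<in> sets BK" for B a
    using emeasure_maharam[OF C(1) that] .
  have "emeasure ?\<mu> (K \<times> {a}) < \<infinity>" for a
  proof -
    have "emeasure \<nu> K < top" using emeasure_finite[of K] by (simp add: less_top[symmetric])
    then show ?thesis using e[OF K_sets, of a] by (simp add: ennreal_mult_less_top)
  qed
  moreover have "emeasure ?\<mu> \<Omega> \<noteq> 0"
  proof
    assume "emeasure ?\<mu> \<Omega> = 0"
    then have "emeasure ?\<mu> (K \<times> {0}) = 0"
      using emeasure_mono[of "K \<times> {0}" \<Omega> ?\<mu>] S Omega_sets by auto
    then show False using e[OF K_sets, of 0] C(3) by simp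
  qed
  moreover have "emeasure ?\<mu> (pre X) = emeasure ?\<mu> X" if "X \<in> sets PM" for X
  proof (rule invariant_from_slices[OF S _ that])
    fix i B a assume i: "i \<in> A" and B: "B \<in> sets BK" "B \<subseteq> P i"
    have "ennreal (exp (- \<psi> (\<phi> i))) * ennreal (exp (\<psi> (a + \<phi> i))) = ennreal (exp (\<psi> a))"
      by (simp add: ennreal_mult[symmetric] exp_add[symmetric] additive.add[OF \<psi>])
    then show "emeasure ?\<mu> (T ` B \<times> {a + \<phi> i}) = emeasure ?\<mu> (B \<times> {a})"
      unfolding e[OF T_image_sets[OF B(1)]] e[OF B(1)] C(5)[OF i B]
      by (metis (no_types, lifting) mult.assoc mult.commute)
  qed
  ultimately show ?thesis using S unfolding radon_inv_def by blast
qed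

end

section \<open>Towers\<close>

text \<open>\<open>C k j\<close> is the base of the stage \<open>k\<close> tower with label
  \<open>j\<close>; its height is the length of the word of order \<open>k\<close> over
  \<open>j\<close>, and its levels lie in the pieces named by that word. The same \<open>w\<close>
  refines every stage into the next; this is the self-similarity.\<close>

locale tower_system = piece_system K T A P \<phi>
  for K :: "real set" and T :: "real \<Rightarrow> real" and A :: "nat set" and P :: "nat \<Rightarrow> real set"
    and \<phi> :: "nat \<Rightarrow> 'g::{ab_group_add, countable}" +
  fixes C :: "nat \<Rightarrow> nat \<Rightarrow> real set" and w :: "nat \<Rightarrow> nat list"
  assumes prim: "primitive_substitution A w \<phi>"
    and card_A: "2 \<le> card A"
    and C_0: "j \<in> A \<Longrightarrow> C 0 j = P j"
    and C_compact: "j \<in> A \<Longrightarrow> compact (C k j)"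
    and level_cover: "K = (\<Union>j\<in>A. \<Union>m<length (subst_pow w k j). (T ^^ m) ` C k j)"
    and level_disjoint: "j \<in> A \<Longrightarrow> m < length (subst_pow w k j) \<Longrightarrow> j' \<in> A \<Longrightarrow> m' < length (subst_pow w k j') \<Longrightarrow>
      (j, m) \<noteq> (j', m') \<Longrightarrow> (T ^^ m) ` C k j \<inter> (T ^^ m') ` C k j' = {}"
    and level_letter: "j \<in> A \<Longrightarrow> m < length (subst_pow w k j) \<Longrightarrow> (T ^^ m) ` C k j \<subseteq> P (subst_pow w k j ! m)"
    and base_refine: "i \<in> A \<Longrightarrow> C k i = (\<Union>j\<in>A. \<Union>m\<in>{m. m < length (w j) \<and> w j ! m = i}.
      (T ^^ length (concat (map (subst_pow w k) (take m (w j))))) ` C (Suc k) j)"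
    and mesh: "e > 0 \<Longrightarrow> \<exists>k0. \<forall>k\<ge>k0. \<forall>j\<in>A. \<forall>m<length (subst_pow w k j).
      \<forall>p\<in>(T ^^ m) ` C k j. \<forall>q\<in>(T ^^ m) ` C k j. dist p q < e"
begin

sublocale S: primitive_substitution A w \<phi> by (rule prim)

abbreviation W where "W k j \<equiv> subst_pow w k j"
abbreviation height where "height k j \<equiv> length (W k j)"
abbreviation level where "level k j m \<equiv> (T ^^ m) ` C k j"
abbreviation shift where "shift k j m \<equiv> length (concat (map (W k) (take m (w j))))"

definition psum :: "nat \<Rightarrow> nat \<Rightarrow> 'g" where "psum j m = sum_list (map \<phi> (take m (w j)))"
definition lsum :: "nat \<Rightarrow> nat \<Rightarrow> nat \<Rightarrow> 'g" where "lsum k j m = sum_list (map \<phi> (take m (W k j)))"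
definition occ :: "nat \<Rightarrow> (nat \<times> nat) set" where
  "occ i = {(j, m). j \<in> A \<and> m < length (w j) \<and> w j ! m = i}"
definition positions :: "(nat \<times> nat) set" where "positions = Sigma A (\<lambda>j. {..<length (w j)})"

lemma two: "j \<in> A \<Longrightarrow> 2 \<le> length (w j)"
  using card_A card_length[of "w j"] S.set_word[of j] by simp

lemma height_pos: "j \<in> A \<Longrightarrow> 0 < height k j"
proof (cases "k = 0")
  case False
  assume "j \<in> A"
  then have "set (W k j) \<noteq> {}" using False S.set_pow[of j k] by auto
  then show ?thesis by simp
qed (simp add: subst_pow_0)

lemma C_sub: "j \<in> A \<Longrightarrow> C k j \<subseteq> K"
proof -
  assume j: "j \<in> A"
  have "level k j 0 \<subseteq> (\<Union>j\<in>A. \<Union>m<height k j. level k j m)"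
    using j height_pos[OF j, of k] by blast
  then show ?thesis using level_cover[of k] by simp
qed

lemma T_pow_in: "p \<in> K \<Longrightarrow> (T ^^ m) p \<in> K"
  by (induction m) (auto simp: T_in)

lemma T_pow_inj: "inj_on (T ^^ m) K"
proof (induction m)
  case (Suc m)
  have "inj_on (T \<circ> (T ^^ m)) K"
    using Suc T_pow_in T_inj by (intro comp_inj_on) (auto intro: inj_on_subset)
  then show ?case by (simp only: funpow.simps)
qed simp

lemma T_pow_Suc_image: "(T ^^ Suc m) ` B = T ` (T ^^ m) ` B"
  by (simp add: image_comp)

lemma T_pow_sets: "B \<in> sets BK \<Longrightarrow> (T ^^ m) ` B \<in> sets BK"
proof (induction m)
  case (Suc m)
  then show ?case unfolding T_pow_Suc_image by (intro T_image_sets) auto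
qed simp

lemma T_pow_vimage_sets:
  assumes "B \<in> sets BK"
  shows "{p \<in> K. (T ^^ m) p \<in> B} \<in> sets BK"
proof (induction m)
  case 0
  have "{p \<in> K. p \<in> B} = B" using assms sets_BK by blast
  then show ?case using assms by simp
next
  case (Suc m)
  have "{p \<in> K. (T ^^ Suc m) p \<in> B} = T -` {p \<in> K. (T ^^ m) p \<in> B} \<inter> K"
    using T_in by (auto simp: funpow_swap1)
  then show ?case using T_vimage_sets[OF Suc] by simp
qed

lemma C_sets: "j \<in> A \<Longrightarrow> C k j \<in> sets BK"
  using C_compact C_sub sets_BK compact_imp_closed by fastforce

lemma T_pow_cont: "continuous_on K (T ^^ m)"
proof (induction m)
  case (Suc m)
  have "continuous_on K (T \<circ> (T ^^ m))"
    using Suc T_pow_in by (intro continuous_on_compose continuous_on_subset[OF T_cont]) auto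
  then show ?case by simp
qed (simp add: id_def)

lemma level_compact: "j \<in> A \<Longrightarrow> compact (level k j m)"
  using C_compact C_sub T_pow_cont by (meson compact_continuous_image continuous_on_subset)

lemma level_sets: "j \<in> A \<Longrightarrow> level k j m \<in> sets BK"
  using T_pow_sets C_sets by blast

lemma letter_in: "j \<in> A \<Longrightarrow> m < height k j \<Longrightarrow> W k j ! m \<in> A"
  using S.set_pow_subset[of j k] nth_mem by blast

lemma word_letter_in: "j \<in> A \<Longrightarrow> m < length (w j) \<Longrightarrow> w j ! m \<in> A"
  using S.set_word[of j] nth_mem by blast

lemma lsum_Suc: "m < height k j \<Longrightarrow> lsum k j (Suc m) = lsum k j m + \<phi> (W k j ! m)"
  by (simp add: lsum_def take_Suc_conv_app_nth)

lemma word_split: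
  assumes "m < length (w j)"
  shows "W (Suc k) j = concat (map (W k) (take m (w j))) @ W k (w j ! m) @ concat (map (W k) (drop (Suc m) (w j)))"
proof -
  have "W (Suc k) j = concat (map (W k) (take m (w j) @ w j ! m # drop (Suc m) (w j)))"
    using id_take_nth_drop[OF assms] by simp
  then show ?thesis by simp
qed

lemma shift_less: "j \<in> A \<Longrightarrow> m < length (w j) \<Longrightarrow> shift k j m < height (Suc k) j"
  using word_split[of m j k] height_pos[OF word_letter_in, of j m k] by simp

text \<open>Crossing whole towers of stage \<open>k\<close> adds the values \<open>\<phi>\<close> of
  their labels, whatever \<open>k\<close> is; so the fibre shift of a part of a base depends only on
  its position in \<open>w j\<close>.\<close>

lemma lsum_shift: "j \<in> A \<Longrightarrow> m < length (w j) \<Longrightarrow> lsum (Suc k) j (shift k j m) = psum j m"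
proof -
  assume j: "j \<in> A" "m < length (w j)"
  have "lsum (Suc k) j (shift k j m) = sum_list (map \<phi> (concat (map (W k) (take m (w j)))))"
    unfolding lsum_def word_split[OF j(2)] by simp
  also have "\<dots> = psum j m"
    unfolding psum_def using S.sum_pow S.set_word[OF j(1)] set_take_subset[of m "w j"]
    by (intro sum_list_concat_map) blast
  finally show ?thesis .
qed

lemma shift_mono:
  assumes "j \<in> A" "m < m'" "m' \<le> length (w j)"
  shows "shift k j m < shift k j m'"
proof -
  have m: "m < length (w j)" using assms by simp
  have "shift k j m < shift k j (Suc m)"
    using m height_pos[OF word_letter_in[OF assms(1) m], of k] by (simp add: take_Suc_conv_app_nth)
  also have "take m' (w j) = take (Suc m) (w j) @ drop (Suc m) (take m' (w j))"
    using assms(2) append_take_drop_id[of "Suc m" "take m' (w j)"] by (simp add: min_def)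
  then have "shift k j (Suc m) \<le> shift k j m'" by (metis concat_append length_append le_add1 map_append)
  finally show ?thesis .
qed

lemma finite_positions: "finite positions" and occ_sub: "i \<in> A \<Longrightarrow> occ i \<subseteq> positions"
  and finite_occ: "finite (occ i)"
proof -
  show f: "finite positions" unfolding positions_def using finite_A by auto
  show "occ i \<subseteq> positions" if "i \<in> A" unfolding occ_def positions_def by auto
  show "finite (occ i)" by (rule finite_subset[OF _ f]) (auto simp: occ_def positions_def)
qed

lemma refine: "i \<in> A \<Longrightarrow> C k i = (\<Union>(j, m)\<in>occ i. level (Suc k) j (shift k j m))"
  unfolding occ_def by (subst base_refine) auto

lemma refine_disjoint:
  assumes "i \<in> A"
  shows "disjoint_family_on (\<lambda>(j, m). level (Suc k) j (shift k j m)) (occ i)"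
proof -
  have "level (Suc k) j (shift k j m) \<inter> level (Suc k) j' (shift k j' m') = {}"
    if o: "(j, m) \<in> occ i" "(j', m') \<in> occ i" "(j, m) \<noteq> (j', m')" for j m j' m'
  proof (rule level_disjoint)
    show "j \<in> A" "j' \<in> A" using o by (auto simp: occ_def)
    show "shift k j m < height (Suc k) j" "shift k j' m' < height (Suc k) j'"
      using o shift_less by (auto simp: occ_def)
    show "(j, shift k j m) \<noteq> (j', shift k j' m')"
    proof
      assume eq: "(j, shift k j m) = (j', shift k j' m')"
      then have "m \<noteq> m'" using o by auto
      then show False using eq shift_mono[of j m m' k] shift_mono[of j m' m k] o
        by (cases "m < m'") (auto simp: occ_def)
    qed
  qed
  then show ?thesis unfolding disjoint_family_on_def by blast
qed

lemma level_part: "(j, m) \<in> occ i \<Longrightarrow> i \<in> A \<Longrightarrow> level (Suc k) j (shift k j m) \<subseteq> C k i"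
  by (subst refine[of i k]) auto

lemma occ_exists: "i \<in> A \<Longrightarrow> j \<in> A \<Longrightarrow> \<exists>m. (j, m) \<in> occ i"
  using S.set_word[of j] unfolding occ_def by (auto simp: in_set_conv_nth)

lemma occD: "(j, m) \<in> occ i \<Longrightarrow> j \<in> A \<and> m < length (w j) \<and> w j ! m = i"
  by (simp add: occ_def)

subsection \<open>Density\<close>

text \<open>Takes the place of a density theorem. A compact \<open>Q\<close> inside \<open>B\<close>
  and an open \<open>V\<close> around it with little mass outside \<open>Q\<close> are chosen; once
  the mesh is below the distance from \<open>Q\<close> to the complement of \<open>V\<close>, all
  levels meeting \<open>Q\<close> lie in \<open>V\<close>. If each of them had at least the
  proportion \<open>e\<close> of its mass outside \<open>B\<close>, then \<open>V - Q\<close> would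
  carry at least \<open>e\<close> times the mass of \<open>Q\<close>. The stage is arbitrary from
  \<open>k0\<close> on, so that two sets can be treated at a common stage.\<close>

lemma density_level:
  assumes \<eta>: "finite_measure \<eta>" "sets \<eta> = sets BK" and B: "B \<in> sets BK" "measure \<eta> B > 0" and e: "e > 0"
  shows "\<exists>k0. \<forall>k\<ge>k0. \<exists>j\<in>A. \<exists>m<height k j. measure \<eta> (level k j m - B) < e * measure \<eta> (level k j m)"
proof -
  interpret \<eta>: finite_measure \<eta> by fact
  \<comment> \<open>\<open>\<eta>\<close> is carried to the whole real line, where inner and outer
    regularity apply.\<close>
  define N where "N = distr \<eta> borel (\<lambda>p. p)"
  have space: "space \<eta> = K" using sets_eq_imp_space_eq[OF \<eta>(2)] by (simp add: space_restrict_space)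
  have id: "(\<lambda>p. p) \<in> measurable \<eta> borel"
    using measurable_restrict_space1[OF measurable_ident, of borel K] \<eta>(2)
    by (simp add: measurable_cong_sets[OF \<eta>(2) refl] id_def)
  have N: "emeasure N X = emeasure \<eta> (X \<inter> K)" if "X \<in> sets borel" for X
    unfolding N_def using emeasure_distr[OF id, of X] that space by simp
  have sN: "sets N = sets borel" by (simp add: N_def)
  interpret N: finite_measure N
    unfolding N_def by (rule \<eta>.finite_measure_distr[OF id])
  have Bb: "B \<in> sets borel" "B \<subseteq> K" using B(1) sets_BK by auto
  have "emeasure N B > 0" using N[OF Bb(1)] Bb(2) B(2) by (simp add: Int_absorb2 \<eta>.emeasure_eq_measure)
  then have "0 < (SUP S \<in> {S. S \<subseteq> B \<and> compact S}. emeasure N S)"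
    using inner_regular[OF sN _ Bb(1)] N.emeasure_finite by simp
  then obtain Q where Q: "Q \<subseteq> B" "compact Q" "emeasure N Q > 0" unfolding less_SUP_iff by blast
  have Qb: "Q \<in> sets borel" "Q \<subseteq> K" using Q(1) Bb(2) borel_compact[OF Q(2)] by auto
  have mQ: "measure \<eta> Q > 0" using Q(3) N[OF Qb(1)] Qb(2)
    by (simp add: Int_absorb2 \<eta>.emeasure_eq_measure)
  have "emeasure N Q < ennreal ((1 + e) * measure \<eta> Q)"
    using N[OF Qb(1)] Qb(2) mQ e by (simp add: Int_absorb2 \<eta>.emeasure_eq_measure ennreal_less_iff)
  then have "(INF U \<in> {U. Q \<subseteq> U \<and> open U}. emeasure N U) < ennreal ((1 + e) * measure \<eta> Q)"
    using outer_regular[OF sN _ Qb(1)] N.emeasure_finite by simp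
  then obtain V where V: "Q \<subseteq> V" "open V" "emeasure N V < ennreal ((1 + e) * measure \<eta> Q)"
    unfolding INF_less_iff by blast
  have Vb: "V \<in> sets borel" "V \<inter> K \<in> sets \<eta>" using V(2) \<eta>(2) sets_BK closed_K by auto
  have mV: "measure \<eta> (V \<inter> K) < (1 + e) * measure \<eta> Q"
    using V(3) N[OF Vb(1)] by (simp add: \<eta>.emeasure_eq_measure ennreal_less_iff)
  have Q\<eta>: "Q \<in> sets \<eta>" using Qb \<eta>(2) sets_BK by auto
  have diff: "measure \<eta> (V \<inter> K - Q) < e * measure \<eta> Q"
    using \<eta>.finite_measure_Diff[OF Vb(2) Q\<eta>] V(1) Qb(2) mV by (simp add: algebra_simps)
  obtain \<delta> where \<delta>: "\<delta> > 0" "\<And>p q. p \<in> Q \<Longrightarrow> dist p q < \<delta> \<Longrightarrow> q \<in> V"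
  proof (cases "- V = {}")
    case True
    then show ?thesis using that[of 1] by auto
  next
    case False
    obtain \<delta> where "\<delta> > 0" "\<forall>p\<in>Q. \<forall>q\<in>- V. \<delta> \<le> dist p q"
      using separate_compact_closed[OF Q(2), of "- V"] V by (auto simp: closed_Compl)
    then show ?thesis by (intro that[of \<delta>]) force+
  qed
  obtain k0 where k0: "\<And>k j m p q. k \<ge> k0 \<Longrightarrow> j \<in> A \<Longrightarrow> m < height k j \<Longrightarrow> p \<in> level k j m \<Longrightarrow>
      q \<in> level k j m \<Longrightarrow> dist p q < \<delta>"
    using mesh[OF \<delta>(1)] by blast
  have "\<exists>j\<in>A. \<exists>m<height k j. measure \<eta> (level k j m - B) < e * measure \<eta> (level k j m)" if k: "k \<ge> k0" for k
  proof (rule ccontr)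
    assume "\<not> ?thesis"
    then have no: "e * measure \<eta> (level k j m) \<le> measure \<eta> (level k j m - B)" if "j \<in> A" "m < height k j" for j m
      using that by (meson not_le)
    define I where "I = {(j, m). j \<in> A \<and> m < height k j \<and> level k j m \<inter> Q \<noteq> {}}"
    have finI: "finite I"
      by (rule finite_subset[of _ "Sigma A (\<lambda>j. {..<height k j})"]) (use finite_A in \<open>auto simp: I_def\<close>)
    let ?L = "\<lambda>(j, m). level k j m"
    have dis: "disjoint_family_on ?L I"
      unfolding disjoint_family_on_def I_def using level_disjoint[of _ _ k] by blast
    have Lsets: "?L i \<in> sets \<eta>" if "i \<in> I" for i using that level_sets \<eta>(2) by (auto simp: I_def)
    have Q_sub: "Q \<subseteq> (\<Union>i\<in>I. ?L i)"
    proof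
      fix p assume p: "p \<in> Q"
      then have "p \<in> K" using Qb by blast
      then obtain j m where "j \<in> A" "m < height k j" "p \<in> level k j m" using level_cover[of k] by blast
      then show "p \<in> (\<Union>i\<in>I. ?L i)" using p by (intro UN_I[of "(j, m)"]) (auto simp: I_def)
    qed
    have L_V: "?L i \<subseteq> V \<inter> K" if i: "i \<in> I" for i
    proof
      obtain j m where jm: "i = (j, m)" by (cases i)
      then obtain p where p: "j \<in> A" "m < height k j" "p \<in> Q" "p \<in> level k j m" using i by (auto simp: I_def)
      fix q assume q: "q \<in> ?L i"
      then have "dist p q < \<delta>" using k0[OF k p(1,2,4)] jm by simp
      then have "q \<in> V" using \<delta>(2) p(3) by blast
      moreover have "level k j m \<subseteq> K" using level_sets[OF p(1)] by (simp only: sets_BK)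
      then have "q \<in> K" using q jm by auto
      ultimately show "q \<in> V \<inter> K" by simp
    qed
    have "e * measure \<eta> Q \<le> e * measure \<eta> (\<Union>i\<in>I. ?L i)"
      using e finI Lsets by (intro mult_left_mono \<eta>.finite_measure_mono Q_sub) auto
    also have "measure \<eta> (\<Union>i\<in>I. ?L i) = (\<Sum>i\<in>I. measure \<eta> (?L i))"
      using finI Lsets dis by (intro \<eta>.finite_measure_finite_Union) auto
    also have "e * \<dots> = (\<Sum>i\<in>I. e * measure \<eta> (?L i))" by (rule sum_distrib_left)
    also have "\<dots> \<le> (\<Sum>i\<in>I. measure \<eta> (?L i - Q))"
    proof (rule sum_mono)
      fix i assume i: "i \<in> I"
      then have "e * measure \<eta> (?L i) \<le> measure \<eta> (?L i - B)" using no by (auto simp: I_def)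
      also have "\<dots> \<le> measure \<eta> (?L i - Q)" using Q(1) Lsets[OF i] Q\<eta> by (intro \<eta>.finite_measure_mono) auto
      finally show "e * measure \<eta> (?L i) \<le> measure \<eta> (?L i - Q)" .
    qed
    also have "\<dots> = measure \<eta> (\<Union>i\<in>I. ?L i - Q)"
    proof (rule \<eta>.finite_measure_finite_Union[symmetric, OF finI])
      show "disjoint_family_on (\<lambda>i. ?L i - Q) I"
        using dis unfolding disjoint_family_on_def by blast
    qed (use Lsets Q\<eta> in auto)
    also have "\<dots> \<le> measure \<eta> (V \<inter> K - Q)"
    proof (rule \<eta>.finite_measure_mono)
      show "(\<Union>i\<in>I. ?L i - Q) \<subseteq> V \<inter> K - Q" using L_V by blast
    qed (use Vb(2) Q\<eta> in auto)
    finally show False using diff by simp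
  qed
  then show ?thesis by blast
qed

subsection \<open>Invariant measures are quasi-invariant under translations\<close>

text \<open>Each step up the tower is one application of the skew product on a single piece, so the
  fibre moves by the prefix sum.\<close>

lemma mass_level:
  assumes \<mu>: "radon_inv \<mu>" and j: "j \<in> A" and B: "B \<in> sets BK" "B \<subseteq> C k j" and m: "m < height k j"
  shows "emeasure \<mu> ((T ^^ m) ` B \<times> {a + lsum k j m}) = emeasure \<mu> (B \<times> {a})"
  using m
proof (induction m)
  case 0
  then show ?case by (simp add: lsum_def)
next
  case (Suc m)
  then have m: "m < height k j" by simp
  have "(T ^^ m) ` B \<subseteq> P (W k j ! m)" using level_letter[OF j m] B(2) by blast
  then have step: "emeasure \<mu> (T ` (T ^^ m) ` B \<times> {a + lsum k j m + \<phi> (W k j ! m)}) =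
      emeasure \<mu> ((T ^^ m) ` B \<times> {a + lsum k j m})"
    by (intro radon_inv_slice[OF \<mu> letter_in[OF j m] T_pow_sets[OF B(1)]])
  show ?case
    unfolding T_pow_Suc_image lsum_Suc[OF m] add.assoc[symmetric] step by (rule Suc.IH[OF m])
qed

text \<open>The parts of the base are levels of the next towers; each is pushed down to the base of
  its own tower, which lowers the fibre by the prefix sum.\<close>

lemma mass_refine:
  assumes \<mu>: "radon_inv \<mu>" and i: "i \<in> A"
  shows "measure \<mu> (C k i \<times> {a}) = (\<Sum>(j, m)\<in>occ i. measure \<mu> (C (Suc k) j \<times> {a - psum j m}))"
proof -
  note S = radon_invD(1)[OF \<mu>]
  let ?L = "\<lambda>(j, m). level (Suc k) j (shift k j m) \<times> {a}"
  have "C k i \<times> {a} = (\<Union>z\<in>occ i. ?L z)" unfolding refine[OF i] by auto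
  moreover have "measure \<mu> (\<Union>z\<in>occ i. ?L z) = (\<Sum>z\<in>occ i. measure \<mu> (?L z))"
  proof (rule measure_finite_Union[OF finite_occ])
    show "?L ` occ i \<subseteq> sets \<mu>" using S Times_PM level_sets occD by auto
    show "disjoint_family_on ?L (occ i)"
      unfolding disjoint_family_on_def
    proof (intro ballI impI)
      fix z z' assume "z \<in> occ i" "z' \<in> occ i" "z \<noteq> z'"
      then have "(\<lambda>(j, m). level (Suc k) j (shift k j m)) z \<inter> (\<lambda>(j, m). level (Suc k) j (shift k j m)) z' = {}"
        using refine_disjoint[OF i, of k] unfolding disjoint_family_on_def by blast
      moreover have "?L y = (\<lambda>(j, m). level (Suc k) j (shift k j m)) y \<times> {a}" for y by (cases y) simp
      ultimately show "?L z \<inter> ?L z' = {}" by (simp only: Sigma_Int_distrib1[symmetric] Sigma_empty1)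
    qed
    show "emeasure \<mu> (?L z) \<noteq> \<infinity>" if z: "z \<in> occ i" for z
    proof -
      obtain j m where jm: "z = (j, m)" by (cases z)
      then have "j \<in> A" using z by (simp add: occ_def)
      then have "level (Suc k) j (shift k j m) \<subseteq> K" using level_sets[of j "shift k j m" "Suc k"] by (simp only: sets_BK)
      from slice_finite[OF \<mu> this, of a] show ?thesis using jm by (simp add: less_top)
    qed
  qed
  moreover have "measure \<mu> (?L (j, m)) = measure \<mu> (C (Suc k) j \<times> {a - psum j m})" if jm: "(j, m) \<in> occ i" for j m
  proof -
    have j: "j \<in> A" "m < length (w j)" using occD[OF jm] by auto
    have "emeasure \<mu> (level (Suc k) j (shift k j m) \<times> {a - psum j m + psum j m}) = emeasure \<mu> (C (Suc k) j \<times> {a - psum j m})"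
      using mass_level[OF \<mu> j(1) C_sets[OF j(1)] order_refl shift_less[OF j, of k], where a="a - psum j m"] lsum_shift[OF j]
      by simp
    then show ?thesis by (simp add: measure_def)
  qed
  ultimately show ?thesis by (simp add: case_prod_beta cong: sum.cong)
qed

end

section \<open>Translates of invariant measures along the fibres\<close>

context piece_system
begin

text \<open>The sign is chosen so that the translate gives \<open>B \<times> {a}\<close> the mass
  that \<open>\<mu>\<close> gives \<open>B \<times> {a + h}\<close>.\<close>

definition translate :: "'g \<Rightarrow> (real \<times> 'g) measure \<Rightarrow> (real \<times> 'g) measure" where
  "translate h \<mu> = distr \<mu> PM (\<lambda>(p, a). (p, a - h))"

lemma translate_measurable: "(\<lambda>(p, a). (p, a - h)) \<in> measurable PM PM"
proof (rule measurableI)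
  show "(case z of (p, a) \<Rightarrow> (p, a - h)) \<in> space PM" if "z \<in> space PM" for z
    using that by (auto simp: space_PM)
  fix X assume X: "X \<in> sets PM"
  have "sec ((\<lambda>(p, a). (p, a - h)) -` X \<inter> space PM) b = sec X (b - h)" for b
    using PM_sub[OF X] by (auto simp: sec_def space_PM)
  then show "(\<lambda>(p, a). (p, a - h)) -` X \<inter> space PM \<in> sets PM"
    unfolding PM_iff[of "_ \<inter> _"] using sec_sets[OF X] by (auto simp: space_PM)
qed

lemma emeasure_translate:
  assumes "sets \<mu> = sets PM" "X \<in> sets PM"
  shows "emeasure (translate h \<mu>) X = emeasure \<mu> ((\<lambda>(p, a). (p, a - h)) -` X \<inter> \<Omega>)"
  unfolding translate_def using translate_measurable assms sets_eq_imp_space_eq[OF assms(1)]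
  by (subst emeasure_distr) (auto simp: measurable_cong_sets[OF assms(1) refl] space_PM)

lemma emeasure_translate_slice:
  assumes "sets \<mu> = sets PM" "B \<in> sets BK"
  shows "emeasure (translate h \<mu>) (B \<times> {a}) = emeasure \<mu> (B \<times> {a + h})"
proof -
  have "(\<lambda>(p, a). (p, a - h)) -` (B \<times> {a}) \<inter> \<Omega> = B \<times> {a + h}"
    using assms(2) sets_BK by (auto simp: algebra_simps)
  then show ?thesis using emeasure_translate[OF assms(1) Times_PM[OF assms(2)]] by simp
qed

lemma translate_radon_inv:
  assumes \<mu>: "radon_inv \<mu>"
  shows "radon_inv (translate h \<mu>)"
proof -
  note S = radon_invD(1)[OF \<mu>]
  have S': "sets (translate h \<mu>) = sets PM" by (simp add: translate_def)
  have "emeasure (translate h \<mu>) (K \<times> {a}) < \<infinity>" for a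
    using emeasure_translate_slice[OF S K_sets] radon_invD(2)[OF \<mu>] by simp
  moreover have "(\<lambda>(p, a). (p, a - h)) -` \<Omega> \<inter> \<Omega> = \<Omega>" by auto
  then have "emeasure (translate h \<mu>) \<Omega> \<noteq> 0"
    using emeasure_translate[OF S Omega_sets] radon_invD(3)[OF \<mu>] by simp
  moreover have "emeasure (translate h \<mu>) (pre X) = emeasure (translate h \<mu>) X" if "X \<in> sets PM" for X
  proof (rule invariant_from_slices[OF S' _ that])
    fix i B a assume i: "i \<in> A" and B: "B \<in> sets BK" "B \<subseteq> P i"
    show "emeasure (translate h \<mu>) (T ` B \<times> {a + \<phi> i}) = emeasure (translate h \<mu>) (B \<times> {a})"
      using radon_inv_slice[OF \<mu> i B, of "a + h"]
      by (simp add: emeasure_translate_slice[OF S] T_image_sets B ac_simps)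
  qed
  ultimately show ?thesis using S' unfolding radon_inv_def by blast
qed

lemma translate_ergodic:
  assumes \<mu>: "radon_inv \<mu>" "ergodic \<mu>"
  shows "ergodic (translate h \<mu>)"
  unfolding ergodic_def
proof (intro allI impI)
  fix E assume E: "inv_set E"
  note S = radon_invD(1)[OF \<mu>(1)]
  have Es: "E \<in> sets PM" using E inv_set_def by blast
  let ?t = "\<lambda>(p, a). (p, a - h)"
  define E' where "E' = ?t -` E \<inter> \<Omega>"
  have "E' \<in> sets PM"
    unfolding E'_def using measurable_sets[OF translate_measurable Es] by (simp add: space_PM)
  moreover have "pre E' = E'"
  proof -
    have "z \<in> pre E' \<longleftrightarrow> z \<in> E'" for z
    proof (cases z)
      case (Pair p a)
      show ?thesis
        using inv_set_iff[OF E, of p "a - h"] T_in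
        by (auto simp: Pair pre_def E'_def skew_apply algebra_simps)
    qed
    then show ?thesis by blast
  qed
  ultimately have "inv_set E'" unfolding inv_set_def by blast
  then have "emeasure \<mu> E' = 0 \<or> emeasure \<mu> (\<Omega> - E') = 0" using \<mu>(2) ergodic_def by blast
  moreover have "emeasure (translate h \<mu>) E = emeasure \<mu> E'"
    unfolding E'_def by (rule emeasure_translate[OF S Es])
  moreover have "?t -` (\<Omega> - E) \<inter> \<Omega> = \<Omega> - E'" unfolding E'_def by auto
  then have "emeasure (translate h \<mu>) (\<Omega> - E) = emeasure \<mu> (\<Omega> - E')"
    using emeasure_translate[OF S, of "\<Omega> - E" h] Es Omega_sets by auto
  ultimately show "emeasure (translate h \<mu>) E = 0 \<or> emeasure (translate h \<mu>) (\<Omega> - E) = 0" by simp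
qed

definition periods :: "(real \<times> 'g) measure \<Rightarrow> 'g set" where
  "periods \<mu> = {h. \<exists>c>0. \<forall>a. \<forall>B\<in>sets BK. emeasure \<mu> (B \<times> {a + h}) = ennreal c * emeasure \<mu> (B \<times> {a})}"

text \<open>Applied in contraposition: two elements whose difference is no period cannot both be
  periods.\<close>

lemma periods_diff:
  assumes "g \<in> periods \<mu>" "h \<in> periods \<mu>"
  shows "g - h \<in> periods \<mu>"
proof -
  obtain c c' where c: "c > 0" "\<And>a B. B \<in> sets BK \<Longrightarrow> emeasure \<mu> (B \<times> {a + g}) = ennreal c * emeasure \<mu> (B \<times> {a})"
    and c': "c' > 0" "\<And>a B. B \<in> sets BK \<Longrightarrow> emeasure \<mu> (B \<times> {a + h}) = ennreal c' * emeasure \<mu> (B \<times> {a})"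
    using assms unfolding periods_def by blast
  have "emeasure \<mu> (B \<times> {a + (g - h)}) = ennreal (c / c') * emeasure \<mu> (B \<times> {a})" if B: "B \<in> sets BK" for B a
  proof -
    have "emeasure \<mu> (B \<times> {a + (g - h)}) = ennreal c * emeasure \<mu> (B \<times> {a - h})"
      using c(2)[OF B, of "a - h"] by (simp add: algebra_simps)
    moreover have "emeasure \<mu> (B \<times> {a}) = ennreal c' * emeasure \<mu> (B \<times> {a - h})"
      using c'(2)[OF B, of "a - h"] by simp
    moreover have "ennreal (c / c') * ennreal c' = ennreal c" using c(1) c'(1) by (simp add: ennreal_mult[symmetric])
    ultimately show ?thesis by (metis mult.assoc)
  qed
  then show ?thesis unfolding periods_def using c(1) c'(1) by (intro CollectI exI[of _ "c / c'"]) auto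
qed

text \<open>Fibrewise form of the singular alternative in \<open>ergodic_dichotomy\<close>: the set
  \<open>E\<close> carries all of \<open>\<mu>\<close>, and moved up by \<open>h\<close> it becomes
  null.\<close>

lemma singular_translate:
  assumes \<mu>: "radon_inv \<mu>" "ergodic \<mu>" and h: "h \<notin> periods \<mu>"
  shows "\<exists>E\<in>sets PM. emeasure \<mu> (\<Omega> - E) = 0 \<and> (\<forall>a. emeasure \<mu> (sec E a \<times> {a + h}) = 0)"
proof -
  note S = radon_invD(1)[OF \<mu>(1)]
  have "\<not> (\<exists>c>0. \<forall>a. \<forall>B\<in>sets BK. emeasure (translate h \<mu>) (B \<times> {a}) = ennreal c * emeasure \<mu> (B \<times> {a}))"
    using h emeasure_translate_slice[OF S, of _ h] unfolding periods_def by auto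
  then obtain E where E: "inv_set E" "emeasure \<mu> (\<Omega> - E) = 0" "emeasure (translate h \<mu>) E = 0"
    using ergodic_dichotomy[OF \<mu> translate_radon_inv[OF \<mu>(1)] translate_ergodic[OF \<mu>], of h] by blast
  have Es: "E \<in> sets PM" using E(1) inv_set_def by blast
  have "emeasure \<mu> (sec E a \<times> {a + h}) = 0" for a
  proof -
    have "emeasure (translate h \<mu>) (sec E a \<times> {a}) \<le> emeasure (translate h \<mu>) E"
      using Es by (intro emeasure_mono) (auto simp: sec_def translate_def)
    then show ?thesis using E(3) emeasure_translate_slice[OF S sec_sets[OF Es]] by simp
  qed
  then show ?thesis using E(2) Es by blast
qed

text \<open>Lets \<open>density_level\<close>, which speaks of one finite measure on
  \<open>K\<close>, control several fibres at the same time.\<close>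

lemma slice_sum_measure:
  assumes \<mu>: "radon_inv \<mu>" and H: "finite H"
  shows "\<exists>\<eta>. finite_measure \<eta> \<and> sets \<eta> = sets BK \<and>
    (\<forall>B\<in>sets BK. measure \<eta> B = (\<Sum>b\<in>H. measure \<mu> (B \<times> {b})))"
proof -
  note S = radon_invD(1)[OF \<mu>]
  have space: "space \<mu> = \<Omega>" using sets_eq_imp_space_eq[OF S] by (simp add: space_PM)
  define D where "D = restrict_space \<mu> (K \<times> H)"
  have KH: "B \<times> H \<in> sets \<mu>" if "B \<in> sets BK" for B
    unfolding S PM_def using that by (intro pair_measureI) auto
  have fst: "fst \<in> measurable D BK"
    unfolding D_def using S by (intro measurable_restrict_space1) (simp add: measurable_cong_sets[OF S refl] PM_def)
  define \<eta> where "\<eta> = distr D BK fst"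
  have fin: "emeasure \<mu> (B \<times> {b}) \<noteq> \<infinity>" if "B \<in> sets BK" for B b
    using slice_finite[OF \<mu>, of B b] that sets_BK by auto
  have sum: "emeasure \<mu> (B \<times> H) = (\<Sum>b\<in>H. emeasure \<mu> (B \<times> {b}))" if B: "B \<in> sets BK" for B
  proof -
    have eq: "B \<times> H = (\<Union>b\<in>H. B \<times> {b})" by auto
    show ?thesis
      unfolding eq using Times_PM[OF B] S H
      by (intro sum_emeasure[symmetric]) (auto simp: disjoint_family_on_def)
  qed
  have e: "emeasure \<eta> B = (\<Sum>b\<in>H. emeasure \<mu> (B \<times> {b}))" if B: "B \<in> sets BK" for B
  proof -
    have BK: "B \<subseteq> K" using B sets_BK by blast
    have "emeasure \<eta> B = emeasure D (fst -` B \<inter> space D)"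
      unfolding \<eta>_def by (rule emeasure_distr[OF fst B])
    also have "fst -` B \<inter> space D = B \<times> H" using BK by (auto simp: D_def space_restrict_space space)
    also have "emeasure D (B \<times> H) = emeasure \<mu> (B \<times> H)"
    proof -
      have "K \<times> H \<inter> space \<mu> = K \<times> H" unfolding space by blast
      then show ?thesis unfolding D_def using KH[OF K_sets] BK by (intro emeasure_restrict_space) auto
    qed
    finally show ?thesis using sum[OF B] by simp
  qed
  have s: "sets \<eta> = sets BK" by (simp add: \<eta>_def)
  have m: "measure \<eta> B = (\<Sum>b\<in>H. measure \<mu> (B \<times> {b}))" if B: "B \<in> sets BK" for B
  proof -
    have "emeasure \<eta> B = (\<Sum>b\<in>H. ennreal (measure \<mu> (B \<times> {b})))"
      unfolding e[OF B] using fin[OF B] by (intro sum.cong refl emeasure_eq_ennreal_measure) auto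
    also have "\<dots> = ennreal (\<Sum>b\<in>H. measure \<mu> (B \<times> {b}))" by (rule sum_ennreal) simp
    finally show ?thesis by (simp add: measure_def sum_nonneg)
  qed
  have "finite_measure \<eta>"
  proof (rule finite_measureI)
    have "space \<eta> = K" by (simp add: \<eta>_def space_restrict_space)
    then show "emeasure \<eta> (space \<eta>) \<noteq> \<infinity>" using e[OF K_sets] fin[OF K_sets] H by simp
  qed
  then show ?thesis using s m by blast
qed

end

context tower_system
begin

text \<open>If the translate by \<open>g\<close> were singular, some level would have, up to a small proportion, no
  mass in any of finitely many translates; but each of its parts at the next stage also lies
  in one of these translates.\<close>

lemma period_of_words:
  assumes words: "\<And>i j. i \<in> A \<Longrightarrow> j \<in> A \<Longrightarrow> \<exists>m m'. (j, m) \<in> occ i \<and> (j, m') \<in> occ i \<and> psum j m' - psum j m = g"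
    and \<mu>: "radon_inv \<mu>" "ergodic \<mu>"
  shows "g \<in> periods \<mu>"
proof (rule ccontr)
  assume g: "g \<notin> periods \<mu>"
  note S = radon_invD(1)[OF \<mu>(1)]
  \<comment> \<open>All differences between two occurrences of one letter in one word that are not
    periods; finitely many, since the words are finite.\<close>
  define \<Theta> where "\<Theta> = {h. \<exists>i\<in>A. \<exists>j m m'. (j, m) \<in> occ i \<and> (j, m') \<in> occ i \<and> h = psum j m' - psum j m} - periods \<mu>"
  have "\<Theta> \<subseteq> (\<lambda>((j, m), (j', m')). psum j' m' - psum j m) ` (positions \<times> positions)"
    unfolding \<Theta>_def using occ_sub by (force simp: image_iff)
  then have fin: "finite \<Theta>" using finite_positions by (meson finite_SigmaI finite_imageI finite_subset)
  have "\<exists>E. \<forall>h\<in>\<Theta>. E h \<in> sets PM \<and> emeasure \<mu> (\<Omega> - E h) = 0 \<and> (\<forall>a. emeasure \<mu> (sec (E h) a \<times> {a + h}) = 0)"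
    using singular_translate[OF \<mu>] unfolding \<Theta>_def by (intro bchoice) blast
  then obtain E where E: "\<And>h. h \<in> \<Theta> \<Longrightarrow> E h \<in> sets PM" "\<And>h. h \<in> \<Theta> \<Longrightarrow> emeasure \<mu> (\<Omega> - E h) = 0"
    "\<And>h a. h \<in> \<Theta> \<Longrightarrow> emeasure \<mu> (sec (E h) a \<times> {a + h}) = 0" by blast
  obtain a where a: "emeasure \<mu> (K \<times> {a}) \<noteq> 0" using positive_slice[OF \<mu>(1)] by blast
  \<comment> \<open>Over \<open>B\<close> the fibre \<open>a\<close> keeps the full mass of
    \<open>K \<times> {a}\<close>, while every fibre \<open>a + h\<close> with
    \<open>h \<in> \<Theta>\<close> is null there.\<close>
  define B where "B = K - (\<Union>h\<in>\<Theta>. K - sec (E h) a)"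
  have B: "B \<in> sets BK"
    unfolding B_def using K_sets sec_sets[OF E(1)] fin by (intro sets.Diff sets.finite_UN) auto
  have small: "measure \<mu> ((Q \<inter> B) \<times> {a + h}) = 0" if h: "h \<in> \<Theta>" for h Q
  proof -
    have "(Q \<inter> B) \<times> {a + h} \<subseteq> sec (E h) a \<times> {a + h}" using h unfolding B_def by auto
    then have "emeasure \<mu> ((Q \<inter> B) \<times> {a + h}) \<le> emeasure \<mu> (sec (E h) a \<times> {a + h})"
      using Times_PM[OF sec_sets[OF E(1)[OF h]]] S by (intro emeasure_mono) auto
    then show ?thesis using E(3)[OF h] by (simp add: measure_def)
  qed
  have H0: "0 \<in> periods \<mu>" unfolding periods_def by (intro CollectI exI[of _ 1]) auto
  define H where "H = (\<lambda>h. a + h) ` insert 0 \<Theta>"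
  obtain \<eta> where \<eta>: "finite_measure \<eta>" "sets \<eta> = sets BK" and
    \<eta>H: "\<And>B. B \<in> sets BK \<Longrightarrow> measure \<eta> B = (\<Sum>b\<in>H. measure \<mu> (B \<times> {b}))"
    using slice_sum_measure[OF \<mu>(1), of H] fin unfolding H_def by blast
  have \<eta>_eq: "measure \<eta> X = measure \<mu> (X \<times> {a}) + (\<Sum>h\<in>\<Theta>. measure \<mu> (X \<times> {a + h}))" if "X \<in> sets BK" for X
  proof -
    have "0 \<notin> \<Theta>" using H0 \<Theta>_def by blast
    then show ?thesis unfolding \<eta>H[OF that] H_def using fin by (subst sum.reindex) (auto simp: inj_on_def)
  qed
  have fin_e: "emeasure \<mu> (X \<times> {b}) = ennreal (measure \<mu> (X \<times> {b}))" if "X \<subseteq> K" for X b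
    using slice_finite[OF \<mu>(1) that, of b] by (intro emeasure_eq_ennreal_measure) auto
  have "measure \<eta> B > 0"
  proof -
    have "emeasure \<mu> ((K - B) \<times> {a}) = 0"
    proof -
      have eq: "(K - B) \<times> {a} = (\<Union>h\<in>\<Theta>. (K - sec (E h) a) \<times> {a})" unfolding B_def by auto
      have "(K - sec (E h) a) \<times> {a} \<in> null_sets \<mu>" if h: "h \<in> \<Theta>" for h
      proof -
        have "(K - sec (E h) a) \<times> {a} \<in> sets \<mu>"
          using S Times_PM[OF sets.Diff[OF K_sets sec_sets[OF E(1)[OF h]]]] by simp
        moreover have "(K - sec (E h) a) \<times> {a} \<subseteq> \<Omega> - E h" by (auto simp: sec_def)
        then have "emeasure \<mu> ((K - sec (E h) a) \<times> {a}) \<le> emeasure \<mu> (\<Omega> - E h)"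
          using E(1)[OF h] Omega_sets S by (intro emeasure_mono) auto
        ultimately show ?thesis using E(2)[OF h] by (auto simp: null_sets_def)
      qed
      then have "(\<Union>h\<in>\<Theta>. (K - sec (E h) a) \<times> {a}) \<in> null_sets \<mu>" using fin by (intro null_sets.finite_UN) auto
      then show ?thesis unfolding eq by (simp add: null_sets_def)
    qed
    moreover have "emeasure \<mu> (K \<times> {a}) = emeasure \<mu> (B \<times> {a}) + emeasure \<mu> ((K - B) \<times> {a})"
    proof -
      have "B \<subseteq> K" using B sets_BK by blast
      then have eq: "K \<times> {a} = B \<times> {a} \<union> (K - B) \<times> {a}" by blast
      have "B \<times> {a} \<inter> (K - B) \<times> {a} = {}" by blast
      then show ?thesis
        unfolding eq using S Times_PM[OF B, of a] Times_PM[OF sets.Diff[OF K_sets B], of a]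
        by (intro plus_emeasure[symmetric]) auto
    qed
    ultimately have "emeasure \<mu> (B \<times> {a}) \<noteq> 0" using a by simp
    then have "measure \<mu> (B \<times> {a}) > 0" using fin_e[of B a] B sets_BK by (auto simp: zero_less_measure_iff)
    then show ?thesis unfolding \<eta>_eq[OF B] by (simp add: add_pos_nonneg sum_nonneg)
  qed
  define L where "L = real (card positions)"
  \<comment> \<open>With \<open>M\<close> the mass of the chosen level in the fibre \<open>a\<close>
    and \<open>X\<close> its total mass in the fibres \<open>a + h\<close>, density gives
    \<open>X < e * (M + X)\<close>; together with \<open>M \<le> L * X\<close> this choice of
    \<open>e\<close> yields \<open>X < X / 2\<close>.\<close>
  define e where "e = 1 / (2 * (L + 1))"
  have e: "e > 0" unfolding e_def L_def by simp
  obtain k j m where jm: "j \<in> A" "m < height k j" and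
    dens: "measure \<eta> (level k j m - B) < e * measure \<eta> (level k j m)"
    using density_level[OF \<eta> B \<open>measure \<eta> B > 0\<close> e] by blast
  define Q where "Q = level k j m"
  have Q: "Q \<in> sets BK" unfolding Q_def using level_sets jm by blast
  have QK: "Q \<subseteq> K" using Q sets_BK by blast
  define X where "X = (\<Sum>h\<in>\<Theta>. measure \<mu> (Q \<times> {a + h}))"
  have X0: "0 \<le> X" unfolding X_def by (simp add: sum_nonneg)
  have split: "measure \<mu> (Q \<times> {b}) = measure \<mu> ((Q \<inter> B) \<times> {b}) + measure \<mu> ((Q - B) \<times> {b})" for b
  proof -
    have s: "(Q \<inter> B) \<times> {b} \<in> sets \<mu>" "(Q - B) \<times> {b} \<in> sets \<mu>"
      using Times_PM[OF sets.Int[OF Q B]] Times_PM[OF sets.Diff[OF Q B]] S by auto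
    have f: "emeasure \<mu> ((Q \<inter> B) \<times> {b}) \<noteq> \<infinity>" "emeasure \<mu> ((Q - B) \<times> {b}) \<noteq> \<infinity>"
    proof -
      have "Q \<inter> B \<subseteq> K" "Q - B \<subseteq> K" using QK by blast+
      then show "emeasure \<mu> ((Q \<inter> B) \<times> {b}) \<noteq> \<infinity>" "emeasure \<mu> ((Q - B) \<times> {b}) \<noteq> \<infinity>"
        using slice_finite[OF \<mu>(1)] by (simp_all add: less_top)
    qed
    have "Q \<times> {b} = (Q \<inter> B) \<times> {b} \<union> (Q - B) \<times> {b}" by blast
    then show ?thesis using measure_Union[OF f s] by auto
  qed
  have "X = (\<Sum>h\<in>\<Theta>. measure \<mu> ((Q - B) \<times> {a + h}))"
    unfolding X_def using split small by (intro sum.cong) auto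
  also have "\<dots> \<le> measure \<eta> (Q - B)" unfolding \<eta>_eq[OF sets.Diff[OF Q B]] by simp
  also have "\<dots> < e * (measure \<mu> (Q \<times> {a}) + X)" using dens \<eta>_eq[OF Q] unfolding Q_def X_def by simp
  finally have X_less: "X < e * (measure \<mu> (Q \<times> {a}) + X)" .
  define a' where "a' = a - lsum k j m"
  have QC: "measure \<mu> (Q \<times> {a + h}) = measure \<mu> (C k j \<times> {a' + h})" for h
    using mass_level[OF \<mu>(1) jm(1) C_sets[OF jm(1)] order_refl jm(2), where a="a' + h"]
    unfolding Q_def a'_def by (simp add: measure_def algebra_simps)
  have part: "measure \<mu> (C (Suc k) j' \<times> {a' - psum j' l}) \<le> X" if o: "(j', l) \<in> occ j" for j' l
  proof -
    have j': "j' \<in> A" using occD[OF o] by blast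
    obtain l1 l2 where l12: "(j', l1) \<in> occ j" "(j', l2) \<in> occ j" "psum j' l2 - psum j' l1 = g"
      using words[OF jm(1) j'] by blast
    \<comment> \<open>The two elements differ by \<open>g\<close>, so they are not both periods, and
      one of the occurrences is displaced from \<open>l\<close> by an element of
      \<open>\<Theta>\<close>.\<close>
    have "psum j' l1 - psum j' l \<notin> periods \<mu> \<or> psum j' l2 - psum j' l \<notin> periods \<mu>"
      using periods_diff[of "psum j' l2 - psum j' l" \<mu> "psum j' l1 - psum j' l"] g l12(3) by auto
    then obtain l' where l': "(j', l') \<in> occ j" "psum j' l' - psum j' l \<notin> periods \<mu>" using l12 by blast
    define h where "h = psum j' l' - psum j' l"
    have h: "h \<in> \<Theta>" unfolding \<Theta>_def h_def using jm(1) o l' by blast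
    have "measure \<mu> (C (Suc k) j' \<times> {a' - psum j' l}) = measure \<mu> (C (Suc k) j' \<times> {(a' + h) - psum j' l'})"
      unfolding h_def by (simp add: algebra_simps)
    also have "\<dots> \<le> measure \<mu> (C k j \<times> {a' + h})"
      unfolding mass_refine[OF \<mu>(1) jm(1), of k "a' + h"]
      using member_le_sum[of "(j', l')" "occ j" "\<lambda>(j', l'). measure \<mu> (C (Suc k) j' \<times> {(a' + h) - psum j' l'})"]
        l'(1) finite_occ by auto
    also have "\<dots> = measure \<mu> (Q \<times> {a + h})" by (rule QC[symmetric])
    also have "\<dots> \<le> X" unfolding X_def using h fin by (intro member_le_sum) auto
    finally show ?thesis .
  qed
  have "measure \<mu> (Q \<times> {a}) = measure \<mu> (C k j \<times> {a'})" using QC[of 0] by simp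
  also have "\<dots> = (\<Sum>(j', l)\<in>occ j. measure \<mu> (C (Suc k) j' \<times> {a' - psum j' l}))"
    by (rule mass_refine[OF \<mu>(1) jm(1)])
  also have "\<dots> \<le> (\<Sum>z\<in>occ j. X)" using part by (intro sum_mono) auto
  also have "\<dots> = real (card (occ j)) * X" by simp
  also have "\<dots> \<le> L * X"
    unfolding L_def using X0 card_mono[OF finite_positions occ_sub[OF jm(1)]] by (intro mult_right_mono) auto
  finally have "e * (measure \<mu> (Q \<times> {a}) + X) \<le> e * ((L + 1) * X)"
    using e by (intro mult_left_mono) (auto simp: algebra_simps)
  also have "\<dots> = X / 2" unfolding e_def L_def by (simp add: field_simps)
  finally show False using X_less X0 by simp
qed

end

context tower_system
begin

section \<open>Ergodicity of Maharam measures\<close>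

lemma conformal_T:
  assumes "conformal \<psi> \<nu>" "i \<in> A" "B \<in> sets BK" "B \<subseteq> P i"
  shows "measure \<nu> (T ` B) = exp (- \<psi> (\<phi> i)) * measure \<nu> B"
  using conformalD(5)[OF assms] by (simp add: measure_def enn2real_mult)

lemma conformal_level:
  assumes \<psi>: "Modules.additive \<psi>" and \<nu>: "conformal \<psi> \<nu>" and j: "j \<in> A"
    and B: "B \<in> sets BK" "B \<subseteq> C k j" and m: "m < height k j"
  shows "measure \<nu> ((T ^^ m) ` B) = exp (- \<psi> (lsum k j m)) * measure \<nu> B"
  using m
proof (induction m)
  case 0
  then show ?case using additive.zero[OF \<psi>] by (simp add: lsum_def)
next
  case (Suc m)
  then have m: "m < height k j" by simp
  have "(T ^^ m) ` B \<subseteq> P (W k j ! m)" using level_letter[OF j m] B(2) by blast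
  then have "measure \<nu> (T ` (T ^^ m) ` B) = exp (- \<psi> (\<phi> (W k j ! m))) * measure \<nu> ((T ^^ m) ` B)"
    by (intro conformal_T[OF \<nu> letter_in[OF j m] T_pow_sets[OF B(1)]])
  also have "\<dots> = exp (- \<psi> (lsum k j m + \<phi> (W k j ! m))) * measure \<nu> B"
    using Suc.IH[OF m] by (simp add: additive.add[OF \<psi>] exp_add[symmetric] algebra_simps)
  finally show ?case unfolding T_pow_Suc_image lsum_Suc[OF m] .
qed

lemma conformal_refine:
  assumes \<psi>: "Modules.additive \<psi>" and \<nu>: "conformal \<psi> \<nu>" and i: "i \<in> A"
  shows "measure \<nu> (C k i) = (\<Sum>(j, m)\<in>occ i. exp (- \<psi> (psum j m)) * measure \<nu> (C (Suc k) j))"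
proof -
  interpret finite_measure \<nu> using conformalD(2)[OF \<nu>] .
  have "measure \<nu> (C k i) = (\<Sum>z\<in>occ i. measure \<nu> ((\<lambda>(j, m). level (Suc k) j (shift k j m)) z))"
    unfolding refine[OF i, of k] using level_sets conformalD(1)[OF \<nu>]
    by (intro finite_measure_finite_Union[OF finite_occ _ refine_disjoint[OF i]]) (auto simp: occ_def)
  also have "\<dots> = (\<Sum>(j, m)\<in>occ i. exp (- \<psi> (psum j m)) * measure \<nu> (C (Suc k) j))"
  proof (rule sum.cong[OF refl])
    fix z assume z: "z \<in> occ i"
    obtain j m where jm: "z = (j, m)" by (cases z)
    then have j: "j \<in> A" "m < length (w j)" using z occD by auto
    show "measure \<nu> ((\<lambda>(j, m). level (Suc k) j (shift k j m)) z) =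
        (case z of (j, m) \<Rightarrow> exp (- \<psi> (psum j m)) * measure \<nu> (C (Suc k) j))"
      using conformal_level[OF \<psi> \<nu> j(1) C_sets[OF j(1)] order_refl shift_less[OF j]] lsum_shift[OF j] jm
      by simp
  qed
  finally show ?thesis .
qed

lemma measure_K_pieces:
  assumes \<nu>: "conformal \<psi> \<nu>"
  shows "measure \<nu> K = (\<Sum>i\<in>A. measure \<nu> (C 0 i))"
proof -
  interpret finite_measure \<nu> using conformalD(2)[OF \<nu>] .
  have "measure \<nu> K = (\<Sum>i\<in>A. measure \<nu> (P i))"
    unfolding P_cover[symmetric] using P_sets conformalD(1)[OF \<nu>] P_disj
    by (intro finite_measure_finite_Union[OF finite_A]) (auto simp: disjoint_family_on_def)
  then show ?thesis using C_0 by simp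
qed

text \<open>Positivity of the matrix makes the masses of the bases of any two towers of the same
  order comparable, uniformly in the order.\<close>

lemma bounded_geometry:
  assumes \<psi>: "Modules.additive \<psi>" and \<nu>: "conformal \<psi> \<nu>"
  shows "\<exists>\<delta>>0. (\<forall>k. \<forall>i\<in>A. measure \<nu> (C k i) > 0) \<and>
    (\<forall>k. \<forall>i\<in>A. \<forall>(j, m)\<in>occ i. \<delta> * measure \<nu> (C k i) \<le> measure \<nu> (level (Suc k) j (shift k j m)))"
proof -
  interpret finite_measure \<nu> using conformalD(2)[OF \<nu>] .
  define v where "v k i = measure \<nu> (C k i)" for k i
  define V where "V k = (\<Sum>i\<in>A. v k i)" for k
  define c where "c = (\<lambda>(j, m). exp (- \<psi> (psum j m)))"
  have v0: "0 \<le> v k i" for k i by (simp add: v_def)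
  have V0: "0 \<le> V k" for k by (simp add: V_def v0 sum_nonneg)
  have vV: "v k i \<le> V k" if "i \<in> A" for k i
    unfolding V_def using that finite_A v0 by (intro member_le_sum) auto
  have ref: "v k i = (\<Sum>(j, m)\<in>occ i. c (j, m) * v (Suc k) j)" if "i \<in> A" for k i
    unfolding v_def c_def using conformal_refine[OF \<psi> \<nu> that] by simp
  obtain j0 where j0: "j0 \<in> A" using S.letters_nonempty by blast
  have ne: "positions \<noteq> {}" unfolding positions_def using j0 two[OF j0] by force
  define \<alpha> where "\<alpha> = Min (c ` positions)"
  define \<beta> where "\<beta> = real (card positions) * Max (c ` positions)"
  have "\<alpha> \<in> c ` positions" unfolding \<alpha>_def using finite_positions ne by (intro Min_in) auto
  then have \<alpha>: "\<alpha> > 0" by (auto simp: c_def)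
  have \<alpha>c: "\<alpha> \<le> c z" if "z \<in> positions" for z unfolding \<alpha>_def using finite_positions that by auto
  have c\<beta>: "c z \<le> Max (c ` positions)" if "z \<in> positions" for z using finite_positions that by auto
  have \<beta>: "\<beta> > 0"
  proof -
    obtain z where "z \<in> positions" using ne by blast
    then have "0 < Max (c ` positions)" using \<alpha> \<alpha>c c\<beta> by (meson less_le_trans)
    then show ?thesis unfolding \<beta>_def using ne finite_positions by (simp add: card_gt_0_iff)
  qed
  \<comment> \<open>Every letter occurs in every word, so each \<open>j\<close> contributes to the
    refinement of \<open>C k i\<close> at least once.\<close>
  have lower: "\<alpha> * V (Suc k) \<le> v k i" if i: "i \<in> A" for k i
  proof -
    have "\<exists>m. \<forall>j\<in>A. (j, m j) \<in> occ i" using occ_exists[OF i] by (intro bchoice) blast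
    then obtain m where m: "\<And>j. j \<in> A \<Longrightarrow> (j, m j) \<in> occ i" by blast
    have "\<alpha> * V (Suc k) = (\<Sum>j\<in>A. \<alpha> * v (Suc k) j)" by (simp add: V_def sum_distrib_left)
    also have "\<dots> \<le> (\<Sum>j\<in>A. c (j, m j) * v (Suc k) j)"
      using m occ_sub[OF i] \<alpha>c v0 by (intro sum_mono mult_right_mono) auto
    also have "\<dots> = (\<Sum>z\<in>(\<lambda>j. (j, m j)) ` A. c z * v (Suc k) (fst z))"
      by (subst sum.reindex) (auto simp: inj_on_def)
    also have "\<dots> \<le> (\<Sum>z\<in>occ i. c z * v (Suc k) (fst z))"
      using m finite_occ v0 by (intro sum_mono2) (auto simp: c_def)
    also have "\<dots> = v k i" unfolding ref[OF i] by (simp add: case_prod_beta)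
    finally show ?thesis .
  qed
  have upper: "v k i \<le> \<beta> * V (Suc k)" if i: "i \<in> A" for k i
  proof -
    have "v k i \<le> (\<Sum>z\<in>occ i. Max (c ` positions) * V (Suc k))"
      unfolding ref[OF i]
    proof (rule sum_mono)
      fix z assume z: "z \<in> occ i"
      obtain j m where jm: "z = (j, m)" by (cases z)
      have "z \<in> positions" using z occ_sub[OF i] by blast
      then have "0 \<le> Max (c ` positions)" "c z \<le> Max (c ` positions)"
        using \<alpha> \<alpha>c[of z] c\<beta>[of z] by linarith+
      moreover have "v (Suc k) j \<le> V (Suc k)" using vV occD z jm by blast
      ultimately show "(case z of (j, m) \<Rightarrow> c (j, m) * v (Suc k) j) \<le> Max (c ` positions) * V (Suc k)"
        using v0 jm by (simp add: mult_mono)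
    qed
    also have "\<dots> = real (card (occ i)) * (Max (c ` positions) * V (Suc k))" by simp
    also have "\<dots> \<le> real (card positions) * (Max (c ` positions) * V (Suc k))"
    proof (rule mult_right_mono)
      show "real (card (occ i)) \<le> real (card positions)" using card_mono[OF finite_positions occ_sub[OF i]] by simp
      obtain z where "z \<in> positions" using ne by blast
      then have "0 < Max (c ` positions)" using \<alpha> \<alpha>c c\<beta> by (meson less_le_trans)
      then show "0 \<le> Max (c ` positions) * V (Suc k)" using V0 by simp
    qed
    finally show ?thesis by (simp add: \<beta>_def mult.assoc)
  qed
  define \<gamma> where "\<gamma> = real (card A) * \<beta>"
  have \<gamma>: "\<gamma> > 0" unfolding \<gamma>_def using \<beta> card_A by simp
  have V_step: "V k \<le> \<gamma> * V (Suc k)" for k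
    unfolding V_def[of k] \<gamma>_def mult.assoc using upper sum_bounded_above[of A "v k" "\<beta> * V (Suc k)"] by simp
  have V_pos: "V k > 0" for k
  proof (induction k)
    case 0
    have "measure \<nu> K > 0" using conformalD(3)[OF \<nu>] by (simp add: emeasure_eq_measure zero_less_measure_iff)
    then show ?case using measure_K_pieces[OF \<nu>] by (simp add: V_def v_def)
  next
    case (Suc k)
    then have "0 < \<gamma> * V (Suc k)" using V_step[of k] by simp
    then show ?case using \<gamma> by (simp add: zero_less_mult_iff)
  qed
  \<comment> \<open>Through two stages: \<open>v k i \<le> \<beta> * V (Suc k) \<le> \<beta> *
    \<gamma> * V (Suc (Suc k))\<close>, while a single part has mass \<open>c (j, m) * v (Suc k) j
    \<ge> \<alpha> * \<alpha> * V (Suc (Suc k))\<close>.\<close>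
  define \<delta> where "\<delta> = \<alpha> * \<alpha> / (\<gamma> * \<beta>)"
  have "\<delta> > 0" unfolding \<delta>_def using \<alpha> \<beta> \<gamma> by simp
  moreover have "measure \<nu> (C k i) > 0" if "i \<in> A" for k i
    using lower[OF that, of k] \<alpha> V_pos[of "Suc k"] unfolding v_def by (meson less_le_trans mult_pos_pos)
  moreover have "\<delta> * measure \<nu> (C k i) \<le> measure \<nu> (level (Suc k) j (shift k j m))"
    if i: "i \<in> A" and jm: "(j, m) \<in> occ i" for k i j m
  proof -
    have j: "j \<in> A" "m < length (w j)" using occD[OF jm] by auto
    have "\<delta> * v k i \<le> \<delta> * (\<beta> * V (Suc k))" using upper[OF i] \<open>\<delta> > 0\<close> by (intro mult_left_mono) auto
    also have "\<dots> = \<alpha> * \<alpha> / \<gamma> * V (Suc k)" unfolding \<delta>_def using \<beta> by simp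
    also have "\<dots> \<le> \<alpha> * \<alpha> / \<gamma> * (\<gamma> * V (Suc (Suc k)))"
      using V_step[of "Suc k"] \<alpha> \<gamma> by (intro mult_left_mono) auto
    also have "\<dots> = \<alpha> * (\<alpha> * V (Suc (Suc k)))" using \<gamma> by simp
    also have "\<dots> \<le> c (j, m) * v (Suc k) j"
      using lower[OF j(1)] \<alpha>c[of "(j, m)"] jm occ_sub[OF i] \<alpha> V0 v0 by (intro mult_mono) auto
    also have "\<dots> = measure \<nu> (level (Suc k) j (shift k j m))"
      using conformal_level[OF \<psi> \<nu> j(1) C_sets[OF j(1)] order_refl shift_less[OF j]] lsum_shift[OF j]
      by (simp add: c_def v_def)
    finally show ?thesis by (simp add: v_def)
  qed
  ultimately show ?thesis by blast
qed

text \<open>Both bases contain a level of the same stage \<open>Suc k\<close> tower. Pulled down to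
  the base of that tower, each exceptional set fills less than half of it, because the level
  occupies at least the proportion \<open>\<delta>\<close> of \<open>C k i1\<close> or
  \<open>C k i2\<close>; so some point is good for both.\<close>

lemma share:
  assumes \<psi>: "Modules.additive \<psi>" and \<nu>: "conformal \<psi> \<nu>"
    and \<delta>: "\<And>k i j m. i \<in> A \<Longrightarrow> (j, m) \<in> occ i \<Longrightarrow>
      \<delta> * measure \<nu> (C k i) \<le> measure \<nu> (level (Suc k) j (shift k j m))"
    and i: "i1 \<in> A" "i2 \<in> A" and jm: "(j, m1) \<in> occ i1" "(j, m2) \<in> occ i2"
    and E: "E1 \<in> sets BK" "E2 \<in> sets BK"
    and d1: "measure \<nu> (C k i1 - E1) < \<delta> / 2 * measure \<nu> (C k i1)"
    and d2: "measure \<nu> (C k i2 - E2) < \<delta> / 2 * measure \<nu> (C k i2)"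
  shows "\<exists>p\<in>C (Suc k) j. (T ^^ shift k j m1) p \<in> E1 \<and> (T ^^ shift k j m2) p \<in> E2"
proof -
  interpret finite_measure \<nu> using conformalD(2)[OF \<nu>] .
  note S = conformalD(1)[OF \<nu>]
  define bad where "bad m E = C (Suc k) j - {p \<in> K. (T ^^ shift k j m) p \<in> E}" for m E
  have jA: "j \<in> A" using occD[OF jm(1)] by blast
  have bad_sets: "bad m E \<in> sets BK" if "E \<in> sets BK" for m E
    unfolding bad_def using C_sets[OF jA] T_pow_vimage_sets[OF that] by (rule sets.Diff)
  have small: "measure \<nu> (bad m E) < measure \<nu> (C (Suc k) j) / 2"
    if i: "i \<in> A" and jm: "(j, m) \<in> occ i" and E: "E \<in> sets BK"
    and d: "measure \<nu> (C k i - E) < \<delta> / 2 * measure \<nu> (C k i)" for i m E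
  proof -
    have m: "m < length (w j)" using occD[OF jm] by blast
    define e where "e = exp (- \<psi> (lsum (Suc k) j (shift k j m)))"
    have lv: "measure \<nu> ((T ^^ shift k j m) ` B) = e * measure \<nu> B"
      if "B \<in> sets BK" "B \<subseteq> C (Suc k) j" for B
      unfolding e_def by (rule conformal_level[OF \<psi> \<nu> jA that shift_less[OF jA m]])
    have "(T ^^ shift k j m) ` bad m E \<subseteq> C k i - E"
      using level_part[OF jm i, of k] C_sub[OF jA] unfolding bad_def by blast
    then have "measure \<nu> ((T ^^ shift k j m) ` bad m E) \<le> measure \<nu> (C k i - E)"
      using S sets.Diff[OF C_sets[OF i] E] by (intro finite_measure_mono) auto
    moreover have "bad m E \<subseteq> C (Suc k) j" by (auto simp: bad_def)
    ultimately have "e * measure \<nu> (bad m E) \<le> measure \<nu> (C k i - E)"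
      using lv[OF bad_sets[OF E], of m] by simp
    also have "\<dots> < \<delta> / 2 * measure \<nu> (C k i)" by (rule d)
    also have "\<dots> \<le> e * (measure \<nu> (C (Suc k) j) / 2)"
      using \<delta>[OF i jm, of k] lv[OF C_sets[OF jA] order_refl] by simp
    finally show ?thesis by (simp add: e_def)
  qed
  have "measure \<nu> (bad m1 E1 \<union> bad m2 E2) \<le> measure \<nu> (bad m1 E1) + measure \<nu> (bad m2 E2)"
    using bad_sets E S by (intro measure_Un_le) auto
  also have "\<dots> < measure \<nu> (C (Suc k) j)" using small[OF i(1) jm(1) E(1) d1] small[OF i(2) jm(2) E(2) d2] by simp
  finally have "bad m1 E1 \<union> bad m2 E2 \<noteq> C (Suc k) j" by auto
  then obtain p where "p \<in> C (Suc k) j" "p \<notin> bad m1 E1" "p \<notin> bad m2 E2" unfolding bad_def by blast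
  then show ?thesis unfolding bad_def by blast
qed

text \<open>The conformal factor from the base up to a level is constant, so proportions in the
  level and in the base agree.\<close>

lemma density_base:
  assumes \<psi>: "Modules.additive \<psi>" and \<nu>: "conformal \<psi> \<nu>" and B: "B \<in> sets BK" "measure \<nu> B > 0" and e: "e > 0"
  shows "\<exists>k0. \<forall>k\<ge>k0. \<exists>j\<in>A. \<exists>m<height k j.
    measure \<nu> (C k j - {p \<in> K. (T ^^ m) p \<in> B}) < e * measure \<nu> (C k j)"
proof -
  have "measure \<nu> (C k j - {p \<in> K. (T ^^ m) p \<in> B}) < e * measure \<nu> (C k j)"
    if j: "j \<in> A" and m: "m < height k j" and d: "measure \<nu> (level k j m - B) < e * measure \<nu> (level k j m)" for j m k
  proof -
    have C: "C k j \<subseteq> K" using C_sub[OF j] .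
    have "level k j m - B = (T ^^ m) ` (C k j - {p \<in> K. (T ^^ m) p \<in> B})" using C by blast
    then have "measure \<nu> (level k j m - B) =
        exp (- \<psi> (lsum k j m)) * measure \<nu> (C k j - {p \<in> K. (T ^^ m) p \<in> B})"
      using conformal_level[OF \<psi> \<nu> j sets.Diff[OF C_sets[OF j] T_pow_vimage_sets[OF B(1)]] Diff_subset m] by simp
    moreover have "measure \<nu> (level k j m) = exp (- \<psi> (lsum k j m)) * measure \<nu> (C k j)"
      by (rule conformal_level[OF \<psi> \<nu> j C_sets[OF j] order_refl m])
    ultimately show ?thesis using d by (simp add: mult.left_commute[of e])
  qed
  then show ?thesis using density_level[OF conformalD(2,1)[OF \<nu>] B e] by meson
qed

lemma inv_set_level:
  assumes E: "inv_set E" and j: "j \<in> A" and p: "p \<in> C k j" and m: "m < height k j"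
  shows "((T ^^ m) p, a) \<in> E \<longleftrightarrow> (p, a - lsum k j m) \<in> E"
  using m
proof (induction m arbitrary: a)
  case (Suc m)
  then have m: "m < height k j" by simp
  have pK: "p \<in> K" using C_sub[OF j] p by blast
  have "(T ^^ m) p \<in> P (W k j ! m)" using level_letter[OF j m] p by blast
  then have c: "cocycle ((T ^^ m) p) = \<phi> (W k j ! m)" using cocycle_eq letter_in[OF j m] by blast
  have "((T ^^ Suc m) p, a) \<in> E \<longleftrightarrow> ((T ^^ m) p, a - \<phi> (W k j ! m)) \<in> E"
    using inv_set_iff[OF E T_pow_in[OF pK, of m], of "a - \<phi> (W k j ! m)"] c by simp
  also have "\<dots> \<longleftrightarrow> (p, a - lsum k j (Suc m)) \<in> E"
    using Suc.IH[OF m] by (simp add: lsum_Suc[OF m] algebra_simps)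
  finally show ?case .
qed (simp add: lsum_def)

lemma inv_set_shift:
  assumes E: "inv_set E" and jm: "(j, m) \<in> occ i" and p: "p \<in> C (Suc k) j"
  shows "((T ^^ shift k j m) p, a) \<in> E \<longleftrightarrow> (p, a - psum j m) \<in> E"
  using inv_set_level[OF E _ p shift_less] lsum_shift occD[OF jm] by metis

text \<open>A point of \<open>B\<close> lies in \<open>E\<close> over the fibre \<open>a\<close> but
  not over \<open>a - g\<close>. Where \<open>B\<close> almost fills a level, the base of the tower
  is almost filled both by \<open>E1\<close> and by \<open>E2\<close>; the two occurrences of its
  letter at displacement \<open>g\<close> bring both conditions to the same point in the same
  fibre.\<close>

lemma invariant_under_period:
  assumes words: "\<And>i j. i \<in> A \<Longrightarrow> j \<in> A \<Longrightarrow> \<exists>m m'. (j, m) \<in> occ i \<and> (j, m') \<in> occ i \<and> psum j m' - psum j m = g"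
    and \<psi>: "Modules.additive \<psi>" and \<nu>: "conformal \<psi> \<nu>" and E: "inv_set E"
  shows "measure \<nu> (sec E a - sec E (a - g)) = 0"
proof (rule ccontr)
  assume "\<not> ?thesis"
  then have pos: "measure \<nu> (sec E a - sec E (a - g)) > 0" by (simp add: zero_less_measure_iff)
  interpret finite_measure \<nu> using conformalD(2)[OF \<nu>] .
  have Es: "E \<in> sets PM" using E inv_set_def by blast
  define B where "B = sec E a - sec E (a - g)"
  have B: "B \<in> sets BK" unfolding B_def using sec_sets[OF Es] by (intro sets.Diff)
  obtain \<delta> where \<delta>: "\<delta> > 0"
    "\<And>k i j m. i \<in> A \<Longrightarrow> (j, m) \<in> occ i \<Longrightarrow> \<delta> * measure \<nu> (C k i) \<le> measure \<nu> (level (Suc k) j (shift k j m))"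
    using bounded_geometry[OF \<psi> \<nu>] by blast
  obtain k j m where jm: "j \<in> A" "m < height k j"
    "measure \<nu> (C k j - {p \<in> K. (T ^^ m) p \<in> B}) < \<delta> / 2 * measure \<nu> (C k j)"
    using density_base[OF \<psi> \<nu> B, of "\<delta> / 2"] pos \<delta>(1) B_def by (auto 0 3)
  define b where "b = a - lsum k j m"
  have inB: "(p, b) \<in> E \<and> (p, b - g) \<notin> E" if "p \<in> C k j" "(T ^^ m) p \<in> B" for p
    using that inv_set_level[OF E jm(1) that(1) jm(2)] unfolding B_def b_def
    by (auto simp: sec_def algebra_simps)
  define E1 where "E1 = sec E b"
  define E2 where "E2 = K - sec E (b - g)"
  have E12: "E1 \<in> sets BK" "E2 \<in> sets BK"
    unfolding E1_def E2_def using sec_sets[OF Es] K_sets by auto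
  have "C k j - E1 \<subseteq> C k j - {p \<in> K. (T ^^ m) p \<in> B}" "C k j - E2 \<subseteq> C k j - {p \<in> K. (T ^^ m) p \<in> B}"
    using inB by (auto simp: E1_def E2_def sec_def)
  then have "measure \<nu> (C k j - E1) \<le> measure \<nu> (C k j - {p \<in> K. (T ^^ m) p \<in> B})"
    "measure \<nu> (C k j - E2) \<le> measure \<nu> (C k j - {p \<in> K. (T ^^ m) p \<in> B})"
    using conformalD(1)[OF \<nu>] sets.Diff[OF C_sets[OF jm(1)] T_pow_vimage_sets[OF B]]
    by (auto intro!: finite_measure_mono)
  then have d: "measure \<nu> (C k j - E1) < \<delta> / 2 * measure \<nu> (C k j)" "measure \<nu> (C k j - E2) < \<delta> / 2 * measure \<nu> (C k j)"
    using jm(3) by linarith+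
  obtain m1 m2 where m12: "(j, m1) \<in> occ j" "(j, m2) \<in> occ j" "psum j m2 - psum j m1 = g"
    using words[OF jm(1) jm(1)] by blast
  obtain p where p: "p \<in> C (Suc k) j" "(T ^^ shift k j m2) p \<in> E1" "(T ^^ shift k j m1) p \<in> E2"
    using share[OF \<psi> \<nu> \<delta>(2) jm(1) jm(1) m12(2,1) E12 d] by blast
  have "(p, b - psum j m2) \<in> E" using p(2) inv_set_shift[OF E m12(2) p(1)] by (simp add: E1_def sec_def)
  moreover have "(p, b - g - psum j m1) \<notin> E"
    using p(3) inv_set_shift[OF E m12(1) p(1)] by (simp add: E2_def sec_def)
  moreover have "b - psum j m2 = b - g - psum j m1" unfolding m12(3)[symmetric] by simp
  ultimately show False by simp
qed

text \<open>Invariance of \<open>E\<close> under fibre translations modulo null sets does not yet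
  decide between \<open>E\<close> and its complement. A level almost inside \<open>E\<close> and one
  almost outside may carry different letters and fibres; both letters occur in one word, and the
  mismatch of the fibres is removed by the assumed translation invariance.\<close>

lemma ergodic_of_periods:
  assumes \<psi>: "Modules.additive \<psi>" and \<nu>: "conformal \<psi> \<nu>" and E: "inv_set E"
    and inv: "\<And>a g. measure \<nu> (sec E a - sec E (a - g)) = 0"
  shows "emeasure (maharam_measure \<psi> \<nu>) E = 0 \<or> emeasure (maharam_measure \<psi> \<nu>) (\<Omega> - E) = 0"
proof (rule ccontr)
  assume "\<not> ?thesis"
  then have ne: "emeasure (maharam_measure \<psi> \<nu>) E \<noteq> 0" "emeasure (maharam_measure \<psi> \<nu>) (\<Omega> - E) \<noteq> 0" by auto
  interpret finite_measure \<nu> using conformalD(2)[OF \<nu>] .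
  note S = conformalD(1)[OF \<nu>]
  have Es: "E \<in> sets PM" using E inv_set_def by blast
  have slice: "\<exists>a. measure \<nu> (sec X a) > 0" if X: "X \<in> sets PM" "emeasure (maharam_measure \<psi> \<nu>) X \<noteq> 0" for X
  proof (rule ccontr)
    assume "\<not> ?thesis"
    then have "emeasure \<nu> (sec X a) = 0" for a by (simp add: emeasure_eq_measure zero_less_measure_iff)
    then have "emeasure (maharam_measure \<psi> \<nu>) (sec X a \<times> {a}) = 0" for a
      using emeasure_maharam[OF S sec_sets[OF X(1)]] by simp
    then show False using emeasure_slices[OF sets_maharam[OF S] X(1)] X(2) by simp
  qed
  obtain a1 where a1: "measure \<nu> (sec E a1) > 0" using slice[OF Es ne(1)] by blast
  have "sec (\<Omega> - E) a = K - sec E a" for a by (auto simp: sec_def)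
  then obtain a2 where a2: "measure \<nu> (K - sec E a2) > 0" using slice[OF _ ne(2)] Es Omega_sets by auto
  obtain \<delta> where \<delta>: "\<delta> > 0"
    "\<And>k i j m. i \<in> A \<Longrightarrow> (j, m) \<in> occ i \<Longrightarrow> \<delta> * measure \<nu> (C k i) \<le> measure \<nu> (level (Suc k) j (shift k j m))"
    using bounded_geometry[OF \<psi> \<nu>] by blast
  have \<delta>2: "\<delta> / 2 > 0" using \<delta>(1) by simp
  obtain k1 where k1: "\<And>k. k \<ge> k1 \<Longrightarrow> \<exists>j\<in>A. \<exists>m<height k j.
      measure \<nu> (C k j - {p \<in> K. (T ^^ m) p \<in> sec E a1}) < \<delta> / 2 * measure \<nu> (C k j)"
    using density_base[OF \<psi> \<nu> sec_sets[OF Es] a1 \<delta>2] by blast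
  obtain k2 where k2: "\<And>k. k \<ge> k2 \<Longrightarrow> \<exists>j\<in>A. \<exists>m<height k j.
      measure \<nu> (C k j - {p \<in> K. (T ^^ m) p \<in> K - sec E a2}) < \<delta> / 2 * measure \<nu> (C k j)"
    using density_base[OF \<psi> \<nu> sets.Diff[OF K_sets sec_sets[OF Es]] a2 \<delta>2] by blast
  define k where "k = max k1 k2"
  obtain j1 n1 where j1: "j1 \<in> A" "n1 < height k j1"
    "measure \<nu> (C k j1 - {p \<in> K. (T ^^ n1) p \<in> sec E a1}) < \<delta> / 2 * measure \<nu> (C k j1)"
    using k1[of k] by (auto simp: k_def)
  obtain j2 n2 where j2: "j2 \<in> A" "n2 < height k j2"
    "measure \<nu> (C k j2 - {p \<in> K. (T ^^ n2) p \<in> K - sec E a2}) < \<delta> / 2 * measure \<nu> (C k j2)"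
    using k2[of k] by (auto simp: k_def)
  obtain m1 m2 where m1: "(j1, m1) \<in> occ j1" and m2: "(j1, m2) \<in> occ j2"
    using occ_exists[OF j1(1) j1(1)] occ_exists[OF j2(1) j1(1)] by blast
  define b1 where "b1 = a1 - lsum k j1 n1"
  define b2 where "b2 = a2 - lsum k j2 n2"
  \<comment> \<open>The fibre in which the second base must be read so that the positions
    \<open>m1\<close> and \<open>m2\<close> in the word of \<open>j1\<close> lead to the same fibre
    over \<open>C (Suc k) j1\<close>.\<close>
  define b where "b = b1 - psum j1 m1 + psum j1 m2"
  define E1 where "E1 = sec E b1"
  define E2 where "E2 = K - sec E b"
  have E12: "E1 \<in> sets BK" "E2 \<in> sets BK"
    unfolding E1_def E2_def using sec_sets[OF Es] K_sets by auto
  have "C k j1 - E1 \<subseteq> C k j1 - {p \<in> K. (T ^^ n1) p \<in> sec E a1}"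
    using inv_set_level[OF E j1(1) _ j1(2)] by (auto simp: E1_def b1_def sec_def)
  moreover have "{p \<in> K. (T ^^ n1) p \<in> sec E a1} \<in> sets BK"
    using sec_sets[OF Es] by (rule T_pow_vimage_sets)
  then have "C k j1 - {p \<in> K. (T ^^ n1) p \<in> sec E a1} \<in> sets \<nu>"
    using C_sets[OF j1(1), of k] S by simp
  ultimately have "measure \<nu> (C k j1 - E1) \<le> measure \<nu> (C k j1 - {p \<in> K. (T ^^ n1) p \<in> sec E a1})"
    by (rule finite_measure_mono)
  then have d1: "measure \<nu> (C k j1 - E1) < \<delta> / 2 * measure \<nu> (C k j1)"
    using j1(3) by linarith
  have "C k j2 - E2 \<subseteq> (C k j2 - {p \<in> K. (T ^^ n2) p \<in> K - sec E a2}) \<union> (sec E b - sec E (b - (b - b2)))"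
    using inv_set_level[OF E j2(1) _ j2(2)] C_sub[OF j2(1)] by (auto simp: E2_def b2_def sec_def)
  moreover have s2: "{p \<in> K. (T ^^ n2) p \<in> K - sec E a2} \<in> sets BK"
    using K_sets sec_sets[OF Es] by (intro T_pow_vimage_sets sets.Diff)
  have s: "C k j2 - {p \<in> K. (T ^^ n2) p \<in> K - sec E a2} \<in> sets \<nu>"
    "sec E b - sec E (b - (b - b2)) \<in> sets \<nu>"
    using s2 C_sets[OF j2(1), of k] sec_sets[OF Es] S by auto
  ultimately have "measure \<nu> (C k j2 - E2) \<le>
      measure \<nu> ((C k j2 - {p \<in> K. (T ^^ n2) p \<in> K - sec E a2}) \<union> (sec E b - sec E (b - (b - b2))))"
    using s by (intro finite_measure_mono sets.Un)
  also have "\<dots> \<le> measure \<nu> (C k j2 - {p \<in> K. (T ^^ n2) p \<in> K - sec E a2}) + measure \<nu> (sec E b - sec E (b - (b - b2)))"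
    by (rule measure_Un_le[OF s])
  finally have d2: "measure \<nu> (C k j2 - E2) < \<delta> / 2 * measure \<nu> (C k j2)" using j2(3) inv[of b "b - b2"] by simp
  obtain p where p: "p \<in> C (Suc k) j1" "(T ^^ shift k j1 m1) p \<in> E1" "(T ^^ shift k j1 m2) p \<in> E2"
    using share[OF \<psi> \<nu> \<delta>(2) j1(1) j2(1) m1 m2 E12 d1 d2] by blast
  have "(p, b1 - psum j1 m1) \<in> E" using p(2) inv_set_shift[OF E m1 p(1)] by (simp add: E1_def sec_def)
  moreover have "(p, b - psum j1 m2) \<notin> E" using p(3) inv_set_shift[OF E m2 p(1)] by (simp add: E2_def sec_def)
  ultimately show False by (simp add: b_def)
qed

section \<open>Conformal measures have no atoms\<close>

text \<open>There are at least two letters, so every part of a base has a disjoint companion with at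
  least the proportion \<open>\<delta>0\<close> of the mass of that base; passing to the next stage
  therefore loses a fixed factor.\<close>

lemma level_mass:
  assumes \<psi>: "Modules.additive \<psi>" and \<nu>: "conformal \<psi> \<nu>"
  shows "\<exists>\<delta>>0. \<delta> < 1 \<and> (\<forall>k. \<forall>j\<in>A. \<forall>m<height k j. measure \<nu> (level k j m) \<le> (1 - \<delta>) ^ k * measure \<nu> K)"
proof -
  interpret finite_measure \<nu> using conformalD(2)[OF \<nu>] .
  note S = conformalD(1)[OF \<nu>]
  obtain \<delta>0 where \<delta>0: "\<delta>0 > 0"
    "\<And>k i j m. i \<in> A \<Longrightarrow> (j, m) \<in> occ i \<Longrightarrow> \<delta>0 * measure \<nu> (C k i) \<le> measure \<nu> (level (Suc k) j (shift k j m))"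
    using bounded_geometry[OF \<psi> \<nu>] by blast
  define \<delta> where "\<delta> = min \<delta>0 (1 / 2)"
  have \<delta>: "\<delta> > 0" "\<delta> < 1" "\<delta> \<le> \<delta>0" using \<delta>0(1) by (auto simp: \<delta>_def)
  have part: "measure \<nu> (level (Suc k) j (shift k j m)) \<le> (1 - \<delta>) * measure \<nu> (C k i)"
    if i: "i \<in> A" and jm: "(j, m) \<in> occ i" for i j m k
  proof -
    have j: "j \<in> A" using occD[OF jm] by blast
    obtain j' where j': "j' \<in> A" "j' \<noteq> j"
    proof -
      have "\<not> A \<subseteq> {j}" using card_A card_mono[of "{j}" A] by auto
      then show ?thesis using that by blast
    qed
    obtain m' where jm': "(j', m') \<in> occ i" using occ_exists[OF i j'(1)] by blast
    let ?X = "level (Suc k) j (shift k j m)" and ?Y = "level (Suc k) j' (shift k j' m')"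
    have "?X \<inter> ?Y = {}"
      using refine_disjoint[OF i, of k] jm jm' j'(2) unfolding disjoint_family_on_def by fast
    then have "measure \<nu> ?X + measure \<nu> ?Y = measure \<nu> (?X \<union> ?Y)"
      using level_sets[OF j] level_sets[OF j'(1)] S by (intro finite_measure_Union[symmetric]) auto
    also have "\<dots> \<le> measure \<nu> (C k i)"
      using level_part[OF jm i, of k] level_part[OF jm' i, of k] C_sets[OF i] S by (intro finite_measure_mono) auto
    finally have "measure \<nu> ?X \<le> measure \<nu> (C k i) - \<delta>0 * measure \<nu> (C k i)"
      using \<delta>0(2)[OF i jm', of k] by simp
    also have "\<dots> \<le> measure \<nu> (C k i) - \<delta> * measure \<nu> (C k i)"
      using \<delta>(3) by (intro diff_left_mono mult_right_mono) auto
    finally show ?thesis by (simp add: algebra_simps)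
  qed
  have "measure \<nu> (level k j m) \<le> (1 - \<delta>) ^ k * measure \<nu> K" if "j \<in> A" "m < height k j" for k j m
    using that
  proof (induction k arbitrary: j m)
    case 0
    have "level 0 j m \<subseteq> K" using level_sets[OF 0(1)] by (simp only: sets_BK)
    then show ?case using K_sets S by (simp add: finite_measure_mono)
  next
    case (Suc k)
    have "m < length (concat (map (W k) (w j)))" using Suc.prems by simp
    then obtain l r where lr: "l < length (w j)" "r < length (W k (w j ! l))" "m = shift k j l + r"
      using concat_map_nth[of m "W k" "w j"] by blast
    define i where "i = w j ! l"
    have i: "i \<in> A" unfolding i_def by (rule word_letter_in[OF Suc.prems(1) lr(1)])
    have jl: "(j, l) \<in> occ i" using Suc.prems(1) lr(1) by (simp add: occ_def i_def)
    let ?X = "level (Suc k) j (shift k j l)"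
    have X: "?X \<in> sets BK" "?X \<subseteq> C k i" using level_sets[OF Suc.prems(1)] level_part[OF jl i] by auto
    have r: "r < height k i" using lr(2) by (simp add: i_def)
    have "level (Suc k) j m = (T ^^ r) ` ?X"
      unfolding lr(3) by (simp add: image_image funpow_add add.commute[of _ r])
    then have "measure \<nu> (level (Suc k) j m) = exp (- \<psi> (lsum k i r)) * measure \<nu> ?X"
      using conformal_level[OF \<psi> \<nu> i X r] by simp
    also have "\<dots> \<le> exp (- \<psi> (lsum k i r)) * ((1 - \<delta>) * measure \<nu> (C k i))"
      using part[OF i jl] by (intro mult_left_mono) auto
    also have "\<dots> = (1 - \<delta>) * measure \<nu> (level k i r)"
      using conformal_level[OF \<psi> \<nu> i C_sets[OF i] order_refl r] by simp
    also have "\<dots> \<le> (1 - \<delta>) * ((1 - \<delta>) ^ k * measure \<nu> K)"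
      using Suc.IH[OF i r] \<delta> by (intro mult_left_mono) auto
    finally show ?case by simp
  qed
  then show ?thesis using \<delta> by blast
qed

text \<open>Finitely many levels of a high stage cover \<open>X\<close>, and each is lighter than
  \<open>X\<close>; one of them meets \<open>X\<close> in positive mass.\<close>

lemma conformal_non_atomic:
  assumes \<psi>: "Modules.additive \<psi>" and \<nu>: "conformal \<psi> \<nu>"
  shows "non_atomic \<nu>"
  unfolding non_atomic_def
proof (intro ballI impI)
  interpret finite_measure \<nu> using conformalD(2)[OF \<nu>] .
  note S = conformalD(1)[OF \<nu>]
  fix X assume X: "X \<in> sets \<nu>" "0 < emeasure \<nu> X"
  then have pos: "0 < measure \<nu> X" by (simp add: emeasure_eq_measure)
  obtain \<delta> where \<delta>: "\<delta> > 0" "\<delta> < 1"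
    "\<And>k j m. j \<in> A \<Longrightarrow> m < height k j \<Longrightarrow> measure \<nu> (level k j m) \<le> (1 - \<delta>) ^ k * measure \<nu> K"
    using level_mass[OF \<psi> \<nu>] by blast
  have "(\<lambda>k. (1 - \<delta>) ^ k * measure \<nu> K) \<longlonglongrightarrow> 0 * measure \<nu> K"
    using \<delta>(1,2) by (intro tendsto_mult_right LIMSEQ_power_zero) auto
  then have "\<forall>\<^sub>F k in sequentially. (1 - \<delta>) ^ k * measure \<nu> K < measure \<nu> X"
    using pos by (intro order_tendstoD) auto
  from eventually_happens'[OF sequentially_bot this]
  obtain k where k: "(1 - \<delta>) ^ k * measure \<nu> K < measure \<nu> X" by blast
  define I where "I = Sigma A (\<lambda>j. {..<height k j})"
  let ?L = "\<lambda>(j, m). level k j m"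
  have L: "?L z \<in> sets \<nu>" if "z \<in> I" for z using that level_sets S by (auto simp: I_def)
  have "\<exists>z\<in>I. measure \<nu> (X \<inter> ?L z) > 0"
  proof (rule ccontr)
    assume "\<not> ?thesis"
    then have zero: "measure \<nu> (X \<inter> ?L z) = 0" if "z \<in> I" for z
      using that by (simp add: zero_less_measure_iff)
    have XK: "X \<subseteq> K" using X(1) S sets_BK by simp
    have "X = (\<Union>z\<in>I. X \<inter> ?L z)"
    proof
      show "X \<subseteq> (\<Union>z\<in>I. X \<inter> ?L z)"
      proof
        fix p assume p: "p \<in> X"
        then obtain j m where "j \<in> A" "m < height k j" "p \<in> level k j m" using XK level_cover[of k] by blast
        then show "p \<in> (\<Union>z\<in>I. X \<inter> ?L z)" using p by (intro UN_I[of "(j, m)"]) (auto simp: I_def)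
      qed
    qed auto
    then have "measure \<nu> X \<le> (\<Sum>z\<in>I. measure \<nu> (X \<inter> ?L z))"
      using measure_UNION_le[of I "\<lambda>z. X \<inter> ?L z" \<nu>] finite_A L X(1) by (auto simp: I_def)
    then show False using zero pos by simp
  qed
  then obtain j m where jm: "j \<in> A" "m < height k j" "measure \<nu> (X \<inter> level k j m) > 0"
    by (auto simp: I_def)
  have lv: "level k j m \<in> sets \<nu>" using level_sets[OF jm(1)] S by simp
  have "measure \<nu> (X \<inter> level k j m) \<le> measure \<nu> (level k j m)" using lv by (intro finite_measure_mono) auto
  also have "\<dots> < measure \<nu> X" using \<delta>(3)[OF jm(1,2)] k by simp
  finally have "emeasure \<nu> (X \<inter> level k j m) < emeasure \<nu> X"
    by (simp add: emeasure_eq_measure ennreal_less_iff)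
  moreover have "0 < emeasure \<nu> (X \<inter> level k j m)" using jm(3) by (simp add: emeasure_eq_measure)
  ultimately show "\<exists>B\<in>sets \<nu>. B \<subseteq> X \<and> 0 < emeasure \<nu> B \<and> emeasure \<nu> B < emeasure \<nu> X"
    using X(1) lv by (intro bexI[of _ "X \<inter> level k j m"]) auto
qed

end

context tower_system
begin

section \<open>Existence of conformal measures\<close>

text \<open>Total mass, before normalization, of a weighted orbit segment with itinerary
  \<open>u\<close>: the point reached after a prefix with sum \<open>s\<close> has weight
  \<open>exp (- \<psi> s)\<close>, see \<open>cost_sum\<close>.\<close>

primrec cost :: "('g \<Rightarrow> real) \<Rightarrow> nat list \<Rightarrow> real" where
  "cost \<psi> [] = 0"
| "cost \<psi> (i # u) = 1 + exp (- \<psi> (\<phi> i)) * cost \<psi> u"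

lemma cost_nonneg: "0 \<le> cost \<psi> u"
  by (induction u) auto

lemma cost_append:
  assumes "Modules.additive \<psi>"
  shows "cost \<psi> (u @ v) = cost \<psi> u + exp (- \<psi> (sum_list (map \<phi> u))) * cost \<psi> v"
proof (induction u)
  case Nil
  then show ?case by (simp add: additive.zero[OF assms])
next
  case (Cons i u)
  have "exp (- \<psi> (sum_list (map \<phi> (i # u)))) = exp (- \<psi> (\<phi> i)) * exp (- \<psi> (sum_list (map \<phi> u)))"
    by (simp add: additive.add[OF assms] exp_add[symmetric])
  then show ?case using Cons by (simp add: distrib_left mult.assoc)
qed

lemma cost_sum:
  assumes "Modules.additive \<psi>"
  shows "cost \<psi> u = (\<Sum>m<length u. exp (- \<psi> (sum_list (map \<phi> (take m u)))))"
  by (induction u)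
    (auto simp: sum.lessThan_Suc_shift additive.zero[OF assms] additive.add[OF assms] sum_distrib_left exp_add[symmetric]
      algebra_simps simp del: sum.lessThan_Suc)

text \<open>Every word has at least two letters, so a cost of stage \<open>Suc k\<close> dominates
  two costs of stage \<open>k\<close>, the second with a factor of at least \<open>c\<close>. The
  growth makes the error in \<open>orbit_measure_conformal\<close> vanish in the limit.\<close>

lemma cost_growth:
  assumes \<psi>: "Modules.additive \<psi>"
  shows "\<exists>c>0. \<forall>k. \<forall>j\<in>A. (1 + c) ^ k \<le> cost \<psi> (W k j)"
proof -
  define c where "c = Min ((\<lambda>i. exp (- \<psi> (\<phi> i))) ` A)"
  have "c \<in> (\<lambda>i. exp (- \<psi> (\<phi> i))) ` A"
    unfolding c_def using finite_A S.letters_nonempty by (intro Min_in) auto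
  then have c: "c > 0" by auto
  have c_le: "c \<le> exp (- \<psi> (\<phi> i))" if "i \<in> A" for i unfolding c_def using finite_A that by auto
  have "(1 + c) ^ k \<le> cost \<psi> (W k j)" if "j \<in> A" for k j
    using that
  proof (induction k arbitrary: j)
    case 0
    then show ?case by (simp add: subst_pow_0)
  next
    case (Suc k)
    obtain a b u where u: "w j = a # b # u"
      using two[OF Suc.prems] by (metis (no_types, opaque_lifting) One_nat_def Suc_1 Suc_le_length_iff)
    have ab: "a \<in> A" "b \<in> A" using S.set_word[OF Suc.prems] u by auto
    have "(1 + c) ^ Suc k = (1 + c) ^ k + c * (1 + c) ^ k" by (simp add: algebra_simps)
    also have "\<dots> \<le> cost \<psi> (W k a) + exp (- \<psi> (\<phi> a)) * cost \<psi> (W k b)"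
      using Suc.IH ab c_le c by (intro add_mono mult_mono) auto
    also have "\<dots> \<le> cost \<psi> (W k a) + exp (- \<psi> (\<phi> a)) * cost \<psi> (W k b @ concat (map (W k) u))"
      by (intro add_left_mono mult_left_mono) (auto simp: cost_append[OF \<psi>] cost_nonneg)
    also have "\<dots> = cost \<psi> (W (Suc k) j)"
      using S.sum_pow[OF ab(1), of k] by (simp add: u cost_append[OF \<psi>])
    finally show ?case .
  qed
  then show ?thesis using c by blast
qed

lemma cost_pos: "j \<in> A \<Longrightarrow> Modules.additive \<psi> \<Longrightarrow> 0 < cost \<psi> (W k j)"
  using cost_growth[of \<psi>] by (meson add_pos_pos less_le_trans zero_less_one zero_less_power)

definition orbit_weight :: "('g \<Rightarrow> real) \<Rightarrow> nat \<Rightarrow> nat \<Rightarrow> nat \<Rightarrow> real" where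
  "orbit_weight \<psi> k j m = exp (- \<psi> (lsum k j m)) / cost \<psi> (W k j)"

definition orbit_measure :: "('g \<Rightarrow> real) \<Rightarrow> nat \<Rightarrow> nat \<Rightarrow> real \<Rightarrow> real measure" where
  "orbit_measure \<psi> k j z =
     distr (point_measure {..<height k j} (\<lambda>m. ennreal (orbit_weight \<psi> k j m))) borel (\<lambda>m. (T ^^ m) z)"

context
  fixes \<psi> :: "'g \<Rightarrow> real" and k j :: nat and z :: real
  assumes \<psi>: "Modules.additive \<psi>" and j: "j \<in> A" and z: "z \<in> C k j"
begin

lemma orbit_weight_nonneg: "0 \<le> orbit_weight \<psi> k j m"
  using cost_nonneg by (simp add: orbit_weight_def)

lemma sum_orbit_weight: "(\<Sum>m<height k j. orbit_weight \<psi> k j m) = 1"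
  using cost_pos[OF j \<psi>, of k] cost_sum[OF \<psi>, of "W k j"]
  by (simp add: orbit_weight_def lsum_def sum_divide_distrib[symmetric])

lemma emeasure_orbit_measure:
  assumes "X \<in> sets borel"
  shows "emeasure (orbit_measure \<psi> k j z) X =
    ennreal (\<Sum>m<height k j. orbit_weight \<psi> k j m * indicator X ((T ^^ m) z))"
proof -
  let ?I = "(\<lambda>m. (T ^^ m) z) -` X \<inter> {..<height k j}"
  have "emeasure (orbit_measure \<psi> k j z) X =
      emeasure (point_measure {..<height k j} (\<lambda>m. ennreal (orbit_weight \<psi> k j m))) ?I"
    unfolding orbit_measure_def using assms by (subst emeasure_distr) (auto simp: space_point_measure)
  also have "\<dots> = (\<Sum>m\<in>?I. ennreal (orbit_weight \<psi> k j m))"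
    by (rule emeasure_point_measure_finite) auto
  also have "\<dots> = ennreal (\<Sum>m\<in>?I. orbit_weight \<psi> k j m)"
    using orbit_weight_nonneg by (intro sum_ennreal) auto
  also have "(\<Sum>m\<in>?I. orbit_weight \<psi> k j m) = (\<Sum>m<height k j. orbit_weight \<psi> k j m * indicator X ((T ^^ m) z))"
    by (rule sum.mono_neutral_cong_left) (auto simp: indicator_def)
  finally show ?thesis .
qed

lemma measure_orbit_measure:
  assumes "X \<in> sets borel"
  shows "measure (orbit_measure \<psi> k j z) X =
    (\<Sum>m<height k j. orbit_weight \<psi> k j m * indicator X ((T ^^ m) z))"
  using emeasure_orbit_measure[OF assms] orbit_weight_nonneg
  by (simp add: measure_def sum_nonneg)

lemma orbit_measure_distribution: "real_distribution (orbit_measure \<psi> k j z)"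
proof -
  have "emeasure (orbit_measure \<psi> k j z) UNIV = 1"
    using sum_orbit_weight by (simp add: emeasure_orbit_measure)
  then have "prob_space (orbit_measure \<psi> k j z)"
    by (intro prob_spaceI) (simp add: orbit_measure_def)
  then show ?thesis
    unfolding real_distribution_def real_distribution_axioms_def by (simp add: orbit_measure_def)
qed

lemma orbit_in: "m < height k j \<Longrightarrow> (T ^^ m) z \<in> K"
  using z C_sub[OF j] T_pow_in by blast

lemma orbit_measure_inter: "X \<in> sets borel \<Longrightarrow> Y \<in> sets borel \<Longrightarrow> X \<inter> K = Y \<inter> K \<Longrightarrow>
    measure (orbit_measure \<psi> k j z) X = measure (orbit_measure \<psi> k j z) Y"
  unfolding measure_orbit_measure using orbit_in by (intro sum.cong refl) (auto simp: indicator_def)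

lemma orbit_measure_K: "K \<subseteq> X \<Longrightarrow> X \<in> sets borel \<Longrightarrow> measure (orbit_measure \<psi> k j z) X = 1"
proof -
  assume X: "K \<subseteq> X" "X \<in> sets borel"
  have "(\<Sum>m<height k j. orbit_weight \<psi> k j m * indicator X ((T ^^ m) z)) = (\<Sum>m<height k j. orbit_weight \<psi> k j m)"
    using orbit_in X(1) by (intro sum.cong refl) (auto simp: indicator_def)
  then show ?thesis using measure_orbit_measure[OF X(2)] sum_orbit_weight by simp
qed

text \<open>Applying \<open>T\<close> moves the weighted segment along by one point, and the weights
  change by the required factor; only the two ends fail to match. Before division by the cost, the
  initial point has weight \<open>1\<close> and the point beyond the end would have weight
  \<open>exp (- \<psi> (\<phi> j))\<close>, since the sum over the entire word is
  \<open>\<phi> j\<close>.\<close>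

lemma orbit_measure_conformal:
  assumes i: "i \<in> A" and Q: "Q \<in> sets BK" "Q \<subseteq> P i"
  shows "\<bar>measure (orbit_measure \<psi> k j z) (T ` Q) - exp (- \<psi> (\<phi> i)) * measure (orbit_measure \<psi> k j z) Q\<bar>
    \<le> (1 + exp (- \<psi> (\<phi> j))) / cost \<psi> (W k j)"
proof -
  define a where "a m = orbit_weight \<psi> k j m * indicator (T ` Q) ((T ^^ m) z)" for m
  define b where "b m = exp (- \<psi> (\<phi> i)) * (orbit_weight \<psi> k j m * indicator Q ((T ^^ m) z))" for m
  define c where "c = cost \<psi> (W k j)"
  have c: "c > 0" unfolding c_def by (rule cost_pos[OF j \<psi>])
  have letter: "W k j ! m = i" if "m < height k j" "(T ^^ m) z \<in> Q" for m
  proof -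
    have "(T ^^ m) z \<in> P (W k j ! m)" using level_letter[OF j that(1)] z by blast
    then show ?thesis using that(2) Q(2) P_disj[OF letter_in[OF j that(1)] i] by blast
  qed
  have next_weight: "exp (- \<psi> (\<phi> i)) * orbit_weight \<psi> k j m = exp (- \<psi> (lsum k j (Suc m))) / c"
    if m: "m < height k j" "(T ^^ m) z \<in> Q" for m
    unfolding orbit_weight_def c_def lsum_Suc[OF m(1)] letter[OF m]
    by (simp add: additive.add[OF \<psi>] exp_add[symmetric] algebra_simps)
  have ab: "a (Suc m) = b m" if m: "Suc m < height k j" for m
  proof -
    have TK: "(T ^^ m) z \<in> K" using orbit_in m by simp
    have QK: "Q \<subseteq> K" using Q(1) by (simp add: sets_BK)
    have "T ((T ^^ m) z) \<in> T ` Q \<longleftrightarrow> (T ^^ m) z \<in> Q" using inj_on_image_mem_iff[OF T_inj TK QK] .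
    then show ?thesis
      using next_weight[of m] m unfolding a_def b_def
      by (cases "(T ^^ m) z \<in> Q") (auto simp: orbit_weight_def c_def indicator_def)
  qed
  obtain n where n: "height k j = Suc n" using height_pos[OF j, of k] by (cases "height k j") auto
  have TQ: "T ` Q \<in> sets borel" "Q \<in> sets borel" using T_image_sets[OF Q(1)] Q(1) by (simp_all add: sets_BK)
  have "measure (orbit_measure \<psi> k j z) (T ` Q) = (\<Sum>m<Suc n. a m)"
    unfolding measure_orbit_measure[OF TQ(1)] n a_def ..
  also have "\<dots> = a 0 + (\<Sum>m<n. b m)"
    using ab n by (simp add: sum.lessThan_Suc_shift del: sum.lessThan_Suc)
  finally have 1: "measure (orbit_measure \<psi> k j z) (T ` Q) = a 0 + (\<Sum>m<n. b m)" .
  have 2: "exp (- \<psi> (\<phi> i)) * measure (orbit_measure \<psi> k j z) Q = (\<Sum>m<n. b m) + b n"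
  proof -
    have "exp (- \<psi> (\<phi> i)) * measure (orbit_measure \<psi> k j z) Q = (\<Sum>m<Suc n. b m)"
      unfolding measure_orbit_measure[OF TQ(2)] n b_def by (rule sum_distrib_left)
    then show ?thesis by simp
  qed
  have "0 \<le> a 0" "a 0 \<le> 1 / c"
    using c additive.zero[OF \<psi>] by (auto simp: a_def orbit_weight_def lsum_def c_def indicator_def)
  moreover have "0 \<le> b n" using orbit_weight_nonneg by (simp add: b_def)
  moreover have "b n \<le> exp (- \<psi> (\<phi> j)) / c"
  proof (cases "(T ^^ n) z \<in> Q")
    case True
    have "lsum k j (Suc n) = \<phi> j" unfolding lsum_def n[symmetric] using S.sum_pow[OF j, of k] by simp
    then show ?thesis using next_weight[of n] True n by (simp add: b_def)
  next
    case False
    then show ?thesis using c by (simp add: b_def)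
  qed
  ultimately show ?thesis using 1 2 by (simp add: c_def[symmetric] add_divide_distrib)
qed

end

section \<open>Clopen subsets of K as test sets for weak limits\<close>

definition clopen :: "real set set" where "clopen = {Q. Q \<subseteq> K \<and> compact Q \<and> compact (K - Q)}"

lemma level_clopen:
  assumes "j \<in> A" "m < height k j"
  shows "level k j m \<in> clopen"
proof -
  define I where "I = Sigma A (\<lambda>j. {..<height k j}) - {(j, m)}"
  have "K - level k j m = (\<Union>(j', m')\<in>I. level k j' m')"
  proof
    show "K - level k j m \<subseteq> (\<Union>(j', m')\<in>I. level k j' m')"
    proof
      fix p assume p: "p \<in> K - level k j m"
      then obtain j' m' where "j' \<in> A" "m' < height k j'" "p \<in> level k j' m'" using level_cover[of k] by blast
      moreover from this have "(j', m') \<noteq> (j, m)" using p by blast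
      ultimately show "p \<in> (\<Union>(j', m')\<in>I. level k j' m')" unfolding I_def by (intro UN_I[of "(j', m')"]) auto
    qed
    show "(\<Union>(j', m')\<in>I. level k j' m') \<subseteq> K - level k j m"
    proof
      fix p assume "p \<in> (\<Union>(j', m')\<in>I. level k j' m')"
      then obtain j' m' where I: "(j', m') \<in> I" "p \<in> level k j' m'" by blast
      then have j': "j' \<in> A" "m' < height k j'" "(j', m') \<noteq> (j, m)" by (auto simp: I_def)
      have "p \<in> K" using I(2) level_sets[OF j'(1), of m' k] by (auto simp only: sets_BK)
      then show "p \<in> K - level k j m" using level_disjoint[OF j'(1,2) assms j'(3)] I(2) by blast
    qed
  qed
  moreover have "compact (\<Union>z\<in>I. (\<lambda>(j', m'). level k j' m') z)"
    using finite_A level_compact by (intro compact_UN) (auto simp: I_def)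
  moreover have "level k j m \<subseteq> K" using level_sets[OF assms(1), of m k] by (simp only: sets_BK)
  ultimately show ?thesis unfolding clopen_def using level_compact[OF assms(1)] by simp
qed

lemma clopen_borel: "Q \<in> clopen \<Longrightarrow> Q \<in> sets BK"
  unfolding sets_BK clopen_def using borel_compact by blast

text \<open>By \<open>mesh\<close> the levels contained in an open set exhaust its trace on
  \<open>K\<close>, and there are only countably many of them.\<close>

lemma sets_BK_clopen: "sets BK = sigma_sets K clopen"
proof
  show "sigma_sets K clopen \<subseteq> sets BK"
    using sets.sigma_sets_subset[of clopen BK] clopen_borel by (auto simp: space_restrict_space)
  have "sets BK = (\<inter>) K ` sigma_sets UNIV {S. open S}"
    by (simp add: sets_restrict_space borel_def)
  also have "\<dots> = sigma_sets K ((\<inter>) K ` {S. open S})"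
  proof (rule sigma_sets_Int)
    show "K \<in> sigma_sets UNIV {S. open S}"
      using closed_K borel_closed[of K] by (simp add: borel_def)
  qed simp
  also have "\<dots> \<subseteq> sigma_sets K clopen"
  proof (rule sigma_sets_mono, safe)
    fix U :: "real set" assume U: "open U"
    interpret sigma_algebra K "sigma_sets K clopen"
      by (rule sigma_algebra_sigma_sets) (auto simp: clopen_def)
    define I where "I k = {(j, m). j \<in> A \<and> m < height k j \<and> level k j m \<subseteq> U}" for k
    have fin: "finite (I k)" for k
      by (rule finite_subset[of _ "Sigma A (\<lambda>j. {..<height k j})"]) (use finite_A in \<open>auto simp: I_def\<close>)
    have "K \<inter> U = (\<Union>k. \<Union>(j, m)\<in>I k. level k j m)"
    proof
      show "K \<inter> U \<subseteq> (\<Union>k. \<Union>(j, m)\<in>I k. level k j m)"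
      proof
        fix p assume p: "p \<in> K \<inter> U"
        then obtain e where e: "e > 0" "ball p e \<subseteq> U" using U openE by blast
        obtain k where k: "\<forall>j\<in>A. \<forall>m<height k j. \<forall>p\<in>level k j m. \<forall>q\<in>level k j m. dist p q < e"
          using mesh[OF e(1)] by blast
        obtain j m where jm: "j \<in> A" "m < height k j" "p \<in> level k j m" using level_cover[of k] p by blast
        then have "level k j m \<subseteq> ball p e" using k by auto
        then have "(j, m) \<in> I k" using jm e by (auto simp: I_def)
        then show "p \<in> (\<Union>k. \<Union>(j, m)\<in>I k. level k j m)" using jm(3) by blast
      qed
      show "(\<Union>k. \<Union>(j, m)\<in>I k. level k j m) \<subseteq> K \<inter> U"
      proof
        fix p assume "p \<in> (\<Union>k. \<Union>(j, m)\<in>I k. level k j m)"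
        then obtain k j m where I: "(j, m) \<in> I k" "p \<in> level k j m" by blast
        then have j: "j \<in> A" "level k j m \<subseteq> U" by (auto simp: I_def)
        have "level k j m \<subseteq> K" using level_sets[OF j(1), of m k] by (simp only: sets_BK)
        then show "p \<in> K \<inter> U" using I(2) j by blast
      qed
    qed
    also have "\<dots> \<in> sigma_sets K clopen"
    proof (rule countable_UN, rule image_subsetI)
      fix k
      show "(\<Union>(j, m)\<in>I k. level k j m) \<in> sigma_sets K clopen"
        using fin level_clopen by (intro finite_UN) (auto simp: I_def)
    qed
    finally show "K \<inter> U \<in> sigma_sets K clopen" .
  qed
  finally show "sets BK \<subseteq> sigma_sets K clopen" .
qed

lemma clopen_Int: "Q \<in> clopen \<Longrightarrow> Q' \<in> clopen \<Longrightarrow> Q \<inter> Q' \<in> clopen"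
  unfolding clopen_def by (auto simp: Diff_Int intro: compact_Int compact_Un)

lemma P_clopen: "i \<in> A \<Longrightarrow> P i \<in> clopen"
  using level_clopen[of i 0 0] C_0[of i] by (simp add: subst_pow_0)

lemma T_clopen:
  assumes "Q \<in> clopen"
  shows "T ` Q \<in> clopen"
proof -
  have Q: "Q \<subseteq> K" "compact Q" "compact (K - Q)" using assms by (auto simp: clopen_def)
  have "K - T ` Q = T ` (K - Q)"
    using inj_on_image_set_diff[OF T_inj, of K Q] Q(1) T_surj by simp
  moreover have "compact (T ` Q)" "compact (T ` (K - Q))"
    using Q continuous_on_subset[OF T_cont] by (auto intro!: compact_continuous_image)
  ultimately show ?thesis using Q(1) T_in unfolding clopen_def by auto
qed

text \<open>Weak convergence on the real line controls sets with null frontier. A limit measure that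
  lives on \<open>K\<close> gives no mass to a frontier missing \<open>K\<close>, so clopen sets
  become continuity sets.\<close>

lemma clopen_open_extension:
  assumes "Q \<in> clopen"
  shows "\<exists>U. open U \<and> U \<inter> K = Q \<and> frontier U \<inter> K = {}"
proof -
  have Q: "Q \<subseteq> K" "compact Q" "compact (K - Q)" using assms by (auto simp: clopen_def)
  have "closed (K - Q)" "Q \<inter> (K - Q) = {}" using Q(3) by (auto intro: compact_imp_closed)
  then obtain U V where UV: "open U" "open V" "Q \<subseteq> U" "K - Q \<subseteq> V" "U \<inter> V = {}"
    using separation_normal_compact[OF Q(2)] by metis
  have "closure U \<inter> V = {}" using UV open_Int_closure_eq_empty[of V U] by blast
  then show ?thesis using UV Q(1) by (intro exI[of _ U]) (auto simp: frontier_def interior_open)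
qed

lemma conformal_exists:
  assumes \<psi>: "Modules.additive \<psi>"
  shows "\<exists>\<nu>. conformal \<psi> \<nu>"
proof -
  have "\<exists>j z. j \<in> A \<and> z \<in> C k j" for k
    using K_ne level_cover[of k] by blast
  then obtain J Z where JZ: "\<And>k. J k \<in> A" "\<And>k. Z k \<in> C k (J k)" by metis
  define N where "N k = orbit_measure \<psi> k (J k) (Z k)" for k
  have dist: "real_distribution (N k)" for k
    unfolding N_def by (rule orbit_measure_distribution[OF \<psi> JZ])
  obtain a b where ab: "K \<subseteq> {a<..b}" "a < b"
  proof -
    obtain c where "\<And>p. p \<in> K \<Longrightarrow> \<bar>p\<bar> \<le> c"
      using compact_imp_bounded[OF compact_K] unfolding bounded_iff by auto
    then have "K \<subseteq> {- c - 1<..\<bar>c\<bar> + 1}" by fastforce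
    moreover have "- c - 1 < \<bar>c\<bar> + 1" by auto
    ultimately show ?thesis using that by blast
  qed
  have "tight N"
    unfolding tight_def
  proof (intro conjI allI impI)
    fix e :: real assume "e > 0"
    moreover have "measure (N k) {a<..b} = 1" for k
      unfolding N_def by (rule orbit_measure_K[OF \<psi> JZ ab(1)]) simp
    ultimately show "\<exists>a b. a < b \<and> (\<forall>n. 1 - e < measure (N n) {a<..b})"
      using ab(2) by (intro exI[of _ a] exI[of _ b]) auto
  qed (rule dist)
  then obtain r M where r: "strict_mono (r :: nat \<Rightarrow> nat)" and M: "real_distribution M"
    and conv: "weak_conv_m (N \<circ> id \<circ> r) M"
    using tight_imp_convergent_subsubsequence[of N id] by (auto simp: strict_mono_def)
  interpret M: real_distribution M by (rule M)
  have dist': "real_distribution ((N \<circ> id \<circ> r) n)" for n using dist by simp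
  have Kb: "K \<in> sets borel" using closed_K by (rule borel_closed)
  have MK: "measure M K = 1"
  proof -
    \<comment> \<open>A bounded continuous function vanishing exactly on \<open>K\<close>: its
      integrals against all \<open>N k\<close> are \<open>0\<close>, hence so is the one against the
      limit.\<close>
    define f where "f t = min 1 (infdist t K)" for t
    have cont: "isCont f t" for t unfolding f_def by (intro continuous_intros)
    have bdd: "norm (f t) \<le> 1" for t using infdist_nonneg[of t K] by (simp add: f_def)
    have f0: "f t = 0 \<longleftrightarrow> t \<in> K" for t
      using in_closed_iff_infdist_zero[OF closed_K K_ne, of t] infdist_nonneg[of t K] by (auto simp: f_def min_def)
    have fm: "f \<in> borel_measurable borel"
      using cont by (intro borel_measurable_continuous_onI continuous_at_imp_continuous_on) auto
    have "integral\<^sup>L (N k) f = 0" for k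
    proof -
      interpret N: real_distribution "N k" by (rule dist)
      have "measure (N k) K = 1" unfolding N_def by (rule orbit_measure_K[OF \<psi> JZ order_refl Kb])
      then have "AE t in N k. t \<in> K" using N.prob_eq_1[of K] Kb by simp
      then show ?thesis using f0 fm by (subst integral_cong_AE[of _ _ "\<lambda>_. 0"]) auto
    qed
    then have "(\<lambda>n. integral\<^sup>L ((N \<circ> id \<circ> r) n) f) = (\<lambda>n. 0)" by auto
    moreover have "(\<lambda>n. integral\<^sup>L ((N \<circ> id \<circ> r) n) f) \<longlonglongrightarrow> integral\<^sup>L M f"
      by (rule weak_conv_imp_integral_bdd_continuous_conv[OF dist' M conv cont bdd])
    ultimately have "integral\<^sup>L M f = 0" using LIMSEQ_unique[OF _ tendsto_const] by metis
    moreover have "integrable M f" using bdd fm by (intro M.integrable_const_bound[where B=1]) auto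
    moreover have "AE t in M. 0 \<le> f t" using infdist_nonneg[of _ K] by (simp add: f_def)
    ultimately have "AE t in M. f t = 0" using integral_nonneg_eq_0_iff_AE[of M f] by simp
    then show ?thesis using f0 Kb M.prob_eq_1[of K] by simp
  qed
  have clopen_conv: "(\<lambda>n. measure (N (r n)) Q) \<longlonglongrightarrow> measure M Q" if Q: "Q \<in> clopen" for Q
  proof -
    obtain U where U: "open U" "U \<inter> K = Q" "frontier U \<inter> K = {}" using clopen_open_extension[OF Q] by blast
    have Qb: "Q \<in> sets borel" using clopen_borel[OF Q] by (simp add: sets_BK)
    have Ub: "U \<in> sets borel" "frontier U \<in> sets borel" using U(1) by (auto simp: frontier_closed)
    have KM: "AE t in M. t \<in> K" using MK M.prob_eq_1[of K] Kb by simp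
    have "AE t in M. t \<notin> frontier U" using KM by eventually_elim (use U(3) in blast)
    then have "emeasure M (frontier U) = 0" using Ub(2) by (subst (asm) AE_iff_measurable) auto
    then have "(\<lambda>n. measure ((N \<circ> id \<circ> r) n) U) \<longlonglongrightarrow> measure M U"
      using weak_conv_imp_continuity_set_conv[OF dist' M conv Ub(1)] by blast
    moreover have "measure M U = measure M Q"
      using KM Ub(1) Qb U(2) by (intro M.finite_measure_eq_AE) auto
    moreover have "measure ((N \<circ> id \<circ> r) n) U = measure (N (r n)) Q" for n
      unfolding N_def o_def id_def using U(2) by (intro orbit_measure_inter[OF \<psi> JZ Ub(1) Qb]) blast
    ultimately show ?thesis by simp
  qed
  obtain c where c: "c > 0" "\<And>k j. j \<in> A \<Longrightarrow> (1 + c) ^ k \<le> cost \<psi> (W k j)"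
    using cost_growth[OF \<psi>] by blast
  define B where "B = Max ((\<lambda>j. exp (- \<psi> (\<phi> j))) ` A)"
  have B: "exp (- \<psi> (\<phi> j)) \<le> B" if "j \<in> A" for j unfolding B_def using finite_A that by auto
  have "0 \<le> B" using B[OF JZ(1)] exp_ge_zero order_trans by blast
  have conf_clopen: "measure M (T ` Q) = exp (- \<psi> (\<phi> i)) * measure M Q"
    if i: "i \<in> A" and Q: "Q \<in> clopen" "Q \<subseteq> P i" for i Q
  proof -
    have "(\<lambda>n. measure (N (r n)) (T ` Q) - exp (- \<psi> (\<phi> i)) * measure (N (r n)) Q) \<longlonglongrightarrow> 0"
    proof (rule Lim_null_comparison)
      have "(\<lambda>n. (1 + B) * (1 / (1 + c)) ^ n) \<longlonglongrightarrow> (1 + B) * 0"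
        using c(1) by (intro tendsto_mult_left LIMSEQ_power_zero) auto
      then show "(\<lambda>n. (1 + B) * (1 / (1 + c)) ^ n) \<longlonglongrightarrow> 0" by simp
      show "\<forall>\<^sub>F n in sequentially. norm (measure (N (r n)) (T ` Q) - exp (- \<psi> (\<phi> i)) * measure (N (r n)) Q)
          \<le> (1 + B) * (1 / (1 + c)) ^ n"
      proof (rule always_eventually, rule allI)
        fix n
        have "norm (measure (N (r n)) (T ` Q) - exp (- \<psi> (\<phi> i)) * measure (N (r n)) Q)
            \<le> (1 + exp (- \<psi> (\<phi> (J (r n))))) / cost \<psi> (W (r n) (J (r n)))"
          unfolding N_def real_norm_def by (rule orbit_measure_conformal[OF \<psi> JZ i clopen_borel[OF Q(1)] Q(2)])
        also have "\<dots> \<le> (1 + B) / (1 + c) ^ n"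
        proof (rule frac_le)
          have "(1 + c) ^ n \<le> (1 + c) ^ r n" using c(1) seq_suble[OF r, of n] by (intro power_increasing) auto
          then show "(1 + c) ^ n \<le> cost \<psi> (W (r n) (J (r n)))" using c(2)[OF JZ(1)] by (meson order_trans)
        qed (use B[OF JZ(1)] c(1) \<open>0 \<le> B\<close> in auto)
        finally show "norm (measure (N (r n)) (T ` Q) - exp (- \<psi> (\<phi> i)) * measure (N (r n)) Q)
          \<le> (1 + B) * (1 / (1 + c)) ^ n" by (simp add: power_divide)
      qed
    qed
    moreover have "(\<lambda>n. measure (N (r n)) (T ` Q) - exp (- \<psi> (\<phi> i)) * measure (N (r n)) Q) \<longlonglongrightarrow>
        measure M (T ` Q) - exp (- \<psi> (\<phi> i)) * measure M Q"
      using Q by (intro tendsto_intros clopen_conv T_clopen)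
    ultimately show ?thesis using LIMSEQ_unique by fastforce
  qed
  define \<nu> where "\<nu> = restrict_space M K"
  have s\<nu>: "sets \<nu> = sets BK" unfolding \<nu>_def by (rule sets_restrict_space_cong) simp
  have space\<nu>: "space \<nu> = K" by (simp add: \<nu>_def space_restrict_space)
  have e\<nu>: "emeasure \<nu> X = ennreal (measure M X)" if "X \<in> sets BK" for X
    using that Kb unfolding \<nu>_def by (subst emeasure_restrict_space) (auto simp: sets_BK M.emeasure_eq_measure)
  have "emeasure \<nu> K = 1" using e\<nu>[OF K_sets] MK by simp
  moreover have fin: "finite_measure \<nu>"
    by (rule finite_measureI) (simp add: space\<nu> e\<nu>[OF K_sets])
  moreover have "emeasure \<nu> (T ` X) = ennreal (exp (- \<psi> (\<phi> i))) * emeasure \<nu> X"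
    if i: "i \<in> A" and X: "X \<in> sets BK" "X \<subseteq> P i" for i X
  proof -
    define e where "e = exp (- \<psi> (\<phi> i))"
    have TP: "T ` P i \<in> sets BK" using T_image_sets P_sets i by blast
    \<comment> \<open>The two sides of the conformal equation, restricted to \<open>P i\<close>, as
      measures of the variable set. They agree on clopen sets, which are stable under intersections
      and generate.\<close>
    define \<nu>1 where "\<nu>1 = distr (restrict_space \<nu> (T ` P i)) BK Ti"
    define \<nu>2 where "\<nu>2 = density \<nu> (\<lambda>p. ennreal e * indicator (P i) p)"
    have Tim: "Ti \<in> measurable (restrict_space \<nu> (T ` P i)) BK"
      by (rule measurable_restrict_space1) (use Ti_meas in \<open>simp add: measurable_cong_sets[OF s\<nu> refl]\<close>)
    have 1: "emeasure \<nu>1 Y = ennreal (measure M (T ` (Y \<inter> P i)))" if Y: "Y \<in> sets BK" for Y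
    proof -
      have YK: "Y \<subseteq> K" using Y by (simp add: sets_BK)
      have "emeasure \<nu>1 Y = emeasure (restrict_space \<nu> (T ` P i)) (Ti -` Y \<inter> space (restrict_space \<nu> (T ` P i)))"
        unfolding \<nu>1_def by (rule emeasure_distr[OF Tim Y])
      also have "space (restrict_space \<nu> (T ` P i)) = T ` P i"
        using TP by (auto simp: space_restrict_space space\<nu> sets_BK)
      also have "Ti -` Y \<inter> T ` P i = T ` (Y \<inter> P i)"
        using Ti_T P_sub[OF i] by (auto 4 4)
      also have "emeasure (restrict_space \<nu> (T ` P i)) (T ` (Y \<inter> P i)) = emeasure \<nu> (T ` (Y \<inter> P i))"
        using TP s\<nu> by (intro emeasure_restrict_space) auto
      also have "\<dots> = ennreal (measure M (T ` (Y \<inter> P i)))"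
        using e\<nu>[OF T_image_sets[OF sets.Int[OF Y P_sets[OF i]]]] .
      finally show ?thesis .
    qed
    have 2: "emeasure \<nu>2 Y = ennreal e * ennreal (measure M (Y \<inter> P i))" if Y: "Y \<in> sets BK" for Y
    proof -
      have "emeasure \<nu>2 Y = (\<integral>\<^sup>+p. ennreal e * indicator (P i) p * indicator Y p \<partial>\<nu>)"
        unfolding \<nu>2_def using Y P_sets[OF i] s\<nu> by (intro emeasure_density) auto
      also have "\<dots> = (\<integral>\<^sup>+p. ennreal e * indicator (Y \<inter> P i) p \<partial>\<nu>)"
        by (intro nn_integral_cong) (auto simp: indicator_def)
      also have "\<dots> = ennreal e * emeasure \<nu> (Y \<inter> P i)"
        using Y P_sets[OF i] s\<nu> by (intro nn_integral_cmult_indicator) auto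
      finally show ?thesis using e\<nu>[OF sets.Int[OF Y P_sets[OF i]]] by simp
    qed
    have "\<nu>1 = \<nu>2"
    proof (rule measure_eqI_generator_eq[where E=clopen and \<Omega>=K and A="\<lambda>_. K"])
      show "Int_stable clopen" using clopen_Int by (auto simp: Int_stable_def)
      show "clopen \<subseteq> Pow K" by (auto simp: clopen_def)
      show "emeasure \<nu>1 Y = emeasure \<nu>2 Y" if Y: "Y \<in> clopen" for Y
        using 1[OF clopen_borel[OF Y]] 2[OF clopen_borel[OF Y]]
          conf_clopen[OF i clopen_Int[OF Y P_clopen[OF i]]]
        by (simp add: e_def ennreal_mult[symmetric])
      show "sets \<nu>1 = sigma_sets K clopen" "sets \<nu>2 = sigma_sets K clopen"
        using sets_BK_clopen s\<nu> by (auto simp: \<nu>1_def \<nu>2_def)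
      show "range (\<lambda>_. K) \<subseteq> clopen" using compact_K by (auto simp: clopen_def)
      show "emeasure \<nu>1 K \<noteq> \<infinity>" using 1[OF K_sets] by simp
    qed simp
    then have "emeasure \<nu>1 X = emeasure \<nu>2 X" by simp
    then show ?thesis
      using 1[OF X(1)] 2[OF X(1)] e\<nu>[OF X(1)] e\<nu>[OF T_image_sets[OF X(1)]] X(2)
      by (simp add: e_def Int_absorb2)
  qed
  ultimately have "conformal \<psi> \<nu>" unfolding conformal_def using s\<nu> by simp
  then show ?thesis by blast
qed

end

section \<open>Classification\<close>

context piece_system
begin

lemma conformal_sum:
  assumes \<nu>: "conformal \<psi> \<nu>" and \<nu>': "conformal \<psi> \<nu>'"
  shows "\<exists>N. conformal \<psi> N \<and> (\<forall>B\<in>sets BK. emeasure N B = emeasure \<nu> B + emeasure \<nu>' B)"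
proof -
  note C = conformalD[OF \<nu>] and C' = conformalD[OF \<nu>']
  interpret \<nu>: finite_measure \<nu> by (rule C(2))
  interpret \<nu>': finite_measure \<nu>' by (rule C'(2))
  define N where "N = measure_of K (sets BK) (\<lambda>B. emeasure \<nu> B + emeasure \<nu>' B)"
  have sub: "sets BK \<subseteq> Pow K" using sets_BK by blast
  have sBK: "sigma_sets K (sets BK) = sets BK"
    using sets.sigma_sets_eq[of BK] by (simp add: space_restrict_space)
  have sN: "sets N = sets BK" unfolding N_def using sub sBK by simp
  have e: "emeasure N B = emeasure \<nu> B + emeasure \<nu>' B" if B: "B \<in> sets BK" for B
  proof (rule emeasure_measure_of[OF N_def sub])
    show "positive (sets N) (\<lambda>B. emeasure \<nu> B + emeasure \<nu>' B)" by (simp add: positive_def)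
    show "countably_additive (sets N) (\<lambda>B. emeasure \<nu> B + emeasure \<nu>' B)"
    proof (rule countably_additiveI)
      fix X :: "nat \<Rightarrow> real set" assume X: "range X \<subseteq> sets N" "disjoint_family X"
      have "(\<Sum>i. emeasure \<nu> (X i) + emeasure \<nu>' (X i)) = (\<Sum>i. emeasure \<nu> (X i)) + (\<Sum>i. emeasure \<nu>' (X i))"
        by (rule suminf_add[symmetric, OF summableI summableI])
      also have "\<dots> = emeasure \<nu> (\<Union>i. X i) + emeasure \<nu>' (\<Union>i. X i)"
        using suminf_emeasure[of X \<nu>] suminf_emeasure[of X \<nu>'] X C(1) C'(1) sN by simp
      finally show "(\<Sum>i. emeasure \<nu> (X i) + emeasure \<nu>' (X i)) = emeasure \<nu> (\<Union>i. X i) + emeasure \<nu>' (\<Union>i. X i)" .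
    qed
    show "B \<in> sets N" using B sN by simp
  qed
  have "space N = K" using sets_eq_imp_space_eq[OF sN] by (simp add: space_restrict_space)
  then have "finite_measure N"
    using e[OF K_sets] by (intro finite_measureI) simp
  moreover have "emeasure N (T ` B) = ennreal (exp (- \<psi> (\<phi> i))) * emeasure N B"
    if "i \<in> A" "B \<in> sets BK" "B \<subseteq> P i" for i B
    using C(5)[OF that] C'(5)[OF that] e[OF that(2)] e[OF T_image_sets[OF that(2)]] by (simp add: distrib_left)
  ultimately have "conformal \<psi> N" unfolding conformal_def using sN e[OF K_sets] C(3) by simp
  then show ?thesis using e by blast
qed

section \<open>Equivalence with the Radon-Nikodym form of conformality\<close>

lemma measure_comp_distr:
  assumes "sets \<nu> = sets BK"
  shows "measure_comp \<nu> T = distr \<nu> BK Ti" and "B \<in> sets BK \<Longrightarrow> emeasure (measure_comp \<nu> T) B = emeasure \<nu> (T ` B)"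
proof -
  have space: "space \<nu> = K" using sets_eq_imp_space_eq[OF assms] by (simp add: space_restrict_space)
  have im: "Ti -` B \<inter> K = T ` B" if "B \<in> sets BK" for B
  proof
    have "B \<subseteq> K" using that by (simp add: sets_BK)
    then show "T ` B \<subseteq> Ti -` B \<inter> K" using Ti_T T_in by auto
    show "Ti -` B \<inter> K \<subseteq> T ` B"
    proof
      fix p assume p: "p \<in> Ti -` B \<inter> K"
      then have "p = T (Ti p)" using T_Ti by simp
      then show "p \<in> T ` B" using p by blast
    qed
  qed
  have sBK: "sigma_sets K (sets BK) = sets BK"
    using sets.sigma_sets_eq[of BK] by (simp add: space_restrict_space)
  \<comment> \<open>Rewriting images under \<open>T\<close> as preimages under its inverse exhibits
    \<open>measure_comp\<close> as a push-forward; this shows that its set function is countably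
    additive, so that \<open>measure_of\<close> takes the intended values.\<close>
  have "measure_of K (sets BK) (\<lambda>B. emeasure \<nu> (T ` B)) = measure_of K (sets BK) (\<lambda>B. emeasure \<nu> (Ti -` B \<inter> K))"
    using sBK im by (intro measure_of_eq) (auto simp: sets_BK)
  then show eq: "measure_comp \<nu> T = distr \<nu> BK Ti"
    unfolding measure_comp_def distr_def space assms by (simp add: space_restrict_space)
  have "Ti \<in> measurable \<nu> BK" using Ti_meas by (simp add: measurable_cong_sets[OF assms refl])
  then show "emeasure (measure_comp \<nu> T) B = emeasure \<nu> (T ` B)" if "B \<in> sets BK"
    unfolding eq using emeasure_distr[of Ti \<nu> BK B] that im[OF that] space by simp
qed

text \<open>\<open>h\<close> writes the density as a finite sum over the pieces, which gives
  measurability and turns integrals into finite sums of masses.\<close>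

lemma conformal_iff_density:
  assumes s: "sets \<nu> = sets BK"
  shows "(\<lambda>p. ennreal (exp (- \<psi> (cocycle p)))) \<in> borel_measurable \<nu>"
    and "(\<forall>i\<in>A. \<forall>B\<in>sets BK. B \<subseteq> P i \<longrightarrow> emeasure \<nu> (T ` B) = ennreal (exp (- \<psi> (\<phi> i))) * emeasure \<nu> B) \<longleftrightarrow>
      measure_comp \<nu> T = density \<nu> (\<lambda>p. ennreal (exp (- \<psi> (cocycle p))))"
proof -
  have space: "space \<nu> = K" using sets_eq_imp_space_eq[OF s] by (simp add: space_restrict_space)
  let ?f = "\<lambda>p. ennreal (exp (- \<psi> (cocycle p)))"
  let ?e = "\<lambda>i. ennreal (exp (- \<psi> (\<phi> i)))"
  define h where "h p = (\<Sum>i\<in>A. ?e i * indicator (P i) p)" for p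
  have hf: "h p = ?f p" if "p \<in> K" for p
  proof -
    obtain i where i: "i \<in> A" "p \<in> P i" using piece[OF \<open>p \<in> K\<close>] by blast
    have "h p = (\<Sum>j\<in>{i}. ?e j * indicator (P j) p)"
      unfolding h_def using i finite_A P_disj
      by (intro sum.mono_neutral_right) (auto simp: indicator_def)
    then show ?thesis using i cocycle_eq by simp
  qed
  have hm: "h \<in> borel_measurable \<nu>"
    unfolding h_def using P_sets s by (intro borel_measurable_sum borel_measurable_times_ennreal) auto
  then show fm: "?f \<in> borel_measurable \<nu>"
    by (rule measurable_cong[THEN iffD1, rotated]) (use hf space in auto)
  have dens: "emeasure (density \<nu> ?f) B = (\<Sum>i\<in>A. ?e i * emeasure \<nu> (B \<inter> P i))" if B: "B \<in> sets BK" for B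
  proof -
    have "emeasure (density \<nu> ?f) B = (\<integral>\<^sup>+p. ?f p * indicator B p \<partial>\<nu>)"
      using fm B s by (intro emeasure_density) auto
    also have "\<dots> = (\<integral>\<^sup>+p. (\<Sum>i\<in>A. ?e i * indicator (B \<inter> P i) p) \<partial>\<nu>)"
    proof (rule nn_integral_cong)
      fix p assume "p \<in> space \<nu>"
      then have "?f p * indicator B p = h p * indicator B p" using hf space by simp
      also have "\<dots> = (\<Sum>i\<in>A. ?e i * indicator (B \<inter> P i) p)"
        unfolding h_def sum_distrib_right by (intro sum.cong refl) (auto simp: indicator_def)
      finally show "?f p * indicator B p = (\<Sum>i\<in>A. ?e i * indicator (B \<inter> P i) p)" .
    qed
    also have "\<dots> = (\<Sum>i\<in>A. \<integral>\<^sup>+p. ?e i * indicator (B \<inter> P i) p \<partial>\<nu>)"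
      using B P_sets s by (intro nn_integral_sum) auto
    also have "\<dots> = (\<Sum>i\<in>A. ?e i * emeasure \<nu> (B \<inter> P i))"
      using B P_sets s by (intro sum.cong refl nn_integral_cmult_indicator) auto
    finally show ?thesis .
  qed
  show "(\<forall>i\<in>A. \<forall>B\<in>sets BK. B \<subseteq> P i \<longrightarrow> emeasure \<nu> (T ` B) = ?e i * emeasure \<nu> B) \<longleftrightarrow>
      measure_comp \<nu> T = density \<nu> ?f"
  proof
    assume c: "\<forall>i\<in>A. \<forall>B\<in>sets BK. B \<subseteq> P i \<longrightarrow> emeasure \<nu> (T ` B) = ?e i * emeasure \<nu> B"
    show "measure_comp \<nu> T = density \<nu> ?f"
    proof (rule measure_eqI)
      show "sets (measure_comp \<nu> T) = sets (density \<nu> ?f)"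
        using s by (simp add: measure_comp_distr(1)[OF s])
      fix B assume "B \<in> sets (measure_comp \<nu> T)"
      then have B: "B \<in> sets BK" by (simp add: measure_comp_distr(1)[OF s])
      have BP: "B \<inter> P i \<in> sets BK" if "i \<in> A" for i using B P_sets[OF that] by (rule sets.Int)
      have "B \<subseteq> K" using B by (simp add: sets_BK)
      then have "B = (\<Union>i\<in>A. B \<inter> P i)" using P_cover by blast
      then have "T ` B = (\<Union>i\<in>A. T ` (B \<inter> P i))" by blast
      moreover have "disjoint_family_on (\<lambda>i. T ` (B \<inter> P i)) A"
        unfolding disjoint_family_on_def
      proof (intro ballI impI)
        fix i j assume ij: "i \<in> A" "j \<in> A" "i \<noteq> j"
        have "T ` (B \<inter> P i) \<inter> T ` (B \<inter> P j) = T ` ((B \<inter> P i) \<inter> (B \<inter> P j))"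
          using P_sub ij by (intro inj_on_image_Int[OF T_inj, symmetric]) auto
        then show "T ` (B \<inter> P i) \<inter> T ` (B \<inter> P j) = {}" using P_disj[OF ij] by auto
      qed
      ultimately have "emeasure \<nu> (T ` B) = (\<Sum>i\<in>A. emeasure \<nu> (T ` (B \<inter> P i)))"
        using T_image_sets[OF BP] s finite_A by (simp add: sum_emeasure image_subset_iff)
      also have "\<dots> = (\<Sum>i\<in>A. ?e i * emeasure \<nu> (B \<inter> P i))"
        using c BP by (intro sum.cong refl) auto
      finally show "emeasure (measure_comp \<nu> T) B = emeasure (density \<nu> ?f) B"
        using dens[OF B] measure_comp_distr(2)[OF s B] by simp
    qed
  next
    assume d: "measure_comp \<nu> T = density \<nu> ?f"
    show "\<forall>i\<in>A. \<forall>B\<in>sets BK. B \<subseteq> P i \<longrightarrow> emeasure \<nu> (T ` B) = ?e i * emeasure \<nu> B"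
    proof (intro ballI impI)
      fix i B assume i: "i \<in> A" and B: "B \<in> sets BK" "B \<subseteq> P i"
      have "emeasure \<nu> (T ` B) = (\<Sum>j\<in>A. ?e j * emeasure \<nu> (B \<inter> P j))"
        using dens[OF B(1)] measure_comp_distr(2)[OF s B(1)] d by simp
      also have "\<dots> = (\<Sum>j\<in>{i}. ?e j * emeasure \<nu> (B \<inter> P j))"
      proof (rule sum.mono_neutral_right[OF finite_A])
        show "\<forall>j\<in>A - {i}. ?e j * emeasure \<nu> (B \<inter> P j) = 0"
        proof
          fix j assume "j \<in> A - {i}"
          then have "B \<inter> P j = {}" using B(2) P_disj[of i j] i by blast
          then show "?e j * emeasure \<nu> (B \<inter> P j) = 0" by simp
        qed
      qed (use i in auto)
      finally show "emeasure \<nu> (T ` B) = ?e i * emeasure \<nu> B" using B(2) by (simp add: Int_absorb2)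
    qed
  qed
qed

text \<open>A Radon-Nikodym derivative is determined almost everywhere, so prescribing it amounts to
  naming a density; quasi-invariance ensures that \<open>RN_deriv\<close> really is one.\<close>

lemma conformal_iff_RN_deriv:
  "conformal \<psi> \<nu> \<longleftrightarrow> sets \<nu> = sets BK \<and> finite_measure \<nu> \<and> emeasure \<nu> K \<noteq> 0 \<and> quasi_invariant T \<nu> \<and>
     (AE p in \<nu>. RN_deriv \<nu> (measure_comp \<nu> T) p = ennreal (exp (- \<psi> (cocycle p))))"
  (is "_ \<longleftrightarrow> ?R")
proof
  let ?f = "\<lambda>p. ennreal (exp (- \<psi> (cocycle p)))"
  assume c: "conformal \<psi> \<nu>"
  note C = conformalD[OF c]
  interpret finite_measure \<nu> by (rule C(2))
  have d: "measure_comp \<nu> T = density \<nu> ?f"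
    using conformal_iff_density(2)[OF C(1)] c unfolding conformal_def by blast
  have "AE p in \<nu>. ?f p = RN_deriv \<nu> (measure_comp \<nu> T) p"
    by (rule RN_deriv_unique[OF conformal_iff_density(1)[OF C(1)] d[symmetric]])
  then have "AE p in \<nu>. RN_deriv \<nu> (measure_comp \<nu> T) p = ?f p" by eventually_elim simp
  moreover have "quasi_invariant T \<nu>"
    unfolding quasi_invariant_def d
    by (rule absolutely_continuousI_density[OF conformal_iff_density(1)[OF C(1)]])
  ultimately show ?R using C by blast
next
  let ?f = "\<lambda>p. ennreal (exp (- \<psi> (cocycle p)))"
  assume r: ?R
  then have s: "sets \<nu> = sets BK" by blast
  interpret finite_measure \<nu> using r by blast
  have "density \<nu> (RN_deriv \<nu> (measure_comp \<nu> T)) = measure_comp \<nu> T"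
    using r by (intro density_RN_deriv) (auto simp: quasi_invariant_def measure_comp_distr(1)[OF s])
  moreover have "density \<nu> (RN_deriv \<nu> (measure_comp \<nu> T)) = density \<nu> ?f"
    using r conformal_iff_density(1)[OF s] by (intro density_cong) auto
  ultimately have "measure_comp \<nu> T = density \<nu> ?f" by simp
  then show "conformal \<psi> \<nu>" using conformal_iff_density(2)[OF s] r unfolding conformal_def by blast
qed

end

text \<open>Towers are asked for separately for each \<open>g\<close>, since the substitution
  realising \<open>g\<close> varies. Conformality, periods and ergodicity are defined without
  towers, so the results for different \<open>g\<close> can be combined.\<close>

locale renormalized_system = piece_system K T A P \<phi>
  for K :: "real set" and T :: "real \<Rightarrow> real" and A :: "nat set" and P :: "nat \<Rightarrow> real set"
    and \<phi> :: "nat \<Rightarrow> 'g::{ab_group_add, countable}" +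
  assumes towers: "\<exists>C w. tower_system K T A P \<phi> C w \<and>
    (\<forall>i\<in>A. \<forall>j\<in>A. \<exists>m m'. m < length (w j) \<and> m' < length (w j) \<and> w j ! m = i \<and> w j ! m' = i \<and>
      sum_list (map \<phi> (take m' (w j))) - sum_list (map \<phi> (take m (w j))) = g)"
begin

lemma tower_with_words:
  obtains C w where "tower_system K T A P \<phi> C w"
    and "\<And>i j. i \<in> A \<Longrightarrow> j \<in> A \<Longrightarrow> \<exists>m m'. (j, m) \<in> tower_system.occ A w i \<and> (j, m') \<in> tower_system.occ A w i \<and>
      tower_system.psum \<phi> w j m' - tower_system.psum \<phi> w j m = g"
proof -
  obtain C w where tw: "tower_system K T A P \<phi> C w" and words: "\<forall>i\<in>A. \<forall>j\<in>A. \<exists>m m'. m < length (w j) \<and>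
      m' < length (w j) \<and> w j ! m = i \<and> w j ! m' = i \<and>
      sum_list (map \<phi> (take m' (w j))) - sum_list (map \<phi> (take m (w j))) = g"
    using towers[of g] by blast
  interpret tower_system K T A P \<phi> C w by (rule tw)
  show ?thesis
  proof (rule that[OF tw])
    fix i j assume ij: "i \<in> A" "j \<in> A"
    then obtain m m' where "m < length (w j)" "m' < length (w j)" "w j ! m = i" "w j ! m' = i"
      "sum_list (map \<phi> (take m' (w j))) - sum_list (map \<phi> (take m (w j))) = g" using words by blast
    then show "\<exists>m m'. (j, m) \<in> occ i \<and> (j, m') \<in> occ i \<and> psum j m' - psum j m = g"
      using ij by (intro exI[of _ m] exI[of _ m']) (auto simp: occ_def psum_def)
  qed
qed

lemma maharam_ergodic:
  assumes \<psi>: "Modules.additive \<psi>" and \<nu>: "conformal \<psi> \<nu>"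
  shows "ergodic (maharam_measure \<psi> \<nu>)"
  unfolding ergodic_def
proof (intro allI impI)
  fix E assume E: "inv_set E"
  have inv: "measure \<nu> (sec E a - sec E (a - g)) = 0" for a g
  proof -
    obtain C w where t: "tower_system K T A P \<phi> C w" and
      words: "\<And>i j. i \<in> A \<Longrightarrow> j \<in> A \<Longrightarrow> \<exists>m m'. (j, m) \<in> tower_system.occ A w i \<and> (j, m') \<in> tower_system.occ A w i \<and>
        tower_system.psum \<phi> w j m' - tower_system.psum \<phi> w j m = g"
      by (rule tower_with_words[of g]) blast
    show ?thesis by (rule tower_system.invariant_under_period[OF t words \<psi> \<nu> E])
  qed
  obtain C w where t: "tower_system K T A P \<phi> C w" by (rule tower_with_words)
  show "emeasure (maharam_measure \<psi> \<nu>) E = 0 \<or> emeasure (maharam_measure \<psi> \<nu>) (\<Omega> - E) = 0"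
    by (rule tower_system.ergodic_of_periods[OF t \<psi> \<nu> E inv])
qed

lemma conformal_unique:
  assumes \<psi>: "Modules.additive \<psi>" and \<nu>: "conformal \<psi> \<nu>" and \<nu>': "conformal \<psi> \<nu>'"
  shows "\<exists>c>0. \<nu>' = scale_measure (ennreal c) \<nu>"
proof -
  note S = conformalD(1)[OF \<nu>] conformalD(1)[OF \<nu>']
  have fe: "ennreal (exp (\<psi> a)) \<noteq> 0" "ennreal (exp (\<psi> a)) \<noteq> top" for a by auto
  from ergodic_dichotomy[OF maharam_radon_inv[OF \<psi> \<nu>] maharam_ergodic[OF \<psi> \<nu>]
      maharam_radon_inv[OF \<psi> \<nu>'] maharam_ergodic[OF \<psi> \<nu>']]
  show ?thesis
  proof (elim disjE exE conjE)
    fix c :: real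
    assume c: "c > 0" "\<forall>a. \<forall>B\<in>sets BK. emeasure (maharam_measure \<psi> \<nu>') (B \<times> {a}) =
      ennreal c * emeasure (maharam_measure \<psi> \<nu>) (B \<times> {a})"
    have "\<nu>' = scale_measure (ennreal c) \<nu>"
    proof (rule measure_eqI)
      fix B assume "B \<in> sets \<nu>'"
      then have B: "B \<in> sets BK" using S by simp
      have "emeasure (maharam_measure \<psi> \<nu>') (B \<times> {0}) = ennreal c * emeasure (maharam_measure \<psi> \<nu>) (B \<times> {0})"
        using c(2) B by blast
      then show "emeasure \<nu>' B = emeasure (scale_measure (ennreal c) \<nu>) B"
        using emeasure_maharam[OF S(1) B, of \<psi> 0] emeasure_maharam[OF S(2) B, of \<psi> 0] additive.zero[OF \<psi>]
        by simp
    qed (use S in simp)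
    then show ?thesis using c(1) by blast
  next
    \<comment> \<open>In the singular case \<open>E\<close> would split the Maharam measure of the
      sum into two invariant parts of positive mass.\<close>
    fix E assume E: "inv_set E" "emeasure (maharam_measure \<psi> \<nu>) (\<Omega> - E) = 0" "emeasure (maharam_measure \<psi> \<nu>') E = 0"
    have Es: "E \<in> sets PM" "\<Omega> - E \<in> sets PM" using E(1) inv_set_compl[OF E(1)] by (auto simp: inv_set_def)
    obtain N where N: "conformal \<psi> N" "\<And>B. B \<in> sets BK \<Longrightarrow> emeasure N B = emeasure \<nu> B + emeasure \<nu>' B"
      using conformal_sum[OF \<nu> \<nu>'] by blast
    note SN = conformalD(1)[OF N(1)]
    have sum: "emeasure (maharam_measure \<psi> N) X = emeasure (maharam_measure \<psi> \<nu>) X + emeasure (maharam_measure \<psi> \<nu>') X"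
      if X: "X \<in> sets PM" for X
    proof -
      have "emeasure (maharam_measure \<psi> N) (sec X a \<times> {a}) =
          emeasure (maharam_measure \<psi> \<nu>) (sec X a \<times> {a}) + emeasure (maharam_measure \<psi> \<nu>') (sec X a \<times> {a})" for a
        unfolding emeasure_maharam[OF SN sec_sets[OF X]] emeasure_maharam[OF S(1) sec_sets[OF X]]
          emeasure_maharam[OF S(2) sec_sets[OF X]] N(2)[OF sec_sets[OF X]] by (rule distrib_right)
      then show ?thesis
        unfolding emeasure_slices[OF sets_maharam[OF SN] X] emeasure_slices[OF sets_maharam[OF S(1)] X]
          emeasure_slices[OF sets_maharam[OF S(2)] X] by (simp add: nn_integral_add)
    qed
    have whole: "emeasure (maharam_measure \<psi> M) \<Omega> = emeasure (maharam_measure \<psi> M) E + emeasure (maharam_measure \<psi> M) (\<Omega> - E)"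
      if "sets M = sets BK" for M
    proof -
      have "E \<union> (\<Omega> - E) = \<Omega>" using PM_sub[OF Es(1)] by blast
      then show ?thesis
        using plus_emeasure[of E "maharam_measure \<psi> M" "\<Omega> - E"] Es sets_maharam[OF that] by simp
    qed
    have "emeasure (maharam_measure \<psi> \<nu>) E \<noteq> 0"
      using whole[OF S(1)] E(2) radon_invD(3)[OF maharam_radon_inv[OF \<psi> \<nu>]] by simp
    moreover have "emeasure (maharam_measure \<psi> \<nu>') (\<Omega> - E) \<noteq> 0"
      using whole[OF S(2)] E(3) radon_invD(3)[OF maharam_radon_inv[OF \<psi> \<nu>']] by simp
    moreover have "emeasure (maharam_measure \<psi> N) E = 0 \<or> emeasure (maharam_measure \<psi> N) (\<Omega> - E) = 0"
      using maharam_ergodic[OF \<psi> N(1)] E(1) ergodic_def by blast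
    ultimately show ?thesis using sum[OF Es(1)] sum[OF Es(2)] by simp
  qed
qed

text \<open>Every \<open>g\<close> is a period, and the proportionality constants are multiplicative
  because one fibre has finite positive mass. The fibre over \<open>0\<close> is the conformal
  measure: invariance moves a set in fibre \<open>0\<close> to its image under \<open>T\<close> in
  fibre \<open>\<phi> i\<close>, and the constant of \<open>\<phi> i\<close> brings that image back
  to fibre \<open>0\<close>.\<close>

lemma ergodic_is_maharam:
  assumes \<mu>: "radon_inv \<mu>" "ergodic \<mu>"
  shows "\<exists>\<psi> \<nu>. Modules.additive \<psi> \<and> conformal \<psi> \<nu> \<and> \<mu> = maharam_measure \<psi> \<nu>"
proof -
  note S = radon_invD(1)[OF \<mu>(1)]
  have "g \<in> periods \<mu>" for g
  proof -
    obtain C w where t: "tower_system K T A P \<phi> C w" and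
      words: "\<And>i j. i \<in> A \<Longrightarrow> j \<in> A \<Longrightarrow> \<exists>m m'. (j, m) \<in> tower_system.occ A w i \<and> (j, m') \<in> tower_system.occ A w i \<and>
        tower_system.psum \<phi> w j m' - tower_system.psum \<phi> w j m = g"
      by (rule tower_with_words[of g]) blast
    show ?thesis by (rule tower_system.period_of_words[OF t words \<mu>])
  qed
  then have "\<exists>c. \<forall>g. c g > 0 \<and> (\<forall>a. \<forall>B\<in>sets BK. emeasure \<mu> (B \<times> {a + g}) = ennreal (c g) * emeasure \<mu> (B \<times> {a}))"
    unfolding periods_def by (intro choice) blast
  then obtain c where c: "\<And>g. c g > 0"
    "\<And>g a B. B \<in> sets BK \<Longrightarrow> emeasure \<mu> (B \<times> {a + g}) = ennreal (c g) * emeasure \<mu> (B \<times> {a})" by blast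
  have c0: "emeasure \<mu> (B \<times> {g}) = ennreal (c g) * emeasure \<mu> (B \<times> {0})" if "B \<in> sets BK" for B g
    using c(2)[OF that, of 0 g] by simp
  obtain a where "emeasure \<mu> (K \<times> {a}) \<noteq> 0" using positive_slice[OF \<mu>(1)] by blast
  then have K0: "emeasure \<mu> (K \<times> {0}) \<noteq> 0" using c0[OF K_sets, of a] by auto
  define \<psi> where "\<psi> g = ln (c g)" for g
  have ec: "exp (\<psi> g) = c g" for g using c(1) by (simp add: \<psi>_def)
  have mult: "c (g + h) = c g * c h" for g h
  proof -
    define M where "M = measure \<mu> (K \<times> {0})"
    have M: "emeasure \<mu> (K \<times> {0}) = ennreal M"
      unfolding M_def using slice_finite[OF \<mu>(1) order_refl, of 0] by (intro emeasure_eq_ennreal_measure) auto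
    then have "M > 0" using K0 by (metis M_def ennreal_0 less_eq_real_def measure_nonneg)
    have "ennreal (c (g + h)) * ennreal M = ennreal (c h) * (ennreal (c g) * ennreal M)"
      using c0[OF K_sets, of "g + h"] c(2)[OF K_sets, of g h] c0[OF K_sets, of g] M by simp
    then have "ennreal (c (g + h) * M) = ennreal (c h * (c g * M))"
      using c(1)[of g] c(1)[of h] c(1)[of "g + h"] \<open>M > 0\<close> by (simp add: ennreal_mult less_imp_le)
    then have "c (g + h) * M = c h * (c g * M)"
      using c(1)[of g] c(1)[of h] c(1)[of "g + h"] \<open>M > 0\<close> by (simp add: less_imp_le)
    then show ?thesis using \<open>M > 0\<close> by simp
  qed
  have \<psi>: "Modules.additive \<psi>"
  proof (rule Modules.additive.intro)
    fix g h
    show "\<psi> (g + h) = \<psi> g + \<psi> h" unfolding \<psi>_def mult using c(1)[of g] c(1)[of h] by (simp add: ln_mult)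
  qed
  obtain \<nu> where \<nu>: "finite_measure \<nu>" "sets \<nu> = sets BK"
    "\<And>B. B \<in> sets BK \<Longrightarrow> measure \<nu> B = (\<Sum>b\<in>{0}. measure \<mu> (B \<times> {b}))"
    using slice_sum_measure[OF \<mu>(1), of "{0}"] by blast
  interpret finite_measure \<nu> by (rule \<nu>(1))
  have e: "emeasure \<nu> B = emeasure \<mu> (B \<times> {0})" if B: "B \<in> sets BK" for B
  proof -
    have "B \<subseteq> K" using B by (simp add: sets_BK)
    then have "emeasure \<mu> (B \<times> {0}) = ennreal (measure \<mu> (B \<times> {0}))"
      using slice_finite[OF \<mu>(1), of B 0] by (intro emeasure_eq_ennreal_measure) auto
    then show ?thesis using \<nu>(3)[OF B] by (simp add: emeasure_eq_measure)
  qed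
  have "emeasure \<nu> (T ` B) = ennreal (exp (- \<psi> (\<phi> i))) * emeasure \<nu> B"
    if i: "i \<in> A" and B: "B \<in> sets BK" "B \<subseteq> P i" for i B
  proof -
    have "emeasure \<nu> B = emeasure \<mu> (T ` B \<times> {0 + \<phi> i})"
      unfolding e[OF B(1)] by (rule radon_inv_slice[OF \<mu>(1) i B, symmetric])
    also have "\<dots> = ennreal (c (\<phi> i)) * emeasure \<nu> (T ` B)"
      unfolding e[OF T_image_sets[OF B(1)]] by (rule c(2)[OF T_image_sets[OF B(1)]])
    finally have "ennreal (exp (- \<psi> (\<phi> i))) * emeasure \<nu> B =
        ennreal (exp (- \<psi> (\<phi> i))) * ennreal (exp (\<psi> (\<phi> i))) * emeasure \<nu> (T ` B)"
      by (simp add: ec mult.assoc)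
    then show ?thesis by (simp add: ennreal_mult[symmetric] exp_add[symmetric])
  qed
  then have conf: "conformal \<psi> \<nu>"
    unfolding conformal_def using \<nu>(1,2) K0 e[OF K_sets] by simp
  have "\<mu> = maharam_measure \<psi> \<nu>"
  proof (rule measure_eq_slices[OF S sets_maharam[OF \<nu>(2)]])
    fix B a assume B: "B \<in> sets BK"
    show "emeasure \<mu> (B \<times> {a}) = emeasure (maharam_measure \<psi> \<nu>) (B \<times> {a})"
      unfolding emeasure_maharam[OF \<nu>(2) B] ec e[OF B] c0[OF B, of a] by (rule mult.commute)
  qed
  then show ?thesis using \<psi> conf by blast
qed

lemma conformal_exists: "Modules.additive \<psi> \<Longrightarrow> \<exists>\<nu>. conformal \<psi> \<nu>"
proof -
  assume \<psi>: "Modules.additive \<psi>"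
  obtain C w where "tower_system K T A P \<phi> C w" by (rule tower_with_words)
  then show ?thesis using \<psi> by (rule tower_system.conformal_exists)
qed

lemma conformal_non_atomic: "Modules.additive \<psi> \<Longrightarrow> conformal \<psi> \<nu> \<Longrightarrow> non_atomic \<nu>"
proof -
  assume *: "Modules.additive \<psi>" "conformal \<psi> \<nu>"
  obtain C w where "tower_system K T A P \<phi> C w" by (rule tower_with_words)
  then show ?thesis using * by (rule tower_system.conformal_non_atomic)
qed

end

section \<open>Discreteness of the group and the Borel structure of the product\<close>

lemma open_int_vec: "open (S :: (int ^ 'm) set)"
  unfolding open_vec_def
proof
  fix v assume v: "v \<in> S"
  then show "\<exists>A. (\<forall>i. open (A i) \<and> v $ i \<in> A i) \<and> (\<forall>y. (\<forall>i. y $ i \<in> A i) \<longrightarrow> y \<in> S)"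
    by (intro exI[of _ "\<lambda>i. {v $ i}"]) (auto simp: open_discrete vec_eq_iff[symmetric])
qed

locale int_vec_system = renormalized_system K T A P \<phi>
  for K :: "real set" and T :: "real \<Rightarrow> real" and A :: "nat set" and P :: "nat \<Rightarrow> real set"
    and \<phi> :: "nat \<Rightarrow> int ^ 'm"
begin

text \<open>The group is discrete and countable, so Borel sets of the product are countable unions
  of Borel sets in single fibres.\<close>

lemma sets_PM: "sets PM = sets (restrict_space borel \<Omega>)"
proof
  have open_section: "open {p. (p, a) \<in> X}" if "open X" for X :: "(real \<times> (int ^ 'm)) set" and a
    using open_vimage[OF that continuous_on_Pair[OF continuous_on_id continuous_on_const], of a]
    by (simp add: vimage_def)
  have "(\<lambda>z. z) \<in> borel_measurable PM"
  proof (rule borel_measurableI)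
    fix X :: "(real \<times> (int ^ 'm)) set" assume X: "open X"
    have "sec ((\<lambda>z. z) -` X \<inter> space PM) a = {p. (p, a) \<in> X} \<inter> K" for a
      by (auto simp: sec_def space_PM)
    moreover have "{p. (p, a) \<in> X} \<inter> K \<in> sets BK" for a
      using open_section[OF X, of a] closed_K by (simp add: sets_BK sets.Int)
    ultimately show "(\<lambda>z. z) -` X \<inter> space PM \<in> sets PM" unfolding PM_iff[of "_ \<inter> _"] by (auto simp: space_PM)
  qed
  then have "X \<inter> \<Omega> \<in> sets PM" if "X \<in> sets borel" for X
    using measurable_sets[OF _ that, of "\<lambda>z. z" PM] by (simp add: space_PM)
  then show "sets (restrict_space borel \<Omega>) \<subseteq> sets PM"
    by (auto simp: sets_restrict_space Int_commute)
  show "sets PM \<subseteq> sets (restrict_space borel \<Omega>)"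
  proof
    fix X assume X: "X \<in> sets PM"
    have "X = (\<Union>a. sec X a \<times> {a})" by (auto simp: sec_def)
    moreover have "sec X a \<times> {a} \<in> sets borel" for a
    proof -
      have "fst -` sec X a \<inter> space borel \<in> sets (borel :: (real \<times> (int ^ 'm)) measure)"
        using sec_sets[OF X, of a]
        by (intro measurable_sets[OF borel_measurable_continuous_onI[OF continuous_on_fst[OF continuous_on_id]]])
          (simp add: sets_BK)
      moreover have "snd -` {a} \<in> sets (borel :: (real \<times> (int ^ 'm)) measure)"
        by (intro borel_open open_vimage open_int_vec continuous_on_snd continuous_on_id)
      moreover have "sec X a \<times> {a} = (fst -` sec X a \<inter> space borel) \<inter> snd -` {a}" by auto
      ultimately show ?thesis by (metis sets.Int)
    qed
    then have "(\<Union>a. sec X a \<times> {a}) \<in> sets borel" by (intro sets.countable_UN') auto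
    ultimately have "X \<in> sets borel" by simp
    then show "X \<in> sets (restrict_space borel \<Omega>)"
      using PM_sub[OF X] by (auto simp: sets_restrict_space intro!: image_eqI[of _ _ X])
  qed
qed

text \<open>The projection of a compact set to the discrete group is compact, hence finite; so
  finiteness on compact sets is finiteness on each fibre.\<close>

lemma ergodic_invariant_radon_iff: "ergodic_invariant_radon \<Omega> skew \<mu> \<longleftrightarrow> radon_inv \<mu> \<and> ergodic \<mu>"
proof (cases "sets \<mu> = sets PM")
  case True
  have space: "space \<mu> = \<Omega>" using sets_eq_imp_space_eq[OF True] by (simp add: space_PM)
  have cpt: "(\<forall>C. compact C \<and> C \<subseteq> \<Omega> \<longrightarrow> emeasure \<mu> C < \<infinity>) \<longleftrightarrow> (\<forall>a. emeasure \<mu> (K \<times> {a}) < \<infinity>)"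
  proof
    assume c: "\<forall>C. compact C \<and> C \<subseteq> \<Omega> \<longrightarrow> emeasure \<mu> C < \<infinity>"
    show "\<forall>a. emeasure \<mu> (K \<times> {a}) < \<infinity>"
    proof
      fix a :: "int ^ 'm"
      have "compact (K \<times> {a})" using compact_K by (intro compact_Times) auto
      then show "emeasure \<mu> (K \<times> {a}) < \<infinity>" using c by blast
    qed
  next
    assume fin: "\<forall>a. emeasure \<mu> (K \<times> {a}) < \<infinity>"
    show "\<forall>C. compact C \<and> C \<subseteq> \<Omega> \<longrightarrow> emeasure \<mu> C < \<infinity>"
    proof (intro allI impI)
      fix C assume C: "compact C \<and> C \<subseteq> \<Omega>"
      have cS: "compact (snd ` C)" using C by (intro compact_continuous_image continuous_on_snd continuous_on_id) auto
      have "snd ` C \<subseteq> (\<Union>a\<in>snd ` C. {a})" by auto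
      from compactE_image[OF cS open_int_vec this] obtain D where D: "finite D" "snd ` C \<subseteq> (\<Union>a\<in>D. {a})"
        by metis
      have "C \<subseteq> (\<Union>a\<in>D. K \<times> {a})"
      proof
        fix z assume z: "z \<in> C"
        then have "snd z \<in> D" using D(2) by auto
        moreover have "fst z \<in> K" using z C by auto
        ultimately show "z \<in> (\<Union>a\<in>D. K \<times> {a})" by (intro UN_I[of "snd z"]) (auto simp: mem_Times_iff)
      qed
      then have "emeasure \<mu> C \<le> emeasure \<mu> (\<Union>a\<in>D. K \<times> {a})"
        using Times_PM[OF K_sets] True D(1) by (intro emeasure_mono sets.finite_UN) auto
      also have "\<dots> \<le> (\<Sum>a\<in>D. emeasure \<mu> (K \<times> {a}))"
        using Times_PM[OF K_sets] True D(1) by (intro emeasure_subadditive_finite) auto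
      also have "\<dots> < \<infinity>" using fin D(1) by (simp add: less_top[symmetric])
      finally show "emeasure \<mu> C < \<infinity>" .
    qed
  qed
  have e1: "radon_measure_on \<Omega> \<mu> \<longleftrightarrow> emeasure \<mu> \<Omega> \<noteq> 0 \<and> (\<forall>a. emeasure \<mu> (K \<times> {a}) < \<infinity>)"
    unfolding radon_measure_on_def borel_measure_on_def cpt using True sets_PM by simp
  have e2: "invariant_measure skew \<mu> \<longleftrightarrow> (\<forall>X\<in>sets PM. emeasure \<mu> (pre X) = emeasure \<mu> X)"
    unfolding invariant_measure_def space True measurable_cong_sets[OF True True] pre_def
    using skew_measurable by simp
  have e3: "ergodic_measure skew \<mu> \<longleftrightarrow> ergodic \<mu>"
    unfolding ergodic_measure_def ergodic_def inv_set_def space True pre_def by (simp only: Ball_def imp_conjL)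
  show ?thesis
    unfolding ergodic_invariant_radon_def radon_inv_def e1 e2 e3
    by (rule iffI; elim conjE; intro conjI; (assumption | rule True))
next
  case False
  then show ?thesis
    unfolding ergodic_invariant_radon_def radon_measure_on_def borel_measure_on_def radon_inv_def
    using sets_PM by simp
qed

end

section \<open>The interval exchange as an instance of the abstract towers\<close>

context keane_iet_extension
begin

lemma base_1: "base 1 j = mark j"
  by (simp add: base_def)

lemma pieces: "piece_system K T letters (comp_piece d x F)"
proof
  show "compact K" by (rule compact_K)
  show "K \<noteq> {}" unfolding compactification_def by auto
  show "bij_betw T K K" using T_inj T_image by (simp add: bij_betw_def)
  show "continuous_on K T" "continuous_on K (inv_into K T)" by (rule T_cont T_inv_cont)+
  show "compact (comp_piece d x F i)" if "i \<in> letters" for i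
    unfolding comp_piece_hat[OF that] by (rule compact_hat[OF mark_subset[OF that]])
  have "(\<Union>i\<in>letters. comp_piece d x F i) = (\<Union>i\<in>letters. hat (mark i))"
    using comp_piece_hat by simp
  also have "\<dots> = hat (\<Union>i\<in>letters. mark i)" by (rule hat_UN[symmetric]) simp
  finally show "(\<Union>i\<in>letters. comp_piece d x F i) = K" unfolding mark_cover K_hat .
  \<comment> \<open>The pieces are the bases of the trivial renormalization of scale
    \<open>1\<close>, taken here with the zero cocycle.\<close>
  show "comp_piece d x F i \<inter> comp_piece d x F j = {}" if "i \<in> letters" "j \<in> letters" "i \<noteq> j" for i j
    using base_disjoint[OF renormalizable_1[of "\<lambda>_. 0 :: int"] _ _ that] orbits.start that
    by (simp add: base_1 comp_piece_hat)
qed simp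

lemma tower_system_of_renorm:
  fixes \<phi> :: "nat \<Rightarrow> 'g::{ab_group_add, countable}"
  assumes "good_renorm \<phi> g \<Lambda> w"
  shows "tower_system K T letters (comp_piece d x F) \<phi> (\<lambda>k j. hat (base (\<Lambda> ^ k) j)) w"
proof -
  have r: "renormalizable \<phi> \<Lambda> w" and \<Lambda>: "\<Lambda> < 1" and o: "\<Lambda> \<in> orbits" "\<And>i. i < d \<Longrightarrow> \<Lambda> * x i \<in> orbits"
    and set: "\<And>j. j \<in> letters \<Longrightarrow> set (w j) = letters"
    using assms unfolding good_renorm_def by blast+
  note rk = renormalizable_pow[OF r]
  have ok: "\<Lambda> ^ k = 1 \<or> \<Lambda> ^ k \<in> orbits" for k
    using renormalizable_pow_orbits(1)[OF r o, of k] by (cases k) auto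
  have xk: "i < d \<Longrightarrow> \<Lambda> ^ k * x i \<in> orbits" for k i
    using renormalizable_pow_orbits(2)[OF r o] by blast
  show ?thesis
  proof (intro tower_system.intro tower_system_axioms.intro pieces)
    show "primitive_substitution letters w \<phi>"
      using set renormalizableD(5)[OF r] d2 by unfold_locales auto
    show "2 \<le> card letters" using d2 by simp
    show "hat (base (\<Lambda> ^ 0) j) = comp_piece d x F j" if "j \<in> letters" for j
      using comp_piece_hat[OF that] by (simp add: base_1)
    show "compact (hat (base (\<Lambda> ^ k) j))" if "j \<in> letters" for j k
      using compact_hat[OF base_subset[OF renormalizableD(1,2)[OF rk] that]] .
    show "K = (\<Union>j\<in>letters. \<Union>m<length (subst_pow w k j). (T ^^ m) ` hat (base (\<Lambda> ^ k) j))" for k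
      by (rule level_cover[OF rk ok xk])
    show "(T ^^ m) ` hat (base (\<Lambda> ^ k) j) \<inter> (T ^^ m') ` hat (base (\<Lambda> ^ k) j') = {}"
      if "j \<in> letters" "m < length (subst_pow w k j)" "j' \<in> letters" "m' < length (subst_pow w k j')"
        "(j, m) \<noteq> (j', m')" for j m j' m' k
      by (rule level_disjoint[OF rk ok xk that])
    show "(T ^^ m) ` hat (base (\<Lambda> ^ k) j) \<subseteq> comp_piece d x F (subst_pow w k j ! m)"
      if "j \<in> letters" "m < length (subst_pow w k j)" for j m k
      using level_letter[OF rk ok xk that] comp_piece_hat[OF renormalizableD(10)[OF rk that]] by simp
    show "hat (base (\<Lambda> ^ k) i) = (\<Union>j\<in>letters. \<Union>m\<in>{m. m < length (w j) \<and> w j ! m = i}.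
      (T ^^ length (concat (map (subst_pow w k) (take m (w j))))) ` hat (base (\<Lambda> ^ Suc k) j))"
      if "i \<in> letters" for i k
      \<comment> \<open>With this order of the factors the \<open>k\<close>-th power plays the part
        of \<open>v\<close> in \<open>base_refine\<close>, and one further renormalization by
        \<open>w\<close> refines its bases.\<close>
      unfolding power_Suc2 by (rule base_refine[OF rk r that])
    show "\<exists>k0. \<forall>k\<ge>k0. \<forall>j\<in>letters. \<forall>m<length (subst_pow w k j).
      \<forall>p\<in>(T ^^ m) ` hat (base (\<Lambda> ^ k) j). \<forall>q\<in>(T ^^ m) ` hat (base (\<Lambda> ^ k) j). dist p q < e"
      if "e > 0" for e
      by (rule mesh[OF r \<Lambda> that])
  qed
qed

end

theorem theorem1:
  fixes d :: nat and x :: "nat \<Rightarrow> real" and F T :: "real \<Rightarrow> real" and \<phi> :: "nat \<Rightarrow> int ^ 'm"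
  assumes "d \<ge> 2"
    and "iet d 0 1 x F"
    and "keane d x F"
    and "infinitely_complete d x F"
    and "continuous_extension d x F T"
    and "group_closure (\<phi> ` {1..d}) = UNIV"
    and "periodic_type d x F \<phi>"
  shows "(\<forall>\<psi> :: int ^ 'm \<Rightarrow> real. Modules.additive \<psi> \<longrightarrow>
            (\<exists>\<nu>. conformal_measure d x F T \<phi> \<psi> \<nu>) \<and>
            (\<forall>\<nu> \<nu>'. conformal_measure d x F T \<phi> \<psi> \<nu> \<and> conformal_measure d x F T \<phi> \<psi> \<nu>' \<longrightarrow>
               (\<exists>c::real. c > 0 \<and> \<nu>' = scale_measure (ennreal c) \<nu>)) \<and>
            (\<forall>\<nu>. conformal_measure d x F T \<phi> \<psi> \<nu> \<longrightarrow> non_atomic \<nu>))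
       \<and> (\<forall>\<psi> \<nu>. Modules.additive \<psi> \<and> conformal_measure d x F T \<phi> \<psi> \<nu> \<longrightarrow>
            ergodic_invariant_radon (compactification d x F \<times> UNIV) (comp_skew d x F T \<phi>)
              (maharam_measure \<psi> \<nu>))
       \<and> (\<forall>\<mu>. ergodic_invariant_radon (compactification d x F \<times> UNIV) (comp_skew d x F T \<phi>) \<mu> \<longrightarrow>
            (\<exists>\<psi> \<nu> (c::real). Modules.additive \<psi> \<and> conformal_measure d x F T \<phi> \<psi> \<nu> \<and> c > 0 \<and>
               \<mu> = scale_measure (ennreal c) (maharam_measure \<psi> \<nu>)))"
proof -
  interpret X: keane_iet_extension d x F T
    using assms(2,3,5) by unfold_locales
  interpret Y: int_vec_system "compactification d x F" T "{1..d}" "comp_piece d x F" \<phi>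
  proof (intro int_vec_system.intro renormalized_system.intro renormalized_system_axioms.intro)
    show "piece_system (compactification d x F) T {1..d} (comp_piece d x F)" by (rule X.pieces)
    fix g :: "int ^ 'm"
    obtain \<Lambda> w where g: "X.good_renorm \<phi> g \<Lambda> w"
      using X.good_renorm_exists[OF assms(7,4,6)] by blast
    show "\<exists>C w. tower_system (compactification d x F) T {1..d} (comp_piece d x F) \<phi> C w \<and>
      (\<forall>i\<in>{1..d}. \<forall>j\<in>{1..d}. \<exists>m m'. m < length (w j) \<and> m' < length (w j) \<and> w j ! m = i \<and> w j ! m' = i \<and>
        sum_list (map \<phi> (take m' (w j))) - sum_list (map \<phi> (take m (w j))) = g)"
      using X.tower_system_of_renorm[OF g] g unfolding X.good_renorm_def by blast
  qed
  have cocycle: "step_function d (comp_piece d x F) \<phi> = Y.cocycle"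
    by (rule ext) (simp only: step_function_def Y.cocycle_def)
  have conf: "conformal_measure d x F T \<phi> \<psi> \<nu> \<longleftrightarrow> Y.conformal \<psi> \<nu>" for \<psi> \<nu>
    unfolding conformal_measure_def borel_measure_on_def Y.conformal_iff_RN_deriv cocycle ..
  have skew: "comp_skew d x F T \<phi> = skew_product T Y.cocycle"
    unfolding comp_skew_def cocycle ..
  show ?thesis
    unfolding conf skew Y.ergodic_invariant_radon_iff
  proof (intro conjI allI impI)
    fix \<psi> :: "int ^ 'm \<Rightarrow> real" assume \<psi>: "Modules.additive \<psi>"
    show "\<exists>\<nu>. Y.conformal \<psi> \<nu>" by (rule Y.conformal_exists[OF \<psi>])
    show "\<exists>c>0. \<nu>' = scale_measure (ennreal c) \<nu>" if "Y.conformal \<psi> \<nu> \<and> Y.conformal \<psi> \<nu>'" for \<nu> \<nu>'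
      using Y.conformal_unique[OF \<psi>] that by blast
    show "non_atomic \<nu>" if "Y.conformal \<psi> \<nu>" for \<nu> by (rule Y.conformal_non_atomic[OF \<psi> that])
  next
    fix \<psi> :: "int ^ 'm \<Rightarrow> real" and \<nu> assume "Modules.additive \<psi> \<and> Y.conformal \<psi> \<nu>"
    then show "Y.radon_inv (maharam_measure \<psi> \<nu>)" "Y.ergodic (maharam_measure \<psi> \<nu>)"
      using Y.maharam_radon_inv Y.maharam_ergodic by blast+
  next
    fix \<mu> assume "Y.radon_inv \<mu> \<and> Y.ergodic \<mu>"
    then obtain \<psi> \<nu> where "Modules.additive \<psi>" "Y.conformal \<psi> \<nu>" "\<mu> = maharam_measure \<psi> \<nu>"
      using Y.ergodic_is_maharam by blast
    \<comment> \<open>The constant is \<open>1\<close> because \<open>\<nu>\<close> was read off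
      from a fibre of \<open>\<mu>\<close> itself.\<close>
    moreover have "scale_measure (ennreal 1) N = N" for N :: "(real \<times> (int ^ 'm)) measure"
      by (rule measure_eqI) simp_all
    ultimately show "\<exists>\<psi> \<nu> c. Modules.additive \<psi> \<and> Y.conformal \<psi> \<nu> \<and> 0 < c \<and>
        \<mu> = scale_measure (ennreal c) (maharam_measure \<psi> \<nu>)"
      by (intro exI[of _ \<psi>] exI[of _ \<nu>] exI[of _ 1]) simp
  qed
qed

end
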